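(* Let $d\ge 2$ be a fixed integer. There is a randomized (Monte-Carlo) polynomial-space algorithm that, given an undirected graph $G$ together with a proper vertex coloring of $G$ with $d$ colors, and integers $k\ge 1$, $l\ge 0$, decides whether $G$ contains a $(k,l)$-tree in time \[O^*\left(2^{\left( 1 - \frac{x(d-x)}{d(d-1)}\right) k + \left(1-\frac{x}{d}\right)l}\right),\qquad x=\left\lfloor\tfrac{d+(l/k)(d-1)}{2}\right\rceil,\] where $\lfloor\cdot\rceil$ denotes rounding to a nearest integer. In particular, the running time can be bounded by $O^*\left(2^{\left(1 - \frac{\lfloor d/2\rfloor \lceil d/2\rceil}{d(d-1)}\right)k + \frac{l}{2}}\right)$. The algorithm never reports a false positive, and reports false negatives with at most a constant probability (a constant smaller than $1$).
   Context: A $(k,l)$-tree in an undirected graph $G$ is a subgraph of $G$ that is a tree with exactly $k$ vertices, exactly $l$ of which are leaves. A proper $d$-coloring assigns to each vertex one of $d$ colors so that adjacent vertices receive different colors. $O^*(f)$ hides factors polynomial in the input size.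
   Formalization: In the time bound O*(f), a value of f below 1 (possible only when l > k, where no such tree exists) is read as 1, since no algorithm can run in less than one step. *)

theory Defs
  imports
    "HOL-Probability.Probability"
    "HOL-Library.Log_Nat"
    "HOL-Computational_Algebra.Polynomial"
    "Graph_Theory.Digraph_Component"
begin

section \<open>Trees with a given number of leaves\<close>

text \<open>
  A finite simple undirected graph is a \<^locale>\<open>pair_graph\<close>: a symmetric, loop-free relation on a
  finite vertex set, every undirected edge being present as two opposite arcs. In such a digraph
  every edge gives a \<^const>\<open>pre_digraph.cycle\<close> with two arcs, so that \<^const>\<open>forest\<close> and \<^const>\<open>tree\<close>
  fail for every graph with an edge. The cycles of the undirected graph are the cycles
  with at least three arcs.
\<close>

definition undirected_tree :: "'a pair_pre_digraph \<Rightarrow> bool" where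
  "undirected_tree T \<longleftrightarrow>
     pair_graph T \<and> connected T \<and> \<not> (\<exists>p. pre_digraph.cycle T p \<and> 3 \<le> length p)"

definition leaves :: "'a pair_pre_digraph \<Rightarrow> 'a set" where
  "leaves T = {v \<in> pverts T. out_degree T v = 1}"

definition contains_kl_tree :: "'a pair_pre_digraph \<Rightarrow> nat \<Rightarrow> nat \<Rightarrow> bool" where
  "contains_kl_tree G k l \<longleftrightarrow>
     (\<exists>T. subgraph (with_proj T) (with_proj G) \<and> undirected_tree T
        \<and> card (pverts T) = k \<and> card (leaves T) = l)"

definition proper_coloring :: "nat \<Rightarrow> 'a pair_pre_digraph \<Rightarrow> ('a \<Rightarrow> nat) \<Rightarrow> bool" where
  "proper_coloring d G c \<longleftrightarrow>
     (\<forall>v \<in> pverts G. c v < d) \<and> (\<forall>(u, v) \<in> parcs G. c u \<noteq> c v)"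


section \<open>Randomized random access machines with logarithmic cost\<close>

text \<open>
  Programs work on finitely many named registers and on a memory indexed by the natural numbers,
  both holding natural numbers of unbounded size. All resources are measured in bits: an
  operation costs the lengths of all numbers involved, memory addresses included. One step can be
  simulated on a Turing machine in time polynomial in the space that is in use. For polynomial
  space the model is therefore equivalent to Turing machines up to factors that are
  polynomial in the input length.
\<close>

datatype binop = Add | Sub | Mul | Div | Mod | Less | Equal

datatype expr =
    Const nat
  | Reg string
  | Load expr
  | Bin binop expr expr

datatype com =
    Skip
  | Assign string expr
  | Store expr expr
  | Flip string
  | Seq com com
  | Cond expr com com
  | While expr com

record state =
  reg :: "string \<Rightarrow> nat"
  mem :: "nat \<Rightarrow> nat"

fun apply_binop :: "binop \<Rightarrow> nat \<Rightarrow> nat \<Rightarrow> nat" where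
  "apply_binop Add m n = m + n"
| "apply_binop Sub m n = m - n"
| "apply_binop Mul m n = m * n"
| "apply_binop Div m n = m div n"
| "apply_binop Mod m n = m mod n"
| "apply_binop Less m n = of_bool (m < n)"
| "apply_binop Equal m n = of_bool (m = n)"

fun expr_val :: "expr \<Rightarrow> state \<Rightarrow> nat" where
  "expr_val (Const n) s = n"
| "expr_val (Reg x) s = reg s x"
| "expr_val (Load a) s = mem s (expr_val a s)"
| "expr_val (Bin f a b) s = apply_binop f (expr_val a s) (expr_val b s)"

definition bits :: "nat \<Rightarrow> nat" where
  "bits n = max 1 (floorlog 2 n)"

fun expr_cost :: "expr \<Rightarrow> state \<Rightarrow> nat" where
  "expr_cost (Const n) s = bits n"
| "expr_cost (Reg x) s = bits (reg s x)"
| "expr_cost (Load a) s = expr_cost a s + bits (mem s (expr_val a s))"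
| "expr_cost (Bin f a b) s =
     expr_cost a s + expr_cost b s + bits (apply_binop f (expr_val a s) (expr_val b s))"

text \<open>Cells holding 0 are regarded as unused. Only finitely many cells are in use in
  every state reachable from an input.\<close>

definition space_used :: "state \<Rightarrow> nat" where
  "space_used s = (\<Sum>x | reg s x \<noteq> 0. bits (reg s x)) + (\<Sum>a | mem s a \<noteq> 0. bits a + bits (mem s a))"

text \<open>An outcome consists of the final state, the time spent, and the peak space.\<close>

type_synonym outcome = "state \<times> nat \<times> nat"

definition charge :: "nat \<Rightarrow> nat \<Rightarrow> outcome pmf \<Rightarrow> outcome pmf" where
  "charge t m = map_pmf (\<lambda>(s, t', m'). (s, t + t', max m m'))"

text \<open>
  \<open>exec p s D\<close>: started in state \<open>s\<close>, the program \<open>p\<close> terminates for every outcome of its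
  fair and independent coin flips, and \<open>D\<close> is the resulting distribution of outcomes. In the rule
  for \<^const>\<open>Seq\<close>, \<open>E\<close> is only relevant on the support of \<open>D\<close>.
\<close>

inductive exec :: "com \<Rightarrow> state \<Rightarrow> outcome pmf \<Rightarrow> bool" where
  Skip: "exec Skip s (return_pmf (s, 1, space_used s))"
| Assign: "exec (Assign x e) s (return_pmf
    (s\<lparr>reg := (reg s)(x := expr_val e s)\<rparr>, 1 + expr_cost e s, space_used s + expr_cost e s))"
| Store: "exec (Store a e) s (return_pmf
    (s\<lparr>mem := (mem s)(expr_val a s := expr_val e s)\<rparr>,
     1 + expr_cost a s + expr_cost e s, space_used s + expr_cost a s + expr_cost e s))"
| Flip: "exec (Flip x) s (map_pmf
    (\<lambda>b. (s\<lparr>reg := (reg s)(x := of_bool b)\<rparr>, 1, space_used s + 1)) (bernoulli_pmf (1/2)))"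
| Seq: "exec p s D \<Longrightarrow> (\<forall>r \<in> set_pmf D. exec q (fst r) (E r)) \<Longrightarrow>
    exec (Seq p q) s (bind_pmf D (\<lambda>(s', t, m). charge t m (E (s', t, m))))"
| CondTrue: "expr_val e s \<noteq> 0 \<Longrightarrow> exec p s D \<Longrightarrow>
    exec (Cond e p q) s (charge (1 + expr_cost e s) (space_used s + expr_cost e s) D)"
| CondFalse: "expr_val e s = 0 \<Longrightarrow> exec q s D \<Longrightarrow>
    exec (Cond e p q) s (charge (1 + expr_cost e s) (space_used s + expr_cost e s) D)"
| WhileTrue: "expr_val e s \<noteq> 0 \<Longrightarrow> exec (Seq p (While e p)) s D \<Longrightarrow>
    exec (While e p) s (charge (1 + expr_cost e s) (space_used s + expr_cost e s) D)"
| WhileFalse: "expr_val e s = 0 \<Longrightarrow>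
    exec (While e p) s (return_pmf (s, 1 + expr_cost e s, space_used s + expr_cost e s))"

inductive_cases exec_SkipE: "exec Skip s D"
inductive_cases exec_AssignE: "exec (Assign x e) s D"
inductive_cases exec_StoreE: "exec (Store a e) s D"
inductive_cases exec_FlipE: "exec (Flip x) s D"
inductive_cases exec_SeqE: "exec (Seq p q) s D"
inductive_cases exec_CondE: "exec (Cond e p q) s D"
inductive_cases exec_WhileE: "exec (While e p) s D"

lemma exec_deterministic:
  assumes "exec p s D" and "exec p s D'"
  shows "D = D'"
  using assms
proof (induction arbitrary: D' rule: exec.induct)
  case (Seq p s D q E)
  from Seq.prems show ?case
  proof (rule exec_SeqE)
    fix D1 E1
    assume D': "D' = bind_pmf D1 (\<lambda>(s', t, m). charge t m (E1 (s', t, m)))"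
      and D1: "exec p s D1" and E1: "\<forall>r \<in> set_pmf D1. exec q (fst r) (E1 r)"
    have "D = D1" using Seq D1 by blast
    moreover have "E r = E1 r" if "r \<in> set_pmf D" for r
      using Seq.IH(2) E1 that unfolding \<open>D = D1\<close> by blast
    ultimately show ?case
      unfolding D' by (intro bind_pmf_cong) auto
  qed
next
  case (CondTrue e s p D q)
  from CondTrue.prems show ?case
  proof (rule exec_CondE)
    fix D1 assume "D' = charge (Suc (expr_cost e s)) (space_used s + expr_cost e s) D1" "exec p s D1"
    then show ?case using CondTrue.IH by auto
  qed (use CondTrue.hyps in simp)
next
  case (CondFalse e s q D p)
  from CondFalse.prems show ?case
  proof (rule exec_CondE)
    fix D1 assume "D' = charge (Suc (expr_cost e s)) (space_used s + expr_cost e s) D1" "exec q s D1"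
    then show ?case using CondFalse.IH by auto
  qed (use CondFalse.hyps in simp)
next
  case (WhileTrue e s p D)
  from WhileTrue.prems show ?case
  proof (rule exec_WhileE)
    fix D1 assume "D' = charge (Suc (expr_cost e s)) (space_used s + expr_cost e s) D1"
      "exec (Seq p (While e p)) s D1"
    then show ?case using WhileTrue.IH by auto
  qed (use WhileTrue.hyps in simp)
next
  case (WhileFalse e s p)
  from WhileFalse.prems show ?case
    by (rule exec_WhileE) (use WhileFalse.hyps in simp_all)
qed (erule exec_SkipE exec_AssignE exec_StoreE exec_FlipE; simp)+


section \<open>Monte Carlo algorithms and their resources\<close>

definition input_size :: "nat list \<Rightarrow> nat" where
  "input_size xs = (\<Sum>x\<leftarrow>xs. bits x)"

definition initial_state :: "nat list \<Rightarrow> state" where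
  "initial_state xs = \<lparr>reg = (\<lambda>_. 0), mem = (\<lambda>i. if i < length xs then xs ! i else 0)\<rparr>"

definition accepts :: "outcome \<Rightarrow> bool" where
  "accepts r \<longleftrightarrow> reg (fst r) ''result'' \<noteq> 0"

definition monte_carlo_decides ::
  "com \<Rightarrow> 'i set \<Rightarrow> ('i \<Rightarrow> nat list) \<Rightarrow> ('i \<Rightarrow> bool) \<Rightarrow> real \<Rightarrow> bool" where
  "monte_carlo_decides p I enc P \<epsilon> \<longleftrightarrow>
     (\<forall>i \<in> I. \<exists>D. exec p (initial_state (enc i)) D
        \<and> (\<not> P i \<longrightarrow> (\<forall>r \<in> set_pmf D. \<not> accepts r))
        \<and> (P i \<longrightarrow> measure_pmf.prob D {r. \<not> accepts r} \<le> \<epsilon>))"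

text \<open>
  Time \<open>O\<^sup>*(f)\<close>, in the worst case over the coin flips. A value of \<open>f\<close> below 1 is read as 1, since
  every computation takes at least one step.
\<close>

definition runs_in_ostar_time :: "com \<Rightarrow> 'i set \<Rightarrow> ('i \<Rightarrow> nat list) \<Rightarrow> ('i \<Rightarrow> real) \<Rightarrow> bool" where
  "runs_in_ostar_time p I enc f \<longleftrightarrow>
     (\<exists>b :: nat poly. \<forall>i \<in> I. \<exists>D. exec p (initial_state (enc i)) D
        \<and> (\<forall>(s, t, m) \<in> set_pmf D. real t \<le> real (poly b (input_size (enc i))) * max 1 (f i)))"

definition runs_in_polynomial_space :: "com \<Rightarrow> 'i set \<Rightarrow> ('i \<Rightarrow> nat list) \<Rightarrow> bool" where
  "runs_in_polynomial_space p I enc \<longleftrightarrow>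
     (\<exists>b :: nat poly. \<forall>i \<in> I. \<exists>D. exec p (initial_state (enc i)) D
        \<and> (\<forall>(s, t, m) \<in> set_pmf D. m \<le> poly b (input_size (enc i))))"


section \<open>Instances\<close>

type_synonym kl_instance = "nat pair_pre_digraph \<times> (nat \<Rightarrow> nat) \<times> nat \<times> nat"

text \<open>In order to be given to a machine, a graph with \<open>n\<close> vertices has the vertices
  \<open>0, \<dots>, n - 1\<close>.\<close>

definition kl_instances :: "nat \<Rightarrow> kl_instance set" where
  "kl_instances d = {(G, c, k, l).
     pair_graph G \<and> (\<exists>n. pverts G = {..<n}) \<and> proper_coloring d G c \<and> 1 \<le> k}"

text \<open>The number of vertices, \<open>k\<close>, \<open>l\<close>, the colors, and the rows of the adjacency matrix.\<close>

fun encode_instance :: "kl_instance \<Rightarrow> nat list" where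
  "encode_instance (G, c, k, l) =
     (let vs = [0..<card (pverts G)]
      in [length vs, k, l] @ map c vs
         @ concat (map (\<lambda>u. map (\<lambda>v. of_bool ((u, v) \<in> parcs G)) vs) vs))"

fun has_kl_tree :: "kl_instance \<Rightarrow> bool" where
  "has_kl_tree (G, c, k, l) = contains_kl_tree G k l"

definition optimal_x :: "nat \<Rightarrow> nat \<Rightarrow> nat \<Rightarrow> int" where
  "optimal_x d k l = round ((real d + real l / real k * (real d - 1)) / 2)"

fun fine_bound :: "nat \<Rightarrow> kl_instance \<Rightarrow> real" where
  "fine_bound d (G, c, k, l) =
     (let x = real_of_int (optimal_x d k l)
      in 2 powr ((1 - x * (real d - x) / (real d * (real d - 1))) * real k
                 + (1 - x / real d) * real l))"

text \<open>For \<open>l > k\<close>, where there is no such tree, \<open>fine_bound\<close> can be arbitrarily close to 0. In the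
  remaining cases it is at least 1, and reading it as \<open>max 1\<close> in \<^const>\<open>runs_in_ostar_time\<close> is no change.\<close>

lemma fine_bound_ge_1:
  assumes "2 \<le> d" and "1 \<le> k" and "l \<le> k"
  shows "1 \<le> fine_bound d (G, c, k, l)"
proof -
  define D K L x where "D = real d" and "K = real k" and "L = real l"
    and "x = real_of_int (optimal_x d k l)"
  have D: "D \<ge> 2" and K: "L \<le> K" and L: "L \<ge> 0"
    using assms by (auto simp: D_def K_def L_def)
  have "D * (D - 1) - x * (D - x) = (x - D / 2)\<^sup>2 + D * (3 * D - 4) / 4"
    by (simp add: power2_eq_square field_simps)
  with D have 1: "D * (D - 1) - x * (D - x) \<ge> 0" by simp
  have "2 * D * (D - 1) - x * (2 * D - 1 - x)
      = (x - (2 * D - 1) / 2)\<^sup>2 + (D - 2) * (D + 1) + 7 / 4"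
    by (simp add: power2_eq_square field_simps)
  with D have 2: "2 * D * (D - 1) - x * (2 * D - 1 - x) \<ge> 0" by simp
  have "(1 - x * (D - x) / (D * (D - 1))) * K + (1 - x / D) * L
      = ((K - L) * (D * (D - 1) - x * (D - x)) + L * (2 * D * (D - 1) - x * (2 * D - 1 - x)))
        / (D * (D - 1))"
    using D by (simp add: field_simps)
  also have "\<dots> \<ge> 0"
    using 1 2 K L D by simp
  finally have "1 \<le> 2 powr ((1 - x * (D - x) / (D * (D - 1))) * K + (1 - x / D) * L)"
    by (simp add: ge_one_powr_ge_zero)
  then show ?thesis by (simp add: Let_def D_def K_def L_def x_def)
qed

fun coarse_bound :: "nat \<Rightarrow> kl_instance \<Rightarrow> real" where
  "coarse_bound d (G, c, k, l) =
     2 powr ((1 - real_of_int \<lfloor>real d / 2\<rfloor> * real_of_int \<lceil>real d / 2\<rceil> / (real d * (real d - 1)))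
               * real k + real l / 2)"

end

theory Submission
  imports Defs "HOL-Library.Z2" "HOL-Number_Theory.Cong"
begin

text \<open>
  A tree with root \<open>r\<close>, where \<open>r\<close> is a leaf, is a branching walk in which no element (edge, vertex
  mark or leaf mark) repeats. Over the ring of square-free series with coefficients modulo 2, the
  branching walks that are not trees cancel in pairs, provided that the marks of the vertices in
  \<open>Y\<close> and of the edges and leaves outside of \<open>Y\<close> carry labels that have to be
  linearly independent. Here \<open>Y\<close> is the set of vertices with a color in a random set. Random vectors of
  \<open>H\<close> bits attached to the labels are independent with constant probability if there are
  at most \<open>H - 2\<close> labels, and by the isolation lemma random edge weights make the number of
  trees of some weight odd. The independence of the vectors is tested by a sum of \<open>2 ^ H\<close> products of signs,
  whose parity is read off above the factor \<open>2 ^ H\<close>. Each summand is a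
  polynomial in the numbers of edges and leaves and in the weight, evaluated at a power of two by dynamic
  programming over branching walks, so that its coefficients are blocks of binary digits.
  Averaging over the color sets of size \<open>x\<close> bounds the number of labels by the
  exponent of the claimed running time; the integer \<open>x\<close> with the least bound gives the theorem.
\<close>

section \<open>Square-free polynomials over GF(2)\<close>

text \<open>A label on every mark would cost too much, as the number of labels is the exponent. Two
  facts save labels. The weight of a vertex enters the series affinely, so marking a vertex outside
  \<open>Y\<close> changes no parity that ignores its mark; the parities computed with marks in
  \<open>Y\<close> thus agree with those of the fully marked series, whose monomials are exactly the
  trees. And as walks do not turn around, an edge or a leaf at a vertex of \<open>Y\<close> repeats
  only if the mark of that vertex does. The color set is guessed among all \<open>2 ^ d\<close>
  subsets, \<open>d\<close> being fixed; the best \<open>x\<close> only determines how many labels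
  are allowed. The right subset (\<open>2 ^ - d\<close>), independent vectors (3/4) and an isolated
  tree (1/2) give the success probability \<open>3 / (8 * 2 ^ d)\<close>. Independence is tested by
  factors \<open>1 - (-1) ^ b\<close>, which are 0 or 2, so the arithmetic stays in the naturals,
  and one table serves all sign patterns in turn, in polynomial space. In the packing the number of
  edges is the leading digit, so walks that are too long land above the digits that are read, and
  numbers may be reduced modulo \<open>2 ^ N\<close>.\<close>

typedef 'e sqf = "{f :: 'e set \<Rightarrow> bit. \<forall>S. f S \<noteq> 0 \<longrightarrow> finite S}"
  morphisms cf Sqf by (rule exI[of _ "\<lambda>_. 0"]) simp

setup_lifting type_definition_sqf

text \<open>These simplification rules would turn ring operations on \<open>bit\<close> into bitwise
  ones, out of reach of the ring lemmas.\<close>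

declare add_bit_eq_xor [simp del] mult_bit_eq_and [simp del]
  bit_not_zero_iff [simp del] bit_not_one_iff [simp del]

lemma bit_add_eq_0_iff: "a + b = 0 \<longleftrightarrow> a = (b :: bit)"
  by (auto simp: add_eq_0_iff)

lemma cf_infinite: "infinite S \<Longrightarrow> cf f S = 0"
  using cf[of f] by auto

lemma sqf_eqI: "(\<And>S. finite S \<Longrightarrow> cf f S = cf g S) \<Longrightarrow> f = g"
  using cf_infinite by (metis cf_inject ext)

text \<open>Series in commuting variables with \<open>e * e = 0\<close> over GF(2),
  \<open>cf f S\<close> being the coefficient of the product of the variables in \<open>S\<close>.
  The support may be infinite, so that all walks can be summed, but its members are finite, so that
  products are finite sums.\<close>

instantiation sqf :: (type) comm_ring_1
begin

lift_definition zero_sqf :: "'a sqf" is "\<lambda>_. 0" by simp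
lift_definition one_sqf :: "'a sqf" is "\<lambda>S. if S = {} then 1 else 0" by (auto split: if_splits)
lift_definition plus_sqf :: "'a sqf \<Rightarrow> 'a sqf \<Rightarrow> 'a sqf" is "\<lambda>f g S. f S + g S"
  by (metis add_0)
lift_definition uminus_sqf :: "'a sqf \<Rightarrow> 'a sqf" is "\<lambda>f. f" .
lift_definition minus_sqf :: "'a sqf \<Rightarrow> 'a sqf \<Rightarrow> 'a sqf" is "\<lambda>f g S. f S + g S"
  by (metis add_0)
lift_definition times_sqf :: "'a sqf \<Rightarrow> 'a sqf \<Rightarrow> 'a sqf"
  is "\<lambda>f g S. \<Sum>A\<in>Pow S. f A * g (S - A)"
  by (metis finite_Pow_iff sum.infinite)

lemma cf_times: "cf (f * g) S = (\<Sum>A\<in>Pow S. cf f A * cf g (S - A))"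
  by (simp add: times_sqf.rep_eq)

instance
proof
  fix a b c :: "'a sqf"
  show "a * b * c = a * (b * c)"
  proof (rule sqf_eqI)
    fix S :: "'a set" assume S: "finite S"
    have fin: "A \<subseteq> S \<Longrightarrow> finite A" for A using S finite_subset by blast
    have "cf (a * b * c) S
        = (\<Sum>A\<in>Pow S. \<Sum>B\<in>Pow A. cf a B * cf b (A - B) * cf c (S - A))"
      by (simp add: cf_times sum_distrib_right)
    also have "\<dots> = (\<Sum>(A, B)\<in>Sigma (Pow S) Pow. cf a B * cf b (A - B) * cf c (S - A))"
      using S fin by (subst sum.Sigma) auto
    also have "\<dots> = (\<Sum>(B, C)\<in>Sigma (Pow S) (\<lambda>B. Pow (S - B)).
        cf a B * cf b C * cf c (S - B - C))"
      by (rule sum.reindex_bij_witness[where i = "\<lambda>(B, C). (B \<union> C, B)"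
            and j = "\<lambda>(A, B). (B, A - B)"])
        (auto intro!: arg_cong[where f = "cf c"])
    also have "\<dots> = (\<Sum>B\<in>Pow S. \<Sum>C\<in>Pow (S - B). cf a B * cf b C * cf c (S - B - C))"
      using S fin by (subst sum.Sigma) auto
    also have "\<dots> = cf (a * (b * c)) S"
      by (simp add: cf_times sum_distrib_left mult.assoc)
    finally show "cf (a * b * c) S = cf (a * (b * c)) S" .
  qed
  show "a * b = b * a"
  proof (rule sqf_eqI)
    fix S :: "'a set"
    show "cf (a * b) S = cf (b * a) S"
      unfolding cf_times
      by (rule sum.reindex_bij_witness[where i = "\<lambda>A. S - A" and j = "\<lambda>A. S - A"])
        (auto simp: double_diff mult.commute)
  qed
  show "1 * a = a"
  proof (rule sqf_eqI)
    fix S :: "'a set" assume S: "finite S"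
    have "cf (1 * a) S = (\<Sum>A\<in>Pow S. if A = {} then cf a S else 0)"
      unfolding cf_times by (rule sum.cong) (auto simp: one_sqf.rep_eq)
    then show "cf (1 * a) S = cf a S" using S by simp
  qed
  show "(a + b) * c = a * c + b * c"
    by (rule sqf_eqI) (simp only: cf_times plus_sqf.rep_eq distrib_right sum.distrib)
  show "(0 :: 'a sqf) \<noteq> 1"
    by transfer (metis zero_neq_one)
  show "a + b + c = a + (b + c)" by transfer (simp only: add.assoc)
  show "a + b = b + a" by transfer (simp only: add.commute)
  show "0 + a = a" by transfer (simp only: add_0)
  show "- a + a = 0" by transfer (rule ext, simp only: bit_add_eq_0_iff)
  show "a - b = a + - b" by transfer (rule refl)
qed

end

lemma sqf_add_self [simp]: "f + f = (0 :: 'e sqf)"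
  by (rule sqf_eqI) (simp only: plus_sqf.rep_eq zero_sqf.rep_eq bit_add_eq_0_iff)

lemma sqf_two [simp]: "(2 :: 'e sqf) = 0"
  unfolding one_add_one[symmetric] by (rule sqf_add_self)

lemma sqf_minus_eq_plus: "f - g = f + (g :: 'e sqf)"
  by (rule sqf_eqI) (simp add: plus_sqf.rep_eq minus_sqf.rep_eq)

lemma sqf_uminus [simp]: "- f = (f :: 'e sqf)"
  by (rule sqf_eqI) (simp add: uminus_sqf.rep_eq)

lemmas cf_simps = plus_sqf.rep_eq minus_sqf.rep_eq zero_sqf.rep_eq one_sqf.rep_eq uminus_sqf.rep_eq

lemma cf_sum: "cf (\<Sum>i\<in>I. f i) S = (\<Sum>i\<in>I. cf (f i) S)"
  by (induction I rule: infinite_finite_induct) (auto simp: cf_simps)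

lift_definition gen :: "'e \<Rightarrow> 'e sqf" is "\<lambda>e S. if S = {e} then 1 else 0" by (auto split: if_splits)

lemma cf_gen_mult: "cf (gen e * f) S = (if e \<in> S then cf f (S - {e}) else 0)"
proof (cases "finite S")
  case True
  have "cf (gen e * f) S = (\<Sum>A\<in>Pow S. if A = {e} then cf f (S - {e}) else 0)"
    unfolding cf_times by (rule sum.cong) (auto simp: gen.rep_eq)
  with True show ?thesis by simp
qed (simp add: cf_infinite)

lemma gen_square [simp]: "gen e * gen e = 0"
  by (rule sqf_eqI) (auto simp: cf_gen_mult zero_sqf.rep_eq gen.rep_eq)

lemma sqf_square_add: "(f + g) * (f + g) = f * f + g * (g :: 'e sqf)"
proof -
  have "(f + g) * (f + g) = f * f + g * g + (f * g + f * g)"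
    by (simp only: distrib_left distrib_right mult.commute ac_simps)
  then show ?thesis by (simp only: sqf_add_self add_0_right)
qed

text \<open>Squaring is additive in characteristic 2. Hence a sum of elements of square zero has
  square zero.\<close>

lemma sqf_square_sum: "(\<Sum>i\<in>I. f i) * (\<Sum>i\<in>I. f i) = (\<Sum>i\<in>I. f i * (f i :: 'e sqf))"
  by (induction I rule: infinite_finite_induct) (auto simp: sqf_square_add)

text \<open>The terms at \<open>(i, j)\<close> and \<open>(j, i)\<close> cancel in characteristic 2.
  Applied to paths, this cancels a closed walk against its reversal.\<close>

lemma sqf_symmetric_sum:
  assumes "finite I" and "\<And>i j. i \<in> I \<Longrightarrow> j \<in> I \<Longrightarrow> f i j = f j i"
  shows "(\<Sum>i\<in>I. \<Sum>j\<in>I. f i j) = (\<Sum>i\<in>I. f i i :: 'e sqf)"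
  using assms
proof (induction I rule: finite_induct)
  case (insert a I)
  have "(\<Sum>i\<in>insert a I. \<Sum>j\<in>insert a I. f i j)
      = f a a + ((\<Sum>j\<in>I. f a j) + (\<Sum>i\<in>I. f i a)) + (\<Sum>i\<in>I. \<Sum>j\<in>I. f i j)"
    using insert.hyps by (simp add: sum.distrib algebra_simps)
  also have "(\<Sum>i\<in>I. f i a) = (\<Sum>j\<in>I. f a j)"
    using insert.prems by (intro sum.cong) auto
  finally show ?case using insert by simp
qed simp

lemma sqf_prod_one_plus_square:
  assumes "\<And>i. i \<in> I \<Longrightarrow> f i * f i = 0"
  shows "(\<Prod>i\<in>I. 1 + f i) * (\<Prod>i\<in>I. 1 + f i) = (1 :: 'e sqf)"
  using assms
  by (simp add: prod.distrib[symmetric] sqf_square_add)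


subsection \<open>The ideals of the grading by the number of elements of a set\<close>

text \<open>A filtration by ideals in place of a topology. With \<open>G\<close> the set of edge
  variables, each unfolding of the equation for walks gains one order, so its iterates
  converge.\<close>

definition order_ge :: "'e set \<Rightarrow> nat \<Rightarrow> 'e sqf \<Rightarrow> bool" where
  "order_ge G i f \<longleftrightarrow> (\<forall>S. card (S \<inter> G) < i \<longrightarrow> cf f S = 0)"

lemma order_ge_0 [simp]: "order_ge G 0 f" by (simp add: order_ge_def)
lemma order_ge_zero [simp]: "order_ge G i 0" by (simp add: order_ge_def cf_simps)
lemma order_ge_add: "order_ge G i f \<Longrightarrow> order_ge G i g \<Longrightarrow> order_ge G i (f + g)"
  by (simp add: order_ge_def cf_simps)
lemma order_ge_diff: "order_ge G i f \<Longrightarrow> order_ge G i g \<Longrightarrow> order_ge G i (f - g)"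
  by (simp add: order_ge_def cf_simps)
lemma order_ge_mono: "order_ge G j f \<Longrightarrow> i \<le> j \<Longrightarrow> order_ge G i f"
  by (simp add: order_ge_def)

lemma order_ge_mult:
  assumes "order_ge G i f" "order_ge G j g" shows "order_ge G (i + j) (f * g)"
  unfolding order_ge_def
proof (intro allI impI)
  fix S assume S: "card (S \<inter> G) < i + j"
  show "cf (f * g) S = 0"
  proof (cases "finite S")
    case True
    show ?thesis unfolding cf_times
    proof (rule sum.neutral, rule ballI)
      fix A assume "A \<in> Pow S"
      then have "S \<inter> G = (A \<inter> G) \<union> ((S - A) \<inter> G)" "(A \<inter> G) \<inter> ((S - A) \<inter> G) = {}"
        "finite (A \<inter> G)" "finite ((S - A) \<inter> G)"
        using True finite_subset by auto
      then have "card (S \<inter> G) = card (A \<inter> G) + card ((S - A) \<inter> G)"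
        by (metis card_Un_disjoint)
      with S have "card (A \<inter> G) < i \<or> card ((S - A) \<inter> G) < j" by linarith
      then show "cf f A * cf g (S - A) = 0"
        using assms by (auto simp: order_ge_def)
    qed
  qed (simp add: cf_infinite)
qed

lemma order_ge_mult1: "order_ge G i f \<Longrightarrow> order_ge G i (f * g)"
  using order_ge_mult[of G i f 0 g] by simp

lemma order_ge_mult2: "order_ge G i g \<Longrightarrow> order_ge G i (f * g)"
  using order_ge_mult[of G 0 f i g] by simp

lemma order_ge_sum: "(\<And>i. i \<in> I \<Longrightarrow> order_ge G j (f i)) \<Longrightarrow> order_ge G j (\<Sum>i\<in>I. f i)"
  by (induction I rule: infinite_finite_induct) (auto intro: order_ge_add)

lemma order_ge_prod_diff:
  assumes "\<And>i. i \<in> I \<Longrightarrow> order_ge G j (f i - g i)"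
  shows "order_ge G j ((\<Prod>i\<in>I. f i) - (\<Prod>i\<in>I. g i))"
  using assms
proof (induction I rule: infinite_finite_induct)
  case (insert a I)
  have "(\<Prod>i\<in>insert a I. f i) - (\<Prod>i\<in>insert a I. g i)
      = (f a - g a) * (\<Prod>i\<in>I. f i) + g a * ((\<Prod>i\<in>I. f i) - (\<Prod>i\<in>I. g i))"
    using insert.hyps by (simp add: algebra_simps)
  moreover have "order_ge G j \<dots>"
    using insert by (intro order_ge_add order_ge_mult1 order_ge_mult2) auto
  ultimately show ?case by simp
qed auto

lemma order_ge_gen: "e \<in> G \<Longrightarrow> order_ge G 1 (gen e)"
  by (auto simp: order_ge_def gen.rep_eq)

text \<open>A monomial \<open>S\<close> lies outside the ideal of order
  \<open>card (S \<inter> G) + 1\<close>, so the ideals intersect in 0.\<close>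

lemma eq_if_order_ge:
  assumes "\<And>i. order_ge G i (f - g)" shows "f = g"
proof (rule sqf_eqI)
  fix S
  have "cf (f - g) S = 0" using assms[of "Suc (card (S \<inter> G))"] by (simp add: order_ge_def)
  then show "cf f S = cf g S" by (simp only: cf_simps bit_add_eq_0_iff)
qed

text \<open>Contractions for the grading have a unique fixed point, the limit of the iterates from 0.\<close>

definition contraction :: "'e set \<Rightarrow> ((nat \<Rightarrow> 'e sqf) \<Rightarrow> nat \<Rightarrow> 'e sqf) \<Rightarrow> bool" where
  "contraction G \<Psi> \<longleftrightarrow> (\<forall>i F H. (\<forall>v. order_ge G i (F v - H v)) \<longrightarrow>
     (\<forall>v. order_ge G (Suc i) (\<Psi> F v - \<Psi> H v)))"

text \<open>The coefficient at \<open>S\<close> is stable from iterate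
  \<open>Suc (card (S \<inter> G))\<close> on, so the limit can be read off coefficient by
  coefficient.\<close>

definition fixp_of :: "'e set \<Rightarrow> ((nat \<Rightarrow> 'e sqf) \<Rightarrow> nat \<Rightarrow> 'e sqf) \<Rightarrow> nat \<Rightarrow> 'e sqf" where
  "fixp_of G \<Psi> v = Sqf (\<lambda>S. cf ((\<Psi> ^^ Suc (card (S \<inter> G))) (\<lambda>_. 0) v) S)"

lemma cf_fixp_of: "cf (fixp_of G \<Psi> v) S = cf ((\<Psi> ^^ Suc (card (S \<inter> G))) (\<lambda>_. 0) v) S"
proof -
  have "finite T" if "cf ((\<Psi> ^^ Suc (card (T \<inter> G))) (\<lambda>_. 0) v) T \<noteq> 0" for T
    using that cf_infinite by blast
  then show ?thesis unfolding fixp_of_def by (subst Sqf_inverse) (blast, rule refl)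
qed

lemma contractionD:
  "contraction G \<Psi> \<Longrightarrow> (\<And>v. order_ge G i (F v - H v)) \<Longrightarrow> order_ge G (Suc i) (\<Psi> F v - \<Psi> H v)"
  by (simp add: contraction_def)

lemma contraction_iterates:
  assumes "contraction G \<Psi>"
  shows "order_ge G i ((\<Psi> ^^ (i + j)) (\<lambda>_. 0) v - (\<Psi> ^^ i) (\<lambda>_. 0) v)"
proof (induction i arbitrary: v)
  case (Suc i)
  show ?case using contractionD[OF assms Suc] by simp
qed simp

lemma fixp_of_approx:
  assumes "contraction G \<Psi>"
  shows "order_ge G i (fixp_of G \<Psi> v - (\<Psi> ^^ i) (\<lambda>_. 0) v)"
  unfolding order_ge_def
proof (intro allI impI)
  fix S assume "card (S \<inter> G) < i"
  then obtain j where i: "i = Suc (card (S \<inter> G)) + j" using less_iff_Suc_add by auto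
  have "cf ((\<Psi> ^^ i) (\<lambda>_. 0) v - (\<Psi> ^^ Suc (card (S \<inter> G))) (\<lambda>_. 0) v) S = 0"
    using contraction_iterates[OF assms, of "Suc (card (S \<inter> G))" j v]
    unfolding order_ge_def i by blast
  then show "cf (fixp_of G \<Psi> v - (\<Psi> ^^ i) (\<lambda>_. 0) v) S = 0"
    by (simp only: minus_sqf.rep_eq bit_add_eq_0_iff cf_fixp_of)
qed

lemma fixp_of_fixed:
  assumes "contraction G \<Psi>" shows "\<Psi> (fixp_of G \<Psi>) v = fixp_of G \<Psi> v"
proof (rule eq_if_order_ge)
  fix i
  have "order_ge G (Suc i) (\<Psi> (fixp_of G \<Psi>) v - (\<Psi> ^^ Suc i) (\<lambda>_. 0) v)"
    using contractionD[OF assms fixp_of_approx[OF assms]] by simp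
  from order_ge_diff[OF this fixp_of_approx[OF assms, of "Suc i" v]]
  have "order_ge G (Suc i) (\<Psi> (fixp_of G \<Psi>) v - fixp_of G \<Psi> v)" by (simp add: algebra_simps)
  then show "order_ge G i (\<Psi> (fixp_of G \<Psi>) v - fixp_of G \<Psi> v)"
    by (rule order_ge_mono) simp
qed

lemma fixp_of_unique:
  assumes "contraction G \<Psi>" "\<And>v. F v = \<Psi> F v" shows "F v = fixp_of G \<Psi> v"
proof (rule eq_if_order_ge)
  fix i
  show "order_ge G i (F v - fixp_of G \<Psi> v)"
  proof (induction i arbitrary: v)
    case (Suc i)
    have "order_ge G (Suc i) (\<Psi> F v - \<Psi> (fixp_of G \<Psi>) v)"
      by (rule contractionD[OF assms(1) Suc])
    then show ?case by (simp only: fixp_of_fixed[OF assms(1)] assms(2)[symmetric])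
  qed simp
qed

section \<open>Series in which a variable does not occur\<close>

definition free_of :: "'e \<Rightarrow> 'e sqf \<Rightarrow> bool" where
  "free_of e f \<longleftrightarrow> (\<forall>S. e \<in> S \<longrightarrow> cf f S = 0)"

lemma free_of_simps [simp]: "free_of e 0" "free_of e 1"
  by (auto simp: free_of_def cf_simps)

lemma free_of_gen: "e \<noteq> e' \<Longrightarrow> free_of e (gen e')"
  by (auto simp: free_of_def gen.rep_eq)

lemma free_of_add: "free_of e f \<Longrightarrow> free_of e g \<Longrightarrow> free_of e (f + g)"
  by (simp add: free_of_def cf_simps)

lemma free_of_mult: "free_of e f \<Longrightarrow> free_of e g \<Longrightarrow> free_of e (f * g)"
  unfolding free_of_def cf_times
proof (intro allI impI sum.neutral ballI)
  fix S A assume *: "\<forall>S. e \<in> S \<longrightarrow> cf f S = 0" "\<forall>S. e \<in> S \<longrightarrow> cf g S = 0" and "e \<in> S"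
  then consider "e \<in> A" | "e \<in> S - A" by blast
  then show "cf f A * cf g (S - A) = 0" by cases (simp_all only: * mult_zero_left mult_zero_right)
qed

lemma free_of_sum: "(\<And>i. i \<in> I \<Longrightarrow> free_of e (f i)) \<Longrightarrow> free_of e (\<Sum>i\<in>I. f i)"
  by (induction I rule: infinite_finite_induct) (auto intro: free_of_add)

lemma free_of_prod: "(\<And>i. i \<in> I \<Longrightarrow> free_of e (f i)) \<Longrightarrow> free_of e (\<Prod>i\<in>I. f i)"
  by (induction I rule: infinite_finite_induct) (auto intro: free_of_mult)

lemma free_of_fixp_of:
  assumes "\<And>F v. (\<And>w. free_of e (F w)) \<Longrightarrow> free_of e (\<Psi> F v)"
  shows "free_of e (fixp_of G \<Psi> v)"
proof -
  have "free_of e ((\<Psi> ^^ i) (\<lambda>_. 0) v)" for i v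
    by (induction i arbitrary: v) (auto intro: assms)
  then show ?thesis unfolding free_of_def cf_fixp_of by blast
qed

section \<open>The generating series of branching walks\<close>

text \<open>\<open>x v w\<close> stands for the edge between \<open>v\<close> and \<open>w\<close>
  (0 if there is none) and \<open>z v\<close> for a walk that stops at \<open>v\<close>. The vertex
  weights are no parameter of the locale, because they are varied one at a time.\<close>

locale branching_walks =
  fixes n :: nat and x :: "nat \<Rightarrow> nat \<Rightarrow> 'e sqf" and z :: "nat \<Rightarrow> 'e sqf" and G :: "'e set"
  assumes x_sym: "x v w = x w v" and x_loop: "x v v = 0"
    and x_square: "x v w * x v w = 0" and x_order: "order_ge G 1 (x v w)"
    and z_square: "z v * z v = 0"
begin

text \<open>At \<open>v\<close> a walk branches into a nonempty set of neighbors, the empty choice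
  being subtracted, or it stops with the mark \<open>z v\<close>. Turning back is not excluded here;
  it is killed by the square of the edge.\<close>

definition step :: "(nat \<Rightarrow> 'e sqf) \<Rightarrow> (nat \<Rightarrow> 'e sqf) \<Rightarrow> nat \<Rightarrow> 'e sqf" where
  "step a F v = a v * ((\<Prod>w<n. 1 + x v w * F w) - 1 + z v)"

definition series :: "(nat \<Rightarrow> 'e sqf) \<Rightarrow> nat \<Rightarrow> 'e sqf" where
  "series a = fixp_of G (step a)"

lemma step_contraction: "contraction G (step a)"
  unfolding contraction_def
proof (intro allI impI)
  fix i v and F H :: "nat \<Rightarrow> 'e sqf" assume "\<forall>v. order_ge G i (F v - H v)"
  then have "order_ge G (Suc i) ((1 + x v w * F w) - (1 + x v w * H w))" for w
    using order_ge_mult[OF x_order[of v w], of i "F w - H w"] by (simp add: algebra_simps)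
  then have "order_ge G (Suc i) (a v * ((\<Prod>w<n. 1 + x v w * F w) - (\<Prod>w<n. 1 + x v w * H w)))"
    by (intro order_ge_mult2 order_ge_prod_diff)
  also have "a v * ((\<Prod>w<n. 1 + x v w * F w) - (\<Prod>w<n. 1 + x v w * H w))
      = step a F v - step a H v"
    by (simp add: step_def algebra_simps)
  finally show "order_ge G (Suc i) (step a F v - step a H v)" .
qed

lemma series_eq: "series a v = a v * ((\<Prod>w<n. 1 + x v w * series a w) - 1 + z v)"
  using fixp_of_fixed[OF step_contraction, of a v]
  unfolding series_def by (simp only: step_def)

lemma series_unique: "(\<And>v. F v = step a F v) \<Longrightarrow> F v = series a v"
  unfolding series_def by (rule fixp_of_unique[OF step_contraction])

lemma free_of_step:
  assumes "\<And>v w. free_of e (x v w)" "\<And>v. free_of e (z v)" "\<And>v. free_of e (a v)"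
    "\<And>v. free_of e (F v)"
  shows "free_of e (step a F v)"
  unfolding step_def sqf_minus_eq_plus
  by (intro free_of_mult free_of_add free_of_prod free_of_simps assms)

text \<open>The weight of a vertex enters linearly: walks visiting \<open>u\<close> twice cancel. The linear system for
  \<open>L\<close> describes the walks with one visit to \<open>u\<close>. Its symmetry makes the closed walks at \<open>u\<close> cancel
  in pairs, and those equal to their reversal vanish because they use an edge twice.\<close>

lemma series_affine:
  assumes u: "u < n"
  obtains A B where "\<And>\<alpha> v. series (a(u := \<alpha>)) v = A v + \<alpha> * B v"
    and "\<And>e v. (\<And>v w. free_of e (x v w)) \<Longrightarrow> (\<And>v. free_of e (z v)) \<Longrightarrow>
      (\<And>v. v \<noteq> u \<Longrightarrow> free_of e (a v)) \<Longrightarrow> free_of e (A v) \<and> free_of e (B v)"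
proof -
  \<comment> \<open>Weight 0 at \<open>u\<close> gives the walks that avoid
    \<open>u\<close>.\<close>
  define F0 where "F0 = series (a(u := 0))"
  have F0: "F0 v = (a(u := 0)) v * ((\<Prod>w<n. 1 + x v w * F0 w) - 1 + z v)" for v
    unfolding F0_def by (rule series_eq)
  have F0u: "F0 u = 0" using F0[of u] by simp
  define E where "E v = (\<Prod>w<n. 1 + x v w * F0 w)" for v
  \<comment> \<open>The derivative of the system in the weight of \<open>u\<close>:
    \<open>L v\<close> describes the ways from \<open>v\<close> to a first visit of
    \<open>u\<close>, with side branches that avoid \<open>u\<close>.\<close>
  define lin where "lin L v = (if v = u then 1 else a v * E v * (\<Sum>w<n. x v w * L w))" for L v
  have lin: "contraction G lin"
    unfolding contraction_def
  proof (intro allI impI)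
    fix i v and F H :: "nat \<Rightarrow> 'e sqf" assume "\<forall>v. order_ge G i (F v - H v)"
    then have "order_ge G (Suc i) (x v w * (F w - H w))" for w
      using order_ge_mult[OF x_order[of v w], of i "F w - H w"] by simp
    then have "order_ge G (Suc i) (a v * E v * (\<Sum>w<n. x v w * (F w - H w)))"
      by (rule order_ge_mult2[OF order_ge_sum])
    also have "a v * E v * (\<Sum>w<n. x v w * (F w - H w))
        = a v * E v * (\<Sum>w<n. x v w * F w) - a v * E v * (\<Sum>w<n. x v w * H w)"
      by (simp add: sum_subtractf right_diff_distrib)
    finally show "order_ge G (Suc i) (lin F v - lin H v)" by (simp add: lin_def)
  qed
  define L where "L = fixp_of G lin"
  have L: "L v = lin L v" for v using fixp_of_fixed[OF lin, of v] by (simp add: L_def)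
  define M where "M v = (\<Sum>w<n. x v w * L w)" for v
  have Lu: "L u = 1" using L[of u] by (simp add: lin_def)
  have LM: "L v = a v * E v * M v" if "v \<noteq> u" for v using L[of v] that by (simp add: lin_def M_def)
  have MM: "M v * M v = 0" for v
    unfolding M_def sqf_square_sum
    by (rule sum.neutral) (simp add: x_square mult.assoc mult.left_commute[of "L _"] 
        mult.assoc[symmetric, of "x _ _" "x _ _"])
  let ?I = "{..<n} - {u}"
  have split: "M v = x v u + (\<Sum>w\<in>?I. x v w * L w)" for v
    unfolding M_def using u Lu by (subst sum.remove[of _ u]) auto
  \<comment> \<open>The closed walks at \<open>u\<close> vanish: writing \<open>x u w\<close> in
    terms of \<open>M w\<close> turns the sum into terms with the factor
    \<open>M w * M w = 0\<close> and a symmetric double sum with diagonal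
    \<open>x w w = 0\<close>.\<close>
  have "M u = (\<Sum>w\<in>?I. x u w * L w)" using split[of u] x_loop by simp
  also have "\<dots> = (\<Sum>w\<in>?I. (M w + (\<Sum>w'\<in>?I. x w w' * L w')) * L w)"
  proof (rule sum.cong[OF refl])
    fix w
    have "x u w = M w + (\<Sum>w'\<in>?I. x w w' * L w')"
      unfolding split[of w] x_sym[of u w] by (simp only: add.assoc sqf_add_self add_0_right)
    then show "x u w * L w = (M w + (\<Sum>w'\<in>?I. x w w' * L w')) * L w" by simp
  qed
  also have "\<dots> = (\<Sum>w\<in>?I. M w * L w) + (\<Sum>w\<in>?I. \<Sum>w'\<in>?I. x w w' * L w' * L w)"
    by (simp add: distrib_right sum.distrib sum_distrib_right)
  also have "(\<Sum>w\<in>?I. M w * L w) = 0"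
    by (rule sum.neutral) (simp add: LM mult.left_commute[of "M _"] MM)
  also have "(\<Sum>w\<in>?I. \<Sum>w'\<in>?I. x w w' * L w' * L w) = (\<Sum>w\<in>?I. x w w * L w * L w)"
    by (rule sqf_symmetric_sum) (simp_all add: x_sym mult.commute mult.left_commute)
  also have "\<dots> = 0" by (simp add: x_loop)
  finally have Mu: "M u = 0" by simp
  \<comment> \<open>What hangs below the visit to \<open>u\<close>. Its square is
    \<open>1 + 1 + 0\<close>, so a second visit contributes nothing, whatever
    \<open>\<alpha>\<close> is.\<close>
  define Q where "Q = E u - 1 + z u"
  have EE: "E v * E v = 1" for v
    unfolding E_def
    by (rule sqf_prod_one_plus_square) (metis mult.assoc mult.commute mult_zero_right x_square)
  have QQ: "Q * Q = 0"
    unfolding Q_def sqf_minus_eq_plus sqf_square_add EE z_square by simp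
  have series: "series (a(u := \<alpha>)) v = F0 v + \<alpha> * (Q * L v)" for \<alpha> v
  proof -
    define D where "D = \<alpha> * Q"
    have DD: "D * D = 0" unfolding D_def using QQ by (metis mult.assoc mult.commute mult_zero_right)
    have lin_prod: "(\<Prod>i\<in>I. 1 + D * f i) = 1 + D * (\<Sum>i\<in>I. f i)" if "finite I" for f I
      using that
    proof (induction I rule: finite_induct)
      case (insert i I)
      have "(1 + D * f i) * (1 + D * (\<Sum>i\<in>I. f i))
          = 1 + D * (f i + (\<Sum>i\<in>I. f i)) + D * D * (f i * (\<Sum>i\<in>I. f i))"
        by (simp add: algebra_simps)
      then show ?case using insert DD by simp
    qed simp
    have prod: "(\<Prod>w<n. 1 + x v w * (F0 w + D * L w)) = E v * (1 + D * M v)" for v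
    proof -
      have "1 + x v w * (F0 w + D * L w) = (1 + x v w * F0 w) * (1 + D * (x v w * L w))" for w
      proof -
        have "(1 + x v w * F0 w) * (1 + D * (x v w * L w))
            = 1 + x v w * (F0 w + D * L w) + x v w * x v w * (F0 w * D * L w)"
          by (simp add: algebra_simps)
        then show ?thesis by (simp only: x_square mult_zero_left add_0_right)
      qed
      then show ?thesis by (simp add: prod.distrib E_def lin_prod M_def)
    qed
    \<comment> \<open>The affine candidate solves the full system: \<open>D * D = 0\<close>
      linearizes the products, and at \<open>u\<close> the remaining term contains
      \<open>M u = 0\<close>. Uniqueness of the fixed point does the rest.\<close>
    have "F0 v + D * L v = step (a(u := \<alpha>)) (\<lambda>v. F0 v + D * L v) v" for v
    proof (cases "v = u")
      case True
      then show ?thesis unfolding step_def prod using Mu F0u Lu by (simp add: D_def Q_def)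
    next
      case False
      have "step (a(u := \<alpha>)) (\<lambda>v. F0 v + D * L v) v
          = a v * (E v - 1 + z v) + D * (a v * E v * M v)"
        unfolding step_def prod using False by (simp add: algebra_simps)
      with False show ?thesis using F0[of v] LM[of v] by (simp add: E_def)
    qed
    then have "F0 v + D * L v = series (a(u := \<alpha>)) v" by (rule series_unique)
    then show ?thesis by (simp add: D_def mult.assoc)
  qed
  show thesis
  proof (rule that[of F0 "\<lambda>v. Q * L v"])
    show "series (a(u := \<alpha>)) v = F0 v + \<alpha> * (Q * L v)" for \<alpha> v by (rule series)
    fix e v assume fr: "\<And>v w. free_of e (x v w)" "\<And>v. free_of e (z v)"
      "\<And>v. v \<noteq> u \<Longrightarrow> free_of e (a v)"
    have fF0: "free_of e (F0 v)" for v
      unfolding F0_def series_def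
      by (rule free_of_fixp_of, rule free_of_step) (auto simp: fr)
    have fE: "free_of e (E v)" for v
      unfolding E_def by (intro free_of_prod free_of_add free_of_mult fr fF0 free_of_simps)
    have fL: "free_of e (L v)" for v
      unfolding L_def
    proof (rule free_of_fixp_of)
      fix F :: "nat \<Rightarrow> 'e sqf" and v assume "\<And>w. free_of e (F w)"
      then show "free_of e (lin F v)"
        by (cases "v = u") (auto simp: lin_def intro!: free_of_mult free_of_sum fr fE)
    qed
    show "free_of e (F0 v) \<and> free_of e (Q * L v)"
      using fF0 fE fL fr unfolding Q_def sqf_minus_eq_plus
      by (intro conjI free_of_mult free_of_add free_of_simps) auto
  qed
qed

end

section \<open>Branching walks and their monomials\<close>

text \<open>The monomial of a branching walk lists its edges, its vertices, and its leaves with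
  multiplicity.\<close>

datatype el = Edge nat nat | Vert nat | Lf nat

definition edge :: "nat \<Rightarrow> nat \<Rightarrow> el" where "edge v w = Edge (min v w) (max v w)"

lemma edge_commute: "edge v w = edge w v"
  by (simp add: edge_def min.commute max.commute)

lemma edge_eq_iff: "edge a b = edge c d \<longleftrightarrow> (a = c \<and> b = d) \<or> (a = d \<and> b = c)"
  by (auto simp: edge_def min_def max_def)

lemma edge_neq [simp]: "edge v w \<noteq> Vert u" "edge v w \<noteq> Lf u" "Vert u \<noteq> edge v w" "Lf u \<noteq> edge v w"
  by (auto simp: edge_def)

text \<open>Walks are kept as lists of multisets because they are evaluated in several semirings: in
  \<open>sqf\<close> for parities, in the naturals by the program, and in the reals to bound their
  number.\<close>

definition evalm :: "('e \<Rightarrow> 'b :: comm_semiring_1) \<Rightarrow> 'e multiset list \<Rightarrow> 'b" where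
  "evalm h A = (\<Sum>m\<leftarrow>A. \<Prod>e\<in>#m. h e)"

definition lmul :: "'e multiset list \<Rightarrow> 'e multiset list \<Rightarrow> 'e multiset list" where
  "lmul A B = concat (map (\<lambda>a. map ((+) a) B) A)"

lemma evalm_simps [simp]: "evalm h [] = 0" "evalm h (m # A) = (\<Prod>e\<in>#m. h e) + evalm h A"
  "evalm h (A @ B) = evalm h A + evalm h B" "evalm h (map (add_mset e) A) = h e * evalm h A"
  by (simp_all add: evalm_def o_def sum_list_const_mult)

lemma evalm_lmul: "evalm h (lmul A B) = evalm h A * evalm h B"
  by (induction A) (simp_all add: lmul_def evalm_def o_def sum_list_const_mult distrib_right)

lemma set_lmul: "set (lmul A B) = {a + b | a b. a \<in> set A \<and> b \<in> set B}"
  by (auto simp: lmul_def)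

text \<open>Nonempty choices of one monomial each from some of the \<open>f w\<close>. The empty
  choice is left out from the start, since the semirings need not have subtraction.\<close>

definition forests :: "(nat \<Rightarrow> 'e multiset list) \<Rightarrow> nat \<Rightarrow> 'e multiset list" where
  "forests f n = foldl (\<lambda>A w. A @ lmul (f w) ({#} # A)) [] [0..<n]"

definition fold_val :: "(nat \<Rightarrow> 'b :: comm_semiring_1) \<Rightarrow> nat \<Rightarrow> 'b" where
  "fold_val t n = foldl (\<lambda>A w. A + t w * (1 + A)) 0 [0..<n]"

lemma forests_simps [simp]: "forests f 0 = []"
  "forests f (Suc n) = forests f n @ lmul (f n) ({#} # forests f n)"
  by (simp_all add: forests_def)

lemma fold_val_simps [simp]: "fold_val t 0 = 0"
  "fold_val t (Suc n) = fold_val t n + t n * (1 + fold_val t n)"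
  by (simp_all add: fold_val_def)

lemma evalm_forests: "evalm h (forests f n) = fold_val (\<lambda>w. evalm h (f w)) n"
  by (induction n) (simp_all add: evalm_lmul)

lemma one_plus_fold_val: "1 + fold_val t n = (\<Prod>w<n. 1 + t w)"
  by (induction n) (simp_all add: add.assoc[symmetric] distrib_right mult.commute[of "prod _ _"])

lemma fold_val_ring: "fold_val t n = (\<Prod>w<n. 1 + t w) - (1 :: 'b :: comm_ring_1)"
  using one_plus_fold_val[of t n] by (simp add: algebra_simps)

text \<open>The walks in question do not turn around: \<open>p\<close> is the vertex from which \<open>v\<close> was entered.\<close>

primrec walks :: "nat \<Rightarrow> (nat \<Rightarrow> nat \<Rightarrow> bool) \<Rightarrow> nat \<Rightarrow> nat \<Rightarrow> nat \<Rightarrow> el multiset list" where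
  "walks n E 0 = (\<lambda>p v. [])"
| "walks n E (Suc i) = (\<lambda>p v. map (add_mset (Vert v)) (forests (\<lambda>w.
     if E v w \<and> w \<noteq> p then map (add_mset (edge v w)) (walks n E i v w) else []) n @ [{#Lf v#}]))"

primrec walks_val :: "nat \<Rightarrow> (nat \<Rightarrow> nat \<Rightarrow> bool) \<Rightarrow> (el \<Rightarrow> 'b :: comm_semiring_1) \<Rightarrow>
    nat \<Rightarrow> nat \<Rightarrow> nat \<Rightarrow> 'b" where
  "walks_val n E h 0 = (\<lambda>p v. 0)"
| "walks_val n E h (Suc i) = (\<lambda>p v. h (Vert v) * (fold_val (\<lambda>w.
     if E v w \<and> w \<noteq> p then h (edge v w) * walks_val n E h i v w else 0) n + h (Lf v)))"

lemma evalm_walks: "evalm h (walks n E i p v) = walks_val n E h i p v"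
proof (induction i arbitrary: p v)
  case (Suc i)
  have "evalm h (if E v w \<and> w \<noteq> p then map (add_mset (edge v w)) (walks n E i v w) else [])
      = (if E v w \<and> w \<noteq> p then h (edge v w) * walks_val n E h i v w else 0)" for w
    by (simp add: Suc)
  then show ?case by (simp add: evalm_forests distrib_left)
qed simp

definition without :: "nat \<Rightarrow> (nat \<Rightarrow> nat \<Rightarrow> bool) \<Rightarrow> nat \<Rightarrow> nat \<Rightarrow> bool" where
  "without r E v w \<longleftrightarrow> E v w \<and> v \<noteq> r \<and> w \<noteq> r"

definition rooted_walks :: "nat \<Rightarrow> (nat \<Rightarrow> nat \<Rightarrow> bool) \<Rightarrow> nat \<Rightarrow> nat \<Rightarrow> el multiset list" where
  "rooted_walks n E i r = concat (map (\<lambda>w. if E r w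
     then map (add_mset (edge r w)) (walks n (without r E) i r w) else []) [0..<n])"

definition rooted_val :: "nat \<Rightarrow> (nat \<Rightarrow> nat \<Rightarrow> bool) \<Rightarrow> (el \<Rightarrow> 'b :: comm_semiring_1) \<Rightarrow>
    nat \<Rightarrow> nat \<Rightarrow> 'b" where
  "rooted_val n E h i r = (\<Sum>w<n. if E r w then h (edge r w) * walks_val n (without r E) h i r w else 0)"

lemma evalm_concat_upt: "evalm h (concat (map f [0..<n])) = (\<Sum>w<n. evalm h (f w))"
  by (induction n) simp_all

lemma evalm_rooted_walks: "evalm h (rooted_walks n E i r) = rooted_val n E h i r"
  unfolding rooted_walks_def rooted_val_def evalm_concat_upt
  by (intro sum.cong) (auto simp: evalm_walks)


subsection \<open>Coefficients\<close>

text \<open>A repeated element annihilates the product, so only square-free monomials leave a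
  trace.\<close>

lemma cf_prod_gen: "cf (\<Prod>e\<in>#m. gen e) S = of_bool (finite S \<and> m = mset_set S)"
proof (induction m arbitrary: S)
  case empty
  show ?case by (auto simp: cf_simps mset_set_empty_iff)
next
  case (add e m)
  have "cf (\<Prod>e\<in>#add_mset e m. gen e) S = of_bool (e \<in> S \<and> finite S \<and> m = mset_set (S - {e}))"
    by (simp add: cf_gen_mult add)
  also have "(e \<in> S \<and> finite S \<and> m = mset_set (S - {e})) \<longleftrightarrow> finite S \<and> add_mset e m = mset_set S"
  proof (cases "finite S")
    case True
    have "e \<in> S" if "add_mset e m = mset_set S"
      using arg_cong[OF that, of set_mset] True by auto
    moreover have "mset_set S = add_mset e (mset_set (S - {e}))" if "e \<in> S"
      using True that by (rule mset_set.remove)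
    ultimately show ?thesis using True by auto
  qed simp
  finally show ?case .
qed

text \<open>Only vertices outside \<open>Y\<close> lose their mark; edges and leaves stay visible
  even where they carry no label.\<close>

definition marked :: "nat set \<Rightarrow> el \<Rightarrow> bool" where
  "marked Y e \<longleftrightarrow> (case e of Vert v \<Rightarrow> v \<in> Y | _ \<Rightarrow> True)"

definition formal :: "nat set \<Rightarrow> el \<Rightarrow> el sqf" where
  "formal Y e = (if marked Y e then gen e else 1)"

lemma prod_formal: "(\<Prod>e\<in>#m. formal Y e) = (\<Prod>e\<in>#filter_mset (marked Y) m. gen e)"
  by (induction m) (auto simp: formal_def)

lemma cf_evalm_formal: "finite S \<Longrightarrow>
  cf (evalm (formal Y) A) S = of_nat (length (filter (\<lambda>m. filter_mset (marked Y) m = mset_set S) A))"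
  by (induction A) (auto simp: cf_simps prod_formal cf_prod_gen add.commute)

definition parity_of :: "el set \<Rightarrow> (el set \<Rightarrow> bool) \<Rightarrow> el sqf \<Rightarrow> bit" where
  "parity_of U \<phi> f = (\<Sum>S | S \<subseteq> U \<and> \<phi> S. cf f S)"

lemma parity_of_add: "parity_of U \<phi> (f + g) = parity_of U \<phi> f + parity_of U \<phi> g"
  by (simp add: parity_of_def cf_simps sum.distrib)

text \<open>Multiplication by \<open>gen e\<close> maps \<open>S\<close> to
  \<open>insert e S\<close>, and \<open>\<phi>\<close> cannot tell the two apart. So replacing the
  weight 1 by a new variable preserves the parity.\<close>

lemma parity_of_mult_gen:
  assumes "finite U" "e \<in> U" "free_of e f" "\<And>S. \<phi> (insert e S) = \<phi> S"
  shows "parity_of U \<phi> (gen e * f) = parity_of U \<phi> f"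
proof -
  have "parity_of U \<phi> (gen e * f) = (\<Sum>S | (S \<subseteq> U \<and> \<phi> S) \<and> e \<in> S. cf f (S - {e}))"
    unfolding parity_of_def cf_gen_mult using assms(1)
    by (subst sum.inter_filter[symmetric]) auto
  also have "\<dots> = (\<Sum>S | (S \<subseteq> U \<and> \<phi> S) \<and> e \<notin> S. cf f S)"
    using assms(2,4)
    by (intro sum.reindex_bij_witness[where i = "insert e" and j = "\<lambda>S. S - {e}"])
      (auto simp: insert_absorb, (metis assms(4) insert_Diff)+)
  also have "\<dots> = (\<Sum>S | S \<subseteq> U \<and> \<phi> S. if e \<notin> S then cf f S else 0)"
    using assms(1) by (subst sum.inter_filter[symmetric]) auto
  also have "\<dots> = parity_of U \<phi> f"
    unfolding parity_of_def using assms(3) by (intro sum.cong) (auto simp: free_of_def)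
  finally show ?thesis .
qed

text \<open>A walk satisfying \<open>P\<close> contributes to exactly one of the coefficients
  summed, because its marked part is a set; any other walk contributes to none.\<close>

lemma of_nat_length_filter_eq_parity_of:
  assumes U: "finite U"
    and P: "\<And>m. m \<in> set A \<Longrightarrow> P m \<Longrightarrow>
      \<exists>S. S \<subseteq> U \<and> \<phi> S \<and> filter_mset (marked Y) m = mset_set S"
    and \<phi>: "\<And>m S. m \<in> set A \<Longrightarrow> S \<subseteq> U \<Longrightarrow> \<phi> S \<Longrightarrow> filter_mset (marked Y) m = mset_set S \<Longrightarrow> P m"
  shows "of_nat (length (filter P A)) = parity_of U \<phi> (evalm (formal Y) A)"
proof -
  let ?C = "{S. S \<subseteq> U \<and> \<phi> S}"
  have fin: "finite ?C" using U by simp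
  have fS: "finite S" if "S \<in> ?C" for S using that U finite_subset by auto
  have "length (filter P A) = (\<Sum>S\<in>?C. length (filter (\<lambda>m. filter_mset (marked Y) m = mset_set S) A))"
    using P \<phi>
  proof (induction A)
    case (Cons m A)
    have "(\<Sum>S\<in>?C. length (filter (\<lambda>m. filter_mset (marked Y) m = mset_set S) (m # A)))
        = (\<Sum>S\<in>?C. of_bool (filter_mset (marked Y) m = mset_set S)) + length (filter P A)"
      using Cons by (simp add: sum.distrib[symmetric] if_distrib cong: if_cong)
        (auto intro!: sum.cong)
    also have "(\<Sum>S\<in>?C. of_bool (filter_mset (marked Y) m = mset_set S)) = (of_bool (P m) :: nat)"
    proof (cases "P m")
      case True
      then obtain S where S: "S \<in> ?C" "filter_mset (marked Y) m = mset_set S"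
        using Cons.prems(1)[of m] by auto
      have "(\<Sum>S'\<in>?C. of_bool (filter_mset (marked Y) m = mset_set S'))
          = (\<Sum>S'\<in>?C. if S' = S then 1 else (0 :: nat))"
        using S fS by (intro sum.cong) (auto simp: mset_set_eq_iff[OF fS fS])
      then show ?thesis using S True fin by simp
    next
      case False
      have "(\<Sum>S'\<in>?C. of_bool (filter_mset (marked Y) m = mset_set S')) = (0 :: nat)"
        by (rule sum.neutral) (use False Cons.prems(2)[of m] in auto)
      then show ?thesis using False by simp
    qed
    finally show ?case by simp
  qed simp
  then have "of_nat (length (filter P A))
      = (\<Sum>S\<in>?C. of_nat (length (filter (\<lambda>m. filter_mset (marked Y) m = mset_set S) A)) :: bit)"
    by simp
  also have "\<dots> = parity_of U \<phi> (evalm (formal Y) A)"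
    unfolding parity_of_def using fS by (intro sum.cong) (auto simp: cf_evalm_formal)
  finally show ?thesis .
qed


subsection \<open>Marking all vertices\<close>

definition edge_els :: "el set" where "edge_els = range (case_prod Edge)"

definition xgen :: "(nat \<Rightarrow> nat \<Rightarrow> bool) \<Rightarrow> nat \<Rightarrow> nat \<Rightarrow> el sqf" where
  "xgen E v w = (if E v w then gen (edge v w) else 0)"

locale simple_graph =
  fixes n :: nat and E :: "nat \<Rightarrow> nat \<Rightarrow> bool"
  assumes E_sym: "E v w \<longleftrightarrow> E w v" and E_irrefl: "\<not> E v v"
    and E_less: "E v w \<Longrightarrow> v < n"
begin

lemma E_less2: "E v w \<Longrightarrow> w < n"
  using E_sym E_less by blast

sublocale branching_walks n "xgen E" "\<lambda>v. gen (Lf v)" edge_els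
proof
  show "xgen E v w = xgen E w v" for v w using E_sym by (simp add: xgen_def edge_commute)
  show "xgen E v v = 0" for v using E_irrefl by (simp add: xgen_def)
  show "xgen E v w * xgen E v w = 0" for v w by (simp add: xgen_def)
  show "order_ge edge_els 1 (xgen E v w)" for v w
    using order_ge_gen[of "edge v w" edge_els] by (auto simp: xgen_def edge_def edge_els_def)
  show "gen (Lf v) * gen (Lf v) = 0" for v by simp
qed

abbreviation weight :: "nat set \<Rightarrow> nat \<Rightarrow> el sqf" where
  "weight Y v \<equiv> formal Y (Vert v)"

lemma formal_simps [simp]: "formal Y (edge v w) = gen (edge v w)" "formal Y (Lf v) = gen (Lf v)"
  "v \<in> Y \<Longrightarrow> formal Y (Vert v) = gen (Vert v)" "v \<notin> Y \<Longrightarrow> formal Y (Vert v) = 1"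
  by (auto simp: formal_def marked_def edge_def)

text \<open>Forbidding the return to \<open>p\<close> changes nothing after multiplication by the
  edge from \<open>p\<close> to \<open>v\<close>, because the return would square that edge, and
  nothing at all if \<open>p\<close> is no neighbor of \<open>v\<close>.\<close>

lemma walks_val_formal:
  shows "xgen E p v * walks_val n E (formal Y) i p v
      = xgen E p v * ((step (weight Y) ^^ i) (\<lambda>_. 0)) v"
    and "\<not> E v p \<Longrightarrow> walks_val n E (formal Y) i p v = ((step (weight Y) ^^ i) (\<lambda>_. 0)) v"
proof (induction i arbitrary: p v)
  case (Suc i)
  let ?S = "(step (weight Y) ^^ i) (\<lambda>_. 0)"
  have t: "(if E v w \<and> w \<noteq> p then formal Y (edge v w) * walks_val n E (formal Y) i v w else 0)
      = (if w = p then 0 else xgen E v w * ?S w)" for p v w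
    proof (cases "E v w")
    case True
    then have "xgen E v w = gen (edge v w)" by (simp add: xgen_def)
    with Suc(1)[of v w] True show ?thesis by simp
  next
    case False
    then have "xgen E v w = 0" by (simp add: xgen_def)
    with False show ?thesis by simp
  qed
  have val: "walks_val n E (formal Y) (Suc i) p v
      = weight Y v * ((\<Prod>w<n. 1 + (if w = p then 0 else xgen E v w * ?S w)) - 1 + gen (Lf v))" for p v
    unfolding walks_val.simps t fold_val_ring by simp
  have step: "((step (weight Y) ^^ Suc i) (\<lambda>_. 0)) v
      = weight Y v * ((\<Prod>w<n. 1 + xgen E v w * ?S w) - 1 + gen (Lf v))" for v
    by (simp only: funpow.simps o_apply step_def[of _ ?S])
  {
    case 2
    then have "(\<Prod>w<n. 1 + (if w = p then 0 else xgen E v w * ?S w)) = (\<Prod>w<n. 1 + xgen E v w * ?S w)"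
      by (intro prod.cong) (auto simp: xgen_def)
    then show ?case by (simp only: val step)
  next
    case 1
    have "xgen E p v * (\<Prod>w<n. 1 + (if w = p then 0 else xgen E v w * ?S w))
        = xgen E p v * (\<Prod>w<n. 1 + xgen E v w * ?S w)"
    proof (cases "p < n")
      case True
      let ?R = "\<Prod>w\<in>{..<n} - {p}. 1 + xgen E v w * ?S w"
      have "(\<Prod>w<n. 1 + xgen E v w * ?S w) = (1 + xgen E v p * ?S p) * ?R"
        using True by (subst prod.remove[of _ p]) auto
      moreover have "(\<Prod>w<n. 1 + (if w = p then 0 else xgen E v w * ?S w)) = ?R"
        using True by (subst prod.remove[of _ p]) auto
      moreover have "xgen E p v * (1 + xgen E v p * ?S p) = xgen E p v"
        using x_square[of p v] x_sym[of p v]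
        by (simp add: distrib_left mult.assoc[symmetric])
      ultimately show ?thesis by (simp only: mult.assoc[symmetric])
    next
      case False
      then show ?thesis by (intro arg_cong[where f = "(*) _"] prod.cong) auto
    qed
    moreover have "xgen E p v * (weight Y v * (P - 1 + gen (Lf v)))
        = weight Y v * (xgen E p v * P - xgen E p v + xgen E p v * gen (Lf v))" for P
      by (simp add: algebra_simps)
    ultimately show ?case by (simp only: val step)
  }
qed simp_all

end

text \<open>The root is a leaf with a single child, and the rest of the walk lives in the graph
  without it. Its own vertex and leaf marks are omitted, so later counts of vertices and leaves are
  lower by one.\<close>

definition root_series :: "nat \<Rightarrow> (nat \<Rightarrow> nat \<Rightarrow> bool) \<Rightarrow> nat set \<Rightarrow> nat \<Rightarrow> el sqf" where
  "root_series n E Y r = (\<Sum>w<n. xgen E r w *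
     branching_walks.series n (xgen (without r E)) (\<lambda>v. gen (Lf v)) edge_els (\<lambda>v. formal Y (Vert v)) w)"

context simple_graph
begin

lemma without: "simple_graph n (without r E)"
  by unfold_locales (use E_sym E_irrefl E_less in \<open>auto simp: without_def\<close>)

text \<open>The series and its \<open>k\<close>-th iterate differ only in order \<open>k\<close> and
  above, and the edge at the root adds one. So depth \<open>k\<close> suffices for monomials with at
  most \<open>k\<close> edges.\<close>

lemma cf_rooted_val:
  assumes S: "card (S \<inter> edge_els) \<le> k"
  shows "cf (rooted_val n E (formal Y) k r) S = cf (root_series n E Y r) S"
proof -
  interpret W: simple_graph n "without r E" by (rule without)
  let ?S = "(W.step (weight Y) ^^ k) (\<lambda>_. 0)"
  have "rooted_val n E (formal Y) k r = (\<Sum>w<n. xgen E r w * ?S w)"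
    unfolding rooted_val_def
    by (rule sum.cong) (auto simp: xgen_def W.walks_val_formal(2) without_def)
  moreover have "root_series n E Y r = (\<Sum>w<n. xgen E r w * W.series (weight Y) w)"
    by (simp add: root_series_def)
  ultimately have "root_series n E Y r - rooted_val n E (formal Y) k r
      = (\<Sum>w<n. xgen E r w * (W.series (weight Y) w - ?S w))"
    by (simp add: sum_subtractf right_diff_distrib)
  moreover have "order_ge edge_els (1 + k) \<dots>"
    unfolding W.series_def
    by (intro order_ge_sum order_ge_mult x_order fixp_of_approx W.step_contraction)
  ultimately have "cf (root_series n E Y r - rooted_val n E (formal Y) k r) S = 0"
    using S by (simp add: order_ge_def)
  then show ?thesis by (simp only: minus_sqf.rep_eq bit_add_eq_0_iff)
qed

text \<open>By \<open>series_affine\<close> the series is \<open>A + \<alpha> * B\<close> in the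
  weight of \<open>u\<close>, where \<open>A\<close> and \<open>B\<close> are free of the mark of
  \<open>u\<close>. The two sides only differ in \<open>\<alpha> = gen (Vert u)\<close> against
  \<open>\<alpha> = 1\<close>.\<close>

lemma parity_of_root_series_insert:
  assumes U: "finite U" "Vert u \<in> U" and u: "u < n" "u \<notin> Y"
    and \<phi>: "\<And>S. \<phi> (insert (Vert u) S) = \<phi> S"
  shows "parity_of U \<phi> (root_series n E (insert u Y) r) = parity_of U \<phi> (root_series n E Y r)"
proof -
  interpret W: simple_graph n "without r E" by (rule without)
  obtain A B where AB: "\<And>\<alpha> v. W.series ((weight Y)(u := \<alpha>)) v = A v + \<alpha> * B v"
    and fr: "\<And>e v. (\<And>v w. free_of e (xgen (without r E) v w)) \<Longrightarrow> (\<And>v. free_of e (gen (Lf v))) \<Longrightarrow>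
      (\<And>v. v \<noteq> u \<Longrightarrow> free_of e (weight Y v)) \<Longrightarrow> free_of e (A v) \<and> free_of e (B v)"
    using W.series_affine[OF u(1), of "weight Y"] by blast
  have fx: "free_of (Vert u) (xgen E' v w)" for E' v w
    by (auto simp: xgen_def intro!: free_of_gen)
  have fAB: "free_of (Vert u) (A v)" "free_of (Vert u) (B v)" for v
  proof -
    have "free_of (Vert u) (weight Y v)" if "v \<noteq> u" for v
      using that by (cases "v \<in> Y") (auto intro!: free_of_gen)
    then have "free_of (Vert u) (A v) \<and> free_of (Vert u) (B v)"
      by (intro fr fx free_of_gen) auto
    then show "free_of (Vert u) (A v)" "free_of (Vert u) (B v)" by auto
  qed
  have "(weight Y)(u := 1) = weight Y" using u(2) by auto
  then have s1: "W.series (weight Y) v = A v + B v" for v using AB[of 1 v] by simp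
  have "(weight Y)(u := gen (Vert u)) = weight (insert u Y)"
    using u(2) by (auto simp: fun_eq_iff formal_def marked_def)
  then have s2: "W.series (weight (insert u Y)) v = A v + gen (Vert u) * B v" for v
    using AB[of "gen (Vert u)" v] by simp
  let ?A = "\<Sum>w<n. xgen E r w * A w" and ?B = "\<Sum>w<n. xgen E r w * B w"
  have fB: "free_of (Vert u) ?B" by (intro free_of_sum free_of_mult fx fAB)
  have "root_series n E Y r = ?A + ?B"
    by (simp add: root_series_def s1 distrib_left sum.distrib)
  moreover have "root_series n E (insert u Y) r = ?A + gen (Vert u) * ?B"
    by (simp add: root_series_def s2 distrib_left sum.distrib sum_distrib_left mult.left_commute)
  ultimately show ?thesis
    using U fB \<phi> by (simp add: parity_of_add parity_of_mult_gen)
qed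

lemma parity_of_root_series:
  assumes U: "finite U" "\<And>u. u < n \<Longrightarrow> Vert u \<in> U" and Y: "Y \<subseteq> {..<n}"
    and \<phi>: "\<And>S u. u \<notin> Y \<Longrightarrow> \<phi> (insert (Vert u) S) = \<phi> S"
  shows "parity_of U \<phi> (root_series n E Y r) = parity_of U \<phi> (root_series n E {..<n} r)"
proof -
  have "parity_of U \<phi> (root_series n E (Y \<union> D) r) = parity_of U \<phi> (root_series n E Y r)"
    if "finite D" "D \<subseteq> {..<n} - Y" for D
    using that
  proof (induction D rule: finite_induct)
    case (insert u D)
    have "parity_of U \<phi> (root_series n E (insert u (Y \<union> D)) r)
        = parity_of U \<phi> (root_series n E (Y \<union> D) r)"
      using insert U \<phi> by (intro parity_of_root_series_insert) auto
    with insert show ?case by simp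
  qed simp
  from this[of "{..<n} - Y"] show ?thesis using Y by (simp add: Un_absorb1)
qed

text \<open>The bridge between what is computed, walks with vertex marks in \<open>Y\<close> only,
  and what is wanted, the series with all vertices marked, whose monomials turn out to be the
  trees.\<close>

theorem parity_of_walks:
  assumes U: "finite U" "\<And>u. u < n \<Longrightarrow> Vert u \<in> U" and Y: "Y \<subseteq> {..<n}"
    and \<phi>: "\<And>S u. u \<notin> Y \<Longrightarrow> \<phi> (insert (Vert u) S) = \<phi> S"
    and \<phi>_edges: "\<And>S. \<phi> S \<Longrightarrow> card (S \<inter> edge_els) \<le> k"
    and P: "\<And>m. m \<in> set (rooted_walks n E k r) \<Longrightarrow> P m \<Longrightarrow>
      \<exists>S. S \<subseteq> U \<and> \<phi> S \<and> filter_mset (marked Y) m = mset_set S"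
    and P\<phi>: "\<And>m S. m \<in> set (rooted_walks n E k r) \<Longrightarrow> S \<subseteq> U \<Longrightarrow> \<phi> S \<Longrightarrow>
      filter_mset (marked Y) m = mset_set S \<Longrightarrow> P m"
  shows "odd (length (filter P (rooted_walks n E k r))) \<longleftrightarrow>
    odd (card {S. S \<subseteq> U \<and> \<phi> S \<and> cf (root_series n E {..<n} r) S = 1})"
proof -
  have "of_nat (length (filter P (rooted_walks n E k r)))
      = parity_of U \<phi> (rooted_val n E (formal Y) k r)"
    using of_nat_length_filter_eq_parity_of[OF U(1) P P\<phi>] by (simp add: evalm_rooted_walks)
  also have "\<dots> = parity_of U \<phi> (root_series n E Y r)"
    unfolding parity_of_def by (rule sum.cong) (auto simp: cf_rooted_val \<phi>_edges)
  also have "\<dots> = parity_of U \<phi> (root_series n E {..<n} r)"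
    by (rule parity_of_root_series) (use U Y \<phi> in auto)
  also have "\<dots> = (\<Sum>S | S \<subseteq> U \<and> \<phi> S. if cf (root_series n E {..<n} r) S = 1 then 1 else 0)"
    unfolding parity_of_def by (rule sum.cong) (auto simp: bit_not_one_iff)
  also have "\<dots> = of_nat (card {S. S \<subseteq> U \<and> \<phi> S \<and> cf (root_series n E {..<n} r) S = 1})"
    using U(1) by (simp add: sum.If_cases Int_def conj_assoc)
  finally have "odd (of_nat (length (filter P (rooted_walks n E k r))) :: bit) \<longleftrightarrow>
      odd (of_nat (card {S. S \<subseteq> U \<and> \<phi> S \<and> cf (root_series n E {..<n} r) S = 1}) :: bit)"
    by simp
  then show ?thesis by (simp only: even_of_nat_iff)
qed

end

section \<open>Rooted trees\<close>

text \<open>The root of a one-vertex branch becomes a leaf once the branch is attached to a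
  parent.\<close>

definition with_root :: "nat \<Rightarrow> nat set \<Rightarrow> nat set \<Rightarrow> nat set" where
  "with_root v V L = (if V = {v} then {v} else L)"

text \<open>In \<open>rtree E v V A L\<close> the set \<open>L\<close> consists of the leaves other than the root \<open>v\<close>.\<close>

inductive rtree :: "(nat \<Rightarrow> nat \<Rightarrow> bool) \<Rightarrow> nat \<Rightarrow> nat set \<Rightarrow> el set \<Rightarrow> nat set \<Rightarrow> bool" for E where
  single: "rtree E v {v} {} {}"
| join: "rtree E v V A L \<Longrightarrow> rtree E w V' A' L' \<Longrightarrow> V \<inter> V' = {} \<Longrightarrow> E v w \<Longrightarrow>
    rtree E v (V \<union> V') (insert (edge v w) (A \<union> A')) (L \<union> with_root w V' L')"

lemma rtree_root: "rtree E v V A L \<Longrightarrow> v \<in> V"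
  by (induction rule: rtree.induct) auto

lemma rtree_finite: "rtree E v V A L \<Longrightarrow> finite V"
  by (induction rule: rtree.induct) auto

lemma rtree_singleton: "rtree E v V A L \<Longrightarrow> V = {u} \<Longrightarrow> A = {} \<and> L = {}"
proof (induction rule: rtree.induct)
  case (join v V A L w V' A' L')
  then have "v \<in> {u}" "w \<in> {u}"
    using rtree_root[OF join(1)] rtree_root[OF join(2)] by blast+
  then show ?case
    using join(3) rtree_root[OF join(1)] rtree_root[OF join(2)] by auto
qed auto

lemma rtree_leaves: "rtree E v V A L \<Longrightarrow> L \<subseteq> V - {v}"
proof (induction rule: rtree.induct)
  case (join v V A L w V' A' L')
  then show ?case using rtree_root[OF join(1)] rtree_root[OF join(2)]
    by (auto simp: with_root_def split: if_splits)
qed auto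

lemma rtree_edges: "rtree E v V A L \<Longrightarrow> e \<in> A \<Longrightarrow> \<exists>a\<in>V. \<exists>b\<in>V. E a b \<and> e = edge a b"
proof (induction rule: rtree.induct)
  case (join v V A L w V' A' L')
  from join.prems consider "e = edge v w" | "e \<in> A" | "e \<in> A'" by blast
  then show ?case
  proof cases
    case 1
    then show ?thesis using join.hyps rtree_root[OF join(1)] rtree_root[OF join(2)] by blast
  qed (use join.IH in blast)+
qed auto

lemma rtree_edgeD: "rtree E v V A L \<Longrightarrow> edge a b \<in> A \<Longrightarrow> a \<in> V \<and> b \<in> V \<and> (E a b \<or> E b a)"
  using rtree_edges[of E v V A L "edge a b"] by (auto simp: edge_eq_iff)

lemma rtree_no_marks: "rtree E v V A L \<Longrightarrow> Vert u \<notin> A \<and> Lf u \<notin> A"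
  using rtree_edges by fastforce

lemma rtree_card_edges: "rtree E v V A L \<Longrightarrow> finite A \<and> card V = Suc (card A)"
proof (induction rule: rtree.induct)
  case (join v V A L w V' A' L')
  have "A \<inter> A' = {}"
  proof (rule ccontr)
    assume "A \<inter> A' \<noteq> {}"
    then obtain e where e: "e \<in> A" "e \<in> A'" by blast
    then obtain a b where "e = edge a b" "a \<in> V" using rtree_edges[OF join(1)] by blast
    with e rtree_edgeD[OF join(2)] have "a \<in> V'" by blast
    with \<open>a \<in> V\<close> join show False by blast
  qed
  moreover have "edge v w \<notin> A \<union> A'"
    using rtree_edgeD[OF join(1)] rtree_edgeD[OF join(2)] rtree_root[OF join(1)]
      rtree_root[OF join(2)] join(3) by blast
  ultimately show ?case
    using join rtree_finite[OF join(1)] rtree_finite[OF join(2)]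
    by (simp add: card_Un_disjoint)
qed simp

definition tree_els :: "nat \<Rightarrow> nat set \<Rightarrow> el set \<Rightarrow> nat set \<Rightarrow> el set" where
  "tree_els v V A L = Vert ` V \<union> A \<union> Lf ` with_root v V L"


text \<open>Induction along the children: \<open>P j\<close> is the invariant once the candidates
  below \<open>j\<close> have been considered.\<close>

lemma forests_invariant:
  assumes "m \<in> set (forests f n)" and "P 0 {#}"
    and "\<And>j m. j < n \<Longrightarrow> P j m \<Longrightarrow> P (Suc j) m"
    and "\<And>j a b. j < n \<Longrightarrow> a \<in> set (f j) \<Longrightarrow> P j b \<Longrightarrow> P (Suc j) (a + b)"
  shows "P n m"
proof -
  have P0: "P n {#}" if "\<And>j m. j < n \<Longrightarrow> P j m \<Longrightarrow> P (Suc j) m" for n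
    using that by (induction n) (use assms(2) in auto)
  show ?thesis using assms(1,3,4)
  proof (induction n arbitrary: m)
    case (Suc n)
    have P: "m = {#} \<or> m \<in> set (forests f n) \<Longrightarrow> P n m" for m
      using P0[of n] Suc by auto
    from Suc.prems(1) have "m \<in> set (forests f n) \<or>
        (\<exists>a b. m = a + b \<and> a \<in> set (f n) \<and> (b = {#} \<or> b \<in> set (forests f n)))"
      by (auto simp: set_lmul)
    then show ?case using P Suc.prems(2,3) by blast
  qed simp
qed

definition universe :: "nat \<Rightarrow> el set" where
  "universe n = case_prod Edge ` ({..<n} \<times> {..<n}) \<union> Vert ` {..<n} \<union> Lf ` {..<n}"

lemma finite_universe [simp]: "finite (universe n)"
  by (simp add: universe_def)

lemma edge_in_universe: "v < n \<Longrightarrow> w < n \<Longrightarrow> edge v w \<in> universe n"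
  by (auto simp: universe_def edge_def min_def max_def)

lemma walks_universe: "m \<in> set (walks n E i p v) \<Longrightarrow> v < n \<Longrightarrow> set_mset m \<subseteq> universe n"
proof (induction i arbitrary: p v m)
  case (Suc i)
  let ?f = "\<lambda>w. if E v w \<and> w \<noteq> p then map (add_mset (edge v w)) (walks n E i v w) else []"
  have "set_mset m \<subseteq> universe n" if "m \<in> set (forests ?f n)" for m
    using that
  proof (rule forests_invariant[where P = "\<lambda>_ m. set_mset m \<subseteq> universe n"])
    fix j a b assume "j < n" "a \<in> set (?f j)" "set_mset b \<subseteq> universe n"
    then show "set_mset (a + b) \<subseteq> universe n"
      using Suc.IH[of _ v j] Suc.prems(2) by (auto simp: edge_in_universe split: if_splits) blast
  qed auto
  moreover have "Vert v \<in> universe n" "Lf v \<in> universe n"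
    using Suc.prems(2) by (auto simp: universe_def)
  ultimately show ?case using Suc.prems(1) by auto blast
qed simp

lemma rooted_walks_universe:
  assumes "m \<in> set (rooted_walks n E i r)" and "\<And>w. E r w \<Longrightarrow> r < n"
  shows "set_mset m \<subseteq> universe n"
  using assms walks_universe[of _ n "without r E" i r]
  by (auto simp: rooted_walks_def edge_in_universe split: if_splits) blast

subsection \<open>Square-free monomials come from trees\<close>

text \<open>A vertex shared by two branches, or by a branch and \<open>v\<close>, would be marked
  twice. So square-freeness yields the disjointness that \<open>rtree.join\<close> requires.\<close>

lemma forest_rtree:
  assumes IH: "\<And>w m. w < n \<Longrightarrow> m \<in> set (f w) \<Longrightarrow> (\<And>e. count m e \<le> 1) \<Longrightarrow>
      \<exists>V A L m'. m = add_mset (edge v w) m' \<and> E v w \<and> rtree E w V A L \<and> set_mset m' = tree_els w V A L"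
    and "m \<in> set (forests f n)" and "\<And>e. count (add_mset (Vert v) m) e \<le> 1"
  shows "\<exists>V A L. rtree E v V A L \<and> V \<noteq> {v} \<and>
      set_mset m = Vert ` (V - {v}) \<union> A \<union> Lf ` L"
  using assms
proof (induction n arbitrary: m)
  case (Suc n)
  have IH: "m \<in> set (forests f n) \<Longrightarrow> (\<And>e. count (add_mset (Vert v) m) e \<le> 1) \<Longrightarrow>
      \<exists>V A L. rtree E v V A L \<and> V \<noteq> {v} \<and> set_mset m = Vert ` (V - {v}) \<union> A \<union> Lf ` L" for m
    using Suc.IH[of m] Suc.prems(1) by (metis less_SucI)
  from Suc.prems(2) consider "m \<in> set (forests f n)"
    | a b where "m = a + b" "a \<in> set (f n)" "b = {#} \<or> b \<in> set (forests f n)"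
    by (auto simp: set_lmul)
  then show ?case
  proof cases
    case 1
    then show ?thesis using IH Suc.prems(3) by blast
  next
    case (2 a b)
    have cnt: "count (add_mset (Vert v) b) e \<le> 1" "count a e \<le> 1" for e
      using Suc.prems(3)[of e] by (auto simp: 2(1) split: if_splits)
    obtain V' A' L' m' where a: "a = add_mset (edge v n) m'" and E: "E v n"
      and t': "rtree E n V' A' L'" and m': "set_mset m' = tree_els n V' A' L'"
      using Suc.prems(1)[of n a] 2(2) cnt(2) by blast
    obtain V A L where t: "rtree E v V A L" and b: "set_mset b = Vert ` (V - {v}) \<union> A \<union> Lf ` L"
    proof (cases "b = {#}")
      case True
      then show ?thesis using that[OF rtree.single] by simp
    next
      case False
      then show ?thesis using IH[of b] 2(3) cnt(1) that by blast
    qed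
    have "V \<inter> V' = {}"
    proof (rule ccontr)
      assume "V \<inter> V' \<noteq> {}"
      then obtain u where u: "u \<in> V" "u \<in> V'" by blast
      have "Vert u \<in># m'" using u(2) by (simp add: m' tree_els_def)
      moreover have "Vert u \<in># add_mset (Vert v) b"
      proof (cases "u = v")
        case False
        then have "Vert u \<in> set_mset b" unfolding b using u(1) by auto
        then show ?thesis by simp
      qed simp
      ultimately have "count m' (Vert u) \<ge> 1" "count (add_mset (Vert v) b) (Vert u) \<ge> 1"
        by (simp_all only: count_greater_eq_one_iff)
      moreover have "count m' (Vert u) + count (add_mset (Vert v) b) (Vert u)
          \<le> count (add_mset (Vert v) m) (Vert u)" by (simp add: 2(1) a)
      ultimately show False using Suc.prems(3)[of "Vert u"] by linarith
    qed
    from rtree.join[where A' = A' and L' = L', OF t t' this E]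
    have "rtree E v (V \<union> V') (insert (edge v n) (A \<union> A')) (L \<union> with_root n V' L')" .
    moreover have "V \<union> V' \<noteq> {v}"
      using rtree_root[OF t'] rtree_root[OF t] \<open>V \<inter> V' = {}\<close> by auto
    moreover have "set_mset m
        = Vert ` (V \<union> V' - {v}) \<union> insert (edge v n) (A \<union> A') \<union> Lf ` (L \<union> with_root n V' L')"
      using rtree_root[OF t] \<open>V \<inter> V' = {}\<close> unfolding 2(1) a set_mset_union set_mset_add_mset_insert m' b tree_els_def
      by (auto simp: image_Un)
    ultimately show ?thesis by blast
  qed
qed simp

lemma walks_rtree:
  assumes "m \<in> set (walks n E i p v)" and "\<And>e. count m e \<le> 1"
  shows "\<exists>V A L. rtree E v V A L \<and> set_mset m = tree_els v V A L"
  using assms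
proof (induction i arbitrary: p v m)
  case (Suc i)
  let ?f = "\<lambda>w. if E v w \<and> w \<noteq> p then map (add_mset (edge v w)) (walks n E i v w) else []"
  from Suc.prems(1) consider m' where "m = add_mset (Vert v) m'" "m' \<in> set (forests ?f n)"
    | "m = {#Vert v, Lf v#}" by auto
  then show ?case
  proof cases
    case 1
    have "\<exists>V A L m'. m = add_mset (edge v w) m' \<and> E v w \<and> rtree E w V A L \<and> set_mset m' = tree_els w V A L"
      if "w < n" and m: "m \<in> set (?f w)" and cnt: "\<And>e. count m e \<le> 1" for w m
    proof -
      obtain m' where m': "m = add_mset (edge v w) m'" "m' \<in> set (walks n E i v w)" "E v w"
        using m by (auto split: if_splits)
      have "count m' e \<le> 1" for e using cnt[of e] m'(1) by (auto split: if_splits)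
      with Suc.IH[OF m'(2)] m' show ?thesis by blast
    qed
    moreover have "count (add_mset (Vert v) m') e \<le> 1" for e using Suc.prems(2) 1(1) by simp
    ultimately have "\<exists>V A L. rtree E v V A L \<and> V \<noteq> {v} \<and>
        set_mset m' = Vert ` (V - {v}) \<union> A \<union> Lf ` L"
      by (rule forest_rtree[OF _ 1(2)])
    then obtain V A L where "rtree E v V A L" "V \<noteq> {v}" "set_mset m' = Vert ` (V - {v}) \<union> A \<union> Lf ` L"
      by blast
    moreover from this(1) have "v \<in> V" by (rule rtree_root)
    ultimately show ?thesis using 1(1)
      by (intro exI[of _ V] exI[of _ A] exI[of _ L]) (auto simp: tree_els_def with_root_def)
  next
    case 2
    then show ?thesis
      by (intro exI[of _ "{v}"] exI[of _ "{}"]) (auto simp: tree_els_def with_root_def intro: rtree.single)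
  qed
qed simp

lemma rtree_mono: "rtree E v V A L \<Longrightarrow> (\<And>a b. E a b \<Longrightarrow> E' a b) \<Longrightarrow> rtree E' v V A L"
  by (induction rule: rtree.induct) (auto intro: rtree.intros)

lemma rtree_without_root: "rtree (without r E) v V A L \<Longrightarrow> v \<noteq> r \<Longrightarrow> r \<notin> V"
  by (induction rule: rtree.induct) (auto simp: without_def)

text \<open>Depth \<open>card (S \<inter> edge_els)\<close> suffices to see \<open>S\<close>. A walk
  behind a nonzero coefficient has no repetition, hence is a tree.\<close>

lemma (in simple_graph) root_series_sound:
  assumes "cf (root_series n E {..<n} r) S \<noteq> 0"
  shows "\<exists>w V A L. E r w \<and> rtree (without r E) w V A L \<and> r \<notin> V \<and> S = insert (edge r w) (tree_els w V A L)"
proof -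
  define k where "k = card (S \<inter> edge_els)"
  have S: "finite S" using assms cf_infinite by blast
  have "cf (evalm (formal {..<n}) (rooted_walks n E k r)) S \<noteq> 0"
    using assms cf_rooted_val[of S k "{..<n}" r] by (simp add: k_def evalm_rooted_walks)
  then have "length (filter (\<lambda>m. filter_mset (marked {..<n}) m = mset_set S) (rooted_walks n E k r)) \<noteq> 0"
    using S by (metis cf_evalm_formal of_nat_0)
  then obtain m where m: "m \<in> set (rooted_walks n E k r)" "filter_mset (marked {..<n}) m = mset_set S"
    by (auto simp: filter_empty_conv)
  then obtain w m' where w: "w < n" "E r w" "m = add_mset (edge r w) m'"
    "m' \<in> set (walks n (without r E) k r w)"
    by (auto simp: rooted_walks_def split: if_splits)
  have "filter_mset (marked {..<n}) m = m"
    using rooted_walks_universe[OF m(1)] E_less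
    by (auto simp: filter_mset_eq_conv marked_def universe_def split: el.splits)
  with m have mS: "m = mset_set S" by simp
  then have "count m e \<le> 1" for e using S by (simp add: count_mset_set')
  then have "count m' e \<le> 1" for e using w(3) by (metis count_add_mset le_Suc_eq not_less_eq_eq)
  from walks_rtree[OF w(4) this] obtain V A L
    where t: "rtree (without r E) w V A L" "set_mset m' = tree_els w V A L" by blast
  have "S = insert (edge r w) (tree_els w V A L)"
    using mS w(3) t(2) S by (metis finite_set_mset_mset_set set_mset_add_mset_insert)
  moreover have "w \<noteq> r" using w(2) E_irrefl by blast
  then have "r \<notin> V" using rtree_without_root[OF t(1)] by blast
  ultimately show ?thesis using t(1) w(2) by blast
qed

subsection \<open>Trees have coefficient one\<close>

definition supported :: "'e set \<Rightarrow> 'e sqf \<Rightarrow> bool" where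
  "supported B f \<longleftrightarrow> (\<forall>S. cf f S \<noteq> 0 \<longrightarrow> S \<subseteq> B)"

lemma supportedD: "supported B f \<Longrightarrow> \<not> S \<subseteq> B \<Longrightarrow> cf f S = 0"
  by (auto simp: supported_def)

lemma supported_mono: "supported B f \<Longrightarrow> B \<subseteq> C \<Longrightarrow> supported C f"
  by (auto simp: supported_def)

lemma supported_1 [simp]: "supported B 1"
  unfolding supported_def
proof (intro allI impI)
  fix S assume "cf (1 :: 'a sqf) S \<noteq> 0"
  then have "S = {}" by (rule contrapos_np) (simp add: one_sqf.rep_eq)
  then show "S \<subseteq> B" by simp
qed

lemma supported_add: "supported B f \<Longrightarrow> supported B g \<Longrightarrow> supported B (f + g)"
  unfolding supported_def
proof (intro allI impI)
  fix S assume *: "\<forall>S. cf f S \<noteq> 0 \<longrightarrow> S \<subseteq> B" "\<forall>S. cf g S \<noteq> 0 \<longrightarrow> S \<subseteq> B" "cf (f + g) S \<noteq> 0"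
  have "cf f S + cf g S \<noteq> 0" using *(3) by (simp only: plus_sqf.rep_eq not_False_eq_True)
  then have "cf f S \<noteq> 0 \<or> cf g S \<noteq> 0" by (metis add_0_left)
  then show "S \<subseteq> B" using * by blast
qed

lemma supported_gen: "e \<in> B \<Longrightarrow> supported B (gen e)"
  unfolding supported_def
proof (intro allI impI)
  fix S assume "e \<in> B" "cf (gen e) S \<noteq> 0"
  moreover from this(2) have "S = {e}" by (rule contrapos_np) (simp add: gen.rep_eq)
  ultimately show "S \<subseteq> B" by blast
qed

lemma supported_mult: "supported B f \<Longrightarrow> supported B g \<Longrightarrow> supported B (f * g)"
  unfolding supported_def
proof (intro allI impI)
  fix S assume *: "\<forall>S. cf f S \<noteq> 0 \<longrightarrow> S \<subseteq> B" "\<forall>S. cf g S \<noteq> 0 \<longrightarrow> S \<subseteq> B" "cf (f * g) S \<noteq> 0"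
  from *(3) have "(\<Sum>A\<in>Pow S. cf f A * cf g (S - A)) \<noteq> 0" by (simp only: cf_times not_False_eq_True)
  then obtain A where A: "A \<in> Pow S" "cf f A * cf g (S - A) \<noteq> 0"
    by (rule sum.not_neutral_contains_not_neutral)
  have "cf f A \<noteq> 0" "cf g (S - A) \<noteq> 0"
    by (rule notI, use A(2) in simp)+
  then show "S \<subseteq> B" using * by blast
qed

text \<open>The variables of the factors are disjoint, so a single splitting of
  \<open>S \<union> T\<close> survives in the product.\<close>

lemma cf_mult_supported:
  assumes "supported B f" "supported C g" "B \<inter> C = {}" "S \<subseteq> B" "T \<subseteq> C" "finite S" "finite T"
  shows "cf (f * g) (S \<union> T) = cf f S * cf g T"
proof -
  have "cf (f * g) (S \<union> T) = (\<Sum>A\<in>Pow (S \<union> T). if A = S then cf f S * cf g T else 0)"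
    unfolding cf_times
  proof (rule sum.cong[OF refl])
    fix A assume A: "A \<in> Pow (S \<union> T)"
    show "cf f A * cf g (S \<union> T - A) = (if A = S then cf f S * cf g T else 0)"
    proof (cases "A = S")
      case True
      moreover have "S \<union> T - S = T" using assms(3-5) by blast
      ultimately show ?thesis by simp
    next
      case False
      then have "\<not> A \<subseteq> B \<or> \<not> S \<union> T - A \<subseteq> C" using A assms(3-5) by blast
      then have "cf f A = 0 \<or> cf g (S \<union> T - A) = 0"
        by (elim disjE) (rule disjI1 disjI2, erule supportedD[OF assms(1)] supportedD[OF assms(2)])+
      then show ?thesis by (elim disjE) (simp_all only: False if_False mult_zero_left mult_zero_right)
    qed
  qed
  then show ?thesis using assms(6,7) by simp
qed

text \<open>Equality after the edge variables outside \<open>A\<close> are set to 0.\<close>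

definition agree :: "el set \<Rightarrow> el sqf \<Rightarrow> el sqf \<Rightarrow> bool" where
  "agree A f g \<longleftrightarrow> (\<forall>S. S \<inter> edge_els \<subseteq> A \<longrightarrow> cf f S = cf g S)"

lemma agree_refl [simp]: "agree A f f" by (simp add: agree_def)

lemma agree_add: "agree A f g \<Longrightarrow> agree A f' g' \<Longrightarrow> agree A (f + f') (g + g')"
  by (simp add: agree_def cf_simps)

lemma agree_mult: "agree A f g \<Longrightarrow> agree A f' g' \<Longrightarrow> agree A (f * f') (g * g')"
  unfolding agree_def cf_times
proof (intro allI impI sum.cong refl)
  fix S B assume *: "\<forall>S. S \<inter> edge_els \<subseteq> A \<longrightarrow> cf f S = cf g S"
    "\<forall>S. S \<inter> edge_els \<subseteq> A \<longrightarrow> cf f' S = cf g' S" "S \<inter> edge_els \<subseteq> A" "B \<in> Pow S"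
  then have "B \<inter> edge_els \<subseteq> A" "(S - B) \<inter> edge_els \<subseteq> A" by auto
  then show "cf f B * cf f' (S - B) = cf g B * cf g' (S - B)" using * by simp
qed

lemma agree_prod: "(\<And>i. i \<in> I \<Longrightarrow> agree A (f i) (g i)) \<Longrightarrow> agree A (\<Prod>i\<in>I. f i) (\<Prod>i\<in>I. g i)"
  by (induction I rule: infinite_finite_induct) (auto intro: agree_mult)

lemma edge_in_edge_els [simp]: "edge v w \<in> edge_els"
  by (auto simp: edge_els_def edge_def)

text \<open>Deleting the edges outside \<open>A\<close> from the graph has the effect of setting
  their variables to 0.\<close>

lemma series_agree:
  assumes "simple_graph n E" "simple_graph n H"
    and H: "\<And>v w. H v w \<longleftrightarrow> E v w \<and> edge v w \<in> A"
  shows "agree A (branching_walks.series n (xgen E) (\<lambda>v. gen (Lf v)) edge_els a w)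
    (branching_walks.series n (xgen H) (\<lambda>v. gen (Lf v)) edge_els a w)"
proof -
  interpret E: simple_graph n E by fact
  interpret H: simple_graph n H by fact
  have x: "agree A (xgen E v w) (xgen H v w)" for v w
    unfolding agree_def
  proof (intro allI impI)
    fix S assume S: "S \<inter> edge_els \<subseteq> A"
    then have "cf (gen (edge v w)) S = 0" if "edge v w \<notin> A"
      using that by (auto simp: gen.rep_eq)
    then show "cf (xgen E v w) S = cf (xgen H v w) S"
      by (auto simp: xgen_def H cf_simps)
  qed
  have step: "agree A (E.step a F w) (H.step a F' w)" if "\<And>w. agree A (F w) (F' w)" for F F' w
    unfolding E.step_def H.step_def sqf_minus_eq_plus
    by (intro agree_mult agree_add agree_prod x that agree_refl)
  have "agree A ((E.step a ^^ i) (\<lambda>_. 0) w) ((H.step a ^^ i) (\<lambda>_. 0) w)" for i w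
    by (induction i arbitrary: w) (auto intro: step)
  then show ?thesis
    unfolding E.series_def H.series_def agree_def cf_fixp_of by blast
qed

text \<open>The tree is the whole graph on \<open>V\<close>, and only \<open>v\<close> may have
  neighbors outside, so the series can be computed along the construction of the tree. The product
  is the branching factor of \<open>v\<close> restricted to \<open>V\<close>, without the marks of
  \<open>v\<close> itself.\<close>

lemma (in simple_graph) rtree_coefficient:
  assumes "rtree H v V A L" "V \<subseteq> {..<n}"
    and "\<And>a b. a \<in> V \<Longrightarrow> b \<in> V \<Longrightarrow> E a b \<longleftrightarrow> edge a b \<in> A"
    and "\<And>a b. a \<in> V - {v} \<Longrightarrow> b \<notin> V \<Longrightarrow> \<not> E a b"
  shows "supported (Vert ` (V - {v}) \<union> A \<union> Lf ` (V - {v}))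
      (\<Prod>b\<in>V. 1 + xgen E v b * series (weight {..<n}) b) \<and>
    cf (\<Prod>b\<in>V. 1 + xgen E v b * series (weight {..<n}) b) (Vert ` (V - {v}) \<union> A \<union> Lf ` L) = 1"
  using assms
proof (induction rule: rtree.induct)
  case (single v)
  have "\<not> E v v" by (rule E_irrefl)
  then show ?case by (simp add: xgen_def cf_simps)
next
  case (join v V A L w V' A' L')
  let ?s = "series (weight {..<n})"
  let ?P = "\<lambda>v V. \<Prod>b\<in>V. 1 + xgen E v b * ?s b"
  let ?e = "edge v w"
  note t = join(1) and t' = join(2)
  have v: "v \<in> V" "v \<notin> V'" and w: "w \<in> V'" "w \<notin> V"
    using rtree_root[OF t] rtree_root[OF t'] join(3) by auto
  have fin: "finite V" "finite V'" "finite A" "finite A'"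
    using rtree_finite rtree_card_edges t t' by blast+
  have AV: "edge a b \<in> A \<Longrightarrow> a \<in> V \<and> b \<in> V" "edge a b \<in> A' \<Longrightarrow> a \<in> V' \<and> b \<in> V'" for a b
    using rtree_edgeD[OF t] rtree_edgeD[OF t'] by blast+
  have Eiff: "E a b \<longleftrightarrow> edge a b \<in> insert ?e (A \<union> A')" if "a \<in> V \<union> V'" "b \<in> V \<union> V'" for a b
    using join.prems(2) that by blast
  have Eout: "\<not> E a b" if "a \<in> V \<union> V' - {v}" "b \<notin> V \<union> V'" for a b
    using join.prems(3) that by blast
  have e: "?e \<notin> A" "?e \<notin> A'" using AV v w by blast+
  have E1: "E a b \<longleftrightarrow> edge a b \<in> A" if "a \<in> V" "b \<in> V" for a b
  proof -
    have "edge a b \<notin> A'" "edge a b \<noteq> ?e" using that AV(2) w join(3) by (auto simp: edge_eq_iff)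
    then show ?thesis using Eiff[of a b] that by blast
  qed
  have E2: "E a b \<longleftrightarrow> edge a b \<in> A'" if "a \<in> V'" "b \<in> V'" for a b
  proof -
    have "edge a b \<notin> A" "edge a b \<noteq> ?e" using that AV(1) v join(3) by (auto simp: edge_eq_iff)
    then show ?thesis using Eiff[of a b] that by blast
  qed
  have E12: "E a b \<longleftrightarrow> a = v \<and> b = w" if "a \<in> V" "b \<in> V'" for a b
  proof -
    have "edge a b \<notin> A" "edge a b \<notin> A'" using that AV join(3) by blast+
    then show ?thesis using Eiff[of a b] that v w by (auto simp: edge_eq_iff)
  qed
  have E21: "E a b \<longleftrightarrow> a = w \<and> b = v" if "a \<in> V'" "b \<in> V" for a b
    using E12[OF that(2,1)] E_sym by blast
  have IH: "supported (Vert ` (V - {v}) \<union> A \<union> Lf ` (V - {v})) (?P v V)"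
      "cf (?P v V) (Vert ` (V - {v}) \<union> A \<union> Lf ` L) = 1"
    using join.IH(1) join.prems(1) E1 E12 Eout v by blast+
  have IH': "supported (Vert ` (V' - {w}) \<union> A' \<union> Lf ` (V' - {w})) (?P w V')"
      "cf (?P w V') (Vert ` (V' - {w}) \<union> A' \<union> Lf ` L') = 1"
    using join.IH(2) join.prems(1) E2 E21 Eout v w by blast+
  have Evw: "E v w" using E12 v w by blast
  \<comment> \<open>The branch at \<open>w\<close> as entered from \<open>v\<close>; the way back to
    \<open>v\<close> is cut off by the square of the edge.\<close>
  define R where "R = gen (Vert w) * (?P w V' + 1 + gen (Lf w))"
  have branch: "?P v V' = 1 + gen ?e * R"
  proof -
    have "?P v V' = (1 + xgen E v w * ?s w) * (\<Prod>b\<in>V' - {w}. 1 + xgen E v b * ?s b)"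
      using fin w by (subst prod.remove[of _ w]) auto
    also have "(\<Prod>b\<in>V' - {w}. 1 + xgen E v b * ?s b) = 1"
      using E12 v by (intro prod.neutral) (auto simp: xgen_def)
    also have "xgen E v w = gen ?e" using Evw by (simp add: xgen_def)
    finally have 1: "?P v V' = 1 + gen ?e * ?s w" by simp
    have "(\<Prod>b<n. 1 + xgen E w b * ?s b) = (\<Prod>b\<in>insert v V'. 1 + xgen E w b * ?s b)"
    proof (rule prod.mono_neutral_right)
      show "insert v V' \<subseteq> {..<n}" using join.prems(1) v by auto
      show "\<forall>b\<in>{..<n} - insert v V'. 1 + xgen E w b * ?s b = 1"
        using Eout[of w] E21[of w] w v by (auto simp: xgen_def)
    qed simp
    also have "\<dots> = (1 + gen ?e * ?s v) * ?P w V'"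
      using fin v Evw E_sym by (auto simp: xgen_def edge_commute[of w v])
    finally have "?s w = gen (Vert w) * ((1 + gen ?e * ?s v) * ?P w V' + 1 + gen (Lf w))"
      using join.prems(1) w series_eq[of "weight {..<n}" w] by (auto simp: sqf_minus_eq_plus)
    then have "gen ?e * ?s w = gen (Vert w) * ((gen ?e * (1 + gen ?e * ?s v)) * ?P w V' + gen ?e * (1 + gen (Lf w)))"
      by (simp add: algebra_simps)
    also have "gen ?e * (1 + gen ?e * ?s v) = gen ?e"
      by (simp add: distrib_left mult.assoc[symmetric])
    also have "gen (Vert w) * (gen ?e * ?P w V' + gen ?e * (1 + gen (Lf w))) = gen ?e * R"
      by (simp add: R_def algebra_simps)
    finally show ?thesis using 1 by simp
  qed
  let ?B = "Vert ` (V - {v}) \<union> A \<union> Lf ` (V - {v})"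
  let ?C = "insert ?e (Vert ` V' \<union> A' \<union> Lf ` V')"
  have suppC: "supported ?C (1 + gen ?e * R)"
    unfolding R_def using w
    by (intro supported_add supported_mult supported_1 supported_gen supported_mono[OF IH'(1)]) auto
  have suppB: "supported ?B (?P v V)" by (rule IH(1))
  have prodU: "?P v (V \<union> V') = ?P v V * (1 + gen ?e * R)"
    using fin join(3) branch by (simp add: prod.union_disjoint)
  have "supported (?B \<union> ?C) (?P v (V \<union> V'))"
    unfolding prodU by (intro supported_mult supported_mono[OF suppB] supported_mono[OF suppC]) auto
  then have 1: "supported (Vert ` (V \<union> V' - {v}) \<union> insert ?e (A \<union> A') \<union> Lf ` (V \<union> V' - {v})) (?P v (V \<union> V'))"
    by (rule supported_mono) (use v in auto)
  have LV: "L \<subseteq> V - {v}" "L' \<subseteq> V' - {w}" using rtree_leaves t t' by blast+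
  let ?S = "Vert ` (V - {v}) \<union> A \<union> Lf ` L"
  let ?T = "insert ?e (Vert ` V' \<union> A' \<union> Lf ` with_root w V' L')"
  have AA: "A \<inter> A' = {}"
    using rtree_edges[OF t] AV(2) join(3) by fastforce
  have nm: "Vert u \<notin> A" "Lf u \<notin> A" "Vert u \<notin> A'" "Lf u \<notin> A'" for u
    using rtree_no_marks t t' by blast+
  have "cf (?P v (V \<union> V')) (?S \<union> ?T) = cf (?P v V) ?S * cf (1 + gen ?e * R) ?T"
    unfolding prodU
  proof (rule cf_mult_supported[OF suppB suppC])
    show "?B \<inter> ?C = {}" using e nm AA join(3) by auto
    show "?S \<subseteq> ?B" using LV by auto
    show "?T \<subseteq> ?C" using LV w by (auto simp: with_root_def)
    have "finite L" "finite L'"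
      using finite_subset[OF LV(1)] finite_subset[OF LV(2)] fin by auto
    then show "finite ?S" "finite ?T" using fin by (auto simp: with_root_def)
  qed
  also have "cf (1 + gen ?e * R) ?T = 1"
  proof -
    let ?T' = "Vert ` (V' - {w}) \<union> A' \<union> Lf ` with_root w V' L'"
    have T': "?T - {?e} - {Vert w} = ?T'" using e nm w by auto
    have "cf (1 + gen ?e * R) ?T = cf (?P w V' + 1 + gen (Lf w)) ?T'"
      unfolding R_def plus_sqf.rep_eq[of 1] cf_gen_mult T' using w by (simp add: one_sqf.rep_eq)
    \<comment> \<open>Either the branch is the single vertex \<open>w\<close> and its leaf mark
      supplies the 1, or it branches further and the product supplies it. The other two summands
      have coefficient 0.\<close>
    also have "\<dots> = 1"
    proof (cases "V' = {w}")
      case True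
      then have "A' = {}" using rtree_singleton[OF t'] by simp
      moreover have "cf (?P w V') {Lf w} = 0"
        using supportedD[OF IH'(1), of "{Lf w}"] True \<open>A' = {}\<close> by auto
      ultimately show ?thesis using True by (simp add: cf_simps gen.rep_eq with_root_def)
    next
      case False
      then have ne: "?T' \<noteq> {}" and "Lf w \<notin> ?T'"
        using w nm LV by (auto simp: with_root_def)
      then have "?T' \<noteq> {Lf w}" by blast
      with ne False IH'(2) show ?thesis by (simp add: cf_simps gen.rep_eq with_root_def)
    qed
    finally show ?thesis .
  qed
  finally have "cf (?P v (V \<union> V')) (?S \<union> ?T) = 1" using IH(2) by simp
  moreover have "?S \<union> ?T = Vert ` (V \<union> V' - {v}) \<union> insert ?e (A \<union> A') \<union> Lf ` (L \<union> with_root w V' L')"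
    using v by auto
  ultimately show ?case using 1 by simp
qed

text \<open>Apart from the root edge only edges of \<open>A\<close> occur in the monomial, so all
  others may be deleted. Then nothing but the tree is left below the root, and
  \<open>rtree_coefficient\<close> applies.\<close>

lemma (in simple_graph) root_series_complete:
  assumes r: "E r w" and t: "rtree (without r E) w V A L" and V: "V \<subseteq> {..<n}"
  shows "cf (root_series n E {..<n} r) (insert (edge r w) (tree_els w V A L)) = 1"
proof -
  let ?H = "\<lambda>a b. without r E a b \<and> edge a b \<in> A"
  have H: "simple_graph n ?H"
    by unfold_locales (use E_sym E_irrefl E_less edge_commute in \<open>auto simp: without_def\<close>)
  interpret H: simple_graph n ?H by (rule H)
  let ?T = "tree_els w V A L"
  have wr: "w \<noteq> r" using r E_irrefl by blast
  have rV: "r \<notin> V" using rtree_without_root[OF t wr] .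
  have w: "w \<in> V" using rtree_root[OF t] .
  have ed: "edge a b \<in> ?T \<longleftrightarrow> edge a b \<in> A" for a b by (auto simp: tree_els_def)
  have notA: "edge r b \<notin> A" for b using rtree_edgeD[OF t, of r b] rV by blast
  let ?s = "\<lambda>w. branching_walks.series n (xgen (without r E)) (\<lambda>v. gen (Lf v)) edge_els (weight {..<n}) w"
  have "cf (root_series n E {..<n} r) (insert (edge r w) ?T)
      = (\<Sum>b<n. cf (xgen E r b * ?s b) (insert (edge r w) ?T))"
    by (simp add: root_series_def cf_sum)
  also have "\<dots> = (\<Sum>b<n. if b = w then cf (?s w) ?T else 0)"
  proof (rule sum.cong[OF refl])
    fix b
    have "edge r b \<in> insert (edge r w) ?T \<longleftrightarrow> b = w"
      using ed notA by (auto simp: edge_eq_iff wr)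
    moreover have "insert (edge r w) ?T - {edge r w} = ?T" using ed notA by auto
    ultimately show "cf (xgen E r b * ?s b) (insert (edge r w) ?T) = (if b = w then cf (?s w) ?T else 0)"
      using r by (auto simp: xgen_def cf_gen_mult cf_simps)
  qed
  also have "\<dots> = cf (?s w) ?T"
  proof -
    have "w < n" using w V by auto
    then show ?thesis by simp
  qed
  also have "\<dots> = cf (H.series (weight {..<n}) w) ?T"
  proof -
    have "agree A (?s w) (H.series (weight {..<n}) w)"
      by (rule series_agree[OF without H]) auto
    moreover have "?T \<inter> edge_els \<subseteq> A" by (auto simp: tree_els_def edge_els_def)
    ultimately show ?thesis by (simp add: agree_def)
  qed
  also have "\<dots> = 1"
  proof -
    let ?P = "\<Prod>b\<in>V. 1 + xgen ?H w b * H.series (weight {..<n}) b"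
    have AH: "without r E a b" if "edge a b \<in> A" for a b
      using rtree_edgeD[OF t that] E_sym by (auto simp: without_def)
    have P: "supported (Vert ` (V - {w}) \<union> A \<union> Lf ` (V - {w})) ?P"
      "cf ?P (Vert ` (V - {w}) \<union> A \<union> Lf ` L) = 1"
      using H.rtree_coefficient[OF t V] AH rtree_edgeD[OF t] by blast+
    have "(\<Prod>b<n. 1 + xgen ?H w b * H.series (weight {..<n}) b) = ?P"
    proof (rule prod.mono_neutral_right)
      show "\<forall>b\<in>{..<n} - V. 1 + xgen ?H w b * H.series (weight {..<n}) b = 1"
        using rtree_edgeD[OF t, of w] by (auto simp: xgen_def)
    qed (use V in auto)
    then have s: "H.series (weight {..<n}) w = gen (Vert w) * (?P + 1 + gen (Lf w))"
      using H.series_eq[of "weight {..<n}" w] w V by (auto simp: sqf_minus_eq_plus)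
    have nm: "Vert u \<notin> A" "Lf u \<notin> A" for u using rtree_no_marks[OF t] by blast+
    have LV: "L \<subseteq> V - {w}" by (rule rtree_leaves[OF t])
    have T': "?T - {Vert w} = Vert ` (V - {w}) \<union> A \<union> Lf ` with_root w V L"
      using nm by (auto simp: tree_els_def)
    have "cf (H.series (weight {..<n}) w) ?T
        = cf (?P + 1 + gen (Lf w)) (Vert ` (V - {w}) \<union> A \<union> Lf ` with_root w V L)"
      unfolding s cf_gen_mult T' using w by (simp add: tree_els_def)
    also have "\<dots> = 1"
    proof (cases "V = {w}")
      case True
      then have "A = {}" using rtree_singleton[OF t] by simp
      moreover have "cf ?P {Lf w} = 0"
        using supportedD[OF P(1), of "{Lf w}"] True \<open>A = {}\<close> by auto
      ultimately show ?thesis using True by (simp add: cf_simps gen.rep_eq with_root_def)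
    next
      case False
      then have "Vert ` (V - {w}) \<union> A \<union> Lf ` L \<noteq> {}" "Lf w \<notin> Vert ` (V - {w}) \<union> A \<union> Lf ` L"
        using w nm LV by auto
      moreover from this(2) have "Vert ` (V - {w}) \<union> A \<union> Lf ` L \<noteq> {Lf w}" by blast
      ultimately show ?thesis using False P(2) by (simp add: cf_simps gen.rep_eq with_root_def)
    qed
    finally show ?thesis .
  qed
  finally show ?thesis .
qed

section \<open>Rooted trees and undirected trees\<close>

definition neighbors :: "el set \<Rightarrow> nat \<Rightarrow> nat set" where
  "neighbors A a = {b. edge a b \<in> A}"

lemma rtree_neighbors_finite: "rtree E v V A L \<Longrightarrow> finite (neighbors A a)"
  using rtree_edgeD rtree_finite by (auto simp: neighbors_def intro: finite_subset[of _ V])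

lemma rtree_root_neighbors: "rtree E v V A L \<Longrightarrow> V \<noteq> {v} \<Longrightarrow> neighbors A v \<noteq> {}"
  by (induction rule: rtree.induct) (auto simp: neighbors_def)

text \<open>Joining raises the degree of the attached root \<open>w\<close> by one. So
  \<open>w\<close> becomes a leaf exactly if it was alone, which is what \<open>with_root\<close>
  records.\<close>

lemma rtree_leaf_iff:
  assumes "rtree E v V A L" "b \<in> V - {v}"
  shows "b \<in> L \<longleftrightarrow> card (neighbors A b) = 1"
  using assms
proof (induction rule: rtree.induct)
  case (join v V A L w V' A' L')
  note t = join(1) and t' = join(2)
  let ?A = "insert (edge v w) (A \<union> A')"
  have v: "v \<in> V" "v \<notin> V'" and w: "w \<in> V'" "w \<notin> V"
    using rtree_root[OF t] rtree_root[OF t'] join(3) by auto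
  have LV: "L \<subseteq> V - {v}" "L' \<subseteq> V' - {w}" using rtree_leaves t t' by blast+
  have AV: "edge a b \<in> A \<Longrightarrow> a \<in> V" "edge a b \<in> A' \<Longrightarrow> a \<in> V'" for a b
    using rtree_edgeD[OF t] rtree_edgeD[OF t'] by blast+
  consider "b \<in> V - {v}" | "b \<in> V' - {w}" | "b = w" using join.prems by blast
  then show ?case
  proof cases
    case 1
    have "neighbors ?A b = neighbors A b"
      using 1 AV(2)[of b] join(3) w(2) by (auto simp: neighbors_def edge_eq_iff)
    moreover have "b \<notin> with_root w V' L'"
      using 1 LV w(1) join(3) by (auto simp: with_root_def split: if_splits)
    ultimately show ?thesis using join.IH(1)[OF 1] by simp
  next
    case 2
    have "neighbors ?A b = neighbors A' b"
      using 2 AV(1)[of b] join(3) v(2) by (auto simp: neighbors_def edge_eq_iff)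
    moreover have "b \<notin> L" "b \<in> with_root w V' L' \<longleftrightarrow> b \<in> L'"
      using 2 LV join(3) by (auto simp: with_root_def split: if_splits)
    ultimately show ?thesis using join.IH(2)[OF 2] by simp
  next
    case 3
    have vw: "v \<noteq> w" using v w by blast
    have "neighbors ?A w = insert v (neighbors A' w)"
      using AV(1)[of w] w(2) vw by (auto simp: neighbors_def edge_eq_iff)
    moreover have "v \<notin> neighbors A' w"
      using rtree_edgeD[OF t', of w v] v(2) by (auto simp: neighbors_def)
    ultimately have "card (neighbors ?A w) = Suc (card (neighbors A' w))"
      using rtree_neighbors_finite[OF t'] by simp
    moreover have "card (neighbors A' w) = 0 \<longleftrightarrow> V' = {w}"
      using rtree_neighbors_finite[OF t', of w] rtree_root_neighbors[OF t'] rtree_singleton[OF t', of w]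
      by (auto simp: neighbors_def)
    moreover have "w \<in> L \<union> with_root w V' L' \<longleftrightarrow> V' = {w}"
      using LV w by (auto simp: with_root_def)
    ultimately show ?thesis using 3 by simp
  qed
qed simp

lemma rtree_has_leaf: "rtree E v V A L \<Longrightarrow> V \<noteq> {v} \<Longrightarrow> L \<noteq> {}"
proof (induction rule: rtree.induct)
  case (join v V A L w V' A' L')
  then show ?case by (auto simp: with_root_def)
qed simp

text \<open>The new leaves are left existential because attaching \<open>b\<close> may turn the leaf
  \<open>a\<close> into an inner vertex.\<close>

lemma rtree_grow:
  assumes "rtree E v V A L" "a \<in> V" "b \<notin> V" "E a b"
  shows "\<exists>L'. rtree E v (insert b V) (insert (edge a b) A) L'"
  using assms
proof (induction rule: rtree.induct)
  case (single v)
  then show ?case using rtree.join[OF rtree.single[of E v] rtree.single[of E b]] by auto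
next
  case (join v V A L w V' A' L')
  show ?case
  proof (cases "a \<in> V")
    case True
    then obtain L1 where "rtree E v (insert b V) (insert (edge a b) A) L1"
      using join by blast
    from rtree.join[OF this join(2) _ join(4)] join.prems join(3)
    show ?thesis by (auto simp: insert_commute)
  next
    case False
    then obtain L1 where "rtree E w (insert b V') (insert (edge a b) A') L1"
      using join by blast
    from rtree.join[OF join(1) this _ join(4)] join.prems join(3)
    show ?thesis by (auto simp: insert_commute)
  qed
qed

lemma rtree_avoid: "rtree E v V A L \<Longrightarrow> r \<notin> V \<Longrightarrow> rtree (without r E) v V A L"
proof (induction rule: rtree.induct)
  case (join v V A L w V' A' L')
  then have "without r E v w" using rtree_root[OF join(1)] rtree_root[OF join(2)]
    by (auto simp: without_def)
  with join show ?case by (intro rtree.join) auto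
qed (rule rtree.single)

text \<open>In the last join the part containing the root must be trivial, otherwise the root would
  have a second neighbor.\<close>

lemma rtree_single_child:
  assumes "rtree E r V A L" "card (neighbors A r) = 1"
  obtains w V' A' L' where "E r w" "rtree (without r E) w V' A' L'" "r \<notin> V'"
    "V = insert r V'" "A = insert (edge r w) A'" "L = with_root w V' L'"
  using assms
proof (cases rule: rtree.cases)
  case single
  with assms(2) show ?thesis by (simp add: neighbors_def)
next
  case (join V1 A1 L1 w V2 A2 L2)
  have w: "w \<in> V2" "w \<notin> V1" using rtree_root[OF join(5)] join(6) by auto
  have "V1 = {r}"
  proof (rule ccontr)
    assume "V1 \<noteq> {r}"
    then obtain b where b: "edge r b \<in> A1"
      using rtree_root_neighbors[OF join(4)] by (auto simp: neighbors_def)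
    then have "b \<noteq> w" using rtree_edgeD[OF join(4) b] w by blast
    moreover have "{b, w} \<subseteq> neighbors A r" using b join(2) by (auto simp: neighbors_def)
    then have "card {b, w} \<le> card (neighbors A r)"
      using rtree_neighbors_finite[OF assms(1)] by (rule card_mono[rotated])
    ultimately show False using assms(2) by simp
  qed
  moreover from this have "A1 = {}" "L1 = {}" using rtree_singleton[OF join(4)] by auto
  moreover have "r \<notin> V2" using rtree_root[OF join(4)] join(6) by blast
  ultimately show ?thesis
    using that[OF join(7) rtree_avoid[OF join(5)]] join by auto
qed

section \<open>Rooted trees as digraphs\<close>

definition tree_of :: "nat set \<Rightarrow> el set \<Rightarrow> nat pair_pre_digraph" where
  "tree_of V A = \<lparr>pverts = V, parcs = {(a, b). edge a b \<in> A}\<rparr>"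

lemma tree_of_simps [simp]: "pverts (tree_of V A) = V"
  "(a, b) \<in> parcs (tree_of V A) \<longleftrightarrow> edge a b \<in> A"
  by (auto simp: tree_of_def)

lemma out_degree_tree_of: "out_degree (tree_of V A) a = card (neighbors A a)"
proof -
  have "out_arcs (with_proj (tree_of V A)) a = Pair a ` neighbors A a"
    by (auto simp: out_arcs_def neighbors_def tree_of_def)
  moreover have "inj_on (Pair a) (neighbors A a)" by (simp add: inj_on_def)
  ultimately show ?thesis unfolding out_degree_def by (simp only: card_image)
qed

lemma pair_graph_tree_of:
  assumes t: "rtree E v V A L" and E: "\<And>a. \<not> E a a"
  shows "pair_graph (tree_of V A)"
proof -
  have AV: "a \<in> V \<and> b \<in> V" if "edge a b \<in> A" for a b using rtree_edgeD[OF t that] by blast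
  have "parcs (tree_of V A) \<subseteq> V \<times> V" using AV by auto
  then have fin: "finite (parcs (tree_of V A))"
    using rtree_finite[OF t] finite_subset by blast
  have loop: "edge a a \<notin> A" for a using rtree_edgeD[OF t, of a a] E by blast
  show ?thesis
  proof (intro_locales)
    show "pair_wf_digraph (tree_of V A)" by unfold_locales (auto dest: AV)
    then interpret pair_wf_digraph "tree_of V A" .
    show "pair_fin_digraph_axioms (tree_of V A)"
      by unfold_locales (use rtree_finite[OF t] fin in auto)
    show "pair_loopfree_digraph_axioms (tree_of V A)"
      by unfold_locales (use loop in auto)
    show "pair_sym_digraph_axioms (tree_of V A)"
      by unfold_locales (auto simp: symmetric_def sym_def arcs_ends_def arc_to_ends_def
        image_iff edge_commute tree_of_def)
  qed
qed

text \<open>In a cycle with at least three arcs both neighbors of a vertex of maximal depth would have to be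
  its parent.\<close>

lemma rtree_parents:
  assumes "rtree E v V A L"
  shows "\<exists>par (dep :: nat \<Rightarrow> nat). dep v = 0 \<and> (\<forall>a b. edge a b \<in> A \<longrightarrow>
    (par a = b \<and> dep a > dep b) \<or> (par b = a \<and> dep b > dep a))"
  using assms
proof (induction rule: rtree.induct)
  case (join v V A L w V' A' L')
  note t = join(1) and t' = join(2)
  obtain par1 and dep1 :: "nat \<Rightarrow> nat" where 1: "dep1 v = 0" "\<And>a b. edge a b \<in> A \<Longrightarrow>
    (par1 a = b \<and> dep1 a > dep1 b) \<or> (par1 b = a \<and> dep1 b > dep1 a)" using join.IH(1) by blast
  obtain par2 and dep2 :: "nat \<Rightarrow> nat" where 2: "dep2 w = 0" "\<And>a b. edge a b \<in> A' \<Longrightarrow>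
    (par2 a = b \<and> dep2 a > dep2 b) \<or> (par2 b = a \<and> dep2 b > dep2 a)" using join.IH(2) by blast
  have v: "v \<in> V" "v \<notin> V'" and w: "w \<in> V'" "w \<notin> V"
    using rtree_root[OF t] rtree_root[OF t'] join(3) by auto
  define par where "par a = (if a = w then v else if a \<in> V' then par2 a else par1 a)" for a
  define dep where "dep a = (if a \<in> V' then Suc (dep2 a) else dep1 a)" for a
  have "(par a = b \<and> dep a > dep b) \<or> (par b = a \<and> dep b > dep a)"
    if ab: "edge a b \<in> insert (edge v w) (A \<union> A')" for a b
  proof -
    consider "edge a b = edge v w" | "edge a b \<in> A" | "edge a b \<in> A'" using ab by blast
    then show ?thesis
    proof cases
      case 1
      then show ?thesis using v w \<open>dep1 v = 0\<close> by (auto simp: edge_eq_iff par_def dep_def)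
    next
      case 2
      then have "a \<in> V" "b \<in> V" using rtree_edgeD[OF t] by blast+
      then have "a \<notin> V'" "b \<notin> V'" "a \<noteq> w" "b \<noteq> w" using join(3) w by blast+
      then show ?thesis using 1(2)[OF 2] by (simp add: par_def dep_def)
    next
      case 3
      then have "a \<in> V'" "b \<in> V'" using rtree_edgeD[OF t'] by blast+
      then show ?thesis using 2(2)[OF 3] 2(1) by (auto simp: par_def dep_def)
    qed
  qed
  moreover have "dep v = 0" using v 1(1) by (simp add: dep_def)
  ultimately show ?case by blast
qed auto

lemma cas_step:
  assumes "pre_digraph.cas D u p v" "Suc i < length p"
  shows "tail D (p ! Suc i) = head D (p ! i)"
  using assms
proof (induction p arbitrary: u i)
  case (Cons e p)
  note [simp] = pre_digraph.cas.simps
  show ?case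
  proof (cases i)
    case 0
    then show ?thesis using Cons.prems by (cases p) auto
  next
    case (Suc j)
    then show ?thesis using Cons by auto
  qed
qed simp

lemma rtree_acyclic:
  assumes t: "rtree E v V A L"
  shows "\<not> (\<exists>p. pre_digraph.cycle (with_proj (tree_of V A)) p \<and> 3 \<le> length p)"
proof
  assume "\<exists>p. pre_digraph.cycle (with_proj (tree_of V A)) p \<and> 3 \<le> length p"
  then obtain p u where p: "pre_digraph.awalk (with_proj (tree_of V A)) u p u"
    "distinct (tl (pre_digraph.awalk_verts (with_proj (tree_of V A)) u p))" and m: "3 \<le> length p"
    unfolding pre_digraph.cycle_def by blast
  let ?D = "with_proj (tree_of V A)"
  let ?m = "length p"
  have ne: "p \<noteq> []" using m by auto
  have cas: "pre_digraph.cas ?D u p u" and arcs: "set p \<subseteq> parcs (tree_of V A)"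
    using p(1) unfolding pre_digraph.awalk_def by auto
  have verts: "pre_digraph.awalk_verts ?D u p = tail ?D (hd p) # map (head ?D) p"
    using pre_digraph.awalk_verts_conv'[OF cas] ne by simp
  have dist: "distinct (map snd p)" using p(2) unfolding verts by simp
  have "pre_digraph.awalk_verts ?D u p = map (tail ?D) p @ [head ?D (last p)]"
    using pre_digraph.awalk_verts_conv[of ?D u p] ne by simp
  have last: "snd (last p) = u" "fst (hd p) = u"
    using cas ne
  proof -
    have "pre_digraph.cas ?D x p y \<Longrightarrow> p \<noteq> [] \<Longrightarrow> snd (last p) = y \<and> fst (hd p) = x" for x y p
      by (induction p arbitrary: x) (auto simp: pre_digraph.cas.simps)
    then show "snd (last p) = u" "fst (hd p) = u" using cas ne by blast+
  qed
  obtain par and dep :: "nat \<Rightarrow> nat" where pd: "\<And>a b. edge a b \<in> A \<Longrightarrow>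
    (par a = b \<and> dep a > dep b) \<or> (par b = a \<and> dep b > dep a)"
    using rtree_parents[OF t] by blast
  have "\<exists>i<?m. \<forall>j<?m. dep (snd (p ! j)) \<le> dep (snd (p ! i))"
  proof -
    have "finite ((\<lambda>i. dep (snd (p ! i))) ` {..<?m})" "(\<lambda>i. dep (snd (p ! i))) ` {..<?m} \<noteq> {}"
      using ne by auto
    from Max_in[OF this] obtain i where "i < ?m"
      "Max ((\<lambda>i. dep (snd (p ! i))) ` {..<?m}) = dep (snd (p ! i))" by auto
    then show ?thesis by (intro exI[of _ i]) (metis Max_ge finite_imageI finite_lessThan imageI lessThan_iff)
  qed
  then obtain i where i: "i < ?m" "\<And>j. j < ?m \<Longrightarrow> dep (snd (p ! j)) \<le> dep (snd (p ! i))" by blast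
  \<comment> \<open>Cyclic predecessor and successor of \<open>i\<close>. They differ because there
    are at least three arcs.\<close>
  define i' where "i' = (if i = 0 then ?m - 1 else i - 1)"
  define j where "j = (if Suc i = ?m then 0 else Suc i)"
  have lt: "i' < ?m" "j < ?m" and "i' \<noteq> j" using i m by (auto simp: i'_def j_def)
  have "fst (p ! i) = snd (p ! i')"
  proof (cases "i = 0")
    case True
    then show ?thesis using last ne by (simp add: i'_def last_conv_nth hd_conv_nth)
  next
    case False
    then show ?thesis using cas_step[OF cas, of "i - 1"] i by (simp add: i'_def)
  qed
  then have e1: "edge (snd (p ! i')) (snd (p ! i)) \<in> A"
    using arcs i(1) by (metis nth_mem prod.collapse subsetD tree_of_simps(2))
  have "fst (p ! j) = snd (p ! i)"
  proof (cases "Suc i = ?m")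
    case True
    then have "i = ?m - 1" by simp
    then show ?thesis using last ne True by (simp add: j_def last_conv_nth hd_conv_nth)
  next
    case False
    then show ?thesis using cas_step[OF cas, of i] i by (simp add: j_def)
  qed
  then have e2: "edge (snd (p ! i)) (snd (p ! j)) \<in> A"
    using arcs lt(2) by (metis nth_mem prod.collapse subsetD tree_of_simps(2))
  have "par (snd (p ! i)) = snd (p ! i')" using pd[OF e1] i(2)[OF lt(1)] by auto
  moreover have "par (snd (p ! i)) = snd (p ! j)" using pd[OF e2] i(2)[OF lt(2)] by auto
  ultimately have "map snd p ! i' = map snd p ! j" using lt by simp
  then show False using nth_eq_iff_index_eq[OF dist, of i' j] lt \<open>i' \<noteq> j\<close> by simp
qed

lemma rtree_reach: "rtree E v V A L \<Longrightarrow> a \<in> V \<Longrightarrow> (v, a) \<in> {(a, b). edge a b \<in> A}\<^sup>*"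
proof (induction rule: rtree.induct)
  case (join v V A L w V' A' L')
  let ?R = "\<lambda>A. {(a, b). edge a b \<in> A}"
  let ?A = "insert (edge v w) (A \<union> A')"
  have "(?R A)\<^sup>* \<subseteq> (?R ?A)\<^sup>*" "(?R A')\<^sup>* \<subseteq> (?R ?A)\<^sup>*" by (auto intro!: rtrancl_mono)
  moreover have "(v, w) \<in> ?R ?A" by simp
  ultimately show ?case using join.IH join.prems
    by (metis (no_types, lifting) Un_iff converse_rtrancl_into_rtrancl subsetD)
qed simp

lemma undirected_tree_tree_of:
  assumes t: "rtree E v V A L" and E: "\<And>a. \<not> E a a"
  shows "undirected_tree (tree_of V A)"
proof -
  interpret pair_graph "tree_of V A" by (rule pair_graph_tree_of[OF t E])
  let ?R = "{(a, b). edge a b \<in> A}"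
  have R: "parcs (tree_of V A) = ?R" by (auto simp: tree_of_def)
  have "sym ?R" by (auto simp: sym_def edge_commute)
  then have symR: "sym (?R\<^sup>*)" by (rule sym_rtrancl)
  have "(a, b) \<in> ?R\<^sup>*" if "a \<in> V" "b \<in> V" for a b
    using rtree_reach[OF t that(1)] rtree_reach[OF t that(2)] symR
    by (meson rtrancl_trans symD)
  then have "a \<rightarrow>\<^sup>*\<^bsub>with_proj (tree_of V A)\<^esub> b" if "a \<in> V" "b \<in> V" for a b
    using that reachable_conv[of a b] by (simp add: R)
  then have "strongly_connected (with_proj (tree_of V A))"
    using rtree_root[OF t] by (intro strongly_connectedI) auto
  then have "connected (with_proj (tree_of V A))"
    unfolding connected_def strongly_connected_def
    using reachable_mk_symmetricI by auto
  then show ?thesis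
    unfolding undirected_tree_def using pair_graph_axioms rtree_acyclic[OF t] by blast
qed

text \<open>A maximal subtree built from edges of \<open>T\<close> reaches all vertices by
  connectedness and contains all edges by acyclicity.\<close>

lemma undirected_tree_rtree:
  assumes T: "undirected_tree T" and E: "\<And>a b. (a, b) \<in> parcs T \<Longrightarrow> E a b" and r: "r \<in> pverts T"
  obtains A L where "rtree E r (pverts T) A L" "T = tree_of (pverts T) A"
proof -
  interpret T: pair_graph T using T by (simp add: undirected_tree_def)
  define A0 where "A0 = (\<lambda>(a, b). edge a b) ` parcs T"
  have symT: "(a, b) \<in> parcs T \<longleftrightarrow> (b, a) \<in> parcs T" for a b
    using T.graph_symmetric by auto
  have A0: "edge a b \<in> A0 \<longleftrightarrow> (a, b) \<in> parcs T" for a b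
    unfolding A0_def using symT by (auto simp: edge_eq_iff intro: rev_image_eqI[of "(a, b)"])
  have TA0: "T = tree_of (pverts T) A0"
    by (rule pair_pre_digraph.equality) (auto simp: tree_of_def A0)
  define VS where "VS = {V. V \<subseteq> pverts T \<and> (\<exists>A L. A \<subseteq> A0 \<and> rtree E r V A L)}"
  have "{r} \<in> VS" unfolding VS_def using r rtree.single by blast
  moreover have "finite VS"
    unfolding VS_def using T.pair_finite_verts by (auto intro: finite_subset[of _ "Pow (pverts T)"])
  ultimately obtain V where V: "V \<in> VS" "\<And>V'. V' \<in> VS \<Longrightarrow> V \<subseteq> V' \<Longrightarrow> V = V'"
    using finite_has_maximal2[of VS "{r}"] by blast
  then obtain A L where t: "rtree E r V A L" and "V \<subseteq> pverts T" "A \<subseteq> A0" unfolding VS_def by blast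
  have closed: "b \<in> V" if a: "a \<in> V" and ab: "(a, b) \<in> parcs T" for a b
  proof (rule ccontr)
    assume b: "b \<notin> V"
    obtain L' where "rtree E r (insert b V) (insert (edge a b) A) L'"
      using rtree_grow[OF t a b E[OF ab]] by blast
    moreover have "insert b V \<subseteq> pverts T" "insert (edge a b) A \<subseteq> A0"
      using ab \<open>V \<subseteq> pverts T\<close> \<open>A \<subseteq> A0\<close> T.in_arcsD2 by (auto simp: A0)
    ultimately have "insert b V \<in> VS" unfolding VS_def by blast
    from V(2)[OF this] b show False by blast
  qed
  have "strongly_connected (with_proj T)"
    using T by (intro T.symmetric_connected_imp_strongly_connected)
      (auto simp: undirected_tree_def T.pair_sym_arcs)
  then have reach: "(r, a) \<in> (parcs T)\<^sup>*" if "a \<in> pverts T" for a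
    using that r T.reachable_conv[of r a] by (auto simp: strongly_connected_def)
  have "a \<in> V" if "a \<in> pverts T" for a
    using reach[OF that]
  proof (induction rule: rtrancl_induct)
    case base
    show ?case by (rule rtree_root[OF t])
  next
    case (step y z)
    then show ?case using closed by blast
  qed
  with \<open>V \<subseteq> pverts T\<close> have VT: "V = pverts T" by blast
  have "A = A0"
  proof (rule ccontr)
    assume "A \<noteq> A0"
    then obtain a b where ab: "(a, b) \<in> parcs T" "edge a b \<notin> A"
      using \<open>A \<subseteq> A0\<close> unfolding A0_def by auto
    have "pair_graph (tree_of V A)"
    proof -
      \<comment> \<open>\<open>E\<close> is not assumed irreflexive, but a join never uses a loop,
        because its two parts are disjoint.\<close>
      have "rtree (\<lambda>a b. E a b \<and> a \<noteq> b) r V A L"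
        using t
      proof (induction rule: rtree.induct)
        case (join v V A L w V' A' L')
        then show ?case using rtree_root[OF join(1)] rtree_root[OF join(2)]
          by (intro rtree.join) auto
      qed (rule rtree.single)
      then show ?thesis by (rule pair_graph_tree_of) simp
    qed
    then interpret S: pair_graph "tree_of V A" .
    have "(r, a) \<in> {(a, b). edge a b \<in> A}\<^sup>*" "(r, b) \<in> {(a, b). edge a b \<in> A}\<^sup>*"
      using rtree_reach[OF t] ab(1) VT T.in_arcsD1 T.in_arcsD2 by blast+
    moreover have "sym ({(a, b). edge a b \<in> A}\<^sup>*)"
      by (rule sym_rtrancl) (auto simp: sym_def edge_commute)
    ultimately have "(a, b) \<in> {(a, b). edge a b \<in> A}\<^sup>*"
      by (meson rtrancl_trans symD)
    moreover have "parcs (tree_of V A) = {(a, b). edge a b \<in> A}" by (auto simp: tree_of_def)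
    ultimately have "a \<rightarrow>\<^sup>*\<^bsub>with_proj (tree_of V A)\<^esub> b"
      using S.reachable_conv[of a b] ab(1) VT T.in_arcsD1 T.in_arcsD2 by auto
    then obtain p where "S.apath a p b" using S.reachable_apath by blast
    then have p: "S.awalk a p b" "distinct (S.awalk_verts a p)" by (auto simp: S.apath_def)
    have cas: "pre_digraph.cas (with_proj T) x q y = pre_digraph.cas (with_proj (tree_of V A)) x q y" for x q y
      by (induction q arbitrary: x) (auto simp: pre_digraph.cas.simps)
    have verts: "pre_digraph.awalk_verts (with_proj T) x q
        = pre_digraph.awalk_verts (with_proj (tree_of V A)) x q" for x q
      by (induction q arbitrary: x) (auto simp: pre_digraph.awalk_verts.simps)
    have app: "pre_digraph.cas (with_proj T) x q y \<Longrightarrow> pre_digraph.cas (with_proj T) x (q @ [(y, z)]) z \<and>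
        pre_digraph.awalk_verts (with_proj T) x (q @ [(y, z)]) = pre_digraph.awalk_verts (with_proj T) x q @ [z]" for x q y z
      by (induction q arbitrary: x) (auto simp: pre_digraph.cas.simps pre_digraph.awalk_verts.simps)
    have casS: "pre_digraph.cas (with_proj (tree_of V A)) a p b" "set p \<subseteq> parcs (tree_of V A)"
      using p(1) by (auto simp: pre_digraph.awalk_def)
    have neab: "a \<noteq> b" using ab(1) T.no_loops' by blast
    have "p \<noteq> []" using casS(1) neab by (auto simp: pre_digraph.cas.simps)
    moreover have "length p \<noteq> 1"
    proof
      assume "length p = 1"
      then obtain e where "p = [e]" by (auto simp: length_Suc_conv)
      with casS have "e = (a, b)" "e \<in> parcs (tree_of V A)"
        by (auto simp: pre_digraph.cas.simps prod_eq_iff)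
      then show False using ab(2) by simp
    qed
    \<comment> \<open>The arc \<open>(a, b)\<close> is not in the subtree, so the path has at least
      two arcs and closes to a cycle of the forbidden length.\<close>
    ultimately have len: "3 \<le> length (p @ [(b, a)])" by (cases p) (auto simp: Suc_le_eq)
    have "parcs (tree_of V A) \<subseteq> parcs T"
    proof (rule subrelI)
      fix x y assume "(x, y) \<in> parcs (tree_of V A)"
      then show "(x, y) \<in> parcs T" using \<open>A \<subseteq> A0\<close> A0[of x y] by auto
    qed
    then have "set p \<subseteq> parcs T" using casS(2) by blast
    then have "pre_digraph.awalk (with_proj T) a (p @ [(b, a)]) a"
      using app[of a p b a] cas casS ab(1) symT T.in_arcsD1[OF ab(1)]
      by (auto simp: pre_digraph.awalk_def)
    moreover have "distinct (tl (pre_digraph.awalk_verts (with_proj T) a (p @ [(b, a)])))"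
    proof -
      have *: "pre_digraph.awalk_verts (with_proj T) a p = a # map snd p"
        using pre_digraph.awalk_verts_conv'[of "with_proj T" a p b] cas casS(1) \<open>p \<noteq> []\<close>
        by (cases p) (auto simp: pre_digraph.cas.simps)
      have "distinct (pre_digraph.awalk_verts (with_proj (tree_of V A)) a p)" using p(2) by simp
      then have "distinct (a # map snd p)" by (simp only: verts[symmetric] *)
      then show ?thesis using app[of a p b a] cas casS(1) * by auto
    qed
    ultimately have "pre_digraph.cycle (with_proj T) (p @ [(b, a)])"
      unfolding pre_digraph.cycle_def by blast
    with len T show False unfolding undirected_tree_def by blast
  qed
  then show thesis using that[of A L] t VT TA0 by simp
qed

definition root_trees :: "(nat \<Rightarrow> nat \<Rightarrow> bool) \<Rightarrow> nat \<Rightarrow> (nat \<times> nat set \<times> el set \<times> nat set) set" where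
  "root_trees E r = {(w, V, A, L). E r w \<and> rtree (without r E) w V A L}"

definition root_els :: "nat \<Rightarrow> nat \<times> nat set \<times> el set \<times> nat set \<Rightarrow> el set" where
  "root_els r = (\<lambda>(w, V, A, L). insert (edge r w) (tree_els w V A L))"

lemma (in simple_graph) rtree_vertices_less: "rtree E v V A L \<Longrightarrow> v < n \<Longrightarrow> V \<subseteq> {..<n}"
proof (induction rule: rtree.induct)
  case (join v V A L w V' A' L')
  then show ?case using E_less2 by auto
qed simp

lemma (in simple_graph) root_trees_less:
  assumes "(w, V, A, L) \<in> root_trees E r" shows "V \<subseteq> {..<n}" "r < n" "r \<notin> V"
proof -
  interpret W: simple_graph n "without r E" by (rule without)
  have *: "E r w" "rtree (without r E) w V A L" using assms by (auto simp: root_trees_def)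
  show "V \<subseteq> {..<n}" using W.rtree_vertices_less[OF *(2)] E_less2[OF *(1)] by simp
  show "r < n" using *(1) E_less by blast
  show "r \<notin> V" using rtree_without_root[OF *(2)] *(1) E_irrefl by blast
qed

lemma (in simple_graph) cf_root_series_iff:
  "cf (root_series n E {..<n} r) S = 1 \<longleftrightarrow> S \<in> root_els r ` root_trees E r"
proof
  assume "cf (root_series n E {..<n} r) S = 1"
  then have "cf (root_series n E {..<n} r) S \<noteq> 0" by (simp only: one_neq_zero not_False_eq_True)
  from root_series_sound[OF this] show "S \<in> root_els r ` root_trees E r"
    by (force simp: root_trees_def root_els_def)
next
  assume "S \<in> root_els r ` root_trees E r"
  then obtain w V A L where t: "(w, V, A, L) \<in> root_trees E r"
    and S: "S = insert (edge r w) (tree_els w V A L)"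
    by (auto simp: root_els_def)
  then have "E r w" "rtree (without r E) w V A L" by (auto simp: root_trees_def)
  with root_trees_less(1)[OF t] show "cf (root_series n E {..<n} r) S = 1"
    unfolding S by (intro root_series_complete)
qed

text \<open>The tree contains the root \<open>r\<close> in addition to \<open>V\<close>, and \<open>r\<close> is one of its leaves.\<close>

lemma root_trees_imp_kl_tree:
  assumes G: "pair_graph G" and t: "(w, V, A, L) \<in> root_trees (\<lambda>a b. (a, b) \<in> parcs G) r"
    and k: "Suc (card V) = k" and l: "Suc (card (with_root w V L)) = l"
  shows "contains_kl_tree G k l"
proof -
  let ?E = "\<lambda>a b. (a, b) \<in> parcs G"
  interpret G: pair_graph G by fact
  have irr: "\<not> ?E a a" for a using G.no_loops' by blast
  have sym: "?E a b \<longleftrightarrow> ?E b a" for a b using G.graph_symmetric by auto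
  have E: "?E r w" and rt: "rtree (without r ?E) w V A L" using t by (auto simp: root_trees_def)
  have wr: "w \<noteq> r" using E irr by blast
  have rV: "r \<notin> V" by (rule rtree_without_root[OF rt wr])
  have "rtree ?E w V A L" by (rule rtree_mono[OF rt]) (simp add: without_def)
  from rtree.join[OF rtree.single this _ E] rV
  have T: "rtree ?E r (insert r V) (insert (edge r w) A) (with_root w V L)" by simp
  let ?T = "tree_of (insert r V) (insert (edge r w) A)"
  have A: "(a, b) \<in> parcs G" if "edge a b \<in> insert (edge r w) A" for a b
    using rtree_edgeD[OF T that] sym by blast
  have V: "a \<in> pverts G" if "a \<in> insert r V" for a
  proof -
    have "(r, a) \<in> {(a, b). edge a b \<in> insert (edge r w) A}\<^sup>*" by (rule rtree_reach[OF T that])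
    then show ?thesis
    proof (induction rule: rtrancl_induct)
      case base
      then show ?case using E G.in_arcsD1 by blast
    next
      case (step y z)
      then show ?case using A G.in_arcsD2 by blast
    qed
  qed
  interpret T: pair_graph ?T by (rule pair_graph_tree_of[OF T irr])
  have "subgraph (with_proj ?T) (with_proj G)"
    unfolding subgraph_def compatible_def
    using V A by (auto simp: tree_of_def T.wf_digraph_axioms G.wf_digraph_axioms wf_digraph_wp_iff
        G.pair_wf_digraph_axioms T.pair_wf_digraph_axioms)
      (use T.pair_wf_digraph_axioms in \<open>simp_all add: tree_of_def\<close>)
  moreover have "undirected_tree ?T" by (rule undirected_tree_tree_of[OF T irr])
  moreover have "card (pverts ?T) = k" using k rV rtree_finite[OF rt] by simp
  moreover have "leaves ?T = insert r (with_root w V L)"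
  proof -
    have LV: "with_root w V L \<subseteq> V"
      using rtree_leaves[OF rt] rtree_root[OF rt] by (auto simp: with_root_def)
    have nr: "neighbors (insert (edge r w) A) r = {w}"
      using rtree_edgeD[OF rt] rV wr by (auto simp: neighbors_def edge_eq_iff)
    have "a \<in> leaves ?T \<longleftrightarrow> a \<in> insert r (with_root w V L)" for a
    proof (cases "a = r")
      case True
      then show ?thesis by (simp add: leaves_def out_degree_tree_of nr)
    next
      case False
      then show ?thesis
        using rtree_leaf_iff[OF T, of a] LV by (auto simp: leaves_def out_degree_tree_of)
    qed
    then show ?thesis by blast
  qed
  then have "card (leaves ?T) = l"
    using l rV rtree_finite[OF rt] rtree_leaves[OF rt] rtree_root[OF rt]
    by (subst \<open>leaves ?T = _\<close>, subst card_insert_disjoint)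
      (auto simp: with_root_def intro: finite_subset[of _ V])
  ultimately show ?thesis unfolding contains_kl_tree_def by blast
qed

text \<open>Any leaf of the tree can serve as the root; having one neighbor, it is split off by
  \<open>rtree_single_child\<close>.\<close>

lemma kl_tree_imp_root_trees:
  assumes G: "pair_graph G" and T: "contains_kl_tree G k l" and k: "2 \<le> k" and l: "1 \<le> l"
  obtains r w V A L where "(w, V, A, L) \<in> root_trees (\<lambda>a b. (a, b) \<in> parcs G) r"
    "Suc (card V) = k" "Suc (card (with_root w V L)) = l" "r \<in> pverts G"
proof -
  let ?E = "\<lambda>a b. (a, b) \<in> parcs G"
  interpret G: pair_graph G by fact
  obtain T where T: "subgraph (with_proj T) (with_proj G)" "undirected_tree T"
    "card (pverts T) = k" "card (leaves T) = l"
    using T unfolding contains_kl_tree_def by blast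
  have sub: "pverts T \<subseteq> pverts G" "parcs T \<subseteq> parcs G" using T(1) by (auto simp: subgraph_def)
  obtain r where r: "r \<in> leaves T" using T(4) l by fastforce
  then have "r \<in> pverts T" by (simp add: leaves_def)
  then obtain A L where t: "rtree ?E r (pverts T) A L" and TA: "T = tree_of (pverts T) A"
    using undirected_tree_rtree[OF T(2), of ?E r] sub by blast
  have deg: "out_degree T a = card (neighbors A a)" for a
    using out_degree_tree_of[of "pverts T" A a] TA by simp
  then have "card (neighbors A r) = 1" using r by (simp add: leaves_def)
  then obtain w V' A' L' where *: "?E r w" "rtree (without r ?E) w V' A' L'" "r \<notin> V'"
    "pverts T = insert r V'" "A = insert (edge r w) A'" "L = with_root w V' L'"
    using rtree_single_child[OF t] by metis
  have fin: "finite V'" by (rule rtree_finite[OF *(2)])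
  have "leaves T = insert r L"
  proof -
    have LV: "L \<subseteq> pverts T - {r}" by (rule rtree_leaves[OF t])
    have "a \<in> leaves T \<longleftrightarrow> a \<in> insert r L" for a
    proof (cases "a = r")
      case False
      then show ?thesis using rtree_leaf_iff[OF t, of a] LV by (auto simp: leaves_def deg)
    qed (use r in simp)
    then show ?thesis by blast
  qed
  moreover have "r \<notin> L" "finite L"
    using rtree_leaves[OF t] rtree_finite[OF t] finite_subset by blast+
  ultimately have "Suc (card L) = l" using T(4) by simp
  moreover have "Suc (card V') = k" using T(3) * fin by simp
  ultimately show thesis
    using that[of w V' A' L' r] * sub(1) \<open>r \<in> pverts T\<close> by (auto simp: root_trees_def)
qed

text \<open>These necessary conditions settle all inputs that are not passed to the search.\<close>

lemma kl_tree_le: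
  fixes G :: "nat pair_pre_digraph"
  assumes G: "pair_graph G" and T: "contains_kl_tree G k l"
  shows "k \<le> card (pverts G)" "l \<le> k" "2 \<le> k \<Longrightarrow> 1 \<le> l" "k = 1 \<Longrightarrow> l = 0"
proof -
  let ?E = "\<lambda>a b. (a, b) \<in> parcs G"
  interpret G: pair_graph G by fact
  obtain T where T: "subgraph (with_proj T) (with_proj G)" "undirected_tree T"
    "card (pverts T) = k" "card (leaves T) = l"
    using T unfolding contains_kl_tree_def by blast
  interpret T: pair_graph T using T(2) by (simp add: undirected_tree_def)
  have sub: "pverts T \<subseteq> pverts G" "parcs T \<subseteq> parcs G" using T(1) by (auto simp: subgraph_def)
  show "k \<le> card (pverts G)" using card_mono[OF G.pair_finite_verts sub(1)] T(3) by simp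
  have "leaves T \<subseteq> pverts T" by (auto simp: leaves_def)
  then show "l \<le> k" using card_mono[OF T.pair_finite_verts] T(3,4) by blast
  {
    assume "2 \<le> k"
    then obtain r where r: "r \<in> pverts T" using T(3) by fastforce
    obtain A L where t: "rtree ?E r (pverts T) A L" and TA: "T = tree_of (pverts T) A"
      using undirected_tree_rtree[OF T(2), of ?E r] sub r by blast
    have "pverts T \<noteq> {r}" using T(3) \<open>2 \<le> k\<close> by auto
    then obtain a where a: "a \<in> L" using rtree_has_leaf[OF t] by blast
    then have "a \<in> pverts T - {r}" using rtree_leaves[OF t] by blast
    with a have "card (neighbors A a) = 1" using rtree_leaf_iff[OF t] by blast
    then have "out_degree T a = 1" using out_degree_tree_of[of "pverts T" A a] TA by simp
    then have "a \<in> leaves T" using \<open>a \<in> pverts T - {r}\<close> by (simp add: leaves_def)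
    moreover have "finite (leaves T)"
      using T.pair_finite_verts \<open>leaves T \<subseteq> pverts T\<close> finite_subset by blast
    ultimately show "1 \<le> l" using T(4) by (metis One_nat_def Suc_leI card_gt_0_iff empty_iff)
  }
  {
    assume "k = 1"
    then obtain r where r: "pverts T = {r}" using T(3) card_1_singletonE by blast
    have "parcs T = {}"
    proof (rule ccontr)
      assume "parcs T \<noteq> {}"
      then obtain a b where "(a, b) \<in> parcs T" by fastforce
      then show False using T.in_arcsD1 T.in_arcsD2 T.no_loops' r by fastforce
    qed
    then have "leaves T = {}" by (auto simp: leaves_def out_degree_def out_arcs_def)
    then show "l = 0" using T(4) by simp
  }
qed

lemma single_vertex_tree:
  fixes G :: "nat pair_pre_digraph"
  assumes G: "pair_graph G" and v: "v \<in> pverts G"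
  shows "contains_kl_tree G 1 0"
proof -
  interpret G: pair_graph G by fact
  let ?E = "\<lambda>a b. (a, b) \<in> parcs G"
  have irr: "\<not> ?E a a" for a using G.no_loops' by blast
  have t: "rtree ?E v {v} {} {}" by (rule rtree.single)
  interpret T: pair_graph "tree_of {v} {}" by (rule pair_graph_tree_of[OF t irr])
  have "subgraph (with_proj (tree_of {v} {})) (with_proj G)"
    unfolding subgraph_def compatible_def
    using v T.pair_wf_digraph_axioms G.pair_wf_digraph_axioms
    by (simp add: wf_digraph_wp_iff) (simp add: tree_of_def)
  moreover have "undirected_tree (tree_of {v} {})" by (rule undirected_tree_tree_of[OF t irr])
  moreover have "leaves (tree_of {v} {}) = {}"
    by (auto simp: leaves_def out_degree_tree_of neighbors_def)
  ultimately show ?thesis unfolding contains_kl_tree_def by (intro exI[of _ "tree_of {v} {}"]) simp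
qed


section \<open>Labels\<close>

definition n_edges :: "el multiset \<Rightarrow> nat" where
  "n_edges m = (\<Sum>e\<in>#m. case e of Edge _ _ \<Rightarrow> 1 | _ \<Rightarrow> 0)"

definition n_leaves :: "el multiset \<Rightarrow> nat" where
  "n_leaves m = (\<Sum>e\<in>#m. case e of Lf _ \<Rightarrow> 1 | _ \<Rightarrow> 0)"

definition edge_weight :: "(nat \<times> nat \<Rightarrow> nat) \<Rightarrow> el multiset \<Rightarrow> nat" where
  "edge_weight wt m = (\<Sum>e\<in>#m. case e of Edge a b \<Rightarrow> wt (a, b) | _ \<Rightarrow> 0)"

text \<open>The label is empty where another label controls the multiplicity: below the root, an
  edge at a vertex of \<open>Y\<close> and a leaf in \<open>Y\<close> occur at most as often as the
  mark of that vertex. Vertices outside \<open>Y\<close> are not marked at all. For a given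
  \<open>Y\<close> the pair \<open>(v, v)\<close> never serves both the vertex and the leaf.\<close>

definition label :: "nat set \<Rightarrow> el \<Rightarrow> (nat \<times> nat) multiset" where
  "label Y e = (case e of
     Edge a b \<Rightarrow> if a \<in> Y \<or> b \<in> Y then {#} else {#(a, b)#}
   | Vert v \<Rightarrow> if v \<in> Y then {#(v, v)#} else {#}
   | Lf v \<Rightarrow> if v \<in> Y then {#} else {#(v, v)#})"

definition labels :: "nat set \<Rightarrow> el multiset \<Rightarrow> (nat \<times> nat) multiset" where
  "labels Y m = (\<Sum>e\<in>#m. label Y e)"

lemma multiset_fun_simps [simp]:
  "n_edges {#} = 0" "n_edges (a + b) = n_edges a + n_edges b"
  "n_leaves {#} = 0" "n_leaves (a + b) = n_leaves a + n_leaves b"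
  "edge_weight wt {#} = 0" "edge_weight wt (a + b) = edge_weight wt a + edge_weight wt b"
  "labels Y {#} = {#}" "labels Y (a + b) = labels Y a + labels Y b"
  "n_edges (add_mset (Vert v) a) = n_edges a" "n_edges (add_mset (Lf v) a) = n_edges a"
  "n_edges (add_mset (edge v w) a) = Suc (n_edges a)"
  "n_leaves (add_mset (Vert v) a) = n_leaves a" "n_leaves (add_mset (Lf v) a) = Suc (n_leaves a)"
  "n_leaves (add_mset (edge v w) a) = n_leaves a"
  "edge_weight wt (add_mset (Vert v) a) = edge_weight wt a"
  "labels Y (add_mset e a) = label Y e + labels Y a"
  by (simp_all add: n_edges_def n_leaves_def edge_weight_def labels_def edge_def)

lemma multiset_fun_filter:
  "n_edges (filter_mset (marked Y) m) = n_edges m"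
  "n_leaves (filter_mset (marked Y) m) = n_leaves m"
  "edge_weight wt (filter_mset (marked Y) m) = edge_weight wt m"
  "labels Y (filter_mset (marked Y) m) = labels Y m"
  by (induction m; simp add: n_edges_def n_leaves_def edge_weight_def labels_def label_def
      marked_def split: el.split)+

text \<open>Linear independence over GF(2) of the vectors \<open>vb i\<close> of length
  \<open>H\<close>, together with the absence of repetitions: no nonempty subfamily sums to
  0.\<close>

definition indep_labels :: "(nat \<times> nat \<Rightarrow> nat \<Rightarrow> bool) \<Rightarrow> nat \<Rightarrow> (nat \<times> nat) multiset \<Rightarrow> bool" where
  "indep_labels vb H M \<longleftrightarrow> (\<forall>i. count M i \<le> 1) \<and>
     (\<forall>D. D \<subseteq> set_mset M \<longrightarrow> D \<noteq> {} \<longrightarrow> (\<exists>j<H. odd (card {i \<in> D. vb i j})))"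

text \<open>Without turning around, a walk uses the edges at a vertex \<open>c\<close> at most as often as it visits
  \<open>c\<close>.\<close>

lemma walks_edge_count:
  assumes "m \<in> set (walks n E i p v)" "a \<noteq> c"
  shows "count m (edge a c) + of_bool (v = c \<and> p = a) \<le> count m (Vert c)"
  using assms
proof (induction i arbitrary: p v m)
  case (Suc i)
  let ?f = "\<lambda>w. if E v w \<and> w \<noteq> p then map (add_mset (edge v w)) (walks n E i v w) else []"
  have "count b (edge a c) \<le> count b (Vert c) + of_bool (v = c \<and> a < n \<and> a \<noteq> p)"
    if "b \<in> set (forests ?f n)" for b
    using that
  proof (rule forests_invariant[where
        P = "\<lambda>j b. count b (edge a c) \<le> count b (Vert c) + of_bool (v = c \<and> a < j \<and> a \<noteq> p)"])
    fix j m assume "count m (edge a c) \<le> count m (Vert c) + of_bool (v = c \<and> a < j \<and> a \<noteq> p)"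
    then show "count m (edge a c) \<le> count m (Vert c) + of_bool (v = c \<and> a < Suc j \<and> a \<noteq> p)"
      by (rule order_trans) (simp add: of_bool_def)
  next
    fix j a' b assume j: "j < n" "a' \<in> set (?f j)"
      and b: "count b (edge a c) \<le> count b (Vert c) + of_bool (v = c \<and> a < j \<and> a \<noteq> p)"
    obtain m'' where m'': "a' = add_mset (edge v j) m''" "m'' \<in> set (walks n E i v j)" "j \<noteq> p"
      using j(2) by (auto split: if_splits)
    have IH: "count m'' (edge a c) + of_bool (j = c \<and> v = a) \<le> count m'' (Vert c)"
      by (rule Suc.IH[OF m''(2) Suc.prems(2)])
    show "count (a' + b) (edge a c) \<le> count (a' + b) (Vert c) + of_bool (v = c \<and> a < Suc j \<and> a \<noteq> p)"
      using IH b m''(3) Suc.prems(2) unfolding m''(1)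
      by (auto simp: edge_eq_iff split: if_splits)
  qed simp
  note forest = this
  from Suc.prems(1) consider b where "m = add_mset (Vert v) b" "b \<in> set (forests ?f n)"
    | "m = {#Vert v, Lf v#}" by auto
  then show ?case
  proof cases
    case 1
    then show ?thesis using forest[OF 1(2)] by (auto simp: of_bool_def split: if_splits)
  qed simp
qed simp

lemma walks_leaf_count: "m \<in> set (walks n E i p v) \<Longrightarrow> count m (Lf c) \<le> count m (Vert c)"
proof (induction i arbitrary: p v m)
  case (Suc i)
  let ?f = "\<lambda>w. if E v w \<and> w \<noteq> p then map (add_mset (edge v w)) (walks n E i v w) else []"
  have "count b (Lf c) \<le> count b (Vert c)" if "b \<in> set (forests ?f n)" for b
    using that
    by (rule forests_invariant[where P = "\<lambda>_ b. count b (Lf c) \<le> count b (Vert c)"])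
      (use Suc.IH in \<open>fastforce split: if_splits\<close>)+
  then show ?case using Suc.prems by (fastforce split: if_splits)
qed simp

lemma walks_n_leaves: "m \<in> set (walks n E i p v) \<Longrightarrow> n_leaves m \<le> Suc (n_edges m)"
proof (induction i arbitrary: p v m)
  case (Suc i)
  let ?f = "\<lambda>w. if E v w \<and> w \<noteq> p then map (add_mset (edge v w)) (walks n E i v w) else []"
  have "n_leaves b \<le> n_edges b" if "b \<in> set (forests ?f n)" for b
    using that
    by (rule forests_invariant[where P = "\<lambda>_ b. n_leaves b \<le> n_edges b"])
      (use Suc.IH in \<open>fastforce split: if_splits\<close>)+
  then show ?case using Suc.prems by (fastforce split: if_splits)
qed simp

lemma rooted_walks_n_leaves: "m \<in> set (rooted_walks n E i r) \<Longrightarrow> n_leaves m \<le> n_edges m"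
  using walks_n_leaves by (fastforce simp: rooted_walks_def split: if_splits)

text \<open>So the edge by which the walk leaves the root is used only once.\<close>

lemma walks_avoid_edges:
  "m \<in> set (walks n (without r E) i p v) \<Longrightarrow> edge r a \<notin># m"
proof (induction i arbitrary: p v m)
  case (Suc i)
  let ?f = "\<lambda>w. if without r E v w \<and> w \<noteq> p
    then map (add_mset (edge v w)) (walks n (without r E) i v w) else []"
  have "edge r a \<notin># b" if "b \<in> set (forests ?f n)" for b
    using that
    by (rule forests_invariant[where P = "\<lambda>_ b. edge r a \<notin># b"])
      (use Suc.IH in \<open>fastforce simp: without_def edge_eq_iff split: if_splits\<close>)+
  then show ?case using Suc.prems by auto
qed simp

lemma count_label_le:
  "label Y e = {#i#} \<Longrightarrow> count m e \<le> count (labels Y m) i"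
  by (induction m) (auto simp: labels_def)

text \<open>Labeled elements repeat only if their label does. The other marked elements are bounded
  by the visits to a vertex of \<open>Y\<close>: leaves by \<open>walks_leaf_count\<close> and edges
  by \<open>walks_edge_count\<close>, where it matters that walks do not turn around.\<close>

lemma (in simple_graph) rooted_walks_squarefree:
  assumes m: "m \<in> set (rooted_walks n E k r)" and lab: "\<And>i. count (labels Y m) i \<le> 1"
  shows "count (filter_mset (marked Y) m) e \<le> 1"
proof -
  obtain w m' where w: "E r w" "m = add_mset (edge r w) m'" "m' \<in> set (walks n (without r E) k r w)"
    using m by (auto simp: rooted_walks_def split: if_splits)
  have wr: "w \<noteq> r" using w(1) E_irrefl by blast
  have V: "count m (Vert c) \<le> 1" if "c \<in> Y" for c
    using count_label_le[of Y "Vert c" "(c, c)" m] lab[of "(c, c)"] that by (simp add: label_def)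
  show ?thesis
  proof (cases e)
    case (Vert v)
    then show ?thesis using V[of v] by (simp add: marked_def)
  next
    case (Lf v)
    show ?thesis
    proof (cases "v \<in> Y")
      case True
      then show ?thesis using Lf V[of v] walks_leaf_count[OF w(3), of v] w(2) by (simp add: marked_def)
    next
      case False
      then show ?thesis
        using Lf count_label_le[of Y "Lf v" "(v, v)" m] lab[of "(v, v)"]
        by (simp add: label_def marked_def)
    qed
  next
    case (Edge a b)
    have "count m e \<le> 1"
    proof (cases "e \<in># m'")
      case False
      then show ?thesis using w(2) by (simp add: not_in_iff)
    next
      case True
      then have root: "e \<noteq> edge r w" using walks_avoid_edges[OF w(3)] by blast
      have ee: "e = edge a b \<and> a \<noteq> b"
      proof -
        \<comment> \<open>Excludes loops, so that \<open>e\<close> has the form that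
          \<open>walks_edge_count\<close> expects.\<close>
        have good: "e \<in># m' \<Longrightarrow> m' \<in> set (walks n (without r E) i p v) \<Longrightarrow>
            (\<exists>x y. e = edge x y \<and> x \<noteq> y) \<or> (\<exists>x. e = Vert x) \<or> (\<exists>x. e = Lf x)" for e m' i p v
        proof (induction i arbitrary: p v m')
          case (Suc i)
          let ?f = "\<lambda>w. if without r E v w \<and> w \<noteq> p
            then map (add_mset (edge v w)) (walks n (without r E) i v w) else []"
          have "e \<in># b \<longrightarrow> (\<exists>x y. e = edge x y \<and> x \<noteq> y) \<or> (\<exists>x. e = Vert x) \<or> (\<exists>x. e = Lf x)"
            if "b \<in> set (forests ?f n)" for b
            using that
          proof (rule forests_invariant[where P = "\<lambda>_ b. e \<in># b \<longrightarrow>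
              (\<exists>x y. e = edge x y \<and> x \<noteq> y) \<or> (\<exists>x. e = Vert x) \<or> (\<exists>x. e = Lf x)"])
            fix j a b
            assume a: "a \<in> set (?f j)" and b: "e \<in># b \<longrightarrow>
              (\<exists>x y. e = edge x y \<and> x \<noteq> y) \<or> (\<exists>x. e = Vert x) \<or> (\<exists>x. e = Lf x)"
            obtain m'' where "a = add_mset (edge v j) m''" "m'' \<in> set (walks n (without r E) i v j)" "E v j"
              using a by (auto simp: without_def split: if_splits)
            moreover from this(3) have "v \<noteq> j" using E_irrefl by blast
            ultimately show "e \<in># a + b \<longrightarrow>
              (\<exists>x y. e = edge x y \<and> x \<noteq> y) \<or> (\<exists>x. e = Vert x) \<or> (\<exists>x. e = Lf x)"
              using Suc.IH[of m'' v j] b by auto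
          qed auto
          then show ?case using Suc.prems by auto
        qed simp
        from good[OF True w(3)] Edge obtain x y where "e = edge x y" "x \<noteq> y" by auto
        then show ?thesis using Edge by (auto simp: edge_def min_def max_def split: if_splits)
      qed
      show ?thesis
      proof (cases "a \<in> Y \<or> b \<in> Y")
        case True
        then obtain c d where c: "c \<in> Y" "e = edge d c" "d \<noteq> c"
          using ee edge_commute[of a b] by metis
        have "count m e = count m' e" using w(2) root by simp
        also have "\<dots> \<le> count m' (Vert c)" using walks_edge_count[OF w(3) c(3)] c(2) by simp
        also have "\<dots> \<le> 1" using V[OF c(1)] w(2) by simp
        finally show ?thesis .
      next
        case False
        then show ?thesis
          using Edge count_label_le[of Y e "(a, b)" m] lab[of "(a, b)"] by (simp add: label_def)
      qed
    qed
    then show ?thesis by simp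
  qed
qed

definition selected :: "nat set \<Rightarrow> (nat \<times> nat \<Rightarrow> nat \<Rightarrow> bool) \<Rightarrow> nat \<Rightarrow> (nat \<times> nat \<Rightarrow> nat) \<Rightarrow>
    nat \<Rightarrow> nat \<Rightarrow> nat \<Rightarrow> el multiset \<Rightarrow> bool" where
  "selected Y vb H wt k l w m \<longleftrightarrow> n_edges m = k - 1 \<and> n_leaves m = l - 1 \<and>
     edge_weight wt m = w \<and> indep_labels vb H (labels Y m)"

lemma selected_filter: "selected Y vb H wt k l w (filter_mset (marked Y) m)
    = selected Y vb H wt k l w m"
  by (simp add: selected_def multiset_fun_filter)

lemma n_edges_mset_set: "finite S \<Longrightarrow> n_edges (mset_set S) = card (S \<inter> edge_els)"
proof -
  assume S: "finite S"
  have "Edge a b \<in> edge_els" for a b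
    unfolding edge_els_def by (rule range_eqI[of _ _ "(a, b)"]) simp
  moreover have "Vert v \<notin> edge_els" "Lf v \<notin> edge_els" for v by (auto simp: edge_els_def)
  ultimately have "(case e of Edge _ _ \<Rightarrow> 1 | _ \<Rightarrow> 0) = (of_bool (e \<in> edge_els) :: nat)" for e
    by (cases e) auto
  then have "n_edges (mset_set S) = (\<Sum>e\<in>S. of_bool (e \<in> edge_els))"
    unfolding n_edges_def sum_unfold_sum_mset by presburger
  then show ?thesis using S by (simp add: Int_def)
qed

text \<open>The test \<open>selected\<close> sees only marked elements, so
  \<open>parity_of_walks\<close> applies. All walks that are not trees drop out, while the trees are
  still filtered by the same random test.\<close>

theorem (in simple_graph) parity_of_selected:
  assumes k: "2 \<le> k" and Y: "Y \<subseteq> {..<n}"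
  shows "odd (length (filter (selected Y vb H wt k l w) (rooted_walks n E k r))) \<longleftrightarrow>
    odd (card {S \<in> root_els r ` root_trees E r. selected Y vb H wt k l w (mset_set S)})"
proof -
  let ?P = "selected Y vb H wt k l w"
  have "odd (length (filter ?P (rooted_walks n E k r))) \<longleftrightarrow>
    odd (card {S. S \<subseteq> universe n \<and> ?P (mset_set S) \<and> cf (root_series n E {..<n} r) S = 1})"
  proof (rule parity_of_walks[where Y = Y])
    show "finite (universe n)" by simp
    show "Vert u \<in> universe n" if "u < n" for u using that by (simp add: universe_def)
    show "?P (mset_set (insert (Vert u) S)) = ?P (mset_set S)" if "u \<notin> Y" for S u
    proof (cases "finite S \<and> Vert u \<notin> S")
      case True
      then have "filter_mset (marked Y) (mset_set (insert (Vert u) S)) = filter_mset (marked Y) (mset_set S)"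
        using that by (simp add: marked_def)
      then show ?thesis by (metis selected_filter)
    next
      case False
      then show ?thesis by (auto simp: insert_absorb)
    qed
    show "card (S \<inter> edge_els) \<le> k" if "?P (mset_set S)" for S
    proof (cases "finite S")
      case True
      then show ?thesis using that n_edges_mset_set[OF True] by (simp add: selected_def)
    next
      case False
      \<comment> \<open>\<open>mset_set\<close> of an infinite set is empty, which would force
        \<open>k - 1 = 0\<close>.\<close>
      then show ?thesis using that k by (simp add: selected_def)
    qed
    show "\<exists>S. S \<subseteq> universe n \<and> ?P (mset_set S) \<and> filter_mset (marked Y) m = mset_set S"
      if m: "m \<in> set (rooted_walks n E k r)" "?P m" for m
    proof -
      let ?m = "filter_mset (marked Y) m"
      have "count ?m e \<le> 1" for e
        by (rule rooted_walks_squarefree[OF m(1)])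
          (use m(2) in \<open>unfold selected_def indep_labels_def, blast\<close>)
      then have "?m = mset_set (set_mset ?m)"
        by (intro multiset_eqI) (metis One_nat_def count_mset_set(1,3) count_eq_zero_iff finite_set_mset
            le_Suc_eq le_zero_eq)
      moreover have "set_mset ?m \<subseteq> universe n"
        using rooted_walks_universe[OF m(1)] E_less by auto
      ultimately show ?thesis using m(2) selected_filter[of Y vb H wt k l w m] by metis
    qed
    show "?P m" if "?P (mset_set S)" "filter_mset (marked Y) m = mset_set S" for m S
      using that selected_filter[of Y vb H wt k l w m] by simp
  qed (use Y in auto)
  also have "{S. S \<subseteq> universe n \<and> ?P (mset_set S) \<and> cf (root_series n E {..<n} r) S = 1}
      = {S \<in> root_els r ` root_trees E r. ?P (mset_set S)}"
  proof -
    have "S \<subseteq> universe n" if "S \<in> root_els r ` root_trees E r" for S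
    proof -
      obtain w V A L where t: "(w, V, A, L) \<in> root_trees E r" and S: "S = root_els r (w, V, A, L)"
        using \<open>S \<in> root_els r ` root_trees E r\<close> by (metis imageE prod_cases4)
      have rt: "rtree (without r E) w V A L" "E r w" using t by (auto simp: root_trees_def)
      note less = root_trees_less[OF t]
      have "A \<subseteq> universe n"
        using rtree_edges[OF rt(1)] less(1) edge_in_universe by (metis lessThan_iff subsetD subsetI)
      moreover have "with_root w V L \<subseteq> V"
        using rtree_leaves[OF rt(1)] by (auto simp: with_root_def)
      moreover have "edge r w \<in> universe n"
        using less(2) E_less2[OF rt(2)] by (rule edge_in_universe)
      ultimately show ?thesis
        using less(1) unfolding S root_els_def tree_els_def by (auto simp: universe_def)
    qed
    then show ?thesis unfolding cf_root_series_iff by blast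
  qed
  finally show ?thesis .
qed

section \<open>Detecting independent labels by summing over all sign patterns\<close>

lemma prod_one_minus:
  assumes "finite A"
  shows "(\<Prod>i\<in>A. 1 - f i) = (\<Sum>D\<in>Pow A. (-1) ^ card D * (\<Prod>i\<in>D. f i :: int))"
  using assms
proof (induction A rule: finite_induct)
  case (insert a A)
  have fin: "finite D" if "D \<in> Pow A" for D using that insert.hyps(1) finite_subset by auto
  have "(\<Sum>D\<in>Pow (insert a A). (-1) ^ card D * (\<Prod>i\<in>D. f i))
      = (\<Sum>D\<in>Pow A. (-1) ^ card D * (\<Prod>i\<in>D. f i))
        + (\<Sum>D\<in>insert a ` Pow A. (-1) ^ card D * (\<Prod>i\<in>D. f i))"
    unfolding Pow_insert using insert.hyps by (intro sum.union_disjoint) auto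
  also have "(\<Sum>D\<in>insert a ` Pow A. (-1) ^ card D * (\<Prod>i\<in>D. f i))
      = (\<Sum>D\<in>Pow A. (-1) ^ card (insert a D) * (\<Prod>i\<in>insert a D. f i))"
    using insert.hyps by (subst sum.reindex) (auto simp: inj_on_def intro!: sum.cong)
  also have "\<dots> = (\<Sum>D\<in>Pow A. - f a * ((-1) ^ card D * (\<Prod>i\<in>D. f i)))"
  proof (rule sum.cong[OF refl])
    fix D assume D: "D \<in> Pow A"
    then have "a \<notin> D" using insert.hyps by auto
    then show "(-1) ^ card (insert a D) * (\<Prod>i\<in>insert a D. f i)
        = - f a * ((-1) ^ card D * (\<Prod>i\<in>D. f i))"
      using fin[OF D] by simp
  qed
  also have "\<dots> = - f a * (\<Sum>D\<in>Pow A. (-1) ^ card D * (\<Prod>i\<in>D. f i))"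
    by (rule sum_distrib_left[symmetric])
  finally show ?case
    using insert by (simp add: left_diff_distrib)
qed simp

definition digit :: "nat \<Rightarrow> nat \<Rightarrow> nat" where "digit t j = t div 2 ^ j mod 2"

lemma digit_low: "t < 2 ^ H \<Longrightarrow> digit t H = 0" "t < 2 ^ H \<Longrightarrow> digit (t + 2 ^ H) H = 1"
  "j < H \<Longrightarrow> digit (t + 2 ^ H) j = digit t j"
proof -
  assume "j < H"
  then obtain c where "H = Suc (j + c)" using less_iff_Suc_add by blast
  then have "t + 2 ^ H = t + (2 * 2 ^ c) * 2 ^ j"
    by (simp add: power_add mult.commute mult.left_commute)
  then have "(t + 2 ^ H) div 2 ^ j = 2 * 2 ^ c + t div 2 ^ j"
    by (simp only: div_mult_self1 power_not_zero zero_neq_numeral[symmetric] not_False_eq_True)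
  then show "digit (t + 2 ^ H) j = digit t j" by (simp add: digit_def)
qed (simp_all add: digit_def)

text \<open>Through their binary digits the numbers below \<open>2 ^ H\<close> run over all subsets
  of the factors.\<close>

lemma sum_sign_patterns:
  "(\<Sum>t<2 ^ H. \<Prod>j<H. if digit t j = 1 then s j else 1) = (\<Prod>j<H. 1 + s j :: int)"
proof (induction H)
  case (Suc H)
  let ?f = "\<lambda>H t. \<Prod>j<H. if digit t j = 1 then s j else 1"
  have split: "{..<2 ^ Suc H} = {..<2 ^ H} \<union> (\<lambda>t. t + 2 ^ H) ` {..<2 ^ H :: nat}"
  proof -
    have "t \<in> (\<lambda>t. t + 2 ^ H) ` {..<2 ^ H}" if "t < 2 ^ Suc H" "\<not> t < 2 ^ H" for t :: nat
      using that by (intro image_eqI[of _ _ "t - 2 ^ H"]) auto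
    then show ?thesis by auto
  qed
  have 1: "(\<Sum>t<2 ^ Suc H. ?f (Suc H) t)
      = (\<Sum>t<2 ^ H. ?f (Suc H) t) + (\<Sum>t\<in>(\<lambda>t. t + 2 ^ H) ` {..<2 ^ H}. ?f (Suc H) t)"
    unfolding split by (rule sum.union_disjoint) auto
  have "(\<Sum>t\<in>(\<lambda>t. t + 2 ^ H) ` {..<2 ^ H}. ?f (Suc H) t) = (\<Sum>t<2 ^ H. ?f (Suc H) (t + 2 ^ H))"
    by (subst sum.reindex) (auto simp: inj_on_def)
  also have "\<dots> = (\<Sum>t<2 ^ H. ?f H t * s H)"
    by (rule sum.cong) (auto simp: digit_low intro!: prod.cong)
  also have "\<dots> = (\<Sum>t<2 ^ H. ?f H t) * s H"
    by (rule sum_distrib_right[symmetric])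
  finally have 2: "(\<Sum>t\<in>(\<lambda>t. t + 2 ^ H) ` {..<2 ^ H}. ?f (Suc H) t) = (\<Prod>j<H. 1 + s j) * s H"
    by (simp only: Suc)
  have "(\<Sum>t<2 ^ H. ?f (Suc H) t) = (\<Sum>t<2 ^ H. ?f H t)"
    by (rule sum.cong) (auto simp: digit_low)
  then have 3: "(\<Sum>t<2 ^ H. ?f (Suc H) t) = (\<Prod>j<H. 1 + s j)" by (simp only: Suc)
  show ?case unfolding 1 2 3 by (simp add: distrib_left)
qed simp

text \<open>This is \<open>1 - (-1) ^ b\<close> with \<open>b\<close> the scalar product of the
  label vector and the digits of \<open>t\<close>. Being 0 or 2, it brings no negative numbers into
  the dynamic program.\<close>

definition sign_factor :: "(nat \<times> nat \<Rightarrow> nat \<Rightarrow> bool) \<Rightarrow> nat \<Rightarrow> nat \<Rightarrow> nat \<times> nat \<Rightarrow> nat" where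
  "sign_factor vb H t i = 2 * ((\<Sum>j<H. of_bool (vb i j) * digit t j) mod 2)"

lemma sign_factor_int:
  "int (sign_factor vb H t i)
    = 1 - (\<Prod>j<H. if digit t j = 1 then (if vb i j then -1 else 1) else 1)"
proof -
  have "int (2 * ((\<Sum>j\<in>J. of_bool (vb i j) * digit t j) mod 2))
      = 1 - (\<Prod>j\<in>J. if digit t j = 1 then (if vb i j then -1 else 1) else 1)" if "finite J" for J
    using that
  proof (induction J rule: finite_induct)
    case (insert j J)
    have "digit t j = 0 \<or> digit t j = 1" by (auto simp: digit_def)
    then show ?case
    proof
      assume "digit t j = 1"
      moreover have "2 * int (Suc x mod 2) = 2 - 2 * int (x mod 2)" for x by presburger
      ultimately show ?thesis using insert by auto
    qed (use insert in \<open>cases "vb i j"; simp\<close>)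
  qed simp
  then show ?thesis by (simp add: sign_factor_def)
qed

lemma even_card_filter_sym_diff:
  assumes "finite D" "finite D'"
  shows "even (card {p \<in> sym_diff D D'. P p}) \<longleftrightarrow> (even (card {p \<in> D. P p}) \<longleftrightarrow> even (card {p \<in> D'. P p}))"
proof -
  let ?A = "{p \<in> D. P p}" and ?B = "{p \<in> D'. P p}"
  have "{p \<in> sym_diff D D'. P p} = (?A - ?B) \<union> (?B - ?A)" by auto
  moreover have "card ((?A - ?B) \<union> (?B - ?A)) = card (?A - ?B) + card (?B - ?A)"
    using assms by (intro card_Un_disjoint) auto
  moreover have "card ?A = card (?A - ?B) + card (?A \<inter> ?B)" "card ?B = card (?B - ?A) + card (?A \<inter> ?B)"
    using assms card_Diff_subset_Int[of ?A ?B] card_Diff_subset_Int[of ?B ?A]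
      card_mono[of ?A "?A \<inter> ?B"] card_mono[of ?B "?A \<inter> ?B"]
    by (simp_all add: Int_commute)
  ultimately show ?thesis by auto
qed

lemma count_le_one_imp_distinct: "(\<And>i. count (mset xs) i \<le> 1) \<Longrightarrow> distinct xs"
proof (induction xs)
  case (Cons x xs)
  have "count (mset xs) i \<le> count (mset (x # xs)) i" for i by simp
  then have "count (mset xs) i \<le> 1" for i using Cons.prems[of i] le_trans by blast
  moreover have "count (mset xs) x = 0" using Cons.prems[of x] by simp
  then have "x \<notin> set xs" by (simp add: count_eq_zero_iff)
  ultimately show ?case using Cons.IH by simp
qed simp

text \<open>Expanding the product over subsets \<open>D\<close> and summing over \<open>t\<close>
  leaves, by orthogonality of characters, \<open>2 ^ H\<close> times the signed number of those
  \<open>D\<close> whose vectors sum to 0. These are closed under symmetric difference, so a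
  nonempty one pairs them up, and their number is odd only if the empty set is alone.\<close>

theorem sum_sign_factors:
  "\<exists>Z :: nat. (\<Sum>t<2 ^ H. \<Prod>i\<in>#M. sign_factor vb H t i) = 2 ^ H * Z \<and>
    (odd Z \<longleftrightarrow> indep_labels vb H M)"
proof -
  obtain xs where M: "M = mset xs" using ex_mset by metis
  let ?m = "length xs"
  let ?s = "\<lambda>D j. (\<Prod>p\<in>D. if vb (xs ! p) j then -1 else 1 :: int)"
  \<comment> \<open>Subsets of positions, not of labels, so that a repeated label shows up as a
    dependent pair.\<close>
  define good where "good = {D \<in> Pow {..<?m}. \<forall>j<H. even (card {p \<in> D. vb (xs ! p) j})}"
  define Z where "Z = (\<Sum>D\<in>good. (-1 :: int) ^ card D)"
  have fin: "finite good" by (simp add: good_def)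
  have finD: "D \<in> Pow {..<?m} \<Longrightarrow> finite D" for D using finite_subset by auto
  have s: "?s D j = (-1) ^ card {p \<in> D. vb (xs ! p) j}" if "finite D" for D j
    using that by (simp add: prod.If_cases Int_def)
  have "int (\<Sum>t<2 ^ H. \<Prod>i\<in>#M. sign_factor vb H t i)
      = (\<Sum>t<2 ^ H. \<Prod>p<?m. int (sign_factor vb H t (xs ! p)))"
  proof -
    have "(\<Prod>i\<in>#M. sign_factor vb H t i) = (\<Prod>p<?m. sign_factor vb H t (xs ! p))" for t
      unfolding M mset_map[symmetric] prod_mset_prod_list
      by (simp add: prod.list_conv_set_nth atLeast0LessThan)
    then show ?thesis by simp
  qed
  also have "\<dots> = (\<Sum>t<2 ^ H. \<Sum>D\<in>Pow {..<?m}. (-1) ^ card D *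
      (\<Prod>p\<in>D. \<Prod>j<H. if digit t j = 1 then (if vb (xs ! p) j then -1 else 1) else 1))"
    by (simp add: sign_factor_int prod_one_minus)
  also have "\<dots> = (\<Sum>D\<in>Pow {..<?m}. (-1) ^ card D * (\<Sum>t<2 ^ H.
      (\<Prod>p\<in>D. \<Prod>j<H. if digit t j = 1 then (if vb (xs ! p) j then -1 else 1) else 1)))"
    by (subst sum.swap) (simp add: sum_distrib_left)
  also have "\<dots> = (\<Sum>D\<in>Pow {..<?m}. if D \<in> good then (-1) ^ card D * (2 :: int) ^ H else 0)"
  proof (rule sum.cong[OF refl])
    fix D assume D: "D \<in> Pow {..<?m}"
    have "(\<Prod>p\<in>D. \<Prod>j<H. if digit t j = 1 then (if vb (xs ! p) j then -1 else 1) else 1)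
        = (\<Prod>j<H. if digit t j = 1 then ?s D j else 1)" for t
      by (subst prod.swap) (auto intro!: prod.cong)
    then have "(\<Sum>t<2 ^ H. \<Prod>p\<in>D. \<Prod>j<H. if digit t j = 1 then (if vb (xs ! p) j then -1 else 1) else 1)
        = (\<Prod>j<H. 1 + ?s D j)"
      by (simp only: sum_sign_patterns)
    also have "\<dots> = (if D \<in> good then (2 :: int) ^ H else 0)"
    proof (cases "D \<in> good")
      case True
      then have "?s D j = 1" if "j < H" for j using that s[OF finD[OF D]] by (simp add: good_def)
      then show ?thesis using True by simp
    next
      case False
      then obtain j where "j < H" "odd (card {p \<in> D. vb (xs ! p) j})" using D by (auto simp: good_def)
      then show ?thesis using False s[OF finD[OF D]] by (auto intro!: bexI[of _ j])
    qed
    finally show "(-1) ^ card D * (\<Sum>t<2 ^ H.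
        (\<Prod>p\<in>D. \<Prod>j<H. if digit t j = 1 then (if vb (xs ! p) j then -1 else 1) else 1))
        = (if D \<in> good then (-1) ^ card D * (2 :: int) ^ H else 0)" by simp
  qed
  also have "\<dots> = 2 ^ H * Z"
  proof -
    have "good \<subseteq> Pow {..<?m}" by (auto simp: good_def)
    then have "Pow {..<?m} \<inter> good = good" by blast
    then show ?thesis by (simp add: sum.If_cases Z_def sum_distrib_left mult.commute)
  qed
  finally have eq: "int (\<Sum>t<2 ^ H. \<Prod>i\<in>#M. sign_factor vb H t i) = 2 ^ H * Z" .
  have "0 \<le> Z"
  proof -
    have "0 \<le> 2 ^ H * Z" by (simp only: eq[symmetric] of_nat_0_le_iff)
    then show ?thesis by (simp add: zero_le_mult_iff)
  qed
  moreover have "odd Z \<longleftrightarrow> odd (card good)"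
    unfolding Z_def even_sum_iff[OF fin] by simp
  moreover have "odd (card good) \<longleftrightarrow> good = {{}}"
  proof
    show "good = {{}} \<Longrightarrow> odd (card good)" by simp
    assume odd: "odd (card good)"
    have e: "{} \<in> good" by (simp add: good_def)
    show "good = {{}}"
    proof (rule ccontr)
      assume "good \<noteq> {{}}"
      with e obtain D0 p0 where D0: "D0 \<in> good" "p0 \<in> D0" by blast
      let ?A = "{D \<in> good. p0 \<in> D}" and ?B = "{D \<in> good. p0 \<notin> D}"
      have cl: "sym_diff D D0 \<in> good" if "D \<in> good" for D
      proof -
        have D: "finite D" "finite D0" "D \<subseteq> {..<?m}" "D0 \<subseteq> {..<?m}"
          using that D0(1) finD by (auto simp: good_def)
        have "even (card {p \<in> sym_diff D D0. vb (xs ! p) j})" if "j < H" for j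
          using \<open>D \<in> good\<close> D0(1) that unfolding even_card_filter_sym_diff[OF D(1,2)] good_def by blast
        then show ?thesis using D(3,4) unfolding good_def by blast
      qed
      \<comment> \<open>The symmetric difference with \<open>D0\<close> toggles the membership of
        \<open>p0\<close>, so the family splits into equal halves.\<close>
      have "bij_betw (\<lambda>D. sym_diff D D0) ?A ?B"
        by (rule bij_betw_byWitness[where f' = "\<lambda>D. sym_diff D D0"]) (use cl D0(2) in auto)
      then have "card ?A = card ?B" by (rule bij_betw_same_card)
      moreover have "card good = card ?A + card ?B"
      proof -
        have "good = ?A \<union> ?B" by blast
        then show ?thesis using fin by (metis (no_types, lifting) card_Un_disjoint disjoint_iff
              finite_Un mem_Collect_eq)
      qed
      ultimately show False using odd by simp
    qed
  qed
  moreover have "good = {{}} \<longleftrightarrow> indep_labels vb H M"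
  proof
    assume g: "good = {{}}"
    have cnt: "distinct xs"
    proof (rule ccontr)
      assume "\<not> distinct xs"
      then obtain i j where ij: "i < ?m" "j < ?m" "i \<noteq> j" "xs ! i = xs ! j"
        by (auto simp: distinct_conv_nth)
      have "{p \<in> {i, j}. vb (xs ! p) c} = (if vb (xs ! i) c then {i, j} else {})" for c
        using ij(4) by auto
      then have "{i, j} \<in> good" using ij by (simp add: good_def)
      with g show False by simp
    qed
    have "\<exists>j<H. odd (card {i \<in> D. vb i j})" if D: "D \<subseteq> set xs" "D \<noteq> {}" for D
    proof -
      let ?D = "{p. p < ?m \<and> xs ! p \<in> D}"
      have "?D \<noteq> {}" using D by (auto simp: set_conv_nth)
      then have "?D \<notin> good" using g by simp
      then obtain j where j: "j < H" "odd (card {p \<in> ?D. vb (xs ! p) j})"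
        by (auto simp: good_def)
      have "bij_betw ((!) xs) {p \<in> ?D. vb (xs ! p) j} {i \<in> D. vb i j}"
        unfolding bij_betw_def
      proof
        show "inj_on ((!) xs) {p \<in> ?D. vb (xs ! p) j}"
        proof (rule inj_on_nth[OF cnt], rule ballI)
          fix p assume "p \<in> {p \<in> ?D. vb (xs ! p) j}"
          then show "p < ?m" by blast
        qed
        show "(!) xs ` {p \<in> ?D. vb (xs ! p) j} = {i \<in> D. vb i j}"
        proof (intro equalityI subsetI)
          fix i assume i: "i \<in> {i \<in> D. vb i j}"
          then have "i \<in> set xs" using D(1) by blast
          then obtain p where p: "p < ?m" "xs ! p = i" unfolding in_set_conv_nth by blast
          show "i \<in> (!) xs ` {p \<in> ?D. vb (xs ! p) j}"
            by (rule image_eqI[of _ _ p]) (use i p in simp_all)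
        next
          fix i assume "i \<in> (!) xs ` {p \<in> ?D. vb (xs ! p) j}"
          then show "i \<in> {i \<in> D. vb i j}" by auto
        qed
      qed
      from bij_betw_same_card[OF this] j show ?thesis by (intro exI[of _ j]) simp
    qed
    then show "indep_labels vb H M"
      using cnt unfolding indep_labels_def M set_mset_mset distinct_count_atmost_1
      by auto
  next
    assume ind: "indep_labels vb H M"
    then have dist: "distinct xs"
      unfolding indep_labels_def M by (intro count_le_one_imp_distinct) blast
    have "D = {}" if D: "D \<in> good" for D
    proof (rule ccontr)
      assume "D \<noteq> {}"
      have Dm: "D \<subseteq> {..<?m}" using D by (auto simp: good_def)
      then have "(!) xs ` D \<subseteq> set_mset M" "(!) xs ` D \<noteq> {}" using \<open>D \<noteq> {}\<close> by (auto simp: M)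
      then obtain j where j: "j < H" "odd (card {i \<in> (!) xs ` D. vb i j})"
        using ind unfolding indep_labels_def by blast
      have "bij_betw ((!) xs) {p \<in> D. vb (xs ! p) j} {i \<in> (!) xs ` D. vb i j}"
        unfolding bij_betw_def using Dm by (intro conjI inj_on_nth[OF dist]) auto
      from bij_betw_same_card[OF this] j(2) have "odd (card {p \<in> D. vb (xs ! p) j})" by simp
      then show False using D j(1) by (simp add: good_def)
    qed
    moreover have "{} \<in> good" by (simp add: good_def)
    ultimately show "good = {{}}" by blast
  qed
  moreover have "(\<Sum>t<2 ^ H. \<Prod>i\<in>#M. sign_factor vb H t i) = 2 ^ H * nat Z"
  proof -
    have "int (2 ^ H * nat Z) = 2 ^ H * Z" using \<open>0 \<le> Z\<close> by simp
    then show ?thesis using eq by (metis of_nat_eq_iff)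
  qed
  ultimately show ?thesis by (metis even_nat_iff)
qed

section \<open>Packing the generating polynomial into one number\<close>

text \<open>A mixed radix: the weight is the lowest digit, then come the leaves with place value
  \<open>M1\<close> and the edges with place value \<open>M3\<close>. Vertices contribute nothing,
  since their number is not tested.\<close>

definition pack_exp :: "(nat \<times> nat \<Rightarrow> nat) \<Rightarrow> nat \<Rightarrow> nat \<Rightarrow> el \<Rightarrow> nat" where
  "pack_exp wt M1 M3 e = (case e of Edge a b \<Rightarrow> M3 + wt (a, b) | Vert _ \<Rightarrow> 0 | Lf _ \<Rightarrow> M1)"

definition pack_weight :: "nat set \<Rightarrow> (nat \<times> nat \<Rightarrow> nat \<Rightarrow> bool) \<Rightarrow> nat \<Rightarrow> (nat \<times> nat \<Rightarrow> nat) \<Rightarrow>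
    nat \<Rightarrow> nat \<Rightarrow> nat \<Rightarrow> nat \<Rightarrow> el \<Rightarrow> nat" where
  "pack_weight Y vb H wt B M1 M3 t e
     = 2 ^ (B * pack_exp wt M1 M3 e) * (\<Prod>i\<in>#label Y e. sign_factor vb H t i)"

lemma prod_pack_weight:
  "(\<Prod>e\<in>#m. pack_weight Y vb H wt B M1 M3 t e)
    = 2 ^ (B * (M3 * n_edges m + M1 * n_leaves m + edge_weight wt m))
      * (\<Prod>i\<in>#labels Y m. sign_factor vb H t i)"
proof (induction m)
  case (add e m)
  have "pack_exp wt M1 M3 e + (M3 * n_edges m + M1 * n_leaves m + edge_weight wt m)
      = M3 * n_edges (add_mset e m) + M1 * n_leaves (add_mset e m) + edge_weight wt (add_mset e m)"
    by (cases e) (simp_all add: pack_exp_def n_edges_def n_leaves_def edge_weight_def)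
  then have "2 ^ (B * pack_exp wt M1 M3 e) * 2 ^ (B * (M3 * n_edges m + M1 * n_leaves m + edge_weight wt m))
      = (2 :: nat) ^ (B * (M3 * n_edges (add_mset e m) + M1 * n_leaves (add_mset e m)
          + edge_weight wt (add_mset e m)))"
    by (simp only: power_add[symmetric] distrib_left[symmetric])
  then show ?case
    using add by (simp add: pack_weight_def mult_ac)
qed simp

lemma edge_weight_le: "(\<And>i. wt i \<le> W) \<Longrightarrow> edge_weight wt m \<le> n_edges m * W"
proof (induction m)
  case (add e m)
  then show ?case
    by (cases e) (auto simp: edge_weight_def n_edges_def intro: add_mono)
qed simp

text \<open>The number of walks with at most \<open>k\<close> edges is estimated by evaluating the generating
  function at a small real number.\<close>

lemma walks_val_le:
  fixes n :: nat
  assumes n: "0 < n"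
  defines "h \<equiv> \<lambda>e. case e of Edge _ _ \<Rightarrow> 2 / (16 * real n) | _ \<Rightarrow> 2"
  shows "0 \<le> walks_val n E h i p v \<and> walks_val n E h i p v \<le> 8"
proof (induction i arbitrary: p v)
  case (Suc i)
  let ?t = "\<lambda>w. if E v w \<and> w \<noteq> p then h (edge v w) * walks_val n E h i v w else 0"
  have he: "h (edge a b) = 2 / (16 * real n)" "h (Vert a) = 2" "h (Lf a) = 2" for a b
    by (simp_all add: h_def edge_def)
  have t: "0 \<le> ?t w" "?t w \<le> 1 / real n" for w
  proof -
    show "0 \<le> ?t w" using Suc by (auto simp: he)
    have "2 / (16 * real n) * walks_val n E h i v w \<le> 2 / (16 * real n) * 8"
      by (rule mult_left_mono) (use Suc in auto)
    then show "?t w \<le> 1 / real n" using n by (auto simp: he)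
  qed
  \<comment> \<open>The constants fit together: the product is at most \<open>exp 1 \<le> 3\<close>,
    so the next value is at most \<open>2 * (3 - 1 + 2) = 8\<close>, and 8 times the edge weight
    \<open>2 / (16 * n)\<close> is again \<open>1 / n\<close>.\<close>
  have "(\<Prod>w<n. 1 + ?t w) \<le> (\<Prod>w<n. exp (1 / real n))"
  proof (intro prod_mono conjI)
    fix w
    show "0 \<le> 1 + ?t w" using t(1)[of w] by linarith
    show "1 + ?t w \<le> exp (1 / real n)"
      using t(2)[of w] exp_ge_add_one_self[of "1 / real n"] by linarith
  qed
  also have "\<dots> = exp 1" using n by (simp add: exp_of_nat_mult[symmetric])
  also have "\<dots> \<le> 3" by (rule exp_le)
  finally have "(\<Prod>w<n. 1 + ?t w) \<le> 3" .
  moreover have "1 \<le> (\<Prod>w<n. 1 + ?t w)" by (rule prod_ge_1) (use t in auto)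
  ultimately show ?case by (simp add: fold_val_ring he del: One_nat_def)
qed simp

text \<open>The weight of a walk with fewer than \<open>k\<close> edges is at least its label
  product divided by \<open>(16 * n) ^ (k - 1)\<close>, because the factors 2 in \<open>h\<close>
  outweigh the labels. The total weight is at most 1.\<close>

lemma rooted_walks_bound:
  fixes n :: nat
  assumes n: "0 < n" and lab: "\<And>i. g i \<le> (2 :: nat)"
  shows "(\<Sum>m\<leftarrow>filter (\<lambda>m. n_edges m < k) (rooted_walks n E i r). \<Prod>i\<in>#labels Y m. g i) \<le> (16 * n) ^ (k - 1)"
proof -
  define h where "h = (\<lambda>e. case e of Edge _ _ \<Rightarrow> 2 / (16 * real n) | _ \<Rightarrow> 2)"
  have h0: "0 \<le> h e" for e by (auto simp: h_def split: el.split)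
  have "evalm h (rooted_walks n E i r) \<le> (\<Sum>w<n. 1 / real n)"
    unfolding evalm_rooted_walks rooted_val_def
  proof (rule sum_mono)
    fix w
    have "2 / (16 * real n) * walks_val n (without r E) h i r w \<le> 2 / (16 * real n) * 8"
      by (rule mult_left_mono) (use walks_val_le[OF n] in \<open>auto simp: h_def\<close>)
    then show "(if E r w then h (edge r w) * walks_val n (without r E) h i r w else 0) \<le> 1 / real n"
      using n by (auto simp: h_def edge_def)
  qed
  also have "\<dots> = 1" using n by simp
  finally have total: "evalm h (rooted_walks n E i r) \<le> 1" .
  have lab_le: "real (\<Prod>i\<in>#labels Y m. g i) \<le> (\<Prod>e\<in>#m. h e) * real (16 * n) ^ n_edges m" for m
  proof (induction m)
    case (add e m)
    have "real (\<Prod>i\<in>#label Y e. g i) \<le> h e * (if e \<in> edge_els then real (16 * n) else 1)"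
    proof (cases e)
      case (Edge a b)
      then have "e \<in> edge_els" unfolding edge_els_def by (intro range_eqI[of _ _ "(a, b)"]) simp
      then show ?thesis using Edge lab[of "(a, b)"] n by (auto simp: label_def h_def)
    next
      case (Vert v)
      then have "e \<notin> edge_els" by (auto simp: edge_els_def)
      then show ?thesis using Vert lab[of "(v, v)"] by (auto simp: label_def h_def)
    next
      case (Lf v)
      then have "e \<notin> edge_els" by (auto simp: edge_els_def)
      then show ?thesis using Lf lab[of "(v, v)"] by (auto simp: label_def h_def)
    qed
    moreover have "real (16 * n) ^ n_edges (add_mset e m)
        = (if e \<in> edge_els then real (16 * n) else 1) * real (16 * n) ^ n_edges m"
    proof (cases e)
      case (Edge a b)
      then have "e \<in> edge_els" unfolding edge_els_def by (intro range_eqI[of _ _ "(a, b)"]) simp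
      then show ?thesis using Edge by (simp add: n_edges_def)
    qed (auto simp: edge_els_def)
    moreover have "real (\<Prod>i\<in>#labels Y (add_mset e m). g i)
        = real (\<Prod>i\<in>#label Y e. g i) * real (\<Prod>i\<in>#labels Y m. g i)" by simp
    ultimately show ?case
      using mult_mono[OF _ add, of "real (\<Prod>i\<in>#label Y e. g i)" "h e * (if e \<in> edge_els then real (16 * n) else 1)"]
        h0[of e] by (simp add: mult_ac)
  qed simp
  have "real (\<Sum>m\<leftarrow>filter (\<lambda>m. n_edges m < k) A. \<Prod>i\<in>#labels Y m. g i)
      \<le> evalm h A * real (16 * n) ^ (k - 1)" for A
  proof (induction A)
    case (Cons m A)
    have p0: "0 \<le> (\<Prod>e\<in>#m. h e)" by (induction m) (auto intro: mult_nonneg_nonneg h0)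
    show ?case
    proof (cases "n_edges m < k")
      case True
      have "real (\<Prod>i\<in>#labels Y m. g i) \<le> (\<Prod>e\<in>#m. h e) * real (16 * n) ^ n_edges m" by (rule lab_le)
      also have "\<dots> \<le> (\<Prod>e\<in>#m. h e) * real (16 * n) ^ (k - 1)"
        using True n p0 by (intro mult_left_mono power_increasing) auto
      finally show ?thesis using Cons True by (simp add: distrib_right)
    next
      case False
      then show ?thesis using Cons p0 by (simp add: distrib_right add_increasing)
    qed
  qed simp
  from order_trans[OF this[of "rooted_walks n E i r"] mult_right_mono[OF total, of "real (16 * n) ^ (k - 1)"]]
  have "real (\<Sum>m\<leftarrow>filter (\<lambda>m. n_edges m < k) (rooted_walks n E i r). \<Prod>i\<in>#labels Y m. g i)
      \<le> real ((16 * n) ^ (k - 1))" by simp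
  then show ?thesis by (simp only: of_nat_le_iff)
qed

lemma sum_sum_list_swap:
  "(\<Sum>t\<in>T. \<Sum>m\<leftarrow>A. f t m) = (\<Sum>m\<leftarrow>A. \<Sum>t\<in>T. f t m :: nat)"
  by (induction A) (simp_all add: sum.distrib)

lemma sum_list_filter3:
  fixes f :: "'a \<Rightarrow> nat" and g :: "'a \<Rightarrow> nat"
  shows "(\<Sum>m\<leftarrow>A. f m) = (\<Sum>m\<leftarrow>filter (\<lambda>m. g m < j) A. f m) + (\<Sum>m\<leftarrow>filter (\<lambda>m. g m = j) A. f m)
    + (\<Sum>m\<leftarrow>filter (\<lambda>m. g m > j) A. f m)"
  by (induction A) (auto simp: neq_iff)

text \<open>Terms below \<open>j\<close> sum to less than \<open>2 ^ (B * j)\<close>. Terms above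
  are multiples of \<open>2 ^ (B * (j + 1))\<close> and stay even after the division because
  \<open>H < B\<close>. So only the lower terms need a size bound; overflow of higher blocks is
  harmless.\<close>

lemma sum_list_digit:
  fixes g :: "'a \<Rightarrow> nat" and Z :: "'a \<Rightarrow> nat"
  assumes small: "(\<Sum>m\<leftarrow>filter (\<lambda>m. g m < j) A. 2 ^ H * Z m) < 2 ^ B" and HB: "H < B"
  shows "odd ((\<Sum>m\<leftarrow>A. 2 ^ (B * g m) * (2 ^ H * Z m)) div 2 ^ (B * j + H)) \<longleftrightarrow>
    odd (length (filter (\<lambda>m. g m = j \<and> odd (Z m)) A))"
proof -
  let ?f = "\<lambda>m. 2 ^ (B * g m) * (2 ^ H * Z m)"
  let ?lo = "\<Sum>m\<leftarrow>filter (\<lambda>m. g m < j) A. ?f m" and ?mid = "\<Sum>m\<leftarrow>filter (\<lambda>m. g m = j) A. Z m"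
  have "?lo * 2 ^ B \<le> 2 ^ (B * j) * (\<Sum>m\<leftarrow>filter (\<lambda>m. g m < j) A. 2 ^ H * Z m)"
  proof (induction A)
    case (Cons m A)
    have "2 ^ (B * g m) * 2 ^ B \<le> (2 :: nat) ^ (B * j)" if "g m < j"
    proof -
      have "B * g m + B = B * Suc (g m)" by simp
      also have "\<dots> \<le> B * j" using that by (intro mult_le_mono) auto
      finally show ?thesis unfolding power_add[symmetric] by (intro power_increasing) auto
    qed
    then have "?f m * 2 ^ B \<le> 2 ^ (B * j) * (2 ^ H * Z m)" if "g m < j"
      using that mult_le_mono1[of "2 ^ (B * g m) * 2 ^ B" "2 ^ (B * j)" "2 ^ H * Z m"]
      by (simp add: mult_ac)
    then show ?case using Cons by (auto simp: distrib_right distrib_left intro: add_mono)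
  qed simp
  also have "\<dots> < 2 ^ (B * j) * 2 ^ B" using small by simp
  finally have lo: "?lo < 2 ^ (B * j)" by simp
  have mid: "(\<Sum>m\<leftarrow>filter (\<lambda>m. g m = j) A. ?f m) = 2 ^ (B * j) * (2 ^ H * ?mid)"
    by (induction A) (auto simp: distrib_left)
  have "\<exists>X. (\<Sum>m\<leftarrow>filter (\<lambda>m. g m > j) A. ?f m) = 2 ^ (B * j) * (2 ^ B * X)"
  proof (induction A)
    case (Cons m A)
    then obtain X where X: "(\<Sum>m\<leftarrow>filter (\<lambda>m. g m > j) A. ?f m) = 2 ^ (B * j) * (2 ^ B * X)" by blast
    show ?case
    proof (cases "g m > j")
      case True
      then obtain c where "g m = Suc (j + c)" using less_iff_Suc_add by blast
      then have "?f m = 2 ^ (B * j) * (2 ^ B * (2 ^ (B * c) * (2 ^ H * Z m)))"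
        by (simp add: power_add distrib_left mult_ac)
      then show ?thesis using X True
        by (intro exI[of _ "2 ^ (B * c) * (2 ^ H * Z m) + X"]) (simp add: distrib_left)
    next
      case False
      then show ?thesis using X by auto
    qed
  qed simp
  then obtain X where hi: "(\<Sum>m\<leftarrow>filter (\<lambda>m. g m > j) A. ?f m) = 2 ^ (B * j) * (2 ^ B * X)" by blast
  obtain c where c: "B = Suc (H + c)" using HB less_iff_Suc_add by blast
  have "(\<Sum>m\<leftarrow>A. ?f m) = ?lo + 2 ^ (B * j) * (2 ^ H * ?mid) + 2 ^ (B * j) * (2 ^ B * X)"
    unfolding sum_list_filter3[of ?f A g j] mid hi ..
  also have "\<dots> = ?lo + (2 ^ H * (?mid + 2 * 2 ^ c * X)) * 2 ^ (B * j)"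
    by (simp add: c power_add distrib_left mult_ac)
  finally have "(\<Sum>m\<leftarrow>A. ?f m) div 2 ^ (B * j) = 2 ^ H * (?mid + 2 * 2 ^ c * X)"
    using lo by (simp only: div_mult_self1 power_not_zero div_less add_0_right) simp
  then have "(\<Sum>m\<leftarrow>A. ?f m) div 2 ^ (B * j + H) = ?mid + 2 * 2 ^ c * X"
    by (simp only: power_add div_mult2_eq) simp
  then have "odd ((\<Sum>m\<leftarrow>A. ?f m) div 2 ^ (B * j + H)) \<longleftrightarrow> odd ?mid" by simp
  also have "odd ?mid \<longleftrightarrow> odd (length (filter (\<lambda>m. g m = j \<and> odd (Z m)) A))"
    by (induction A) auto
  finally show ?thesis .
qed

definition packed_total :: "nat \<Rightarrow> (nat \<Rightarrow> nat \<Rightarrow> bool) \<Rightarrow> nat set \<Rightarrow> (nat \<times> nat \<Rightarrow> nat \<Rightarrow> bool) \<Rightarrow> nat \<Rightarrow>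
    (nat \<times> nat \<Rightarrow> nat) \<Rightarrow> nat \<Rightarrow> nat \<Rightarrow> nat \<Rightarrow> nat \<Rightarrow> nat \<Rightarrow> nat" where
  "packed_total n E Y vb H wt B M1 M3 k r
     = (\<Sum>t<2 ^ H. rooted_val n E (pack_weight Y vb H wt B M1 M3 t) k r)"

text \<open>As edges are the leading digit, every walk at or below the target exponent has fewer
  than \<open>k\<close> edges. For these the weight and the number of leaves stay below their place
  values, so the exponent can be decoded, and \<open>rooted_walks_bound\<close> shows that blocks of
  \<open>B\<close> bits are wide enough.\<close>

theorem odd_digit_packed_total:
  assumes k: "2 \<le> k" "k \<le> n" and l: "l \<le> n" and w: "w < M1" and wt: "\<And>i. wt i < Q"
    and M1: "M1 = n * Q" and M3: "M3 = M1 * (n + 1)" and H: "H \<le> n + 2" and B: "B = (n + 4)\<^sup>2"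
  shows "odd (packed_total n E Y vb H wt B M1 M3 k r div 2 ^ (B * (M3 * (k - 1) + M1 * (l - 1) + w) + H))
    \<longleftrightarrow> odd (length (filter (selected Y vb H wt k l w) (rooted_walks n E k r)))"
proof -
  let ?A = "rooted_walks n E k r"
  let ?g = "\<lambda>m. M3 * n_edges m + M1 * n_leaves m + edge_weight wt m"
  let ?j = "M3 * (k - 1) + M1 * (l - 1) + w"
  obtain Z where Z: "\<And>m. (\<Sum>t<2 ^ H. \<Prod>i\<in>#labels Y m. sign_factor vb H t i) = 2 ^ H * Z m"
    "\<And>m. odd (Z m) \<longleftrightarrow> indep_labels vb H (labels Y m)"
  proof -
    have "\<forall>m. \<exists>Z. (\<Sum>t<2 ^ H. \<Prod>i\<in>#labels Y m. sign_factor vb H t i) = 2 ^ H * Z \<and>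
        (odd Z \<longleftrightarrow> indep_labels vb H (labels Y m))"
      using sum_sign_factors by blast
    from choice[OF this] show ?thesis using that by blast
  qed
  have "packed_total n E Y vb H wt B M1 M3 k r
      = (\<Sum>t<2 ^ H. \<Sum>m\<leftarrow>?A. 2 ^ (B * ?g m) * (\<Prod>i\<in>#labels Y m. sign_factor vb H t i))"
    unfolding packed_total_def evalm_rooted_walks[symmetric] evalm_def prod_pack_weight ..
  also have "\<dots> = (\<Sum>m\<leftarrow>?A. 2 ^ (B * ?g m) * (2 ^ H * Z m))"
    unfolding Z(1)[symmetric] sum_distrib_left by (rule sum_sum_list_swap)
  finally have total: "packed_total n E Y vb H wt B M1 M3 k r = (\<Sum>m\<leftarrow>?A. 2 ^ (B * ?g m) * (2 ^ H * Z m))" .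
  have M1pos: "0 < M1" using w by simp
  have M3pos: "0 < M3" using M1pos M3 by simp
  have j_less: "?j < M3 * k"
  proof -
    have "M1 * (l - 1) + w < M1 * (l - 1) + M1" using w by simp
    also have "\<dots> = M1 * (l - 1 + 1)" by simp
    also have "\<dots> \<le> M3" unfolding M3 using l by (intro mult_le_mono) auto
    finally have "?j < M3 * (k - 1) + M3" by simp
    also have "\<dots> = M3 * k" using k by (metis Suc_1 Suc_leD add.commute le_add_diff_inverse mult_Suc_right plus_1_eq_Suc)
    finally show ?thesis .
  qed
  have few: "n_edges m < k" if "?g m < M3 * k" for m
  proof -
    have "M3 * n_edges m < M3 * k" using that by linarith
    then show ?thesis by simp
  qed
  have dec: "?g m = ?j \<longleftrightarrow> n_edges m = k - 1 \<and> n_leaves m = l - 1 \<and> edge_weight wt m = w"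
    if m: "m \<in> set ?A" for m
  proof
    assume eq: "?g m = ?j"
    then have e: "n_edges m < k" using few j_less by metis
    have z: "n_leaves m \<le> n_edges m" by (rule rooted_walks_n_leaves[OF m])
    have ew: "edge_weight wt m < M1"
    proof -
      have "0 < Q" using wt[of "(0, 0)"] by simp
      have "edge_weight wt m \<le> n_edges m * (Q - 1)"
        by (rule edge_weight_le) (use wt in \<open>simp add: Suc_leI less_imp_le_nat le_diff_conv2 \<open>0 < Q\<close> Suc_le_eq\<close>)
      also have "\<dots> \<le> n * (Q - 1)" using e k(2) by (intro mult_le_mono1) auto
      also have "\<dots> < n * Q" using k \<open>0 < Q\<close> by simp
      finally show ?thesis by (simp add: M1)
    qed
    have r1: "M1 * n_leaves m + edge_weight wt m < M3"
    proof -
      have "M1 * n_leaves m + edge_weight wt m < M1 * (n_leaves m + 1)" using ew by simp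
      also have "\<dots> \<le> M3" unfolding M3 using z e k by (intro mult_le_mono) auto
      finally show ?thesis .
    qed
    have r2: "M1 * (l - 1) + w < M3"
    proof -
      have "M1 * (l - 1) + w < M1 * (l - 1 + 1)" using w by simp
      also have "\<dots> \<le> M3" unfolding M3 using l by (intro mult_le_mono) auto
      finally show ?thesis .
    qed
    have "(M1 * n_leaves m + edge_weight wt m + n_edges m * M3) div M3
        = (M1 * (l - 1) + w + (k - 1) * M3) div M3" using eq by (simp add: ac_simps)
    then have e: "n_edges m = k - 1" using r1 r2 M3pos by simp
    then have "edge_weight wt m + n_leaves m * M1 = w + (l - 1) * M1" using eq by (simp add: ac_simps)
    moreover from this have "(edge_weight wt m + n_leaves m * M1) div M1 = (w + (l - 1) * M1) div M1" by simp
    then have "n_leaves m = l - 1" using w ew M1pos by simp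
    ultimately show "n_edges m = k - 1 \<and> n_leaves m = l - 1 \<and> edge_weight wt m = w" using e by simp
  qed simp
  have small: "(\<Sum>m\<leftarrow>filter (\<lambda>m. ?g m < ?j) ?A. 2 ^ H * Z m) < 2 ^ B"
  proof -
    have npos: "0 < n" using k by simp
    have "(\<Sum>m\<leftarrow>filter (\<lambda>m. ?g m < ?j) ?A. 2 ^ H * Z m) \<le> (\<Sum>m\<leftarrow>filter (\<lambda>m. n_edges m < k) ?A. 2 ^ H * Z m)"
    proof -
      have "(\<Sum>m\<leftarrow>filter (\<lambda>m. ?g m < ?j) A. 2 ^ H * Z m) \<le> (\<Sum>m\<leftarrow>filter (\<lambda>m. n_edges m < k) A. 2 ^ H * Z m)" for A
      proof (induction A)
        case (Cons m A)
        have "?g m < ?j \<Longrightarrow> n_edges m < k" using few[of m] j_less by linarith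
        then show ?case using Cons by auto
      qed simp
      then show ?thesis .
    qed
    also have "\<dots> = (\<Sum>t<2 ^ H. \<Sum>m\<leftarrow>filter (\<lambda>m. n_edges m < k) ?A. \<Prod>i\<in>#labels Y m. sign_factor vb H t i)"
      unfolding Z(1)[symmetric] by (rule sum_sum_list_swap[symmetric])
    also have "\<dots> \<le> (\<Sum>t<(2 :: nat) ^ H. (16 * n) ^ (k - 1))"
      by (intro sum_mono rooted_walks_bound[OF npos]) (auto simp: sign_factor_def)
    also have "\<dots> = 2 ^ H * (16 * n) ^ (k - 1)" by simp
    \<comment> \<open>The factor \<open>16 * n\<close> costs at most \<open>n + 4\<close> bits per
      edge; this is where the 4 in \<open>B\<close> comes from.\<close>
    also have "\<dots> \<le> 2 ^ H * (2 ^ (n + 4)) ^ (k - 1)"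
    proof (intro mult_le_mono2 power_mono)
      have "n \<le> 2 ^ n" by (rule less_imp_le[OF less_exp])
      then show "16 * n \<le> 2 ^ (n + 4)" by (simp add: power_add)
    qed simp
    also have "\<dots> = 2 ^ (H + (n + 4) * (k - 1))" by (simp add: power_add power_mult)
    also have "\<dots> < 2 ^ B"
    proof (rule power_strict_increasing)
      have "H + (n + 4) * (k - 1) \<le> n + 2 + (n + 4) * n" using H k by (intro add_mono mult_le_mono) auto
      also have "\<dots> < B" by (simp add: B power2_eq_square algebra_simps)
      finally show "H + (n + 4) * (k - 1) < B" .
    qed simp
    finally show ?thesis .
  qed
  have HB: "H < B"
  proof -
    have "n + 2 < (n + 4)\<^sup>2" by (simp add: power2_eq_square algebra_simps)
    then show ?thesis using H B by simp
  qed
  have "filter (\<lambda>m. ?g m = ?j \<and> odd (Z m)) ?A = filter (selected Y vb H wt k l w) ?A"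
    by (rule filter_cong[OF refl]) (use dec Z(2) in \<open>auto simp: selected_def\<close>)
  with sum_list_digit[OF small HB] show ?thesis unfolding total by simp
qed

text \<open>The packed total may therefore be computed modulo \<open>2 ^ N\<close> as long as the
  digits read lie below position \<open>N\<close>.\<close>

lemma odd_mod_div:
  assumes "s < N"
  shows "odd (x mod 2 ^ N div 2 ^ s) \<longleftrightarrow> odd (x div 2 ^ s :: nat)"
  using assms by (simp add: bit_take_bit_iff flip: bit_iff_odd take_bit_eq_mod)

section \<open>Random labels and weights\<close>

text \<open>If the coins outside \<open>blk\<close> determine the outcomes in \<open>\<B>\<close>,
  these are at most one in \<open>2 ^ card blk\<close> of all. An outcome is the set of coins
  showing heads, and probabilities are handled as cardinalities.\<close>

lemma card_inj_on_Diff: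
  assumes "finite P" "blk \<subseteq> P" "\<B> \<subseteq> Pow P" "inj_on (\<lambda>\<omega>. \<omega> - blk) \<B>"
  shows "card \<B> * 2 ^ card blk \<le> 2 ^ card P"
proof -
  have "card \<B> = card ((\<lambda>\<omega>. \<omega> - blk) ` \<B>)" using assms(4) by (simp add: card_image)
  also have "\<dots> \<le> card (Pow (P - blk))" using assms(1,3) by (intro card_mono) auto
  also have "\<dots> = 2 ^ (card P - card blk)"
    using assms(1,2) by (simp add: card_Pow card_Diff_subset finite_subset)
  finally have "card \<B> * 2 ^ card blk \<le> 2 ^ (card P - card blk) * 2 ^ card blk" by (rule mult_le_mono1)
  also have "\<dots> = 2 ^ card P"
    using card_mono[OF assms(1,2)] by (simp add: power_add[symmetric])
  finally show ?thesis .
qed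

definition bit_block :: "('i \<Rightarrow> nat \<Rightarrow> nat) \<Rightarrow> nat \<Rightarrow> 'i \<Rightarrow> nat set" where
  "bit_block pos q i = pos i ` {..<q}"

definition block_value :: "('i \<Rightarrow> nat \<Rightarrow> nat) \<Rightarrow> nat \<Rightarrow> nat set \<Rightarrow> 'i \<Rightarrow> nat" where
  "block_value pos q \<omega> i = (\<Sum>s<q. of_bool (pos i s \<in> \<omega>) * 2 ^ s)"

lemma block_value_less: "block_value pos q \<omega> i < 2 ^ q"
proof (induction q)
  case (Suc q)
  have "block_value pos (Suc q) \<omega> i \<le> block_value pos q \<omega> i + 2 ^ q" by (simp add: block_value_def)
  with Suc show ?case by simp
qed (simp add: block_value_def)

lemma block_value_inj:
  "block_value pos q \<omega> i = block_value pos q \<omega>' i \<Longrightarrow> s < q \<Longrightarrow> pos i s \<in> \<omega> \<longleftrightarrow> pos i s \<in> \<omega>'"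
proof (induction q)
  case (Suc q)
  have *: "block_value pos (Suc q) \<omega> i = block_value pos q \<omega> i + of_bool (pos i q \<in> \<omega>) * 2 ^ q" for \<omega>
    by (simp add: block_value_def)
  have "block_value pos q \<omega> i < 2 ^ q" "block_value pos q \<omega>' i < 2 ^ q" by (rule block_value_less)+
  with Suc.prems(1)[unfolded *] have "pos i q \<in> \<omega> \<longleftrightarrow> pos i q \<in> \<omega>'"
    by (auto simp: of_bool_def split: if_splits)
  moreover from this have "block_value pos q \<omega> i = block_value pos q \<omega>' i"
    using Suc.prems(1)[unfolded *] by simp
  ultimately show ?case using Suc by (auto simp: less_Suc_eq)
qed simp

locale bit_blocks =
  fixes P :: "nat set" and U :: "'i set" and pos :: "'i \<Rightarrow> nat \<Rightarrow> nat" and q :: nat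
  assumes fin: "finite P" "finite U"
    and pos_in: "i \<in> U \<Longrightarrow> s < q \<Longrightarrow> pos i s \<in> P"
    and pos_inj: "i \<in> U \<Longrightarrow> i' \<in> U \<Longrightarrow> s < q \<Longrightarrow> s' < q \<Longrightarrow> pos i s = pos i' s' \<Longrightarrow> i = i' \<and> s = s'"
begin

lemma block: "i \<in> U \<Longrightarrow> bit_block pos q i \<subseteq> P" "i \<in> U \<Longrightarrow> card (bit_block pos q i) = q"
  using pos_in pos_inj by (auto simp: bit_block_def card_image inj_on_def)

lemma eq_off_block:
  assumes "\<omega> - bit_block pos q i = \<omega>' - bit_block pos q i" "i \<in> U" "i' \<in> U" "i' \<noteq> i" "s < q"
  shows "pos i' s \<in> \<omega> \<longleftrightarrow> pos i' s \<in> \<omega>'"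
proof -
  have "pos i' s \<notin> bit_block pos q i"
    using pos_inj assms(2-5) by (auto simp: bit_block_def)
  then show ?thesis using assms(1) by blast
qed

lemma eqI:
  assumes "\<omega> - bit_block pos q i = \<omega>' - bit_block pos q i"
    and "\<And>s. s < q \<Longrightarrow> pos i s \<in> \<omega> \<longleftrightarrow> pos i s \<in> \<omega>'"
  shows "\<omega> = \<omega>'"
  using assms by (auto simp: bit_block_def)

text \<open>The isolation lemma: if the element \<open>i\<close> lies in one but not in another set of minimal weight,
  then its weight is determined by the weights of the other elements.\<close>

definition ambiguous :: "'i set set \<Rightarrow> 'i \<Rightarrow> nat set set" where
  "ambiguous \<F> i = {\<omega> \<in> Pow P. \<exists>A\<in>\<F>. \<exists>B\<in>\<F>. i \<in> A \<and> i \<notin> B \<and>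
     (\<Sum>j\<in>A. block_value pos q \<omega> j) = (\<Sum>j\<in>B. block_value pos q \<omega> j) \<and>
     (\<forall>C\<in>\<F>. (\<Sum>j\<in>A. block_value pos q \<omega> j) \<le> (\<Sum>j\<in>C. block_value pos q \<omega> j))}"

lemma ambiguousI:
  "\<omega> \<in> Pow P \<Longrightarrow> A \<in> \<F> \<Longrightarrow> B \<in> \<F> \<Longrightarrow> i \<in> A \<Longrightarrow> i \<notin> B \<Longrightarrow>
    (\<Sum>j\<in>A. block_value pos q \<omega> j) = (\<Sum>j\<in>B. block_value pos q \<omega> j) \<Longrightarrow>
    (\<And>C. C \<in> \<F> \<Longrightarrow> (\<Sum>j\<in>A. block_value pos q \<omega> j) \<le> (\<Sum>j\<in>C. block_value pos q \<omega> j)) \<Longrightarrow>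
    \<omega> \<in> ambiguous \<F> i"
  unfolding ambiguous_def by blast

lemma card_ambiguous:
  assumes "\<F> \<subseteq> Pow U" "i \<in> U" shows "card (ambiguous \<F> i) * 2 ^ q \<le> 2 ^ card P"
proof -
  let ?v = "block_value pos q"
  have no_less: False
    if \<omega>: "\<omega> \<in> ambiguous \<F> i" "\<omega>' \<in> ambiguous \<F> i"
      and eq: "\<omega> - bit_block pos q i = \<omega>' - bit_block pos q i" and less: "?v \<omega> i < ?v \<omega>' i" for \<omega> \<omega>'
  proof -
    have v: "?v \<omega> j = ?v \<omega>' j" if "j \<in> U" "j \<noteq> i" for j
      unfolding block_value_def using eq_off_block[OF eq assms(2) that] by simp
    have out: "(\<Sum>j\<in>C. ?v \<omega> j) = (\<Sum>j\<in>C. ?v \<omega>' j)" if "C \<in> \<F>" "i \<notin> C" for C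
      using that assms(1) v by (intro sum.cong) auto
    have ins: "(\<Sum>j\<in>C. ?v \<omega> j) < (\<Sum>j\<in>C. ?v \<omega>' j)" if C: "C \<in> \<F>" "i \<in> C" for C
    proof -
      have "C \<subseteq> U" using C assms(1) by blast
      then have "finite C" using fin(2) by (rule finite_subset)
      moreover have "(\<Sum>j\<in>C - {i}. ?v \<omega> j) = (\<Sum>j\<in>C - {i}. ?v \<omega>' j)"
        using C assms(1) v by (intro sum.cong) auto
      ultimately show ?thesis using less C(2) by (simp add: sum.remove[of C i])
    qed
    obtain A B where AB: "A \<in> \<F>" "B \<in> \<F>" "i \<in> A" "i \<notin> B" "(\<Sum>j\<in>A. ?v \<omega> j) = (\<Sum>j\<in>B. ?v \<omega> j)"
      "\<And>C. C \<in> \<F> \<Longrightarrow> (\<Sum>j\<in>A. ?v \<omega> j) \<le> (\<Sum>j\<in>C. ?v \<omega> j)" using \<omega>(1) by (auto simp: ambiguous_def)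
    obtain A' B' where AB': "A' \<in> \<F>" "B' \<in> \<F>" "i \<in> A'" "i \<notin> B'" "(\<Sum>j\<in>A'. ?v \<omega>' j) = (\<Sum>j\<in>B'. ?v \<omega>' j)"
      "\<And>C. C \<in> \<F> \<Longrightarrow> (\<Sum>j\<in>A'. ?v \<omega>' j) \<le> (\<Sum>j\<in>C. ?v \<omega>' j)" using \<omega>(2) by (auto simp: ambiguous_def)
    \<comment> \<open>Raising the weight of \<open>i\<close> alone makes all sets containing
      \<open>i\<close> heavier and no others. Afterwards \<open>B\<close>, which was tied for the
      minimum, is lighter than every set containing \<open>i\<close>.\<close>
    show False
      using AB(5) AB(6)[OF AB'(1)] ins[OF AB'(1,3)] AB'(6)[OF AB(2)] out[OF AB(2,4)] by linarith
  qed
  have "inj_on (\<lambda>\<omega>. \<omega> - bit_block pos q i) (ambiguous \<F> i)"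
  proof (rule inj_onI)
    fix \<omega> \<omega>' assume \<omega>: "\<omega> \<in> ambiguous \<F> i" "\<omega>' \<in> ambiguous \<F> i"
      and eq: "\<omega> - bit_block pos q i = \<omega>' - bit_block pos q i"
    have "?v \<omega> i = ?v \<omega>' i"
    proof (cases "?v \<omega> i" "?v \<omega>' i" rule: linorder_cases)
      case less
      then show ?thesis using no_less[OF \<omega> eq] by simp
    next
      case greater
      then show ?thesis using no_less[OF \<omega>(2,1) eq[symmetric]] by simp
    qed
    then show "\<omega> = \<omega>'" by (intro eqI[OF eq] block_value_inj)
  qed
  with card_inj_on_Diff[OF fin(1) block(1)[OF assms(2)], of "ambiguous \<F> i"] block(2)[OF assms(2)]
  show ?thesis by (auto simp: ambiguous_def)
qed

text \<open>Two different sets of minimal weight differ in some element, which is then ambiguous. A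
  union bound over the at most \<open>2 ^ q / 2\<close> elements leaves probability 1/2.\<close>

theorem isolation:
  assumes \<F>: "\<F> \<subseteq> Pow U" "\<F> \<noteq> {}" and q: "2 * card U \<le> 2 ^ q"
  shows "2 ^ card P \<le> 2 * card {\<omega> \<in> Pow P. \<exists>A\<in>\<F>. \<forall>C\<in>\<F>. C \<noteq> A \<longrightarrow>
    (\<Sum>j\<in>A. block_value pos q \<omega> j) < (\<Sum>j\<in>C. block_value pos q \<omega> j)}"
proof -
  let ?w = "\<lambda>\<omega> A. \<Sum>j\<in>A. block_value pos q \<omega> j"
  let ?G = "{\<omega> \<in> Pow P. \<exists>A\<in>\<F>. \<forall>C\<in>\<F>. C \<noteq> A \<longrightarrow> ?w \<omega> A < ?w \<omega> C}"
  have "Pow P \<subseteq> ?G \<union> (\<Union>i\<in>U. ambiguous \<F> i)"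
  proof
    fix \<omega> assume \<omega>: "\<omega> \<in> Pow P"
    obtain A where A: "A \<in> \<F>" "\<And>C. C \<in> \<F> \<Longrightarrow> ?w \<omega> A \<le> ?w \<omega> C"
      using ex_has_least_nat[of "\<lambda>A. A \<in> \<F>" _ "?w \<omega>"] \<F>(2) by blast
    show "\<omega> \<in> ?G \<union> (\<Union>i\<in>U. ambiguous \<F> i)"
    proof (cases "\<exists>C\<in>\<F>. C \<noteq> A \<and> ?w \<omega> C = ?w \<omega> A")
      case True
      then obtain C where C: "C \<in> \<F>" "C \<noteq> A" "?w \<omega> C = ?w \<omega> A" by blast
      from C(2) consider i where "i \<in> A" "i \<notin> C" | i where "i \<in> C" "i \<notin> A" by blast
      then have "\<exists>i\<in>U. \<omega> \<in> ambiguous \<F> i"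
      proof cases
        case 1
        then have "\<omega> \<in> ambiguous \<F> i" using A C by (intro ambiguousI[OF \<omega>, of A _ C]) simp_all
        then show ?thesis using 1(1) A(1) \<F>(1) by blast
      next
        case 2
        then have "\<omega> \<in> ambiguous \<F> i" using A C by (intro ambiguousI[OF \<omega>, of C _ A]) simp_all
        then show ?thesis using 2(1) C(1) \<F>(1) by blast
      qed
      then show ?thesis by blast
    next
      case False
      have "?w \<omega> A < ?w \<omega> C" if "C \<in> \<F>" "C \<noteq> A" for C
        using A(2)[OF that(1)] False that by (intro le_neq_implies_less) auto
      then have "\<omega> \<in> ?G" using \<omega> A(1) by blast
      then show ?thesis by blast
    qed
  qed
  then have "card (Pow P) \<le> card (?G \<union> (\<Union>i\<in>U. ambiguous \<F> i))"
    using fin by (intro card_mono) (auto simp: ambiguous_def)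
  also have "\<dots> \<le> card ?G + (\<Sum>i\<in>U. card (ambiguous \<F> i))"
    using card_Un_le[of ?G "\<Union>i\<in>U. ambiguous \<F> i"] card_UN_le[OF fin(2), of "ambiguous \<F>"] by linarith
  finally have "2 ^ card P \<le> card ?G + (\<Sum>i\<in>U. card (ambiguous \<F> i))"
    using fin(1) by (simp add: card_Pow)
  moreover have "(\<Sum>i\<in>U. card (ambiguous \<F> i)) * (2 * card U) \<le> card U * 2 ^ card P"
  proof -
    have "(\<Sum>i\<in>U. card (ambiguous \<F> i)) * (2 * card U) \<le> (\<Sum>i\<in>U. card (ambiguous \<F> i)) * 2 ^ q"
      using q by (rule mult_le_mono2)
    also have "\<dots> \<le> (\<Sum>i\<in>U. 2 ^ card P)"
      unfolding sum_distrib_right by (intro sum_mono card_ambiguous[OF \<F>(1)])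
    finally show ?thesis by simp
  qed
  then have "2 * (\<Sum>i\<in>U. card (ambiguous \<F> i)) \<le> 2 ^ card P"
    by (cases "card U = 0") (use fin(2) in \<open>auto simp: mult_ac\<close>)
  ultimately show ?thesis by linarith
qed

text \<open>A nonempty set \<open>D\<close> of vectors sums to zero with probability \<open>2\<^sup>-\<^sup>q\<close>; there are
  fewer than \<open>2 ^ card I\<close> such sets.\<close>

theorem independence:
  assumes I: "I \<subseteq> U" and q: "card I + 2 \<le> q"
  shows "3 * 2 ^ card P \<le> 4 * card {\<omega> \<in> Pow P. \<forall>D. D \<subseteq> I \<longrightarrow> D \<noteq> {} \<longrightarrow>
    (\<exists>j<q. odd (card {i \<in> D. pos i j \<in> \<omega>}))}"
proof -
  let ?G = "{\<omega> \<in> Pow P. \<forall>D. D \<subseteq> I \<longrightarrow> D \<noteq> {} \<longrightarrow> (\<exists>j<q. odd (card {i \<in> D. pos i j \<in> \<omega>}))}"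
  define bad where "bad D = {\<omega> \<in> Pow P. \<forall>j<q. even (card {i \<in> D. pos i j \<in> \<omega>})}" for D
  have finI: "finite I" using I fin(2) finite_subset by blast
  have bad: "card (bad D) * 2 ^ q \<le> 2 ^ card P" if D: "D \<in> Pow I - {{}}" for D
  proof -
    obtain i where i: "i \<in> D" using D by blast
    then have iU: "i \<in> U" using D I by blast
    have finD: "finite D" using D finI finite_subset by auto
    have "inj_on (\<lambda>\<omega>. \<omega> - bit_block pos q i) (bad D)"
    proof (rule inj_onI)
      fix \<omega> \<omega>' assume \<omega>: "\<omega> \<in> bad D" "\<omega>' \<in> bad D"
        and eq: "\<omega> - bit_block pos q i = \<omega>' - bit_block pos q i"
      have "pos i s \<in> \<omega> \<longleftrightarrow> pos i s \<in> \<omega>'" if s: "s < q" for s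
      proof -
        let ?C = "\<lambda>\<omega>. {i' \<in> D - {i}. pos i' s \<in> \<omega>}"
        have C: "?C \<omega> = ?C \<omega>'" using eq_off_block[OF eq iU _ _ s] D I by blast
        have "{i' \<in> D. pos i' s \<in> \<omega>} = (if pos i s \<in> \<omega> then insert i (?C \<omega>) else ?C \<omega>)" for \<omega>
          using i by auto
        then have "even (card {i' \<in> D. pos i' s \<in> \<omega>}) \<longleftrightarrow> (pos i s \<in> \<omega> \<longleftrightarrow> odd (card (?C \<omega>)))" for \<omega>
          using finD by simp
        moreover have "even (card {i' \<in> D. pos i' s \<in> \<omega>})" "even (card {i' \<in> D. pos i' s \<in> \<omega>'})"
          using \<omega> s by (auto simp: bad_def)
        ultimately have "pos i s \<in> \<omega> \<longleftrightarrow> odd (card (?C \<omega>))" "pos i s \<in> \<omega>' \<longleftrightarrow> odd (card (?C \<omega>'))"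
          by blast+
        then show ?thesis by (simp only: C)
      qed
      then show "\<omega> = \<omega>'" by (rule eqI[OF eq])
    qed
    with card_inj_on_Diff[OF fin(1) block(1)[OF iU], of "bad D"] block(2)[OF iU]
    show ?thesis by (auto simp: bad_def)
  qed
  have "Pow P \<subseteq> ?G \<union> (\<Union>D\<in>Pow I - {{}}. bad D)" unfolding bad_def by blast
  then have "card (Pow P) \<le> card (?G \<union> (\<Union>D\<in>Pow I - {{}}. bad D))"
    using fin finI by (intro card_mono) (auto simp: bad_def)
  also have "\<dots> \<le> card ?G + (\<Sum>D\<in>Pow I - {{}}. card (bad D))"
    using card_Un_le[of ?G "\<Union>D\<in>Pow I - {{}}. bad D"] card_UN_le[of "Pow I - {{}}" bad] finI
    by (meson add_left_mono finite_Diff finite_Pow_iff order_trans)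
  finally have "2 ^ card P \<le> card ?G + (\<Sum>D\<in>Pow I - {{}}. card (bad D))"
    using fin(1) by (simp add: card_Pow)
  \<comment> \<open>Fewer than \<open>2 ^ card I\<close> sets, each bad with probability at most
    \<open>2 ^ - q\<close>, add up to at most 1/4; this is why two bits more than labels are
    required.\<close>
  moreover have "4 * (\<Sum>D\<in>Pow I - {{}}. card (bad D)) \<le> 2 ^ card P"
  proof -
    have "(\<Sum>D\<in>Pow I - {{}}. card (bad D)) * 2 ^ q \<le> (\<Sum>D\<in>Pow I - {{}}. 2 ^ card P)"
      unfolding sum_distrib_right by (rule sum_mono) (rule bad)
    also have "\<dots> \<le> 2 ^ card I * 2 ^ card P"
      using finI card_Diff1_le[of "Pow I" "{}"] by (simp add: card_Pow)
    finally have "(\<Sum>D\<in>Pow I - {{}}. card (bad D)) * 2 ^ q \<le> 2 ^ card I * 2 ^ card P" .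
    moreover have "(\<Sum>D\<in>Pow I - {{}}. card (bad D)) * (4 * 2 ^ card I)
        \<le> (\<Sum>D\<in>Pow I - {{}}. card (bad D)) * 2 ^ q"
    proof (rule mult_le_mono2)
      have "(2 :: nat) ^ (card I + 2) \<le> 2 ^ q" using q by (intro power_increasing) auto
      then show "4 * 2 ^ card I \<le> (2 :: nat) ^ q" by (simp add: power_add)
    qed
    ultimately have "(\<Sum>D\<in>Pow I - {{}}. card (bad D)) * (4 * 2 ^ card I) \<le> 2 ^ card I * 2 ^ card P"
      by (rule le_trans[rotated])
    then have "2 ^ card I * (4 * (\<Sum>D\<in>Pow I - {{}}. card (bad D))) \<le> 2 ^ card I * 2 ^ card P"
      by (simp only: mult_ac)
    then show ?thesis by simp
  qed
  ultimately show ?thesis by linarith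
qed

end


subsection \<open>The probability of success\<close>

definition pair_id :: "nat \<Rightarrow> nat \<times> nat \<Rightarrow> nat" where
  "pair_id n i = fst i * n + snd i"

lemma pair_id_less: "i \<in> {..<n} \<times> {..<n} \<Longrightarrow> pair_id n i < n * n"
proof -
  assume i: "i \<in> {..<n} \<times> {..<n}"
  then have "fst i * n + snd i < Suc (fst i) * n" by auto
  also have "\<dots> \<le> n * n" using i by (intro mult_le_mono1) auto
  finally show ?thesis by (simp add: pair_id_def)
qed

lemma pair_id_inj: "i \<in> {..<n} \<times> {..<n} \<Longrightarrow> j \<in> {..<n} \<times> {..<n} \<Longrightarrow> pair_id n i = pair_id n j \<Longrightarrow> i = j"
proof -
  assume ij: "i \<in> {..<n} \<times> {..<n}" "j \<in> {..<n} \<times> {..<n}" "pair_id n i = pair_id n j"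
  then have "(snd i + fst i * n) div n = (snd j + fst j * n) div n"
    by (simp add: pair_id_def add.commute)
  then have "fst i = fst j" using ij(1,2) by auto
  with ij(3) show "i = j" by (simp add: pair_id_def prod_eq_iff)
qed

lemma block_pos_inj:
  fixes x y s s' q :: nat
  assumes "s < q" "s' < q" "x * q + s = y * q + s'" shows "x = y \<and> s = s'"
proof -
  have "(s + x * q) div q = (s' + y * q) div q" using assms(3) by (simp add: add.commute)
  then have "x = y" using assms(1,2) by simp
  with assms(3) show ?thesis by simp
qed

lemma bit_blocks_pairs:
  assumes "P = {b..<b + n * n * q}"
  shows "bit_blocks P ({..<n} \<times> {..<n}) (\<lambda>i s. b + pair_id n i * q + s) q"
proof
  show "finite P" by (simp add: assms)
  show "finite ({..<n} \<times> {..<n})" by simp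
  fix i s assume i: "i \<in> {..<n} \<times> {..<n}" and s: "s < q"
  have "pair_id n i * q + s < Suc (pair_id n i) * q" using s by simp
  also have "\<dots> \<le> n * n * q" using pair_id_less[OF i] by (intro mult_le_mono1) simp
  finally show "b + pair_id n i * q + s \<in> P" by (simp add: assms)
  fix i' s' assume "i' \<in> {..<n} \<times> {..<n}" "s' < q" "b + pair_id n i * q + s = b + pair_id n i' * q + s'"
  then show "i = i' \<and> s = s'" using block_pos_inj[OF s, of s'] pair_id_inj[OF i] by simp
qed

text \<open>The coins are laid out consecutively: \<open>d\<close> for the set of colors, then
  \<open>n * n\<close> vectors of \<open>H\<close> bits, then \<open>n * n\<close> weights of
  \<open>q\<close> bits.\<close>

definition coin_Y :: "nat \<Rightarrow> (nat \<Rightarrow> nat) \<Rightarrow> nat set \<Rightarrow> nat set" where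
  "coin_Y n c \<omega> = {v. v < n \<and> c v \<in> \<omega>}"

definition coin_vb :: "nat \<Rightarrow> nat \<Rightarrow> nat \<Rightarrow> nat set \<Rightarrow> nat \<times> nat \<Rightarrow> nat \<Rightarrow> bool" where
  "coin_vb d n H \<omega> i j \<longleftrightarrow> d + pair_id n i * H + j \<in> \<omega>"

definition coin_wt :: "nat \<Rightarrow> nat \<Rightarrow> nat \<Rightarrow> nat \<Rightarrow> nat set \<Rightarrow> nat \<times> nat \<Rightarrow> nat" where
  "coin_wt d n H q \<omega> = block_value (\<lambda>i s. d + n * n * H + pair_id n i * q + s) q \<omega>"

definition edge_pairs :: "el set \<Rightarrow> (nat \<times> nat) set" where
  "edge_pairs S = {(a, b). Edge a b \<in> S}"

lemma edge_weight_mset_set: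
  assumes "finite S" shows "edge_weight wt (mset_set S) = (\<Sum>i\<in>edge_pairs S. wt i)"
proof -
  have "edge_weight wt (mset_set S) = (\<Sum>e\<in>S. case e of Edge a b \<Rightarrow> wt (a, b) | _ \<Rightarrow> 0)"
    by (simp add: edge_weight_def sum_unfold_sum_mset)
  also have "\<dots> = (\<Sum>e\<in>case_prod Edge ` edge_pairs S. case e of Edge a b \<Rightarrow> wt (a, b) | _ \<Rightarrow> 0)"
    using assms
    by (intro sum.mono_neutral_right) (auto simp: edge_pairs_def image_iff split: el.split)
  also have "\<dots> = (\<Sum>i\<in>edge_pairs S. wt i)"
    by (subst sum.reindex) (auto simp: inj_on_def intro!: sum.cong)
  finally show ?thesis .
qed

lemma (in simple_graph) root_tree_rtree:
  assumes t: "(w, V, A, L) \<in> root_trees E r"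
  shows "rtree E r (insert r V) (insert (edge r w) A) (with_root w V L)"
proof -
  have *: "E r w" "rtree (without r E) w V A L" using t by (auto simp: root_trees_def)
  have "rtree E w V A L" by (rule rtree_mono[OF *(2)]) (simp add: without_def)
  from rtree.join[OF rtree.single this _ *(1)] root_trees_less(3)[OF t] show ?thesis by simp
qed

lemma (in simple_graph) finite_root_els:
  assumes "S \<in> root_els r ` root_trees E r" shows "finite S"
proof -
  obtain w V A L where t: "(w, V, A, L) \<in> root_trees E r" and S: "S = root_els r (w, V, A, L)"
    using assms by (metis imageE prod_cases4)
  have rt: "rtree (without r E) w V A L" using t by (auto simp: root_trees_def)
  have "finite (with_root w V L)"
    using rtree_finite[OF rt] rtree_leaves[OF rt] finite_subset[of L V] by (auto simp: with_root_def)
  then show ?thesis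
    using rtree_finite[OF rt] rtree_card_edges[OF rt] by (auto simp: S root_els_def tree_els_def)
qed

lemma rtree_vertex_has_edge:
  assumes "rtree E r V A L" "a \<in> V" "a \<noteq> r" shows "\<exists>b. edge b a \<in> A"
proof -
  have "(r, a) \<in> {(a, b). edge a b \<in> A}\<^sup>*" by (rule rtree_reach[OF assms(1,2)])
  then show ?thesis using assms(3) by (auto elim: rtranclE)
qed

text \<open>Isolation acts on sets of edges. For a fixed root these determine the tree: the other
  vertices are the remaining ends of edges, and the leaves are those of degree one.\<close>

lemma (in simple_graph) root_els_determined:
  assumes "S \<in> root_els r ` root_trees E r" "S' \<in> root_els r ` root_trees E r"
    and eq: "edge_pairs S = edge_pairs S'"
  shows "S = S'"
proof -
  let ?As = "\<lambda>P. case_prod Edge ` P"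
  let ?Vs = "\<lambda>P. {a. a \<noteq> r \<and> (\<exists>b. edge b a \<in> ?As P)}"
  let ?rec = "\<lambda>P. Vert ` ?Vs P \<union> ?As P \<union> Lf ` {b \<in> ?Vs P. card (neighbors (?As P) b) = 1}"
  have decomp: "S = ?rec (edge_pairs S)"
    if S_in: "S \<in> root_els r ` root_trees E r" for S
  proof -
    obtain w V A L where t: "(w, V, A, L) \<in> root_trees E r" and S: "S = root_els r (w, V, A, L)"
    proof -
      obtain t where "S = root_els r t" "t \<in> root_trees E r" using S_in by blast
      moreover obtain w V A L where "t = (w, V, A, L)" by (cases t)
      ultimately show ?thesis using that by blast
    qed
    note rt = root_tree_rtree[OF t]
    let ?A = "insert (edge r w) A"
    have rV: "r \<notin> V" by (rule root_trees_less(3)[OF t])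
    have A: "?A = {e \<in> S. e \<in> edge_els}"
    proof (intro equalityI subsetI)
      fix e assume e: "e \<in> ?A"
      then obtain a b where "e = edge a b" using rtree_edges[OF rt] by blast
      then have "e \<in> edge_els" by simp
      with e show "e \<in> {e \<in> S. e \<in> edge_els}" by (auto simp: S root_els_def tree_els_def)
    next
      fix e assume "e \<in> {e \<in> S. e \<in> edge_els}"
      then show "e \<in> ?A" by (auto simp: S root_els_def tree_els_def edge_els_def)
    qed
    have A2: "?A = case_prod Edge ` edge_pairs S"
      unfolding A
    proof (intro equalityI subsetI)
      fix e assume "e \<in> {e \<in> S. e \<in> edge_els}"
      moreover from this obtain i where "e = case_prod Edge i" by (auto simp: edge_els_def)
      ultimately show "e \<in> case_prod Edge ` edge_pairs S"
        by (intro image_eqI[of _ _ i]) (auto simp: edge_pairs_def)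
    next
      fix e assume "e \<in> case_prod Edge ` edge_pairs S"
      then show "e \<in> {e \<in> S. e \<in> edge_els}" by (auto simp: edge_pairs_def edge_els_def)
    qed
    have V: "V = {a. a \<noteq> r \<and> (\<exists>b. edge b a \<in> ?A)}"
    proof (intro equalityI subsetI)
      fix a assume "a \<in> V"
      then show "a \<in> {a. a \<noteq> r \<and> (\<exists>b. edge b a \<in> ?A)}"
        using rtree_vertex_has_edge[OF rt, of a] rV by blast
    next
      fix a assume "a \<in> {a. a \<noteq> r \<and> (\<exists>b. edge b a \<in> ?A)}"
      then show "a \<in> V" using rtree_edgeD[OF rt] by blast
    qed
    have LV: "with_root w V L \<subseteq> insert r V - {r}" by (rule rtree_leaves[OF rt])
    have "with_root w V L = {b \<in> V. card (neighbors ?A b) = 1}"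
    proof (intro equalityI subsetI)
      fix b assume "b \<in> with_root w V L"
      then show "b \<in> {b \<in> V. card (neighbors ?A b) = 1}" using LV rtree_leaf_iff[OF rt, of b] by blast
    next
      fix b assume "b \<in> {b \<in> V. card (neighbors ?A b) = 1}"
      then show "b \<in> with_root w V L" using rV rtree_leaf_iff[OF rt, of b] by blast
    qed
    then have "S = Vert ` V \<union> ?A \<union> Lf ` {b \<in> V. card (neighbors ?A b) = 1}"
      unfolding S root_els_def tree_els_def by auto
    then show ?thesis unfolding A2[symmetric] V[symmetric] .
  qed
  have "S = ?rec (edge_pairs S)" by (rule decomp[OF assms(1)])
  also have "\<dots> = ?rec (edge_pairs S')" unfolding eq ..
  also have "\<dots> = S'" by (rule decomp[OF assms(2), symmetric])
  finally show ?thesis .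
qed

lemma (in simple_graph) edge_pairs_subset:
  assumes "S \<in> root_els r ` root_trees E r"
  shows "edge_pairs S \<subseteq> {..<n} \<times> {..<n}" "Edge a a \<notin> S"
proof -
  obtain w V A L where t: "(w, V, A, L) \<in> root_trees E r" and S: "S = root_els r (w, V, A, L)"
    using assms by (metis imageE prod_cases4)
  note rt = root_tree_rtree[OF t]
  have e: "\<exists>x y. x < n \<and> y < n \<and> x \<noteq> y \<and> e = edge x y" if "e \<in> S" "e \<in> edge_els" for e
  proof -
    have "e \<in> insert (edge r w) A" using that by (auto simp: S root_els_def tree_els_def edge_els_def)
    from rtree_edges[OF rt this] show ?thesis using E_less E_less2 E_irrefl by metis
  qed
  have Ein: "Edge a b \<in> edge_els" for a b
    unfolding edge_els_def by (rule range_eqI[of _ _ "(a, b)"]) simp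
  show "edge_pairs S \<subseteq> {..<n} \<times> {..<n}"
  proof
    fix i assume "i \<in> edge_pairs S"
    then obtain a b where i: "i = (a, b)" "Edge a b \<in> S" by (auto simp: edge_pairs_def)
    obtain x y where "x < n" "y < n" "Edge a b = edge x y" using e[OF i(2) Ein] by blast
    then show "i \<in> {..<n} \<times> {..<n}" using i(1) by (auto simp: edge_def min_def max_def split: if_splits)
  qed
  show "Edge a a \<notin> S"
  proof
    assume "Edge a a \<in> S"
    from e[OF this Ein] show False by (auto simp: edge_def min_def max_def split: if_splits)
  qed
qed

text \<open>For a given \<open>Y\<close> each pair is the label of only one possible element of a
  tree, as trees have no loops. So repetitions never occur in a tree and only linear independence is
  left to chance.\<close>

lemma (in simple_graph) count_labels_root_els:
  assumes S: "S \<in> root_els r ` root_trees E r"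
  shows "count (labels Y (mset_set S)) i \<le> 1"
proof -
  have fin: "finite S" by (rule finite_root_els[OF S])
  have "count (labels Y (mset_set S)) i = (\<Sum>e\<in>S. count (label Y e) i)"
    unfolding labels_def using fin
    by (induction S rule: finite_induct) auto
  also have "\<dots> \<le> (\<Sum>e\<in>S. if e = (case i of (a, b) \<Rightarrow> if a \<noteq> b then Edge a b
      else if a \<in> Y then Vert a else Lf a) then 1 else 0)"
    using edge_pairs_subset(2)[OF S]
    by (intro sum_mono) (auto simp: label_def split: el.splits prod.splits if_splits)
  also have "\<dots> \<le> 1" using fin by simp
  finally show ?thesis .
qed

lemma labels_in_square:
  assumes "\<And>e. e \<in># m \<Longrightarrow> e \<in> universe n"
  shows "set_mset (labels Y m) \<subseteq> {..<n} \<times> {..<n}"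
  using assms
proof (induction m)
  case (add e m)
  have "e \<in> universe n" using add.prems by simp
  then have "set_mset (label Y e) \<subseteq> {..<n} \<times> {..<n}"
    by (auto simp: universe_def label_def split: if_splits)
  with add show ?case by simp
qed simp

lemma indep_labels_cong:
  assumes "\<And>i j. i \<in># M \<Longrightarrow> j < H \<Longrightarrow> vb i j = vb' i j"
  shows "indep_labels vb H M = indep_labels vb' H M"
proof -
  have "(\<exists>j<H. odd (card {i \<in> D. vb i j})) = (\<exists>j<H. odd (card {i \<in> D. vb' i j}))"
    if D: "D \<subseteq> set_mset M" for D
  proof (intro ex_cong1 conj_cong refl)
    fix j assume "j < H"
    then have "{i \<in> D. vb i j} = {i \<in> D. vb' i j}" using D assms by blast
    then show "odd (card {i \<in> D. vb i j}) = odd (card {i \<in> D. vb' i j})" by (rule arg_cong)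
  qed
  then show ?thesis
    unfolding indep_labels_def by (intro conj_cong refl all_cong1 imp_cong) simp_all
qed

text \<open>The three groups of coins are disjoint. The colors hit \<open>X0\<close> with
  probability \<open>2 ^ - d\<close>, the vectors of the labels of \<open>S0\<close> are independent
  with probability at least 3/4, and for each such choice the weights isolate some tree with
  probability at least 1/2. The isolated tree need not be \<open>S0\<close>.\<close>

theorem (in simple_graph) random_success:
  assumes k: "2 \<le> k" "k \<le> n" and q: "2 * (n * n) \<le> 2 ^ q" and M1: "M1 = n * 2 ^ q"
    and S0: "S0 \<in> root_els r ` root_trees E r" "n_edges (mset_set S0) = k - 1" "n_leaves (mset_set S0) = l - 1"
    and X0: "X0 \<subseteq> {..<d}" and lab: "size (labels {v. v < n \<and> c v \<in> X0} (mset_set S0)) + 2 \<le> H"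
    and c: "\<And>v. v < n \<Longrightarrow> c v < d"
    and R: "R = d + n * n * H + n * n * q"
  shows "3 * 2 ^ R \<le> 8 * 2 ^ d * card {\<omega> \<in> Pow {..<R}. \<exists>w<M1. odd (card {S \<in> root_els r ` root_trees E r.
    selected (coin_Y n c \<omega>) (coin_vb d n H \<omega>) H (coin_wt d n H q \<omega>) k l w (mset_set S)})}"
proof -
  let ?T = "root_els r ` root_trees E r"
  define Y where "Y = {v. v < n \<and> c v \<in> X0}"
  let ?P1 = "{d..<d + n * n * H}" and ?P2 = "{d + n * n * H..<d + n * n * H + n * n * q}"
  interpret B1: bit_blocks ?P1 "{..<n} \<times> {..<n}" "\<lambda>i s. d + pair_id n i * H + s" H
    by (rule bit_blocks_pairs) simp
  interpret B2: bit_blocks ?P2 "{..<n} \<times> {..<n}" "\<lambda>i s. d + n * n * H + pair_id n i * q + s" q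
    by (rule bit_blocks_pairs) simp
  define I where "I = set_mset (labels Y (mset_set S0))"
  have univ: "S \<subseteq> universe n" if S_in: "S \<in> ?T" for S
  proof -
    obtain w V A L where t: "(w, V, A, L) \<in> root_trees E r" and S: "S = root_els r (w, V, A, L)"
    proof -
      obtain t where "S = root_els r t" "t \<in> root_trees E r" using S_in by blast
      moreover obtain w V A L where "t = (w, V, A, L)" by (cases t)
      ultimately show ?thesis using that by blast
    qed
    note rt = root_tree_rtree[OF t]
    have Vn: "V \<subseteq> {..<n}" by (rule root_trees_less(1)[OF t])
    have "insert (edge r w) A \<subseteq> universe n"
      using rtree_edges[OF rt] edge_in_universe E_less E_less2 by (metis subsetI)
    moreover have "with_root w V L \<subseteq> V" using rtree_leaves[OF rt] by blast
    ultimately show ?thesis using Vn by (auto simp: S root_els_def tree_els_def universe_def)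
  qed
  have I: "I \<subseteq> {..<n} \<times> {..<n}"
    unfolding I_def by (rule labels_in_square) (use univ[OF S0(1)] finite_root_els[OF S0(1)] in auto)
  have cardI: "card I + 2 \<le> H"
  proof -
    have "card I \<le> size (labels Y (mset_set S0))"
      unfolding I_def by (metis size_multiset_overloaded_eq sum_mono[of _ "\<lambda>_. 1" "count _"] card_eq_sum
          count_greater_eq_one_iff)
    then show ?thesis using lab by (simp add: Y_def)
  qed
  define G1 where "G1 = {\<omega> \<in> Pow ?P1. \<forall>D. D \<subseteq> I \<longrightarrow> D \<noteq> {} \<longrightarrow>
    (\<exists>j<H. odd (card {i \<in> D. d + pair_id n i * H + j \<in> \<omega>}))}"
  have card1: "3 * 2 ^ (n * n * H) \<le> 4 * card G1"
    using B1.independence[OF I cardI] by (simp add: G1_def)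
  \<comment> \<open>The family to be isolated depends on the vectors but not on the weights, so
    isolation is applied for fixed vectors. For vectors in \<open>G1\<close> the tree
    \<open>S0\<close> makes it nonempty.\<close>
  define \<F> where "\<F> \<omega> = edge_pairs ` {S \<in> ?T. n_edges (mset_set S) = k - 1 \<and> n_leaves (mset_set S) = l - 1 \<and>
    indep_labels (coin_vb d n H \<omega>) H (labels Y (mset_set S))}" for \<omega>
  define G2 where "G2 \<omega> = {\<omega>2 \<in> Pow ?P2. \<exists>A\<in>\<F> \<omega>. \<forall>C\<in>\<F> \<omega>. C \<noteq> A \<longrightarrow>
    (\<Sum>i\<in>A. coin_wt d n H q \<omega>2 i) < (\<Sum>i\<in>C. coin_wt d n H q \<omega>2 i)}" for \<omega>
  have card2: "2 ^ (n * n * q) \<le> 2 * card (G2 \<omega>)" if "\<omega> \<in> G1" for \<omega>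
  proof -
    have "indep_labels (coin_vb d n H \<omega>) H (labels Y (mset_set S0))"
      using that count_labels_root_els[OF S0(1)]
      by (auto simp: indep_labels_def G1_def I_def coin_vb_def)
    then have "\<F> \<omega> \<noteq> {}" unfolding \<F>_def using S0 by blast
    moreover have "\<F> \<omega> \<subseteq> Pow ({..<n} \<times> {..<n})"
      unfolding \<F>_def using edge_pairs_subset(1) by fastforce
    moreover have "2 * card ({..<n} \<times> {..<n}) \<le> 2 ^ q" using q by (simp add: card_cartesian_product)
    ultimately show ?thesis
      using B2.isolation[of "\<F> \<omega>"] unfolding G2_def coin_wt_def by simp
  qed
  define good where "good = {\<omega> \<in> Pow {..<R}. \<exists>w<M1. odd (card {S \<in> ?T.
    selected (coin_Y n c \<omega>) (coin_vb d n H \<omega>) H (coin_wt d n H q \<omega>) k l w (mset_set S)})}"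
  have in_good: "X0 \<union> \<omega>1 \<union> \<omega>2 \<in> good" if \<omega>: "\<omega>1 \<in> G1" "\<omega>2 \<in> G2 \<omega>1" for \<omega>1 \<omega>2
  proof -
    let ?\<omega> = "X0 \<union> \<omega>1 \<union> \<omega>2"
    have sub: "\<omega>1 \<subseteq> ?P1" "\<omega>2 \<subseteq> ?P2" using \<omega> by (auto simp: G1_def G2_def)
    have PR: "?\<omega> \<in> Pow {..<R}" using sub X0 by (auto simp: R)
    have Y: "coin_Y n c ?\<omega> = Y"
      using sub c by (fastforce simp: coin_Y_def Y_def)
    have vb: "coin_vb d n H ?\<omega> i j = coin_vb d n H \<omega>1 i j" if "i \<in> {..<n} \<times> {..<n}" "j < H" for i j
      using B1.pos_in[OF that] sub X0 by (auto simp: coin_vb_def)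
    have wt: "coin_wt d n H q ?\<omega> i = coin_wt d n H q \<omega>2 i" if "i \<in> {..<n} \<times> {..<n}" for i
    proof -
      have "d + n * n * H + pair_id n i * q + s \<in> ?\<omega> \<longleftrightarrow> d + n * n * H + pair_id n i * q + s \<in> \<omega>2" if "s < q" for s
        using B2.pos_in[OF \<open>i \<in> _\<close> that] sub X0 by auto
      then show ?thesis by (simp add: coin_wt_def block_value_def)
    qed
    have ind: "indep_labels (coin_vb d n H ?\<omega>) H (labels Y (mset_set S))
        \<longleftrightarrow> indep_labels (coin_vb d n H \<omega>1) H (labels Y (mset_set S))" if S: "S \<in> ?T" for S
    proof -
      have sq: "set_mset (labels Y (mset_set S)) \<subseteq> {..<n} \<times> {..<n}"
        by (rule labels_in_square) (use univ[OF S] finite_root_els[OF S] in auto)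
      then show ?thesis using vb by (intro indep_labels_cong) blast
    qed
    have ew: "edge_weight (coin_wt d n H q ?\<omega>) (mset_set S) = (\<Sum>i\<in>edge_pairs S. coin_wt d n H q \<omega>2 i)"
      if "S \<in> ?T" for S
      using edge_pairs_subset(1)[OF that] wt
      by (auto simp: edge_weight_mset_set[OF finite_root_els[OF that]] intro!: sum.cong)
    obtain S1 where S1: "S1 \<in> ?T" "n_edges (mset_set S1) = k - 1" "n_leaves (mset_set S1) = l - 1"
      "indep_labels (coin_vb d n H \<omega>1) H (labels Y (mset_set S1))"
      and min: "\<And>C. C \<in> \<F> \<omega>1 \<Longrightarrow> C \<noteq> edge_pairs S1 \<Longrightarrow>
        (\<Sum>i\<in>edge_pairs S1. coin_wt d n H q \<omega>2 i) < (\<Sum>i\<in>C. coin_wt d n H q \<omega>2 i)"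
    proof -
      obtain A where A: "A \<in> \<F> \<omega>1" "\<forall>C\<in>\<F> \<omega>1. C \<noteq> A \<longrightarrow>
          (\<Sum>i\<in>A. coin_wt d n H q \<omega>2 i) < (\<Sum>i\<in>C. coin_wt d n H q \<omega>2 i)"
        using \<omega>(2) unfolding G2_def by blast
      from A(1) obtain S where S: "A = edge_pairs S" "S \<in> {S \<in> ?T. n_edges (mset_set S) = k - 1 \<and>
          n_leaves (mset_set S) = l - 1 \<and> indep_labels (coin_vb d n H \<omega>1) H (labels Y (mset_set S))}"
        unfolding \<F>_def by (rule imageE)
      show ?thesis by (rule that[of S]) (use S A(2) in simp_all)
    qed
    \<comment> \<open>The minimal weight. Exactly one tree attains it, and a count of 1 is
      odd.\<close>
    define w where "w = edge_weight (coin_wt d n H q ?\<omega>) (mset_set S1)"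
    have "w \<le> n_edges (mset_set S1) * (2 ^ q - 1)"
    proof -
      have "coin_wt d n H q ?\<omega> i \<le> 2 ^ q - 1" for i
        using block_value_less[of "\<lambda>i s. d + n * n * H + pair_id n i * q + s" q ?\<omega> i]
        unfolding coin_wt_def by linarith
      then show ?thesis unfolding w_def by (rule edge_weight_le)
    qed
    also have "\<dots> \<le> n * (2 ^ q - 1)" using S1(2) k by (intro mult_le_mono1) simp
    also have "\<dots> < M1" using k by (simp add: M1)
    finally have w: "w < M1" .
    have "{S \<in> ?T. selected Y (coin_vb d n H ?\<omega>) H (coin_wt d n H q ?\<omega>) k l w (mset_set S)} = {S1}"
    proof (intro equalityI subsetI)
      fix S assume "S \<in> {S \<in> ?T. selected Y (coin_vb d n H ?\<omega>) H (coin_wt d n H q ?\<omega>) k l w (mset_set S)}"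
      then have S: "S \<in> ?T" "n_edges (mset_set S) = k - 1" "n_leaves (mset_set S) = l - 1"
        "edge_weight (coin_wt d n H q ?\<omega>) (mset_set S) = w"
        "indep_labels (coin_vb d n H \<omega>1) H (labels Y (mset_set S))"
        using ind by (auto simp: selected_def)
      then have "edge_pairs S \<in> \<F> \<omega>1" unfolding \<F>_def by blast
      moreover have "\<not> (\<Sum>i\<in>edge_pairs S1. coin_wt d n H q \<omega>2 i) < (\<Sum>i\<in>edge_pairs S. coin_wt d n H q \<omega>2 i)"
        using S(4) ew[OF S(1)] ew[OF S1(1)] by (simp add: w_def)
      ultimately have "edge_pairs S = edge_pairs S1" using min by blast
      then show "S \<in> {S1}" using root_els_determined[OF S(1) S1(1)] by simp
    next
      fix S assume "S \<in> {S1}"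
      then show "S \<in> {S \<in> ?T. selected Y (coin_vb d n H ?\<omega>) H (coin_wt d n H q ?\<omega>) k l w (mset_set S)}"
        using S1 ind[OF S1(1)] by (simp add: selected_def w_def)
    qed
    then have "odd (card {S \<in> ?T. selected Y (coin_vb d n H ?\<omega>) H (coin_wt d n H q ?\<omega>) k l w (mset_set S)})"
      by simp
    then show ?thesis unfolding good_def using PR w Y by auto
  qed
  have "(\<Sum>\<omega>\<in>G1. card (G2 \<omega>)) \<le> card good"
  proof -
    have fin1: "finite G1" and fin2: "finite (G2 \<omega>)" for \<omega> by (simp_all add: G1_def G2_def)
    have "(\<Sum>\<omega>\<in>G1. card (G2 \<omega>)) = card (Sigma G1 G2)" using fin1 fin2 by simp
    also have "\<dots> \<le> card good"
    proof (rule card_inj_on_le[where f = "\<lambda>(\<omega>1, \<omega>2). X0 \<union> \<omega>1 \<union> \<omega>2"])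
      \<comment> \<open>The parts of an outcome are recovered by intersection with the disjoint
        ranges of coins.\<close>
      have rec: "(X0 \<union> \<omega>1 \<union> \<omega>2) \<inter> ?P1 = \<omega>1" "(X0 \<union> \<omega>1 \<union> \<omega>2) \<inter> ?P2 = \<omega>2"
        if "\<omega>1 \<in> G1" "\<omega>2 \<in> G2 \<omega>" for \<omega>1 \<omega>2 \<omega>
      proof -
        have "\<omega>1 \<subseteq> ?P1" "\<omega>2 \<subseteq> ?P2" using that by (auto simp: G1_def G2_def)
        moreover have "X0 \<inter> ?P1 = {}" "X0 \<inter> ?P2 = {}" "?P1 \<inter> ?P2 = {}" using X0 by auto
        ultimately show "(X0 \<union> \<omega>1 \<union> \<omega>2) \<inter> ?P1 = \<omega>1" "(X0 \<union> \<omega>1 \<union> \<omega>2) \<inter> ?P2 = \<omega>2" by blast+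
      qed
      show "inj_on (\<lambda>(\<omega>1, \<omega>2). X0 \<union> \<omega>1 \<union> \<omega>2) (Sigma G1 G2)"
        by (rule inj_onI) (clarsimp, metis rec)
      show "(\<lambda>(\<omega>1, \<omega>2). X0 \<union> \<omega>1 \<union> \<omega>2) ` Sigma G1 G2 \<subseteq> good" using in_good by auto
      show "finite good" by (simp add: good_def)
    qed
    finally show ?thesis .
  qed
  moreover have "card G1 * 2 ^ (n * n * q) \<le> 2 * (\<Sum>\<omega>\<in>G1. card (G2 \<omega>))"
    using sum_mono[of G1 "\<lambda>_. 2 ^ (n * n * q)" "\<lambda>\<omega>. 2 * card (G2 \<omega>)"] card2
    by (simp add: sum_distrib_left)
  ultimately have "card G1 * 2 ^ (n * n * q) \<le> 2 * card good" by linarith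
  moreover have "3 * 2 ^ (n * n * H) * 2 ^ (n * n * q) \<le> 4 * card G1 * 2 ^ (n * n * q)"
    using card1 by (rule mult_le_mono1)
  ultimately have "3 * 2 ^ (n * n * H) * 2 ^ (n * n * q) \<le> 8 * card good" by linarith
  then have "2 ^ d * (3 * 2 ^ (n * n * H) * 2 ^ (n * n * q)) \<le> 2 ^ d * (8 * card good)"
    by (rule mult_le_mono2)
  moreover have "2 ^ d * (3 * 2 ^ (n * n * H) * 2 ^ (n * n * q)) = 3 * (2 :: nat) ^ R"
    by (simp add: R power_add mult_ac)
  ultimately have "3 * 2 ^ R \<le> 2 ^ d * (8 * card good)" by (simp only:)
  also have "\<dots> = 8 * 2 ^ d * card good" by simp
  finally show ?thesis unfolding good_def .
qed

section \<open>The number of labels\<close>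

text \<open>For a random set of \<open>x\<close> out of \<open>d\<close> colors, \<open>label_numerator d k l x / (d * (d - 1))\<close>
  bounds the expected number of labels of a tree.\<close>

definition label_numerator :: "nat \<Rightarrow> nat \<Rightarrow> nat \<Rightarrow> nat \<Rightarrow> nat" where
  "label_numerator d k l x = (d * (d - 1) - x * (d - x)) * k + (d - 1) * (d - x) * l"

primrec label_bound_upto :: "nat \<Rightarrow> nat \<Rightarrow> nat \<Rightarrow> nat \<Rightarrow> nat" where
  "label_bound_upto d k l 0 = label_numerator d k l 0 div (d * (d - 1))"
| "label_bound_upto d k l (Suc x)
     = min (label_bound_upto d k l x) (label_numerator d k l (Suc x) div (d * (d - 1)))"

text \<open>Rounding down is possible since labels come in whole numbers. Taking the minimum over
  all \<open>x\<close> up to \<open>d\<close> avoids any proof of where it is attained.\<close>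

definition label_bound :: "nat \<Rightarrow> nat \<Rightarrow> nat \<Rightarrow> nat" where
  "label_bound d k l = label_bound_upto d k l d"

lemma label_bound_upto_le: "x \<le> y \<Longrightarrow> label_bound_upto d k l y \<le> label_numerator d k l x div (d * (d - 1))"
  by (induction y) (auto simp: le_Suc_eq)

lemma label_bound_upto_attained: "\<exists>x\<le>y. label_bound_upto d k l y = label_numerator d k l x div (d * (d - 1))"
proof (induction y)
  case (Suc y)
  then obtain x where "x \<le> y" "label_bound_upto d k l y = label_numerator d k l x div (d * (d - 1))" by blast
  then show ?case
    by (cases "label_bound_upto d k l y \<le> label_numerator d k l (Suc y) div (d * (d - 1))")
      (auto simp: min_def intro: exI[of _ x] exI[of _ "Suc y"])
qed simp

lemma label_bound_le: assumes "2 \<le> d" shows "label_bound d k l \<le> k"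
proof -
  have "label_bound d k l \<le> label_numerator d k l d div (d * (d - 1))"
    unfolding label_bound_def by (rule label_bound_upto_le) simp
  also have "\<dots> = k" using assms by (simp add: label_numerator_def)
  finally show ?thesis .
qed

text \<open>Makes the truncated subtraction in \<open>label_numerator\<close> exact.\<close>

lemma mult_diff_le_square:
  fixes d x :: nat assumes "x \<le> d" shows "x * (d - x) \<le> d * (d - 1)"
proof (cases "x = d")
  case False
  show ?thesis
  proof (cases "x = 0")
    case False
    then show ?thesis using assms by (intro mult_le_mono) auto
  qed simp
qed simp

lemma label_bound_le_real:
  assumes d: "2 \<le> d" and x: "x \<le> d"
  shows "real (label_bound d k l) \<le> (1 - real x * (real d - real x) / (real d * (real d - 1))) * real k
    + (1 - real x / real d) * real l"
proof -
  let ?D = "d * (d - 1)"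
  have D: "real ?D = real d * (real d - 1)" using d by (simp add: of_nat_diff)
  have Dpos: "real d * (real d - 1) > 0" using d by simp
  have "real (label_bound d k l) \<le> real (label_numerator d k l x div ?D)"
    unfolding label_bound_def using label_bound_upto_le[OF x] by simp
  also have "\<dots> \<le> real (label_numerator d k l x) / real ?D"
  proof -
    have "label_numerator d k l x div ?D * ?D \<le> label_numerator d k l x" by (rule div_times_less_eq_dividend)
    then have "real (label_numerator d k l x div ?D) * real ?D \<le> real (label_numerator d k l x)"
      by (simp only: of_nat_mult[symmetric] of_nat_le_iff)
    then show ?thesis using Dpos unfolding D[symmetric] by (simp only: pos_le_divide_eq)
  qed
  also have "real (label_numerator d k l x)
      = (real d * (real d - 1) - real x * (real d - real x)) * real k + (real d - 1) * (real d - real x) * real l"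
    using d x mult_diff_le_square[OF x] by (simp add: label_numerator_def of_nat_diff)
  also have "\<dots> / real ?D = (1 - real x * (real d - real x) / (real d * (real d - 1))) * real k
      + (1 - real x / real d) * real l"
    unfolding D using d Dpos by (simp add: field_simps)
  finally show ?thesis .
qed

text \<open>As \<open>label_bound\<close> is a minimum over \<open>0..d\<close>, it suffices that
  the rounded optimum lies in this range, for which \<open>l \<le> k\<close> is used, and that half
  of \<open>d\<close>, rounded up, yields the coarse bound.\<close>

lemma two_pow_label_bound_le:
  assumes d: "2 \<le> d" and k: "1 \<le> k" and l: "l \<le> k"
  shows "2 ^ label_bound d k l \<le> fine_bound d (G, c, k, l)"
    and "2 ^ label_bound d k l \<le> coarse_bound d (G, c, k, l)"
proof -
  have pow: "(2 :: real) ^ label_bound d k l \<le> 2 powr y" if "real (label_bound d k l) \<le> y" for y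
    using that by (simp add: powr_realpow[symmetric])
  define z where "z = (real d + real l / real k * (real d - 1)) / 2"
  have lk: "0 \<le> real l / real k" "real l / real k \<le> 1" using k l by auto
  have "0 \<le> z" using d lk unfolding z_def by (intro divide_nonneg_nonneg add_nonneg_nonneg mult_nonneg_nonneg) auto
  then have z0: "0 \<le> optimal_x d k l"
    unfolding optimal_x_def z_def[symmetric] by (simp add: round_def)
  have "real l / real k * (real d - 1) \<le> 1 * (real d - 1)"
    using d lk by (intro mult_right_mono) auto
  moreover define w where "w = real l / real k * (real d - 1)"
  moreover have "2 * z = real d + w" unfolding z_def w_def by simp
  ultimately have "w \<le> real d - 1" "2 * z = real d + w" by simp_all
  \<comment> \<open>\<open>w \<le> d - 1\<close> leaves just the room that rounding may
    take.\<close>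
  then have "z + 1 / 2 \<le> real d" by linarith
  then have zd: "optimal_x d k l \<le> int d"
    unfolding optimal_x_def z_def[symmetric] round_def by linarith
  define x where "x = nat (optimal_x d k l)"
  have x: "x \<le> d" "real_of_int (optimal_x d k l) = real x" using z0 zd by (auto simp: x_def)
  show "2 ^ label_bound d k l \<le> fine_bound d (G, c, k, l)"
    using pow[OF label_bound_le_real[OF d x(1)]] by (simp add: x(2) Let_def)
  define y where "y = nat \<lceil>real d / 2\<rceil>"
  have y: "real_of_int \<lceil>real d / 2\<rceil> = real y" unfolding y_def by simp
  have fl: "real_of_int \<lfloor>real d / 2\<rfloor> = real d - real y"
  proof -
    have "\<lfloor>real d / 2\<rfloor> = int d - \<lceil>real d / 2\<rceil>"
    proof -
      have "- (real d / 2) + real_of_int (int d) = real d / 2" by simp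
      then have "\<lfloor>real d / 2\<rfloor> = \<lfloor>- (real d / 2)\<rfloor> + int d"
        using floor_add_int[of "- (real d / 2)" "int d"] by (simp only:)
      then show ?thesis unfolding ceiling_def by linarith
    qed
    then show ?thesis unfolding y[symmetric] by simp
  qed
  have yd: "real y \<ge> real d / 2" unfolding y[symmetric] by simp
  have "real_of_int \<lfloor>real d / 2\<rfloor> \<ge> 0" by simp
  then have "y \<le> d" unfolding fl by simp
  note b = label_bound_le_real[OF d this, of k l]
  have "(1 - real y / real d) * real l \<le> 1 / 2 * real l"
    using yd d by (intro mult_right_mono) (auto simp: field_simps)
  with b have "real (label_bound d k l)
      \<le> (1 - (real d - real y) * real y / (real d * (real d - 1))) * real k + real l / 2"
    by (simp add: mult.commute)
  from pow[OF this] show "2 ^ label_bound d k l \<le> coarse_bound d (G, c, k, l)"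
    by (simp add: y fl)
qed

section \<open>Averaging over the color sets of a fixed size\<close>

definition color_sets :: "nat \<Rightarrow> nat \<Rightarrow> nat set set" where
  "color_sets d x = {X. X \<subseteq> {..<d} \<and> card X = x}"

lemma card_color_sets_avoiding:
  assumes "B \<subseteq> {..<d}"
  shows "card {X \<in> color_sets d x. B \<inter> X = {}} = (d - card B) choose x"
proof -
  have "{X \<in> color_sets d x. B \<inter> X = {}} = {X. X \<subseteq> {..<d} - B \<and> card X = x}"
    using assms by (auto simp: color_sets_def)
  then show ?thesis
    using assms finite_subset[OF assms] by (simp add: n_subsets card_Diff_subset)
qed

lemma size_labels_sum: "size (labels Y m) = (\<Sum>e\<in>#m. size (label Y e))"
  by (induction m) auto

lemma (in simple_graph) n_vertices_root_els:
  assumes "S \<in> root_els r ` root_trees E r"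
  shows "card {v. Vert v \<in> S} = card (S \<inter> edge_els)"
proof -
  obtain t where "S = root_els r t" "t \<in> root_trees E r" using assms by blast
  moreover obtain w V A L where "t = (w, V, A, L)" by (cases t)
  ultimately have t: "(w, V, A, L) \<in> root_trees E r" and S: "S = root_els r (w, V, A, L)" by auto
  note rt = root_tree_rtree[OF t]
  let ?A = "insert (edge r w) A"
  have nm: "Vert u \<notin> ?A" for u using rtree_no_marks[OF rt] by blast
  have "{v. Vert v \<in> S} = V" using nm by (auto simp: S root_els_def tree_els_def)
  moreover have "S \<inter> edge_els = ?A"
  proof -
    have "e \<in> edge_els" if "e \<in> ?A" for e
      using rtree_edges[OF rt that] by auto
    then show ?thesis by (auto simp: S root_els_def tree_els_def edge_els_def)
  qed
  moreover have "card (insert r V) = Suc (card ?A)" using rtree_card_edges[OF rt] by simp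
  moreover have "finite V" "r \<notin> V" using rtree_finite[OF rt] root_trees_less(3)[OF t] by auto
  ultimately show ?thesis by simp
qed

text \<open>For a random set of \<open>x\<close> colors a vertex is labeled with probability
  \<open>x / d\<close>, a leaf with \<open>1 - x / d\<close>, and an edge with the product of
  \<open>(d - x) / d\<close> and \<open>(d - 1 - x) / (d - 1)\<close>, because its ends have
  different colors. Some color set is at least as good as the average.\<close>

lemma (in simple_graph) averaging:
  assumes S: "S \<in> root_els r ` root_trees E r" "n_edges (mset_set S) = k - 1" "n_leaves (mset_set S) = l - 1"
    and d: "2 \<le> d" and c: "\<And>v. v < n \<Longrightarrow> c v < d" and proper: "\<And>a b. E a b \<Longrightarrow> c a \<noteq> c b" and x: "x \<le> d"
  shows "\<exists>X\<subseteq>{..<d}. size (labels {v. v < n \<and> c v \<in> X} (mset_set S)) \<le> label_numerator d k l x div (d * (d - 1))"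
proof -
  have fin: "finite S" by (rule finite_root_els[OF S(1)])
  let ?Y = "\<lambda>X. {v. v < n \<and> c v \<in> X}"
  let ?N = "d choose x" and ?D = "d * (d - 1)"
  have finC: "finite (color_sets d x)" by (simp add: color_sets_def)
  have N: "card (color_sets d x) = ?N" by (simp add: color_sets_def n_subsets)
  have b1: "d * ((d - 1) choose x) = (d - x) * ?N" using binomial_absorb_comp[of d x] by simp
  have b2: "(d - 1) * ((d - 2) choose x) = (d - 1 - x) * ((d - 1) choose x)"
    using binomial_absorb_comp[of "d - 1" x] by (simp add: numeral_2_eq_2)
  have out: "card {X \<in> color_sets d x. i \<notin> X} = (d - 1) choose x" if "i < d" for i
    using card_color_sets_avoiding[of "{i}" d x] that by simp
  have els: "S \<subseteq> universe n"
  proof -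
    obtain t where "S = root_els r t" "t \<in> root_trees E r" using S(1) by blast
    moreover obtain w V A L where "t = (w, V, A, L)" by (cases t)
    ultimately have t: "(w, V, A, L) \<in> root_trees E r" and S: "S = root_els r (w, V, A, L)" by auto
    note rt = root_tree_rtree[OF t]
    have Vn: "V \<subseteq> {..<n}" by (rule root_trees_less(1)[OF t])
    have "insert (edge r w) A \<subseteq> universe n"
      using rtree_edges[OF rt] edge_in_universe E_less E_less2 by (metis subsetI)
    moreover have "with_root w V L \<subseteq> V" using rtree_leaves[OF rt] by blast
    ultimately show ?thesis using Vn by (auto simp: S root_els_def tree_els_def universe_def)
  qed
  have proper': "c a \<noteq> c b" if "Edge a b \<in> S" for a b
  proof -
    obtain t where "S = root_els r t" "t \<in> root_trees E r" using S(1) by blast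
    moreover obtain w V A L where "t = (w, V, A, L)" by (cases t)
    ultimately have t: "(w, V, A, L) \<in> root_trees E r" and S': "S = root_els r (w, V, A, L)" by auto
    note rt = root_tree_rtree[OF t]
    have "Edge a b \<in> insert (edge r w) A"
      using that by (auto simp: S' root_els_def tree_els_def)
    from rtree_edges[OF rt this] obtain a' b' where "E a' b'" "Edge a b = edge a' b'" by blast
    then show ?thesis using proper[of a' b'] by (auto simp: edge_def min_def max_def split: if_splits)
  qed
  \<comment> \<open>The three probabilities multiplied by \<open>d * (d - 1)\<close>, to stay in the
    naturals.\<close>
  let ?w = "\<lambda>e. case e of Vert _ \<Rightarrow> (d - 1) * x | Edge _ _ \<Rightarrow> (d - x) * (d - 1 - x) | Lf _ \<Rightarrow> (d - 1) * (d - x)"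
  have expected: "?D * (\<Sum>X\<in>color_sets d x. size (label (?Y X) e)) = ?N * ?w e" if e: "e \<in> S" for e
  proof (cases e)
    case (Vert v)
    then have v: "v < n" using e els by (auto simp: universe_def)
    have "(\<Sum>X\<in>color_sets d x. size (label (?Y X) e)) = card {X \<in> color_sets d x. c v \<in> X}"
      using Vert v finC by (simp add: label_def if_distrib[of size] sum.If_cases Int_def)
    moreover have "card {X \<in> color_sets d x. c v \<in> X} + card {X \<in> color_sets d x. c v \<notin> X} = ?N"
    proof -
      have "color_sets d x = {X \<in> color_sets d x. c v \<in> X} \<union> {X \<in> color_sets d x. c v \<notin> X}" by blast
      moreover have "card ({X \<in> color_sets d x. c v \<in> X} \<union> {X \<in> color_sets d x. c v \<notin> X})
          = card {X \<in> color_sets d x. c v \<in> X} + card {X \<in> color_sets d x. c v \<notin> X}"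
        using finC by (intro card_Un_disjoint) auto
      ultimately show ?thesis using N by metis
    qed
    ultimately have "d * (\<Sum>X\<in>color_sets d x. size (label (?Y X) e)) + (d - x) * ?N = d * ?N"
      using out[OF c[OF v]] b1 by (metis distrib_left)
    moreover have "d * ?N = x * ?N + (d - x) * ?N" using x by (simp add: distrib_right[symmetric])
    ultimately have "d * (\<Sum>X\<in>color_sets d x. size (label (?Y X) e)) = x * ?N" by linarith
    then have "(d - 1) * (d * (\<Sum>X\<in>color_sets d x. size (label (?Y X) e))) = (d - 1) * (x * ?N)" by (rule arg_cong)
    then show ?thesis using Vert by (simp add: mult_ac)
  next
    case (Lf v)
    then have v: "v < n" using e els by (auto simp: universe_def)
    have "(\<Sum>X\<in>color_sets d x. size (label (?Y X) e)) = card {X \<in> color_sets d x. c v \<notin> X}"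
    proof -
      have "size (label (?Y X) e) = (if c v \<notin> X then 1 else 0)" for X using Lf v by (simp add: label_def)
      then show ?thesis using finC by (simp add: sum.If_cases Int_def)
    qed
    then have "d * (\<Sum>X\<in>color_sets d x. size (label (?Y X) e)) = (d - x) * ?N"
      using out[OF c[OF v]] b1 by simp
    then have "(d - 1) * (d * (\<Sum>X\<in>color_sets d x. size (label (?Y X) e))) = (d - 1) * ((d - x) * ?N)" by (rule arg_cong)
    then show ?thesis using Lf by (simp add: mult_ac)
  next
    case (Edge a b)
    then have ab: "a < n" "b < n" using e els by (auto simp: universe_def)
    have "c a \<noteq> c b" using proper' Edge e by blast
    have "size (label (?Y X) e) = (if {c a, c b} \<inter> X = {} then 1 else 0)" for X using Edge ab by (auto simp: label_def)
    then have "(\<Sum>X\<in>color_sets d x. size (label (?Y X) e)) = card {X \<in> color_sets d x. {c a, c b} \<inter> X = {}}"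
      using finC by (simp add: sum.If_cases Int_def)
    also have "\<dots> = (d - 2) choose x"
      using card_color_sets_avoiding[of "{c a, c b}" d x] c ab \<open>c a \<noteq> c b\<close> by (simp add: numeral_2_eq_2)
    finally have "?D * (\<Sum>X\<in>color_sets d x. size (label (?Y X) e)) = d * ((d - 1) * ((d - 2) choose x))"
      by (simp add: mult_ac)
    also have "\<dots> = (d - 1 - x) * (d * ((d - 1) choose x))" unfolding b2 by (simp add: mult_ac)
    also have "\<dots> = (d - 1 - x) * ((d - x) * ?N)" unfolding b1 ..
    also have "\<dots> = ?N * ?w e" using Edge by (simp add: mult_ac)
    finally show ?thesis .
  qed
  have "?D * (\<Sum>X\<in>color_sets d x. size (labels (?Y X) (mset_set S)))
      = (\<Sum>e\<in>S. ?D * (\<Sum>X\<in>color_sets d x. size (label (?Y X) e)))"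
    unfolding size_labels_sum sum_unfold_sum_mset[symmetric] by (subst sum.swap) (rule sum_distrib_left)
  also have "\<dots> = ?N * (\<Sum>e\<in>S. ?w e)"
    using expected by (simp add: sum_distrib_left)
  also have "(\<Sum>e\<in>S. ?w e) \<le> label_numerator d k l x"
  proof -
    let ?V = "{e \<in> S. case e of Vert _ \<Rightarrow> True | _ \<Rightarrow> False}" and ?L = "{e \<in> S. case e of Lf _ \<Rightarrow> True | _ \<Rightarrow> False}"
      and ?Ed = "{e \<in> S. case e of Edge _ _ \<Rightarrow> True | _ \<Rightarrow> False}"
    have "(\<Sum>e\<in>S. ?w e) = (\<Sum>e\<in>?V. ?w e) + (\<Sum>e\<in>?Ed. ?w e) + (\<Sum>e\<in>?L. ?w e)"
    proof -
      have "e \<in> S \<longleftrightarrow> e \<in> ?V \<union> ?Ed \<union> ?L" for e by (cases e) simp_all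
      then have "S = ?V \<union> ?Ed \<union> ?L" by (rule set_eqI)
      moreover have "?V \<inter> ?Ed = {}" "(?V \<union> ?Ed) \<inter> ?L = {}"
        by (rule equals0I, rename_tac e, case_tac e; simp)+
      moreover from this have "(\<Sum>e\<in>?V \<union> ?Ed \<union> ?L. ?w e) = (\<Sum>e\<in>?V \<union> ?Ed. ?w e) + (\<Sum>e\<in>?L. ?w e)"
        using fin by (intro sum.union_disjoint) auto
      moreover have "(\<Sum>e\<in>?V \<union> ?Ed. ?w e) = (\<Sum>e\<in>?V. ?w e) + (\<Sum>e\<in>?Ed. ?w e)"
        using fin \<open>?V \<inter> ?Ed = {}\<close> by (intro sum.union_disjoint) auto
      ultimately show ?thesis by metis
    qed
    also have "(\<Sum>e\<in>?V. ?w e) = (\<Sum>e\<in>?V. (d - 1) * x)" by (intro sum.cong) (auto split: el.splits)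
    also have "(\<Sum>e\<in>?Ed. ?w e) = (\<Sum>e\<in>?Ed. (d - x) * (d - 1 - x))" by (intro sum.cong) (auto split: el.splits)
    also have "(\<Sum>e\<in>?L. ?w e) = (\<Sum>e\<in>?L. (d - 1) * (d - x))" by (intro sum.cong) (auto split: el.splits)
    finally have split: "(\<Sum>e\<in>S. ?w e) = (\<Sum>e\<in>?V. (d - 1) * x)
      + (\<Sum>e\<in>?Ed. (d - x) * (d - 1 - x)) + (\<Sum>e\<in>?L. (d - 1) * (d - x))" .
    have "card ?Ed = k - 1"
    proof -
      have "e \<in> ?Ed \<longleftrightarrow> e \<in> S \<inter> edge_els" for e
      proof (cases e)
        case (Edge a b)
        then have "e \<in> edge_els" unfolding edge_els_def by (intro range_eqI[of _ _ "(a, b)"]) simp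
        then show ?thesis using Edge by simp
      qed (auto simp: edge_els_def)
      then have "?Ed = S \<inter> edge_els" by (rule set_eqI)
      then show ?thesis using S(2) n_edges_mset_set[OF fin] by simp
    qed
    moreover have "card ?V = k - 1"
    proof -
      have "e \<in> ?V \<longleftrightarrow> e \<in> Vert ` {v. Vert v \<in> S}" for e by (cases e) auto
      then have "?V = Vert ` {v. Vert v \<in> S}" by (rule set_eqI)
      then have "card ?V = card {v. Vert v \<in> S}" by (simp add: card_image inj_on_def)
      then show ?thesis using n_vertices_root_els[OF S(1)] S(2) n_edges_mset_set[OF fin] by simp
    qed
    moreover have "card ?L = l - 1"
    proof -
      have "n_leaves (mset_set S) = (\<Sum>e\<in>S. of_bool (e \<in> ?L))"
        unfolding n_leaves_def sum_unfold_sum_mset[symmetric] 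
        by (rule sum.cong[OF refl]) (rename_tac e, case_tac e; simp)
      then show ?thesis using S(3) fin by (simp add: Int_def)
    qed
    ultimately have "(\<Sum>e\<in>S. ?w e) = (k - 1) * ((d - 1) * x) + (k - 1) * ((d - x) * (d - 1 - x)) + (l - 1) * ((d - 1) * (d - x))"
      unfolding split by simp
    also have "\<dots> \<le> k * ((d - 1) * x) + k * ((d - x) * (d - 1 - x)) + l * ((d - 1) * (d - x))"
      by (intro add_mono mult_le_mono1) auto
    also have "\<dots> = label_numerator d k l x"
    proof -
      have "(d - 1) * x + (d - x) * (d - 1 - x) + x * (d - x) = d * (d - 1)"
      proof (cases "x = d")
        case False
        then obtain y where "d = Suc (x + y)" using x less_iff_Suc_add by (metis le_neq_implies_less)
        then show ?thesis by (simp add: algebra_simps)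
      qed simp
      then have "(d - 1) * x + (d - x) * (d - 1 - x) = d * (d - 1) - x * (d - x)" by linarith
      then show ?thesis unfolding label_numerator_def by (metis distrib_left mult.commute)
    qed
    finally show ?thesis .
  qed
  finally have total: "?D * (\<Sum>X\<in>color_sets d x. size (labels (?Y X) (mset_set S))) \<le> ?N * label_numerator d k l x"
    by simp
  have "\<exists>X\<in>color_sets d x. ?D * size (labels (?Y X) (mset_set S)) \<le> label_numerator d k l x"
  proof (rule ccontr)
    assume "\<not> ?thesis"
    then have "\<And>X. X \<in> color_sets d x \<Longrightarrow> label_numerator d k l x < ?D * size (labels (?Y X) (mset_set S))"
      by (auto simp: not_le)
    moreover have "color_sets d x \<noteq> {}" using N x by (metis binomial_eq_0_iff card.empty not_less)
    ultimately have "(\<Sum>X\<in>color_sets d x. label_numerator d k l x)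
        < (\<Sum>X\<in>color_sets d x. ?D * size (labels (?Y X) (mset_set S)))"
      using finC by (intro sum_strict_mono) auto
    then show False using total by (simp add: N sum_distrib_left)
  qed
  then obtain X where X: "X \<in> color_sets d x" "?D * size (labels (?Y X) (mset_set S)) \<le> label_numerator d k l x"
    by blast
  have "size (labels (?Y X) (mset_set S)) \<le> label_numerator d k l x div ?D"
    using X(2) d by (simp add: less_eq_div_iff_mult_less_eq mult.commute)
  then show ?thesis using X(1) by (auto simp: color_sets_def)
qed

corollary (in simple_graph) ex_colors_few_labels:
  assumes "S \<in> root_els r ` root_trees E r" "n_edges (mset_set S) = k - 1" "n_leaves (mset_set S) = l - 1"
    and "2 \<le> d" "\<And>v. v < n \<Longrightarrow> c v < d" "\<And>a b. E a b \<Longrightarrow> c a \<noteq> c b"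
  shows "\<exists>X\<subseteq>{..<d}. size (labels {v. v < n \<and> c v \<in> X} (mset_set S)) \<le> label_bound d k l"
proof -
  obtain x where x: "x \<le> d" "label_bound d k l = label_numerator d k l x div (d * (d - 1))"
    using label_bound_upto_attained[of d d k l] by (auto simp: label_bound_def)
  show ?thesis unfolding x(2) by (rule averaging[OF assms x(1)])
qed

section \<open>Loop programs\<close>

text \<open>Every assigned number is reduced modulo the register \<open>M\<close> and every store address modulo the
  register \<open>N\<close>. This bounds the sizes of all numbers without any analysis of the program.\<close>

datatype lp = LAssign string expr | LStore expr expr | LSeq lp lp | LFor string string lp

primrec compile :: "lp \<Rightarrow> com" where
  "compile (LAssign x e) = Assign x (Bin Mod e (Reg ''M''))"
| "compile (LStore a e) = Store (Bin Mod a (Reg ''N'')) (Bin Mod e (Reg ''M''))"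
| "compile (LSeq p q) = Seq (compile p) (compile q)"
| "compile (LFor i b p) = Seq (Assign i (Const 0))
     (While (Bin Less (Reg i) (Reg b)) (Seq (compile p) (Assign i (Bin Add (Reg i) (Const 1)))))"

definition set_reg :: "string \<Rightarrow> nat \<Rightarrow> state \<Rightarrow> state" where
  "set_reg x v s = s\<lparr>reg := (reg s)(x := v)\<rparr>"

definition set_mem :: "nat \<Rightarrow> nat \<Rightarrow> state \<Rightarrow> state" where
  "set_mem a v s = s\<lparr>mem := (mem s)(a := v)\<rparr>"

lemma set_simps [simp]:
  "reg (set_reg x v s) = (reg s)(x := v)" "mem (set_reg x v s) = mem s"
  "reg (set_mem a v s) = reg s" "mem (set_mem a v s) = (mem s)(a := v)"
  by (simp_all add: set_reg_def set_mem_def)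

text \<open>The bound of a loop is read once on entry. This agrees with the compiled loop only if
  the body leaves the bound alone, a side condition of \<open>runs_compile\<close>.\<close>

primrec sem :: "lp \<Rightarrow> state \<Rightarrow> state" where
  "sem (LAssign x e) s = set_reg x (expr_val e s mod reg s ''M'') s"
| "sem (LStore a e) s = set_mem (expr_val a s mod reg s ''N'') (expr_val e s mod reg s ''M'') s"
| "sem (LSeq p q) s = sem q (sem p s)"
| "sem (LFor i b p) s
     = ((\<lambda>s. set_reg i (Suc (reg s i)) (sem p s)) ^^ reg s b) (set_reg i 0 s)"

primrec assigned :: "lp \<Rightarrow> string set" where
  "assigned (LAssign x e) = {x}"
| "assigned (LStore a e) = {}"
| "assigned (LSeq p q) = assigned p \<union> assigned q"
| "assigned (LFor i b p) = insert i (assigned p)"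

primrec loop_bounds :: "lp \<Rightarrow> string set" where
  "loop_bounds (LAssign x e) = {}"
| "loop_bounds (LStore a e) = {}"
| "loop_bounds (LSeq p q) = loop_bounds p \<union> loop_bounds q"
| "loop_bounds (LFor i b p) = insert b (loop_bounds p)"

primrec counters_ok :: "lp \<Rightarrow> bool" where
  "counters_ok (LAssign x e) = True"
| "counters_ok (LStore a e) = True"
| "counters_ok (LSeq p q) = (counters_ok p \<and> counters_ok q)"
| "counters_ok (LFor i b p) = (i \<notin> assigned p \<and> counters_ok p)"

section \<open>Syntactic measures that bound time and space\<close>

primrec esize :: "expr \<Rightarrow> nat" where
  "esize (Const n) = 1"
| "esize (Reg x) = 1"
| "esize (Load a) = Suc (esize a)"
| "esize (Bin f a b) = Suc (esize a + esize b)"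

primrec max_const :: "expr \<Rightarrow> nat" where
  "max_const (Const n) = n"
| "max_const (Reg x) = 0"
| "max_const (Load a) = max_const a"
| "max_const (Bin f a b) = max (max_const a) (max_const b)"

primrec lp_esize :: "lp \<Rightarrow> nat" where
  "lp_esize (LAssign x e) = esize e"
| "lp_esize (LStore a e) = max (esize a) (esize e)"
| "lp_esize (LSeq p q) = max (lp_esize p) (lp_esize q)"
| "lp_esize (LFor i b p) = max 1 (lp_esize p)"

primrec lp_max_const :: "lp \<Rightarrow> nat" where
  "lp_max_const (LAssign x e) = max_const e"
| "lp_max_const (LStore a e) = max (max_const a) (max_const e)"
| "lp_max_const (LSeq p q) = max (lp_max_const p) (lp_max_const q)"
| "lp_max_const (LFor i b p) = max 1 (lp_max_const p)"

primrec steps :: "(string \<Rightarrow> nat) \<Rightarrow> lp \<Rightarrow> nat" where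
  "steps \<rho> (LAssign x e) = 1"
| "steps \<rho> (LStore a e) = 1"
| "steps \<rho> (LSeq p q) = steps \<rho> p + steps \<rho> q"
| "steps \<rho> (LFor i b p) = 2 + \<rho> b * (2 + steps \<rho> p)"

text \<open>\<open>X\<close> limits the registers in use, \<open>V\<close> the bits of every number,
  and \<open>A\<close> the addresses, whose lengths are covered by \<open>A < 2 ^ V\<close>.\<close>

definition bounded_state :: "string set \<Rightarrow> nat \<Rightarrow> nat \<Rightarrow> state \<Rightarrow> bool" where
  "bounded_state X V A s \<longleftrightarrow> finite X \<and> 1 \<le> V \<and> A < 2 ^ V \<and> (\<forall>x. reg s x < 2 ^ V) \<and> (\<forall>x. reg s x \<noteq> 0 \<longrightarrow> x \<in> X) \<and>
     (\<forall>a. mem s a < 2 ^ V) \<and> (\<forall>a. mem s a \<noteq> 0 \<longrightarrow> a < A)"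

lemma bits_le: "n < 2 ^ W \<Longrightarrow> 1 \<le> W \<Longrightarrow> bits n \<le> W"
  unfolding bits_def using floorlog_leI[of n 2 W] by simp

lemma apply_binop_less:
  assumes "m < 2 ^ (V * a)" "n < 2 ^ (V * b)" "1 \<le> V"
  shows "apply_binop f m n < 2 ^ (V * Suc (a + b))"
proof -
  have pow: "(2 :: nat) ^ (V * a) \<le> 2 ^ (V * (a + b))" "(2 :: nat) ^ (V * b) \<le> 2 ^ (V * (a + b))"
    by (auto intro: power_increasing)
  have "2 * 2 ^ (V * (a + b)) \<le> (2 :: nat) ^ V * 2 ^ (V * (a + b))"
    using power_increasing[of 1 V "2 :: nat"] assms(3) by (intro mult_le_mono1) simp
  then have big: "2 * 2 ^ (V * (a + b)) \<le> (2 :: nat) ^ (V * Suc (a + b))" by (simp add: power_add)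
  have m: "m < 2 ^ (V * Suc (a + b))" using assms(1) pow(1) big by linarith
  have one: "(1 :: nat) < 2 ^ (V * Suc (a + b))" by (rule one_less_power) (use assms(3) in auto)
  show ?thesis
  proof (cases f)
    case Add
    have "m + n < 2 ^ (V * Suc (a + b))" using assms(1,2) pow big by linarith
    then show ?thesis using Add by simp
  next
    case Mul
    have "m * n < 2 ^ (V * a) * 2 ^ (V * b)" using assms(1,2) by (intro mult_strict_mono) auto
    then show ?thesis using Mul big by (simp add: power_add[symmetric] distrib_left)
  next
    case Sub
    have "m - n < 2 ^ (V * Suc (a + b))" by (rule le_less_trans[OF diff_le_self m])
    then show ?thesis unfolding Sub apply_binop.simps .
  next
    case Div
    have "m div n < 2 ^ (V * Suc (a + b))" by (rule le_less_trans[OF div_le_dividend m])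
    then show ?thesis unfolding Div apply_binop.simps .
  next
    case Mod
    have "m mod n < 2 ^ (V * Suc (a + b))" by (rule le_less_trans[OF mod_less_eq_dividend m])
    then show ?thesis unfolding Mod apply_binop.simps .
  qed (use one in \<open>simp_all add: of_bool_def\<close>)
qed

text \<open>An operation has a result at most one block of \<open>V\<close> bits longer than its
  arguments together, so values need \<open>V\<close> bits per node of the expression. Summing over
  the nodes makes the cost quadratic.\<close>

lemma expr_bounds:
  assumes s: "bounded_state X V A s" and c: "max_const e < 2 ^ V"
  shows "expr_val e s < 2 ^ (V * esize e)" "expr_cost e s \<le> V * (esize e)\<^sup>2"
proof -
  have V: "1 \<le> V" using s by (simp add: bounded_state_def)
  have pos: "1 \<le> esize e" for e by (cases e) auto
  have "expr_val e s < 2 ^ (V * esize e) \<and> expr_cost e s \<le> V * (esize e)\<^sup>2"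
    using c
  proof (induction e)
    case (Const n)
    then show ?case using bits_le[of n V] V by simp
  next
    case (Reg x)
    then show ?case using s bits_le[of "reg s x" V] V by (simp add: bounded_state_def)
  next
    case (Load a)
    have m: "mem s (expr_val a s) < 2 ^ V" using s by (simp add: bounded_state_def)
    also have "\<dots> \<le> 2 ^ (V * esize (Load a))" by (rule power_increasing) auto
    finally have "expr_val (Load a) s < 2 ^ (V * esize (Load a))" by simp
    moreover have "expr_cost (Load a) s \<le> V * (esize a)\<^sup>2 + V"
      using Load bits_le[OF m V] by simp
    then have "expr_cost (Load a) s \<le> V * (esize (Load a))\<^sup>2"
      by (simp add: power2_eq_square algebra_simps)
    ultimately show ?case by blast
  next
    case (Bin f a b)
    then have ab: "expr_val a s < 2 ^ (V * esize a)" "expr_val b s < 2 ^ (V * esize b)"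
      "expr_cost a s \<le> V * (esize a)\<^sup>2" "expr_cost b s \<le> V * (esize b)\<^sup>2" by auto
    have v: "apply_binop f (expr_val a s) (expr_val b s) < 2 ^ (V * Suc (esize a + esize b))"
      by (rule apply_binop_less[OF ab(1,2) V])
    have "expr_cost (Bin f a b) s \<le> V * (esize a)\<^sup>2 + V * (esize b)\<^sup>2 + V * Suc (esize a + esize b)"
      using ab bits_le[OF v] V by simp
    also have "\<dots> \<le> V * (Suc (esize a + esize b))\<^sup>2"
      by (simp add: power2_eq_square algebra_simps)
    finally show ?case using v by simp
  qed
  then show "expr_val e s < 2 ^ (V * esize e)" "expr_cost e s \<le> V * (esize e)\<^sup>2" by auto
qed

text \<open>\<open>V\<close> times the square of the number of nodes is the bound of
  \<open>expr_bounds\<close>; the factor 2 serves stores, which evaluate two expressions.\<close>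

definition step_cost :: "nat \<Rightarrow> nat \<Rightarrow> nat" where
  "step_cost V e = 1 + 2 * V * (e + 2)\<^sup>2"

definition space_bound :: "string set \<Rightarrow> nat \<Rightarrow> nat \<Rightarrow> nat \<Rightarrow> nat" where
  "space_bound X V A e = card X * V + A * (2 * V) + step_cost V e"

lemma space_used_le:
  assumes s: "bounded_state X V A s" shows "space_used s + step_cost V e \<le> space_bound X V A e"
proof -
  have V: "1 \<le> V" and A: "A < 2 ^ V" using s by (auto simp: bounded_state_def)
  have "(\<Sum>x | reg s x \<noteq> 0. bits (reg s x)) \<le> (\<Sum>x | reg s x \<noteq> 0. V)"
    using s by (intro sum_mono bits_le) (auto simp: bounded_state_def)
  also have "\<dots> \<le> card X * V"
    using s by (auto simp: bounded_state_def intro!: card_mono)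
  finally have 1: "(\<Sum>x | reg s x \<noteq> 0. bits (reg s x)) \<le> card X * V" .
  have sub: "{a. mem s a \<noteq> 0} \<subseteq> {..<A}" using s by (auto simp: bounded_state_def)
  have "(\<Sum>a | mem s a \<noteq> 0. bits a + bits (mem s a)) \<le> (\<Sum>a | mem s a \<noteq> 0. V + V)"
  proof (intro sum_mono add_mono bits_le V)
    fix a assume "a \<in> {a. mem s a \<noteq> 0}"
    then have "a < A" using sub by blast
    then show "a < 2 ^ V" using A by linarith
    show "mem s a < 2 ^ V" using s by (simp add: bounded_state_def)
  qed
  also have "\<dots> = card {a. mem s a \<noteq> 0} * (2 * V)" by simp
  also have "\<dots> \<le> A * (2 * V)"
    using card_mono[OF _ sub] by (intro mult_le_mono1) simp
  finally show ?thesis using 1 by (simp add: space_used_def space_bound_def)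
qed

lemma exec_Seq_det:
  assumes "exec p s (return_pmf (s1, t1, m1))" "exec q s1 (return_pmf (s2, t2, m2))"
  shows "exec (Seq p q) s (return_pmf (s2, t1 + t2, max m1 m2))"
  using exec.Seq[of p s "return_pmf (s1, t1, m1)" q "\<lambda>_. return_pmf (s2, t2, m2)"] assms
  by (simp add: bind_return_pmf charge_def)

definition runs :: "com \<Rightarrow> state \<Rightarrow> state \<Rightarrow> nat \<Rightarrow> nat \<Rightarrow> bool" where
  "runs p s s' T S \<longleftrightarrow> (\<exists>t m. exec p s (return_pmf (s', t, m)) \<and> t \<le> T \<and> m \<le> S)"

lemma runs_Seq: "runs p s s1 T1 S \<Longrightarrow> runs q s1 s2 T2 S \<Longrightarrow> runs (Seq p q) s s2 (T1 + T2) S"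
  unfolding runs_def by (metis exec_Seq_det add_mono max.bounded_iff)

lemma runs_mono: "runs p s s' T S \<Longrightarrow> T \<le> T' \<Longrightarrow> S \<le> S' \<Longrightarrow> runs p s s' T' S'"
  unfolding runs_def by (meson order_trans)

lemma runs_Assign:
  assumes "expr_cost e s < step_cost V k" "space_used s + step_cost V k \<le> S"
  shows "runs (Assign x e) s (set_reg x (expr_val e s) s) (step_cost V k) S"
  unfolding runs_def
  by (rule exI[of _ "1 + expr_cost e s"], rule exI[of _ "space_used s + expr_cost e s"])
    (use exec.Assign[of x e s] assms in \<open>auto simp: set_reg_def\<close>)

lemma runs_WhileFalse:
  assumes "expr_val e s = 0" "expr_cost e s < step_cost V k" "space_used s + step_cost V k \<le> S"
  shows "runs (While e p) s s (step_cost V k) S"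
  unfolding runs_def
  by (rule exI[of _ "1 + expr_cost e s"], rule exI[of _ "space_used s + expr_cost e s"])
    (use exec.WhileFalse[OF assms(1), of p] assms in auto)

lemma runs_WhileTrue:
  assumes "expr_val e s \<noteq> 0" "expr_cost e s < step_cost V k" "space_used s + step_cost V k \<le> S"
    and "runs p s s1 T1 S" "runs (While e p) s1 s2 T2 S"
  shows "runs (While e p) s s2 (step_cost V k + T1 + T2) S"
proof -
  obtain t m where *: "exec (Seq p (While e p)) s (return_pmf (s2, t, m))" "t \<le> T1 + T2" "m \<le> S"
    using runs_Seq[OF assms(4,5)] unfolding runs_def by blast
  from exec.WhileTrue[OF assms(1) *(1)]
  have "exec (While e p) s (return_pmf (s2, 1 + expr_cost e s + t, max (space_used s + expr_cost e s) m))"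
    by (simp add: charge_def)
  then show ?thesis unfolding runs_def
    using assms(2,3) * by (intro exI conjI) (assumption, auto)
qed

lemma sem_unassigned: "x \<notin> assigned p \<Longrightarrow> reg (sem p s) x = reg s x"
proof (induction p arbitrary: s)
  case (LFor i b p)
  have "reg (((\<lambda>s. set_reg i (Suc (reg s i)) (sem p s)) ^^ j) (set_reg i 0 s)) x = reg s x" for j
    by (induction j) (use LFor in auto)
  then show ?case by simp
qed auto

lemma mod_less_two_power: "0 < M \<Longrightarrow> M < 2 ^ V \<Longrightarrow> v mod M < (2 :: nat) ^ V"
  using mod_less_divisor[of M v] by linarith

text \<open>The reductions alone preserve \<open>bounded_state\<close>, whatever is computed. So
  time is the number of steps times a uniform cost, and space never exceeds
  \<open>space_bound\<close>.\<close>

theorem runs_compile: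
  assumes "bounded_state X V A s" and "counters_ok p" and "loop_bounds p \<inter> assigned p = {}"
    and "''M'' \<notin> assigned p" "''N'' \<notin> assigned p" and "assigned p \<subseteq> X"
    and "lp_max_const p < 2 ^ V" and "lp_esize p \<le> k"
    and "0 < reg s ''M''" and "0 < reg s ''N''" "reg s ''N'' \<le> A"
  shows "runs (compile p) s (sem p s) (step_cost V (k + 2) * steps (reg s) p) (space_bound X V A (k + 2))
    \<and> bounded_state X V A (sem p s)"
  using assms
proof (induction p arbitrary: s)
  case (LAssign x e)
  let ?e = "Bin Mod e (Reg ''M'')"
  have s: "bounded_state X V A s" by fact
  have "expr_cost ?e s \<le> V * (esize ?e)\<^sup>2" by (rule expr_bounds[OF s]) (use LAssign in simp)
  also have "\<dots> \<le> V * (k + 2 + 2)\<^sup>2" using LAssign by (intro mult_le_mono2 power_mono) auto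
  also have "\<dots> < step_cost V (k + 2)" by (simp add: step_cost_def)
  finally have "runs (Assign x ?e) s (set_reg x (expr_val ?e s) s) (step_cost V (k + 2)) (space_bound X V A (k + 2))"
    by (rule runs_Assign[OF _ space_used_le[OF s]])
  moreover have "bounded_state X V A (set_reg x (expr_val ?e s) s)"
    using s LAssign mod_less_two_power[of "reg s ''M''" V "expr_val e s"] by (auto simp: bounded_state_def)
  ultimately show ?case by simp
next
  case (LStore a e)
  let ?e = "Bin Mod e (Reg ''M'')" and ?a = "Bin Mod a (Reg ''N'')"
  have s: "bounded_state X V A s" by fact
  have c1: "expr_cost ?e s \<le> V * (esize ?e)\<^sup>2" by (rule expr_bounds[OF s]) (use LStore in simp)
  also have "\<dots> \<le> V * (k + 2 + 2)\<^sup>2" using LStore by (intro mult_le_mono2 power_mono) auto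
  finally have c1: "expr_cost ?e s \<le> V * (k + 2 + 2)\<^sup>2" .
  have c2: "expr_cost ?a s \<le> V * (esize ?a)\<^sup>2" by (rule expr_bounds[OF s]) (use LStore in simp)
  also have "\<dots> \<le> V * (k + 2 + 2)\<^sup>2" using LStore by (intro mult_le_mono2 power_mono) auto
  finally have c2: "expr_cost ?a s \<le> V * (k + 2 + 2)\<^sup>2" .
  have "runs (Store ?a ?e) s (sem (LStore a e) s) (step_cost V (k + 2)) (space_bound X V A (k + 2))"
    unfolding runs_def
    by (rule exI[of _ "1 + expr_cost ?a s + expr_cost ?e s"],
        rule exI[of _ "space_used s + expr_cost ?a s + expr_cost ?e s"])
      (use exec.Store[of ?a ?e s] c1 c2 space_used_le[OF s, of "k + 2"] in \<open>auto simp: set_mem_def step_cost_def\<close>)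
  moreover have "bounded_state X V A (sem (LStore a e) s)"
    using s LStore mod_less_two_power[of "reg s ''M''" V "expr_val e s"]
      order.strict_trans2[OF mod_less_divisor[of "reg s ''N''" "expr_val a s"], of A]
    by (auto simp: bounded_state_def)
  ultimately show ?case by simp
next
  case (LSeq p q)
  have 1: "runs (compile p) s (sem p s) (step_cost V (k + 2) * steps (reg s) p) (space_bound X V A (k + 2))
      \<and> bounded_state X V A (sem p s)" by (rule LSeq.IH(1)) (use LSeq.prems in auto)
  have q: "reg (sem p s) x = reg s x" if "x \<in> loop_bounds q" for x
    using that LSeq.prems(3) by (intro sem_unassigned) auto
  have M: "reg (sem p s) ''M'' = reg s ''M''" "reg (sem p s) ''N'' = reg s ''N''"
    using LSeq.prems by (auto intro: sem_unassigned)
  have st: "steps (reg (sem p s)) q = steps (reg s) q"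
  proof -
    have "steps \<rho> q = steps \<rho>' q" if "\<And>x. x \<in> loop_bounds q \<Longrightarrow> \<rho> x = \<rho>' x" for \<rho> \<rho>'
      using that by (induction q) auto
    then show ?thesis using q by blast
  qed
  have 2: "runs (compile q) (sem p s) (sem q (sem p s)) (step_cost V (k + 2) * steps (reg (sem p s)) q) (space_bound X V A (k + 2))
      \<and> bounded_state X V A (sem q (sem p s))" by (rule LSeq.IH(2)) (use LSeq.prems 1 M in auto)
  then show ?case using runs_Seq[OF conjunct1[OF 1]] unfolding st by (simp add: distrib_left)
next
  case (LFor i b p)
  have s: "bounded_state X V A s" by fact
  let ?U = "step_cost V (k + 2)" and ?S = "space_bound X V A (k + 2)"
  let ?e = "Bin Less (Reg i) (Reg b)" and ?inc = "Assign i (Bin Add (Reg i) (Const 1))"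
  let ?f = "\<lambda>s. set_reg i (Suc (reg s i)) (sem p s)"
  have ib: "i \<noteq> b" "b \<notin> assigned p" "i \<notin> assigned p" using LFor.prems by auto
  have cost: "expr_cost e s' < ?U" if "bounded_state X V A s'" "max_const e < 2 ^ V" "esize e \<le> 4" for e s'
  proof -
    have "expr_cost e s' \<le> V * (esize e)\<^sup>2" by (rule expr_bounds[OF that(1,2)])
    also have "\<dots> \<le> V * (k + 2 + 2)\<^sup>2" using that(3) by (intro mult_le_mono2 power_mono) auto
    also have "\<dots> < ?U" by (simp add: step_cost_def)
    finally show ?thesis .
  qed
  have V: "1 \<le> V" using s by (simp add: bounded_state_def)
  have V1: "(1 :: nat) < 2 ^ V" using V by (metis One_nat_def Suc_le_lessD less_numeral_extra(1) one_less_power numeral_2_eq_2 lessI not_less_eq)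
  let ?s0 = "set_reg i 0 s"
  have s0: "bounded_state X V A ?s0" using s LFor.prems(6) by (auto simp: bounded_state_def)
  have init: "runs (Assign i (Const 0)) s ?s0 ?U ?S"
    using runs_Assign[OF cost[OF s, of "Const 0"] space_used_le[OF s]] by simp
  define st where "st = steps (reg s) p"
  have loop: "runs (While ?e (Seq (compile p) ?inc)) s' ((?f ^^ r) s') (?U + r * (?U + (?U * st + ?U))) ?S
      \<and> bounded_state X V A ((?f ^^ r) s')"
    if "bounded_state X V A s'" "reg s' i + r = reg s b" "\<And>x. x \<noteq> i \<Longrightarrow> x \<notin> assigned p \<Longrightarrow> reg s' x = reg s x" for r s'
    using that
  proof (induction r arbitrary: s')
    case 0
    have "expr_val ?e s' = 0" using 0 ib by simp
    from runs_WhileFalse[OF this cost[OF 0(1), of ?e] space_used_le[OF 0(1)]] 0 V1 show ?case by simp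
  next
    case (Suc r)
    have b: "reg s' b = reg s b" using Suc.prems(3) ib by simp
    have MN: "reg s' ''M'' = reg s ''M''" "reg s' ''N'' = reg s ''N''"
      using Suc.prems(3) LFor.prems by auto
    have stp: "steps (reg s') p = st"
    proof -
      have "steps \<rho> p = steps \<rho>' p" if "\<And>x. x \<in> loop_bounds p \<Longrightarrow> \<rho> x = \<rho>' x" for \<rho> \<rho>'
        using that by (induction p) auto
      then show ?thesis unfolding st_def using Suc.prems(3) LFor.prems(3) by (metis Int_iff assigned.simps(4)
            empty_iff insertCI loop_bounds.simps(4))
    qed
    have body: "runs (compile p) s' (sem p s') (?U * st) ?S \<and> bounded_state X V A (sem p s')"
      unfolding stp[symmetric] by (rule LFor.IH) (use LFor.prems Suc.prems MN in auto)
    have ri: "reg (sem p s') i = reg s' i" using ib by (simp add: sem_unassigned)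
    have inc: "runs ?inc (sem p s') (?f s') ?U ?S"
      using runs_Assign[OF cost[of "sem p s'" "Bin Add (Reg i) (Const 1)"] space_used_le[OF conjunct2[OF body]]] body V1 ri
      by simp
    \<comment> \<open>Counters are not reduced; they stay within the bound of their loop, which is
      itself a register value.\<close>
    have "Suc (reg s' i) < 2 ^ V"
    proof -
      have "Suc (reg s' i) \<le> reg s b" using Suc.prems(2) by simp
      also have "\<dots> < 2 ^ V" using s by (simp add: bounded_state_def)
      finally show ?thesis .
    qed
    then have bf: "bounded_state X V A (?f s')"
      using body LFor.prems(6) by (auto simp: bounded_state_def)
    have rest: "runs (While ?e (Seq (compile p) ?inc)) (?f s') ((?f ^^ r) (?f s')) (?U + r * (?U + (?U * st + ?U))) ?S
        \<and> bounded_state X V A ((?f ^^ r) (?f s'))"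
      by (rule Suc.IH[OF bf]) (use Suc.prems in \<open>auto simp: sem_unassigned\<close>)
    have "expr_val ?e s' \<noteq> 0" using Suc.prems(2) b by simp
    from runs_WhileTrue[OF this cost[OF Suc.prems(1), of ?e] space_used_le[OF Suc.prems(1)]
        runs_Seq[OF conjunct1[OF body] inc] conjunct1[OF rest]] V1 rest
    show ?case unfolding funpow_Suc_right o_apply by (simp add: algebra_simps)
  qed
  have main: "runs (While ?e (Seq (compile p) ?inc)) ?s0 ((?f ^^ reg s b) ?s0) (?U + reg s b * (?U + (?U * st + ?U))) ?S
      \<and> bounded_state X V A ((?f ^^ reg s b) ?s0)"
    by (rule loop[OF s0]) simp_all
  have "?U + (?U + reg s b * (?U + (?U * st + ?U))) = ?U * steps (reg s) (LFor i b p)"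
    unfolding st_def by (simp add: algebra_simps)
  with runs_Seq[OF init conjunct1[OF main]] conjunct2[OF main] show ?case
    by (simp only: compile.simps sem.simps simp_thms)
qed

text \<open>Invariant rule. Registers that the loop does not assign keep their values automatically
  and need not be mentioned in \<open>P\<close>.\<close>

lemma sem_LFor:
  assumes wf: "i \<notin> assigned p" "b \<notin> assigned p" "i \<noteq> b"
    and init: "P 0 (set_reg i 0 s)"
    and step: "\<And>j s'. j < reg s b \<Longrightarrow> P j s' \<Longrightarrow> reg s' i = j \<Longrightarrow>
      (\<And>x. x \<notin> insert i (assigned p) \<Longrightarrow> reg s' x = reg s x) \<Longrightarrow> P (Suc j) (set_reg i (Suc j) (sem p s'))"
  shows "P (reg s b) (sem (LFor i b p) s)"
proof -
  let ?f = "\<lambda>s. set_reg i (Suc (reg s i)) (sem p s)"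
  have "j \<le> reg s b \<Longrightarrow> P j ((?f ^^ j) (set_reg i 0 s)) \<and> reg ((?f ^^ j) (set_reg i 0 s)) i = j \<and>
      (\<forall>x. x \<notin> insert i (assigned p) \<longrightarrow> reg ((?f ^^ j) (set_reg i 0 s)) x = reg s x)" for j
  proof (induction j)
    case (Suc j)
    then have "P (Suc j) (set_reg i (Suc j) (sem p ((?f ^^ j) (set_reg i 0 s))))"
      by (intro step) auto
    with Suc show ?case by (auto simp: sem_unassigned)
  qed (use init in auto)
  then show ?thesis by simp
qed

definition fill :: "(nat \<Rightarrow> nat) \<Rightarrow> nat \<Rightarrow> nat \<Rightarrow> (nat \<Rightarrow> nat) \<Rightarrow> nat \<Rightarrow> nat" where
  "fill m base cnt f a = (if base \<le> a \<and> a < base + cnt then f (a - base) else m a)"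

lemma fill_0 [simp]: "fill m base 0 f = m"
  by (auto simp: fill_def)

lemma fill_Suc: "(fill m base j f)(base + j := f j) = fill m base (Suc j) f"
  by (auto simp: fill_def)

lemma sem_LFor_fill:
  assumes wf: "i \<notin> assigned p" "b \<notin> assigned p" "i \<noteq> b"
    and step: "\<And>j s'. j < reg s b \<Longrightarrow> mem s' = fill (mem s) base j f \<Longrightarrow> reg s' i = j \<Longrightarrow>
      (\<And>x. x \<notin> insert i (assigned p) \<Longrightarrow> reg s' x = reg s x) \<Longrightarrow> mem (sem p s') = (mem s')(base + j := f j)"
  shows "mem (sem (LFor i b p) s) = fill (mem s) base (reg s b) f"
proof (rule sem_LFor[OF wf, where P = "\<lambda>j s'. mem s' = fill (mem s) base j f"])
  fix j and s' :: state assume *: "j < reg s b" "mem s' = fill (mem s) base j f" "reg s' i = j"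
    "\<And>x. x \<notin> insert i (assigned p) \<Longrightarrow> reg s' x = reg s x"
  have "mem (sem p s') = (mem s')(base + j := f j)" by (rule step[OF *])
  then show "mem (set_reg i (Suc j) (sem p s')) = fill (mem s) base (Suc j) f"
    by (simp add: *(2) fill_Suc)
qed simp

lemma sem_LFor_accumulate:
  assumes wf: "i \<notin> assigned p" "b \<notin> assigned p" "i \<noteq> b" and xi: "x \<noteq> i"
    and init: "reg s x = g 0"
    and step: "\<And>j s'. j < reg s b \<Longrightarrow> mem s' = mem s \<Longrightarrow> reg s' x = g j \<Longrightarrow> reg s' i = j \<Longrightarrow>
      (\<And>x. x \<notin> insert i (assigned p) \<Longrightarrow> reg s' x = reg s x) \<Longrightarrow> reg (sem p s') x = g (Suc j) \<and> mem (sem p s') = mem s'"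
  shows "reg (sem (LFor i b p) s) x = g (reg s b) \<and> mem (sem (LFor i b p) s) = mem s"
  by (rule sem_LFor[OF wf, where P = "\<lambda>j s'. reg s' x = g j \<and> mem s' = mem s"])
    (use init step xi in auto)

text \<open>Loops bounded by one distinguished register \<open>c\<close> are counted apart, by
  \<open>loop_nesting\<close>. It will be \<open>''T''\<close>, which holds \<open>2 ^ H\<close>:
  two nested loops of this kind would square the exponential factor.\<close>

primrec loop_depth :: "string \<Rightarrow> lp \<Rightarrow> nat" where
  "loop_depth c (LAssign x e) = 0"
| "loop_depth c (LStore a e) = 0"
| "loop_depth c (LSeq p q) = max (loop_depth c p) (loop_depth c q)"
| "loop_depth c (LFor i b p) = (if b = c then 0 else 1) + loop_depth c p"

primrec loop_nesting :: "string \<Rightarrow> lp \<Rightarrow> nat" where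
  "loop_nesting c (LAssign x e) = 0"
| "loop_nesting c (LStore a e) = 0"
| "loop_nesting c (LSeq p q) = max (loop_nesting c p) (loop_nesting c q)"
| "loop_nesting c (LFor i b p) = (if b = c then 1 else 0) + loop_nesting c p"

primrec lp_size :: "lp \<Rightarrow> nat" where
  "lp_size (LAssign x e) = 0"
| "lp_size (LStore a e) = 0"
| "lp_size (LSeq p q) = Suc (lp_size p + lp_size q)"
| "lp_size (LFor i b p) = 2 + lp_size p"

lemma steps_le:
  assumes "\<And>b. b \<in> loop_bounds p \<Longrightarrow> b \<noteq> c \<Longrightarrow> \<rho> b \<le> W" "1 \<le> W" "\<rho> c \<le> T" "1 \<le> T"
  shows "steps \<rho> p \<le> 4 ^ lp_size p * (W ^ loop_depth c p * T ^ loop_nesting c p)"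
  using assms(1)
proof (induction p)
  case (LSeq p q)
  have mono: "W ^ a * T ^ b \<le> W ^ a' * T ^ b'" if "a \<le> a'" "b \<le> b'" for a a' b b'
    using that assms(2,4) by (intro mult_le_mono power_increasing) auto
  let ?w = "W ^ loop_depth c (LSeq p q) * T ^ loop_nesting c (LSeq p q)"
  have "steps \<rho> p \<le> 4 ^ lp_size p * (W ^ loop_depth c p * T ^ loop_nesting c p)"
    using LSeq by simp
  also have "\<dots> \<le> 4 ^ (lp_size p + lp_size q) * ?w"
    by (intro mult_le_mono mono power_increasing) auto
  finally have 1: "steps \<rho> p \<le> 4 ^ (lp_size p + lp_size q) * ?w" .
  have "steps \<rho> q \<le> 4 ^ lp_size q * (W ^ loop_depth c q * T ^ loop_nesting c q)"
    using LSeq by simp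
  also have "\<dots> \<le> 4 ^ (lp_size p + lp_size q) * ?w"
    by (intro mult_le_mono mono power_increasing) auto
  finally have "steps \<rho> (LSeq p q) \<le> 4 * (4 ^ (lp_size p + lp_size q) * ?w)" using 1 by simp
  then show ?case by (simp add: mult.assoc)
next
  case (LFor i b p)
  let ?w = "W ^ loop_depth c p * T ^ loop_nesting c p"
  let ?w' = "W ^ loop_depth c (LFor i b p) * T ^ loop_nesting c (LFor i b p)"
  let ?z = "4 ^ lp_size p :: nat"
  have IH: "steps \<rho> p \<le> ?z * ?w" using LFor by simp
  have bw: "\<rho> b * ?w \<le> ?w'"
  proof (cases "b = c")
    case True
    then show ?thesis using assms(3) mult_le_mono1[of "\<rho> c" T ?w] by (simp add: mult_ac)
  next
    case False
    then show ?thesis using LFor.prems[of b] mult_le_mono1[of "\<rho> b" W ?w] by (simp add: mult_ac)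
  qed
  have one: "1 \<le> ?w" "1 \<le> ?w'" using assms(2,4) by (simp_all add: Suc_le_eq)
  have b: "\<rho> b \<le> ?w'"
  proof -
    have "\<rho> b = \<rho> b * 1" by simp
    also have "\<dots> \<le> \<rho> b * ?w" by (rule mult_le_mono2[OF one(1)])
    also have "\<dots> \<le> ?w'" by (rule bw)
    finally show ?thesis .
  qed
  have "\<rho> b * steps \<rho> p \<le> \<rho> b * (?z * ?w)" using IH by (rule mult_le_mono2)
  also have "\<dots> = ?z * (\<rho> b * ?w)" by simp
  also have "\<dots> \<le> ?z * ?w'" using bw by (rule mult_le_mono2)
  finally have st: "\<rho> b * steps \<rho> p \<le> ?z * ?w'" .
  have zw: "?w' \<le> ?z * ?w'" by simp
  have "steps \<rho> (LFor i b p) = 2 + \<rho> b * 2 + \<rho> b * steps \<rho> p" by (simp add: distrib_left)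
  also have "\<dots> \<le> 16 * (?z * ?w')" using st zw b one(2) by linarith
  finally show ?case by (simp only: lp_size.simps power_add) simp
qed simp_all

section \<open>Distributions of runs\<close>

text \<open>Separates the distribution of final states from the resources, for which only bounds
  valid on every branch are kept.\<close>

definition dist_runs :: "com \<Rightarrow> state \<Rightarrow> state pmf \<Rightarrow> nat \<Rightarrow> nat \<Rightarrow> bool" where
  "dist_runs p s D T S \<longleftrightarrow>
     (\<exists>D'. exec p s D' \<and> map_pmf fst D' = D \<and> (\<forall>(s', t, m) \<in> set_pmf D'. t \<le> T \<and> m \<le> S))"

lemma dist_runs_if_runs: "runs p s s' T S \<Longrightarrow> dist_runs p s (return_pmf s') T S"
  unfolding runs_def dist_runs_def by force

lemma dist_runs_mono: "dist_runs p s D T S \<Longrightarrow> T \<le> T' \<Longrightarrow> S \<le> S' \<Longrightarrow> dist_runs p s D T' S'"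
  unfolding dist_runs_def by (fastforce intro: order_trans)

lemma map_fst_charge [simp]: "map_pmf fst (charge t m D) = map_pmf fst D"
  by (simp add: charge_def pmf.map_comp o_def case_prod_beta)

lemma set_pmf_charge: "set_pmf (charge t m D) = (\<lambda>(s, t', m'). (s, t + t', max m m')) ` set_pmf D"
  by (simp add: charge_def)

lemma dist_runs_Seq:
  assumes p: "dist_runs p s D T1 S" and q: "\<And>s'. s' \<in> set_pmf D \<Longrightarrow> dist_runs q s' (E s') T2 S"
  shows "dist_runs (Seq p q) s (bind_pmf D E) (T1 + T2) S"
proof -
  obtain D1 where D1: "exec p s D1" "map_pmf fst D1 = D" "\<forall>(s', t, m) \<in> set_pmf D1. t \<le> T1 \<and> m \<le> S"
    using p unfolding dist_runs_def by blast
  have "\<forall>s'. \<exists>E1. s' \<in> set_pmf D \<longrightarrow> exec q s' E1 \<and> map_pmf fst E1 = E s' \<and>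
      (\<forall>(s'', t, m) \<in> set_pmf E1. t \<le> T2 \<and> m \<le> S)"
    using q unfolding dist_runs_def by blast
  then obtain E1 where E1: "\<And>s'. s' \<in> set_pmf D \<Longrightarrow> exec q s' (E1 s') \<and> map_pmf fst (E1 s') = E s' \<and>
      (\<forall>(s'', t, m) \<in> set_pmf (E1 s'). t \<le> T2 \<and> m \<le> S)" by metis
  have fst: "fst r \<in> set_pmf D" if "r \<in> set_pmf D1" for r using that D1(2) by auto
  let ?D = "bind_pmf D1 (\<lambda>(s', t, m). charge t m (E1 (fst (s', t, m))))"
  have ex: "exec (Seq p q) s ?D" by (rule exec.Seq[OF D1(1)]) (use E1 fst in blast)
  have "map_pmf fst ?D = bind_pmf D1 (\<lambda>r. map_pmf fst (E1 (fst r)))"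
    by (simp add: map_bind_pmf case_prod_beta)
  also have "\<dots> = bind_pmf D1 (\<lambda>r. E (fst r))"
    by (rule bind_pmf_cong[OF refl]) (use E1 fst in blast)
  also have "\<dots> = bind_pmf D E" unfolding D1(2)[symmetric] by (simp add: bind_map_pmf)
  finally have mp: "map_pmf fst ?D = bind_pmf D E" .
  have "t \<le> T1 + T2 \<and> m \<le> S" if r: "(s', t, m) \<in> set_pmf ?D" for s' t m
  proof -
    obtain s1 t1 m1 where 1: "(s1, t1, m1) \<in> set_pmf D1" "(s', t, m) \<in> set_pmf (charge t1 m1 (E1 s1))"
      using r by (auto simp del: fst_conv) auto
    obtain t2 m2 where 2: "(s', t2, m2) \<in> set_pmf (E1 s1)" "t = t1 + t2" "m = max m1 m2"
      using 1(2) by (auto simp: set_pmf_charge)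
    have "t1 \<le> T1" "m1 \<le> S" using D1(3) 1(1) by auto
    moreover have "s1 \<in> set_pmf D" using fst[OF 1(1)] by simp
    then have "t2 \<le> T2" "m2 \<le> S" using E1[of s1] 2(1) by auto
    ultimately show ?thesis using 2 by simp
  qed
  then show ?thesis unfolding dist_runs_def using ex mp by blast
qed

lemma charge_bounds:
  assumes "\<forall>(s', t, m) \<in> set_pmf D'. t \<le> T \<and> m \<le> S" "c \<le> U" "sp \<le> S"
  shows "\<forall>(s', t, m) \<in> set_pmf (charge c sp D'). t \<le> U + T \<and> m \<le> S"
proof clarify
  fix s' t m assume "(s', t, m) \<in> set_pmf (charge c sp D')"
  then obtain t2 m2 where 2: "(s', t2, m2) \<in> set_pmf D'" "t = c + t2" "m = max sp m2"
    by (auto simp: set_pmf_charge)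
  then have "t2 \<le> T" "m2 \<le> S" using assms(1) by auto
  then show "t \<le> U + T \<and> m \<le> S" using 2 assms by simp
qed

lemma dist_runs_CondTrue:
  assumes "expr_val e s \<noteq> 0" "dist_runs p s D T S" "expr_cost e s < U" "space_used s + U \<le> S"
  shows "dist_runs (Cond e p q) s D (U + T) S"
proof -
  obtain D' where D': "exec p s D'" "map_pmf fst D' = D" "\<forall>(s', t, m) \<in> set_pmf D'. t \<le> T \<and> m \<le> S"
    using assms(2) unfolding dist_runs_def by blast
  show ?thesis unfolding dist_runs_def
    by (rule exI[of _ "charge (1 + expr_cost e s) (space_used s + expr_cost e s) D'"])
      (intro conjI exec.CondTrue charge_bounds, use assms D' in auto)
qed

lemma dist_runs_CondFalse:
  assumes "expr_val e s = 0" "dist_runs q s D T S" "expr_cost e s < U" "space_used s + U \<le> S"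
  shows "dist_runs (Cond e p q) s D (U + T) S"
proof -
  obtain D' where D': "exec q s D'" "map_pmf fst D' = D" "\<forall>(s', t, m) \<in> set_pmf D'. t \<le> T \<and> m \<le> S"
    using assms(2) unfolding dist_runs_def by blast
  show ?thesis unfolding dist_runs_def
    by (rule exI[of _ "charge (1 + expr_cost e s) (space_used s + expr_cost e s) D'"])
      (intro conjI exec.CondFalse charge_bounds, use assms D' in auto)
qed

lemma dist_runs_WhileTrue:
  assumes "expr_val e s \<noteq> 0" "dist_runs (Seq p (While e p)) s D T S" "expr_cost e s < U" "space_used s + U \<le> S"
  shows "dist_runs (While e p) s D (U + T) S"
proof -
  obtain D' where D': "exec (Seq p (While e p)) s D'" "map_pmf fst D' = D"
    "\<forall>(s', t, m) \<in> set_pmf D'. t \<le> T \<and> m \<le> S"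
    using assms(2) unfolding dist_runs_def by blast
  show ?thesis unfolding dist_runs_def
    by (rule exI[of _ "charge (1 + expr_cost e s) (space_used s + expr_cost e s) D'"])
      (intro conjI exec.WhileTrue charge_bounds, use assms D' in auto)
qed

lemma dist_runs_Flip:
  assumes "space_used s + step_cost V k \<le> S"
  shows "dist_runs (Flip x) s (map_pmf (\<lambda>b. set_reg x (of_bool b) s) (bernoulli_pmf (1/2))) (step_cost V k) S"
  unfolding dist_runs_def
  by (rule exI, intro conjI, rule exec.Flip)
    (use assms in \<open>auto simp: set_reg_def pmf.map_comp o_def step_cost_def\<close>)

lemma runs_Store:
  assumes "1 + expr_cost a s + expr_cost e s \<le> step_cost V k" "space_used s + step_cost V k \<le> S"
  shows "runs (Store a e) s (set_mem (expr_val a s) (expr_val e s) s) (step_cost V k) S"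
  unfolding runs_def
  by (rule exI[of _ "1 + expr_cost a s + expr_cost e s"],
      rule exI[of _ "space_used s + expr_cost a s + expr_cost e s"])
    (use exec.Store[of a e s] assms in \<open>auto simp: set_mem_def\<close>)

lemma cost_less:
  assumes "bounded_state X V A s" "max_const e < 2 ^ V" "esize e \<le> k + 2"
  shows "2 * expr_cost e s < step_cost V k"
proof -
  have "expr_cost e s \<le> V * (esize e)\<^sup>2" by (rule expr_bounds[OF assms(1,2)])
  also have "\<dots> \<le> V * (k + 2)\<^sup>2" using assms(3) by (intro mult_le_mono2 power_mono) auto
  finally show ?thesis by (simp add: step_cost_def)
qed

lemma bounded_state_set_reg:
  "bounded_state X V A s \<Longrightarrow> v < 2 ^ V \<Longrightarrow> x \<in> X \<Longrightarrow> bounded_state X V A (set_reg x v s)"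
  by (auto simp: bounded_state_def)

lemma runs_Assign_bounded:
  assumes s: "bounded_state X V A s" and e: "max_const e < 2 ^ V" "esize e \<le> k + 2"
    and v: "expr_val e s = v" "v < 2 ^ V" and x: "x \<in> X"
  shows "runs (Assign x e) s (set_reg x v s) (step_cost V k) (space_bound X V A k)
    \<and> bounded_state X V A (set_reg x v s)"
  using runs_Assign[of e s V k _ x] cost_less[OF s e] space_used_le[OF s, of k] bounded_state_set_reg[OF s v(2) x] v(1)
  by auto

subsection \<open>Powers of two\<close>

text \<open>The modulus has to exist before loop programs can run, so it is computed by a plain
  program whose numbers are bounded by hand.\<close>

definition double_loop :: com where
  "double_loop = While (Bin Less (Reg ''i'') (Reg ''N''))
     (Seq (Assign ''M'' (Bin Mul (Reg ''M'') (Const 2))) (Assign ''i'' (Bin Add (Reg ''i'') (Const 1))))"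

lemma runs_double_loop:
  assumes "bounded_state X V A s" "N < V" "{''i'', ''M''} \<subseteq> X" "3 \<le> k" "reg s ''N'' = N"
    and "reg s ''i'' + r = N" "reg s ''M'' = 2 ^ reg s ''i''"
  shows "runs double_loop s (set_reg ''i'' N (set_reg ''M'' (2 ^ N) s)) (step_cost V k * (1 + 3 * r)) (space_bound X V A k)
    \<and> bounded_state X V A (set_reg ''i'' N (set_reg ''M'' (2 ^ N) s))"
  using assms
proof (induction r arbitrary: s)
  case 0
  let ?e = "Bin Less (Reg ''i'') (Reg ''N'')"
  have s: "bounded_state X V A s" by fact
  have "set_reg ''i'' N (set_reg ''M'' (2 ^ N) s) = s" using 0 by (simp add: set_reg_def fun_upd_idem)
  moreover have "2 * expr_cost ?e s < step_cost V k" by (rule cost_less[OF s]) (use 0 in auto)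
  then have "runs double_loop s s (step_cost V k) (space_bound X V A k)"
    unfolding double_loop_def by (intro runs_WhileFalse space_used_le[OF s]) (use 0 in auto)
  ultimately show ?case using s by simp
next
  case (Suc r)
  let ?e = "Bin Less (Reg ''i'') (Reg ''N'')" and ?U = "step_cost V k" and ?S = "space_bound X V A k"
  have s: "bounded_state X V A s" by fact
  have V: "3 \<le> (2 :: nat) ^ V" if "2 \<le> V" using power_increasing[OF that, of "2 :: nat"] by simp
  have V2: "2 \<le> V" using Suc.prems by linarith
  have iV: "Suc (reg s ''i'') < 2 ^ V"
    using Suc.prems(2,6) less_exp[of V] by linarith
  define s1 where "s1 = set_reg ''M'' (2 ^ Suc (reg s ''i'')) s"
  define s2 where "s2 = set_reg ''i'' (Suc (reg s ''i'')) s1"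
  have M: "(2 :: nat) ^ Suc (reg s ''i'') < 2 ^ V" by (rule power_strict_increasing) (use Suc.prems in auto)
  have 1: "runs (Assign ''M'' (Bin Mul (Reg ''M'') (Const 2))) s s1 ?U ?S \<and> bounded_state X V A s1"
    unfolding s1_def by (rule runs_Assign_bounded[OF s]) (use Suc.prems V[OF V2] M in auto)
  have 2: "runs (Assign ''i'' (Bin Add (Reg ''i'') (Const 1))) s1 s2 ?U ?S \<and> bounded_state X V A s2"
    unfolding s2_def by (rule runs_Assign_bounded[OF conjunct2[OF 1]])
      (use Suc.prems V[OF V2] iV in \<open>auto simp: s1_def\<close>)
  have 3: "runs double_loop s2 (set_reg ''i'' N (set_reg ''M'' (2 ^ N) s2)) (?U * (1 + 3 * r)) ?S
    \<and> bounded_state X V A (set_reg ''i'' N (set_reg ''M'' (2 ^ N) s2))"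
    by (rule Suc.IH) (use Suc.prems 2 in \<open>auto simp: s2_def s1_def\<close>)
  have eq: "set_reg ''i'' N (set_reg ''M'' (2 ^ N) s2) = set_reg ''i'' N (set_reg ''M'' (2 ^ N) s)"
    by (simp add: s2_def s1_def set_reg_def fun_upd_twist)
  have "2 * expr_cost ?e s < ?U" by (rule cost_less[OF s]) (use Suc.prems in auto)
  then have "runs double_loop s (set_reg ''i'' N (set_reg ''M'' (2 ^ N) s2))
      (?U + (?U + ?U) + ?U * (1 + 3 * r)) ?S"
    unfolding double_loop_def
    by (intro runs_WhileTrue[OF _ _ space_used_le[OF s] runs_Seq[OF conjunct1[OF 1] conjunct1[OF 2]]]
        conjunct1[OF 3, unfolded double_loop_def]) (use Suc.prems in auto)
  then show ?case using 3 unfolding eq by (simp add: algebra_simps)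
qed

subsection \<open>Coin flips\<close>

text \<open>Clearing \<open>''b''\<close> after each flip makes the final state depend on the coins
  only through the stored bits.\<close>

definition flip_loop :: com where
  "flip_loop = While (Bin Less (Reg ''i'') (Reg ''R''))
     (Seq (Flip ''b'') (Seq (Store (Bin Add (Reg ''fb'') (Reg ''i'')) (Reg ''b''))
       (Seq (Assign ''b'' (Const 0)) (Assign ''i'' (Bin Add (Reg ''i'') (Const 1))))))"

definition flipped :: "(nat \<Rightarrow> bool) \<Rightarrow> nat \<Rightarrow> state \<Rightarrow> state" where
  "flipped g r s = s\<lparr>reg := (reg s)(''i'' := reg s ''i'' + r),
     mem := fill (mem s) (reg s ''fb'' + reg s ''i'') r (\<lambda>m. of_bool (g (reg s ''i'' + m)))\<rparr>"

lemma dist_runs_flip_loop: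
  assumes "bounded_state X V A s" "{''i'', ''b''} \<subseteq> X" "3 \<le> k" "reg s ''R'' = R"
    and "reg s ''fb'' + R \<le> A" "reg s ''i'' + r = R" "reg s ''b'' = 0"
  shows "dist_runs flip_loop s (map_pmf (\<lambda>g. flipped g r s)
      (Pi_pmf {reg s ''i''..<reg s ''i'' + r} False (\<lambda>_. bernoulli_pmf (1/2))))
      (step_cost V k * (1 + 5 * r)) (space_bound X V A k)
    \<and> (\<forall>g. bounded_state X V A (flipped g r s))"
  using assms
proof (induction r arbitrary: s)
  case 0
  let ?e = "Bin Less (Reg ''i'') (Reg ''R'')"
  have s: "bounded_state X V A s" by fact
  have *: "flipped g 0 s = s" for g by (simp add: flipped_def)
  have "2 * expr_cost ?e s < step_cost V k" by (rule cost_less[OF s]) (use 0 in auto)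
  then have "runs flip_loop s s (step_cost V k) (space_bound X V A k)"
    unfolding flip_loop_def by (intro runs_WhileFalse space_used_le[OF s]) (use 0 in auto)
  then show ?case using s dist_runs_if_runs by (simp add: * )
next
  case (Suc r)
  let ?e = "Bin Less (Reg ''i'') (Reg ''R'')" and ?U = "step_cost V k" and ?S = "space_bound X V A k"
  let ?j = "reg s ''i''"
  have s: "bounded_state X V A s" by fact
  have V: "1 \<le> V" "A < 2 ^ V" using s by (auto simp: bounded_state_def)
  have one: "(1 :: nat) < 2 ^ V" by (rule one_less_power) (use V in auto)
  have iV: "Suc ?j < 2 ^ V" "Suc ?j \<le> A"
    using Suc.prems V by linarith+
  define s1 where "s1 = (\<lambda>x. set_reg ''b'' (of_bool x) s)"
  define s2 where "s2 = (\<lambda>x. set_mem (reg s ''fb'' + ?j) (of_bool x) (s1 x))"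
  define s3 where "s3 = (\<lambda>x. set_reg ''b'' 0 (s2 x))"
  define s4 where "s4 = (\<lambda>x. set_reg ''i'' (Suc ?j) (s3 x))"
  have 1: "dist_runs (Flip ''b'') s (map_pmf s1 (bernoulli_pmf (1/2))) ?U ?S"
    unfolding s1_def by (rule dist_runs_Flip[OF space_used_le[OF s]])
  have b1: "bounded_state X V A (s1 x)" for x
    unfolding s1_def by (rule bounded_state_set_reg[OF s]) (use Suc.prems one in auto)
  have st: "runs (Store (Bin Add (Reg ''fb'') (Reg ''i'')) (Reg ''b'')) (s1 x) (s2 x) ?U ?S
      \<and> bounded_state X V A (s2 x)" for x
  proof
    have c: "2 * expr_cost (Bin Add (Reg ''fb'') (Reg ''i'')) (s1 x) < ?U" "2 * expr_cost (Reg ''b'') (s1 x) < ?U"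
      by (rule cost_less[OF b1]; use Suc.prems in simp)+
    have "runs (Store (Bin Add (Reg ''fb'') (Reg ''i'')) (Reg ''b'')) (s1 x)
        (set_mem (expr_val (Bin Add (Reg ''fb'') (Reg ''i'')) (s1 x)) (expr_val (Reg ''b'') (s1 x)) (s1 x)) ?U ?S"
      by (rule runs_Store[OF _ space_used_le[OF b1]]) (use c in linarith)
    then show "runs (Store (Bin Add (Reg ''fb'') (Reg ''i'')) (Reg ''b'')) (s1 x) (s2 x) ?U ?S"
      by (simp add: s2_def s1_def)
    show "bounded_state X V A (s2 x)"
      using b1[of x] Suc.prems one by (auto simp: bounded_state_def s2_def)
  qed
  have a3: "runs (Assign ''b'' (Const 0)) (s2 x) (s3 x) ?U ?S \<and> bounded_state X V A (s3 x)" for x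
    unfolding s3_def by (rule runs_Assign_bounded[OF conjunct2[OF st]]) (use Suc.prems one in auto)
  have a4: "runs (Assign ''i'' (Bin Add (Reg ''i'') (Const 1))) (s3 x) (s4 x) ?U ?S \<and> bounded_state X V A (s4 x)" for x
    unfolding s4_def by (rule runs_Assign_bounded[OF conjunct2[OF a3]])
      (use Suc.prems one iV in \<open>auto simp: s3_def s2_def s1_def\<close>)
  have s4: "s4 x = s\<lparr>reg := (reg s)(''i'' := Suc ?j), mem := (mem s)(reg s ''fb'' + ?j := of_bool x)\<rparr>" for x
    using Suc.prems(7) by (simp add: s4_def s3_def s2_def s1_def set_reg_def set_mem_def fun_upd_idem fun_upd_twist)
  let ?rest = "Seq (Store (Bin Add (Reg ''fb'') (Reg ''i'')) (Reg ''b''))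
       (Seq (Assign ''b'' (Const 0)) (Assign ''i'' (Bin Add (Reg ''i'') (Const 1))))"
  have "runs ?rest (s1 x) (s4 x) (?U + (?U + ?U)) ?S" for x
    using st a3 a4 by (blast intro: runs_Seq)
  then have rest: "dist_runs ?rest (s1 x) (return_pmf (s4 x)) (?U + (?U + ?U)) ?S" for x
    by (rule dist_runs_if_runs)
  \<comment> \<open>The rule for sequences takes the continuation as a function of the intermediate
    state, so the flipped bit is read back from \<open>''b''\<close>.\<close>
  let ?h = "\<lambda>s'. s'\<lparr>reg := (reg s')(''i'' := Suc ?j, ''b'' := 0), mem := (mem s')(reg s ''fb'' + ?j := reg s' ''b'')\<rparr>"
  have h: "?h (s1 x) = s4 x" for x
    using Suc.prems(7) by (simp add: s4 s1_def set_reg_def fun_upd_idem fun_upd_twist)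
  have body: "dist_runs (Seq (Flip ''b'') ?rest) s (map_pmf s4 (bernoulli_pmf (1/2))) (?U + (?U + (?U + ?U))) ?S"
  proof -
    have "dist_runs (Seq (Flip ''b'') ?rest) s (bind_pmf (map_pmf s1 (bernoulli_pmf (1/2))) (\<lambda>s'. return_pmf (?h s')))
        (?U + (?U + (?U + ?U))) ?S"
      by (rule dist_runs_Seq[OF 1]) (use rest h in auto)
    then show ?thesis by (simp add: bind_map_pmf h map_pmf_def[of s4])
  qed
  let ?Pi = "Pi_pmf {Suc ?j..<Suc ?j + r} False (\<lambda>_. bernoulli_pmf (1/2))"
  have IH: "dist_runs flip_loop (s4 x) (map_pmf (\<lambda>g. flipped g r (s4 x)) ?Pi) (?U * (1 + 5 * r)) ?S
      \<and> (\<forall>g. bounded_state X V A (flipped g r (s4 x)))" for x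
    using Suc.IH[of "s4 x"] Suc.prems a4 by (auto simp: s4)
  have fl: "flipped g r (s4 x) = flipped (g(?j := x)) (Suc r) s" for g x
  proof -
    have "fill ((mem s)(reg s ''fb'' + ?j := of_bool x)) (Suc (reg s ''fb'' + ?j)) r (\<lambda>m. of_bool (g (Suc (?j + m))))
        = fill (mem s) (reg s ''fb'' + ?j) (Suc r) (\<lambda>m. of_bool ((g(?j := x)) (?j + m)))"
    proof
      fix a
      consider "a < reg s ''fb'' + ?j" | "a = reg s ''fb'' + ?j" | m where "a = Suc (reg s ''fb'' + ?j) + m"
        by (metis add_diff_inverse_nat linorder_neqE_nat not_less_eq)
      then show "fill ((mem s)(reg s ''fb'' + ?j := of_bool x)) (Suc (reg s ''fb'' + ?j)) r (\<lambda>m. of_bool (g (Suc (?j + m)))) a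
          = fill (mem s) (reg s ''fb'' + ?j) (Suc r) (\<lambda>m. of_bool ((g(?j := x)) (?j + m))) a"
        by cases (auto simp: fill_def)
    qed
    then show ?thesis by (simp add: flipped_def s4)
  qed
  let ?D = "\<lambda>s'. map_pmf (\<lambda>g. flipped g r s') ?Pi"
  have "dist_runs (Seq (Seq (Flip ''b'') ?rest) flip_loop) s (bind_pmf (map_pmf s4 (bernoulli_pmf (1/2))) ?D)
      (?U + (?U + (?U + ?U)) + ?U * (1 + 5 * r)) ?S"
    by (rule dist_runs_Seq[OF body]) (use IH in auto)
  moreover have "2 * expr_cost ?e s < ?U" by (rule cost_less[OF s]) (use Suc.prems in auto)
  ultimately have loop: "dist_runs flip_loop s (bind_pmf (map_pmf s4 (bernoulli_pmf (1/2))) ?D)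
      (?U + (?U + (?U + (?U + ?U)) + ?U * (1 + 5 * r))) ?S"
    unfolding flip_loop_def
    by (intro dist_runs_WhileTrue space_used_le[OF s]) (use Suc.prems in auto)
  have set: "{?j..<?j + Suc r} = insert ?j {Suc ?j..<Suc ?j + r}" by auto
  have "Pi_pmf {?j..<?j + Suc r} False (\<lambda>_. bernoulli_pmf (1/2))
      = bind_pmf (bernoulli_pmf (1/2)) (\<lambda>x. map_pmf (\<lambda>g. g(?j := x)) ?Pi)"
    unfolding set by (subst Pi_pmf_insert) (auto simp: pair_pmf_def map_bind_pmf map_pmf_def bind_return_pmf bind_assoc_pmf)
  then have D: "map_pmf (\<lambda>g. flipped g (Suc r) s) (Pi_pmf {?j..<?j + Suc r} False (\<lambda>_. bernoulli_pmf (1/2)))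
      = bind_pmf (map_pmf s4 (bernoulli_pmf (1/2))) ?D"
    by (simp add: map_bind_pmf bind_map_pmf pmf.map_comp o_def fl)
  have "bounded_state X V A (flipped g (Suc r) s)" for g
    using IH[of "g ?j"] fl[of g "g ?j"] by (metis fun_upd_triv)
  then show ?case using loop unfolding D by (simp add: algebra_simps)
qed

lemma dist_runs_flips:
  assumes "bounded_state X V A s" "{''i'', ''b''} \<subseteq> X" "3 \<le> k" "reg s ''R'' = R"
    and "reg s ''fb'' + R \<le> A" "reg s ''i'' = 0" "reg s ''b'' = 0"
  defines "res \<equiv> \<lambda>\<omega>. s\<lparr>reg := (reg s)(''i'' := R), mem := fill (mem s) (reg s ''fb'') R (\<lambda>m. of_bool (m \<in> \<omega>))\<rparr>"
  shows "dist_runs flip_loop s (map_pmf res (pmf_of_set (Pow {..<R}))) (step_cost V k * (1 + 5 * R)) (space_bound X V A k)"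
    and "bounded_state X V A (res \<omega>)"
proof -
  have cong: "fill (mem s) (reg s ''fb'') R f = fill (mem s) (reg s ''fb'') R f'" if "\<And>m. m < R \<Longrightarrow> f m = f' m" for f f'
    using that by (auto simp: fill_def fun_eq_iff)
  have fl: "flipped g R s = res {x \<in> {..<R}. g x}" for g
    using assms(6) by (simp add: flipped_def res_def) (rule arg_cong[OF cong], simp)
  have res: "res \<omega> = flipped (\<lambda>x. x \<in> \<omega>) R s" for \<omega>
    using assms(6) by (auto simp: flipped_def res_def fill_def fun_eq_iff)
  have *: "dist_runs flip_loop s (map_pmf (\<lambda>g. flipped g R s)
      (Pi_pmf {reg s ''i''..<reg s ''i'' + R} False (\<lambda>_. bernoulli_pmf (1/2))))
      (step_cost V k * (1 + 5 * R)) (space_bound X V A k)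
    \<and> (\<forall>g. bounded_state X V A (flipped g R s))"
    by (rule dist_runs_flip_loop[OF assms(1-5)]) (use assms(6,7) in auto)
  have "map_pmf res (pmf_of_set (Pow {..<R})) = map_pmf (\<lambda>g. flipped g R s)
      (Pi_pmf {reg s ''i''..<reg s ''i'' + R} False (\<lambda>_. bernoulli_pmf (1/2)))"
    unfolding assms(6) add_0 atLeast0LessThan[symmetric]
    by (subst pmf_of_set_Pow_conv_bernoulli[symmetric, where P = False])
      (auto simp: pmf.map_comp o_def fl atLeast0LessThan)
  with * show "dist_runs flip_loop s (map_pmf res (pmf_of_set (Pow {..<R}))) (step_cost V k * (1 + 5 * R)) (space_bound X V A k)"
    by simp
  show "bounded_state X V A (res \<omega>)" using * res by simp
qed

section \<open>Setting up the parameters\<close>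

primrec expr_regs :: "expr \<Rightarrow> string set" where
  "expr_regs (Const n) = {}"
| "expr_regs (Reg x) = {x}"
| "expr_regs (Load a) = expr_regs a"
| "expr_regs (Bin f a b) = expr_regs a \<union> expr_regs b"

lemma expr_val_cong: "(\<And>x. x \<in> expr_regs e \<Longrightarrow> reg s x = reg s' x) \<Longrightarrow> mem s = mem s' \<Longrightarrow> expr_val e s = expr_val e s'"
  by (induction e) auto

primrec stores :: "lp \<Rightarrow> bool" where
  "stores (LAssign x e) = False"
| "stores (LStore a e) = True"
| "stores (LSeq p q) = (stores p \<or> stores q)"
| "stores (LFor i b p) = stores p"

lemma sem_mem: "\<not> stores p \<Longrightarrow> mem (sem p s) = mem s"
proof (induction p arbitrary: s)
  case (LFor i b p)
  have "mem (((\<lambda>s. set_reg i (Suc (reg s i)) (sem p s)) ^^ j) (set_reg i 0 s)) = mem s" for j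
    by (induction j) (use LFor in auto)
  then show ?case by simp
qed auto

definition pow_prog :: "string \<Rightarrow> string \<Rightarrow> expr \<Rightarrow> lp" where
  "pow_prog x b y = LSeq (LAssign x (Const 1)) (LFor ''i'' b (LAssign x (Bin Mul (Reg x) y)))"

lemma pow_prog_static [simp]:
  "assigned (pow_prog x b y) = {x, ''i''}" "loop_bounds (pow_prog x b y) = {b}"
  "\<not> stores (pow_prog x b y)" "counters_ok (pow_prog x b y) \<longleftrightarrow> x \<noteq> ''i''"
  by (auto simp: pow_prog_def)

lemma sem_pow_prog:
  assumes "x \<notin> expr_regs y \<union> {b, ''i'', ''M''}" "''i'' \<notin> expr_regs y \<union> {b}"
    and "expr_val y s = v" "1 < reg s ''M''"
  shows "reg (sem (pow_prog x b y) s) x = v ^ reg s b mod reg s ''M''"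
proof -
  define s1 where "s1 = set_reg x 1 s"
  have s1: "sem (LAssign x (Const 1)) s = s1" using assms by (simp add: s1_def)
  have "reg (sem (LFor ''i'' b (LAssign x (Bin Mul (Reg x) y))) s1) x = v ^ reg s1 b mod reg s ''M''"
  proof (rule conjunct1[OF sem_LFor_accumulate[where g = "\<lambda>j. v ^ j mod reg s ''M''"]])
    fix j and s' :: state assume *: "mem s' = mem s1" "reg s' x = v ^ j mod reg s ''M''"
      "\<And>z. z \<notin> insert ''i'' (assigned (LAssign x (Bin Mul (Reg x) y))) \<Longrightarrow> reg s' z = reg s1 z"
    have "''M'' \<noteq> x" using assms(1) by blast
    then have M: "reg s' ''M'' = reg s ''M''" using *(3)[of "''M''"] by (simp add: s1_def)
    have "expr_val y s' = expr_val y s"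
    proof (rule expr_val_cong)
      fix z assume "z \<in> expr_regs y"
      then have "z \<noteq> x" "z \<noteq> ''i''" using assms(1,2) by blast+
      then show "reg s' z = reg s z" using *(3)[of z] by (simp add: s1_def)
    qed (use *(1) in \<open>simp add: s1_def\<close>)
    then show "reg (sem (LAssign x (Bin Mul (Reg x) y)) s') x = v ^ Suc j mod reg s ''M'' \<and>
        mem (sem (LAssign x (Bin Mul (Reg x) y)) s') = mem s'"
      using *(2) M assms(3) by (simp add: mod_mult_right_eq mult.commute)
  qed (use assms in \<open>auto simp: s1_def\<close>)
  moreover have "b \<noteq> x" using assms(1) by blast
  ultimately show ?thesis using assms by (simp add: pow_prog_def s1 s1_def)
qed

definition numerator_expr :: "nat \<Rightarrow> nat \<Rightarrow> expr" where
  "numerator_expr d x = Bin Add (Bin Mul (Const (d * (d - 1) - x * (d - x))) (Reg ''k''))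
     (Bin Mul (Const ((d - 1) * (d - x))) (Reg ''l''))"

text \<open>With truncated subtraction \<open>a - (a - b)\<close> is the minimum of \<open>a\<close>
  and \<open>b\<close>. The expression grows exponentially in its second argument, but this is
  bounded in terms of the fixed \<open>d\<close>.\<close>

primrec label_bound_expr :: "nat \<Rightarrow> nat \<Rightarrow> expr" where
  "label_bound_expr d 0 = Bin Div (numerator_expr d 0) (Const (d * (d - 1)))"
| "label_bound_expr d (Suc x) = Bin Sub (label_bound_expr d x) (Bin Sub (label_bound_expr d x)
     (Bin Div (numerator_expr d (Suc x)) (Const (d * (d - 1)))))"

lemma expr_val_label_bound [simp]:
  "expr_val (label_bound_expr d x) s = label_bound_upto d (reg s ''k'') (reg s ''l'') x"
  by (induction x) (auto simp: numerator_expr_def label_numerator_def min_def)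

definition setup_A :: "nat \<Rightarrow> lp" where
  "setup_A d = LSeq (LAssign ''nn'' (Bin Mul (Reg ''n'') (Reg ''n'')))
    (LSeq (LAssign ''n2'' (Bin Mul (Const 2) (Bin Mul (Reg ''n'') (Reg ''n''))))
    (LSeq (LAssign ''H'' (Bin Add (label_bound_expr d d) (Const 2)))
    (LSeq (LAssign ''B'' (Bin Mul (Bin Add (Reg ''n'') (Const 4)) (Bin Add (Reg ''n'') (Const 4))))
    (LAssign ''fb'' (Bin Add (Bin Add (Const 3) (Reg ''n'')) (Bin Mul (Reg ''n'') (Reg ''n'')))))))"

text \<open>Loop programs have no conditionals, so a comparison acts through its value 0 or 1.
  Doubling stops once \<open>''Q''\<close> has reached \<open>2 * (n * n)\<close>, twice the number
  of pairs, as \<open>isolation\<close> requires.\<close>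

definition double_Q :: lp where
  "double_Q = LSeq (LAssign ''q'' (Bin Add (Reg ''q'') (Bin Less (Reg ''Q'') (Reg ''n2''))))
     (LAssign ''Q'' (Bin Mul (Reg ''Q'') (Bin Add (Const 1) (Bin Less (Reg ''Q'') (Reg ''n2'')))))"

definition setup_B :: lp where
  "setup_B = LSeq (LAssign ''Q'' (Const 1)) (LSeq (LAssign ''q'' (Const 0))
    (LSeq (LFor ''i'' ''n2'' double_Q)
    (LSeq (pow_prog ''T'' ''H'' (Const 2)) (pow_prog ''bt'' ''B'' (Const 2)))))"

definition setup_C :: "nat \<Rightarrow> lp" where
  "setup_C d = LSeq (LAssign ''M1'' (Bin Mul (Reg ''n'') (Reg ''Q'')))
    (LSeq (LAssign ''M3'' (Bin Mul (Reg ''M1'') (Bin Add (Reg ''n'') (Const 1))))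
    (LSeq (LAssign ''R'' (Bin Add (Bin Add (Const d) (Bin Mul (Reg ''nn'') (Reg ''H''))) (Bin Mul (Reg ''nn'') (Reg ''q''))))
    (LAssign ''X'' (Bin Add (Bin Mul (Reg ''M3'') (Bin Sub (Reg ''k'') (Const 1)))
      (Bin Mul (Reg ''M1'') (Bin Sub (Reg ''l'') (Const 1)))))))"

definition setup_D :: lp where
  "setup_D = LSeq (pow_prog ''zb'' ''M1'' (Reg ''bt'')) (LSeq (pow_prog ''xb'' ''M3'' (Reg ''bt''))
    (LSeq (pow_prog ''dv'' ''X'' (Reg ''bt'')) (LAssign ''i'' (Const 0))))"

lemma setup_static [simp]:
  "assigned (setup_A d) = {''nn'', ''n2'', ''H'', ''B'', ''fb''}"
  "assigned setup_B = {''Q'', ''q'', ''i'', ''T'', ''bt''}"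
  "assigned (setup_C d) = {''M1'', ''M3'', ''R'', ''X''}"
  "assigned setup_D = {''zb'', ''xb'', ''dv'', ''i''}"
  "assigned double_Q = {''Q'', ''q''}"
  "\<not> stores (setup_A d)" "\<not> stores setup_B" "\<not> stores (setup_C d)" "\<not> stores setup_D"
  "loop_bounds (setup_A d) = {}" "loop_bounds setup_B = {''n2'', ''H'', ''B''}"
  "loop_bounds (setup_C d) = {}" "loop_bounds setup_D = {''M1'', ''M3'', ''X''}"
  "counters_ok (setup_A d)" "counters_ok setup_B" "counters_ok (setup_C d)" "counters_ok setup_D"
  by (auto simp: setup_A_def setup_B_def setup_C_def setup_D_def double_Q_def)

text \<open>With \<open>a = n + 8 + d\<close>, the quantity \<open>2 ^ q\<close> is at most
  \<open>a ^ 3\<close>, \<open>M1\<close> at most \<open>a ^ 4\<close>, \<open>M3\<close> at most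
  \<open>a ^ 5\<close>, and the digit positions are about \<open>3 * a ^ 8\<close>. One more power
  of \<open>a\<close>, which is at least 8, swallows the constants; hence the exponent 9. The same
  \<open>N\<close> serves as memory size and as number of bits of the modulus.\<close>

lemma size_bounds:
  fixes n d k l H q :: nat
  assumes "H \<le> n + 2" "q \<le> 2 * (n * n)" "2 ^ q \<le> 2 * (2 * (n * n))" "k \<le> n" "l \<le> n"
    and M1: "M1 = n * 2 ^ q" and M3: "M3 = M1 * (n + 1)" and N: "N = (n + 8 + d) ^ 9"
  shows "8 * (n * n) < N" "(n + 4) * (n + 4) < N" "H < N"
    and "(3 + n + n * n) + (d + n * n * H + n * n * q) + (k + 1) * (n * n) < N"
    and "(n + 4)\<^sup>2 * (M3 * (k - 1) + M1 * (l - 1) + M1) + H < N"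
    and "M3 < N" "M1 < N" "n < N"
proof -
  define a where "a = n + 8 + d"
  have a: "8 \<le> a" "n \<le> a" "n + 4 \<le> a" "H \<le> a" "k \<le> a" "l \<le> a" "d \<le> a" "n + 1 \<le> a"
    using assms by (auto simp: a_def)
  have p: "a * a ^ i = a ^ Suc i" for i by simp
  have up: "8 * a ^ i \<le> a ^ Suc i" for i using a(1) by (simp add: mult_le_mono1)
  have pos: "1 \<le> a ^ i" for i using a(1) by simp
  have nn: "n * n \<le> a ^ 2" using a by (simp add: power2_eq_square mult_le_mono)
  have B: "(n + 4) * (n + 4) \<le> a ^ 2" unfolding power2_eq_square by (intro mult_le_mono a)
  have s: "a ^ 2 * 8 \<le> a ^ 3" "a ^ 3 * 8 \<le> a ^ 4" "a ^ 4 * 8 \<le> a ^ 5" "a ^ 5 * 8 \<le> a ^ 6" "a ^ 6 * 8 \<le> a ^ 7"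
    "a ^ 7 * 8 \<le> a ^ 8" "a ^ 8 * 8 \<le> a ^ 9" "a * 8 \<le> a ^ 2"
    using up[of 1] up[of 2] up[of 3] up[of 4] up[of 5] up[of 6] up[of 7] up[of 8] by (simp_all add: eval_nat_numeral)
  have N': "N = a ^ 9" using N by (simp add: a_def)
  show "8 * (n * n) < N" "(n + 4) * (n + 4) < N" "H < N" "n < N"
    using nn B s a unfolding N' by linarith+
  have Q: "2 ^ q \<le> a ^ 3" using assms(3) nn s by linarith
  have m1: "M1 \<le> a ^ 4"
  proof -
    have "n * 2 ^ q \<le> a * a ^ 3" by (intro mult_le_mono a Q)
    then show ?thesis by (simp add: M1 eval_nat_numeral)
  qed
  have m3: "M3 \<le> a ^ 5"
  proof -
    have "M1 * (n + 1) \<le> a ^ 4 * a" by (intro mult_le_mono a m1)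
    then show ?thesis by (simp add: M3 eval_nat_numeral)
  qed
  show "M3 < N" "M1 < N" using m1 m3 s a unfolding N' by linarith+
  have "n * n * H \<le> a ^ 2 * a" "(k + 1) * (n * n) \<le> a * a ^ 2" "n * n * q \<le> a ^ 2 * (2 * a ^ 2)"
    by (intro mult_le_mono nn a; use a assms nn in linarith)+
  then have "n * n * H \<le> a ^ 3" "(k + 1) * (n * n) \<le> a ^ 3" "n * n * q \<le> 2 * a ^ 4"
    by (simp_all add: eval_nat_numeral algebra_simps)
  then show "(3 + n + n * n) + (d + n * n * H + n * n * q) + (k + 1) * (n * n) < N"
    using nn s a unfolding N' by linarith
  have "M3 * (k - 1) \<le> a ^ 5 * a" "M1 * (l - 1) \<le> a ^ 4 * a"
    using a by (intro mult_le_mono m1 m3; linarith)+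
  then have "M3 * (k - 1) \<le> a ^ 6" "M1 * (l - 1) \<le> a ^ 5" by (simp_all add: eval_nat_numeral)
  then have "M3 * (k - 1) + M1 * (l - 1) + M1 \<le> a ^ 6 * 3" using m1 s by linarith
  with B have "(n + 4)\<^sup>2 * (M3 * (k - 1) + M1 * (l - 1) + M1) \<le> a ^ 2 * (a ^ 6 * 3)"
    unfolding power2_eq_square[of "n + 4"] by (intro mult_le_mono)
  then have "(n + 4)\<^sup>2 * (M3 * (k - 1) + M1 * (l - 1) + M1) \<le> a ^ 8 * 3" by (simp add: power_add[symmetric] mult.assoc[symmetric])
  then show "(n + 4)\<^sup>2 * (M3 * (k - 1) + M1 * (l - 1) + M1) + H < N" using s a unfolding N' by linarith
qed

lemma sem_setup_A:
  assumes "reg s ''n'' = n" "reg s ''k'' = k" "reg s ''l'' = l" "reg s ''M'' = M"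
    and "8 * (n * n) < M" "(n + 4) * (n + 4) < M" "label_bound d k l + 2 < M" "3 + n + n * n < M"
  shows "reg (sem (setup_A d) s) ''nn'' = n * n" "reg (sem (setup_A d) s) ''n2'' = 2 * (n * n)"
    "reg (sem (setup_A d) s) ''H'' = label_bound d k l + 2" "reg (sem (setup_A d) s) ''B'' = (n + 4)\<^sup>2"
    "reg (sem (setup_A d) s) ''fb'' = 3 + n + n * n"
proof -
  have m: "n * n mod M = n * n" "2 * (n * n) mod M = 2 * (n * n)" "(n + 4) * (n + 4) mod M = (n + 4) * (n + 4)"
    "(label_bound d k l + 2) mod M = label_bound d k l + 2" "(3 + n + n * n) mod M = 3 + n + n * n"
    by (rule mod_less, use assms in linarith)+
  show "reg (sem (setup_A d) s) ''nn'' = n * n" "reg (sem (setup_A d) s) ''n2'' = 2 * (n * n)"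
    "reg (sem (setup_A d) s) ''H'' = label_bound d k l + 2" "reg (sem (setup_A d) s) ''B'' = (n + 4)\<^sup>2"
    "reg (sem (setup_A d) s) ''fb'' = 3 + n + n * n"
    unfolding power2_eq_square
    by (simp_all only: setup_A_def sem.simps set_simps expr_val.simps apply_binop.simps fun_upd_apply
      expr_val_label_bound assms label_bound_def[symmetric] if_True if_False char.inject list.inject list.distinct simp_thms m)
qed

lemma sem_double_Q:
  assumes "reg s ''n2'' = n2" "reg s ''M'' = M" "1 \<le> n2" "2 * n2 < M" "n2 < M"
  defines "s' \<equiv> sem (LFor ''i'' ''n2'' double_Q) (set_reg ''q'' 0 (set_reg ''Q'' 1 s))"
  shows "reg s' ''Q'' = 2 ^ reg s' ''q''" "reg s' ''q'' \<le> n2" "n2 \<le> reg s' ''Q''" "reg s' ''Q'' \<le> 2 * n2"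
proof -
  \<comment> \<open>Either the target is reached, or \<open>''Q''\<close> has been doubled in every
    round and exceeds their number. So \<open>n2\<close> rounds are enough.\<close>
  let ?P = "\<lambda>j (s' :: state). reg s' ''Q'' = 2 ^ reg s' ''q'' \<and> reg s' ''q'' \<le> j \<and> (n2 \<le> reg s' ''Q'' \<or> j < reg s' ''Q'') \<and>
    reg s' ''Q'' \<le> 2 * n2"
  let ?s = "set_reg ''q'' 0 (set_reg ''Q'' 1 s)"
  have "?P (reg ?s ''n2'') s'" unfolding s'_def
  proof (rule sem_LFor[where P = ?P])
    fix j and t :: state assume j: "j < reg ?s ''n2''" and P: "?P j t"
      and t: "\<And>x. x \<notin> insert ''i'' (assigned double_Q) \<Longrightarrow> reg t x = reg ?s x"
    have r: "reg t ''n2'' = n2" "reg t ''M'' = M" using t[of "''n2''"] t[of "''M''"] assms by auto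
    have jn: "j < n2" using j assms by simp
    have q: "Suc (reg t ''q'') mod M = Suc (reg t ''q'')" "reg t ''q'' mod M = reg t ''q''"
      by (rule mod_less, use P jn assms(4,5) in linarith)+
    show "?P (Suc j) (set_reg ''i'' (Suc j) (sem double_Q t))"
    proof (cases "reg t ''Q'' < n2")
      case True
      have Q: "(reg t ''Q'' + reg t ''Q'') mod M = reg t ''Q'' + reg t ''Q''" by (rule mod_less) (use True assms(4) in linarith)
      have "reg (sem double_Q t) ''Q'' = reg t ''Q'' + reg t ''Q''" "reg (sem double_Q t) ''q'' = Suc (reg t ''q'')"
        using True Q q r by (simp_all add: double_Q_def)
      then show ?thesis using P True jn by auto
    next
      case False
      have Q: "reg t ''Q'' mod M = reg t ''Q''" by (rule mod_less) (use P assms(4) in linarith)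
      have "reg (sem double_Q t) ''Q'' = reg t ''Q''" "reg (sem double_Q t) ''q'' = reg t ''q''"
        using False Q q r by (simp_all add: double_Q_def)
      then show ?thesis using P False jn by auto
    qed
  qed (use assms in auto)
  then show "reg s' ''Q'' = 2 ^ reg s' ''q''" "reg s' ''q'' \<le> n2" "n2 \<le> reg s' ''Q''" "reg s' ''Q'' \<le> 2 * n2"
    using assms(1) by auto
qed

lemma sem_setup_B:
  assumes "reg s ''n2'' = n2" "reg s ''M'' = M" "1 \<le> n2" "2 * n2 < M" "n2 < M"
    and "2 ^ reg s ''H'' < M" "2 ^ reg s ''B'' < M"
  defines "s' \<equiv> sem setup_B s"
  shows "reg s' ''Q'' = 2 ^ reg s' ''q''" "reg s' ''q'' \<le> n2" "n2 \<le> reg s' ''Q''" "reg s' ''Q'' \<le> 2 * n2"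
    "reg s' ''T'' = 2 ^ reg s ''H''" "reg s' ''bt'' = 2 ^ reg s ''B''"
proof -
  define s1 where "s1 = sem (LFor ''i'' ''n2'' double_Q) (set_reg ''q'' 0 (set_reg ''Q'' 1 s))"
  note * = sem_double_Q[OF assms(1-5), folded s1_def]
  have M1: "1 < M" using assms by linarith
  have s': "s' = sem (pow_prog ''bt'' ''B'' (Const 2)) (sem (pow_prog ''T'' ''H'' (Const 2)) s1)"
    using M1 assms(2) by (simp add: s'_def setup_B_def s1_def)
  have r: "reg s1 x = reg s x" if "x \<notin> {''Q'', ''q'', ''i''}" for x
    unfolding s1_def using that by (subst sem_unassigned) auto
  show "reg s' ''Q'' = 2 ^ reg s' ''q''" "reg s' ''q'' \<le> n2" "n2 \<le> reg s' ''Q''" "reg s' ''Q'' \<le> 2 * n2"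
    unfolding s' using * by (simp_all add: sem_unassigned)
  have "reg (sem (pow_prog ''T'' ''H'' (Const 2)) s1) ''T'' = 2 ^ reg s1 ''H'' mod reg s1 ''M''"
    by (rule sem_pow_prog) (use r M1 assms in auto)
  then show "reg s' ''T'' = 2 ^ reg s ''H''"
    unfolding s' using r assms by (simp add: sem_unassigned)
  let ?s2 = "sem (pow_prog ''T'' ''H'' (Const 2)) s1"
  have "reg (sem (pow_prog ''bt'' ''B'' (Const 2)) ?s2) ''bt'' = 2 ^ reg ?s2 ''B'' mod reg ?s2 ''M''"
    by (rule sem_pow_prog) (use r M1 assms in \<open>auto simp: sem_unassigned\<close>)
  then show "reg s' ''bt'' = 2 ^ reg s ''B''"
    unfolding s' using r assms by (simp add: sem_unassigned)
qed

lemma sem_setup_C: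
  assumes "reg s ''n'' = n" "reg s ''nn'' = n * n" "reg s ''k'' = k" "reg s ''l'' = l" "reg s ''M'' = M"
    "reg s ''Q'' = Q" "reg s ''q'' = q" "reg s ''H'' = H"
    and "M1 = n * Q" "M3 = M1 * (n + 1)" "R = d + n * n * H + n * n * q" "X = M3 * (k - 1) + M1 * (l - 1)"
    and "M1 < M" "M3 < M" "R < M" "X < M"
  shows "reg (sem (setup_C d) s) ''M1'' = M1" "reg (sem (setup_C d) s) ''M3'' = M3"
    "reg (sem (setup_C d) s) ''R'' = R" "reg (sem (setup_C d) s) ''X'' = X"
proof -
  have m: "n * Q mod M = M1" "M1 * (n + 1) mod M = M3" "(d + n * n * H + n * n * q) mod M = R"
    "(M3 * (k - 1) + M1 * (l - 1)) mod M = X"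
    using assms(9-16) by simp_all
  show "reg (sem (setup_C d) s) ''M1'' = M1" "reg (sem (setup_C d) s) ''M3'' = M3"
    "reg (sem (setup_C d) s) ''R'' = R" "reg (sem (setup_C d) s) ''X'' = X"
    by (simp_all only: setup_C_def sem.simps set_simps expr_val.simps apply_binop.simps fun_upd_apply
      assms(1-8) if_True if_False char.inject list.inject list.distinct simp_thms m)
qed

lemma sem_setup_D:
  assumes "reg s ''bt'' = b" "reg s ''M'' = M" "1 < M"
  shows "reg (sem setup_D s) ''zb'' = b ^ reg s ''M1'' mod M" "reg (sem setup_D s) ''xb'' = b ^ reg s ''M3'' mod M"
    "reg (sem setup_D s) ''dv'' = b ^ reg s ''X'' mod M" "reg (sem setup_D s) ''i'' = 0"
proof -
  let ?p1 = "pow_prog ''zb'' ''M1'' (Reg ''bt'')" and ?p2 = "pow_prog ''xb'' ''M3'' (Reg ''bt'')"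
    and ?p3 = "pow_prog ''dv'' ''X'' (Reg ''bt'')"
  have "reg (sem ?p1 s) ''zb'' = b ^ reg s ''M1'' mod reg s ''M''"
    by (rule sem_pow_prog) (use assms in auto)
  then show "reg (sem setup_D s) ''zb'' = b ^ reg s ''M1'' mod M"
    using assms by (simp add: setup_D_def sem_unassigned)
  have "reg (sem ?p2 (sem ?p1 s)) ''xb'' = b ^ reg (sem ?p1 s) ''M3'' mod reg (sem ?p1 s) ''M''"
    by (rule sem_pow_prog) (use assms in \<open>auto simp: sem_unassigned\<close>)
  then show "reg (sem setup_D s) ''xb'' = b ^ reg s ''M3'' mod M"
    using assms by (simp add: setup_D_def sem_unassigned)
  have "reg (sem ?p3 (sem ?p2 (sem ?p1 s))) ''dv'' = b ^ reg (sem ?p2 (sem ?p1 s)) ''X'' mod reg (sem ?p2 (sem ?p1 s)) ''M''"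
    by (rule sem_pow_prog) (use assms in \<open>auto simp: sem_unassigned\<close>)
  then show "reg (sem setup_D s) ''dv'' = b ^ reg s ''X'' mod M" "reg (sem setup_D s) ''i'' = 0"
    using assms by (simp_all add: setup_D_def sem_unassigned)
qed

section \<open>The main loop\<close>

abbreviation in_Y :: "expr \<Rightarrow> expr" where
  "in_Y v \<equiv> Load (Bin Add (Reg ''fb'') (Load (Bin Add (Const 3) v)))"

abbreviation e_not :: "expr \<Rightarrow> expr" where "e_not e \<equiv> Bin Sub (Const 1) e"

abbreviation pair_expr :: "expr \<Rightarrow> expr \<Rightarrow> expr" where
  "pair_expr v w \<equiv> Bin Add (Bin Mul v (Reg ''n'')) w"

text \<open>The truncated differences form minimum and maximum, so that both directions of an edge
  share one label and one weight.\<close>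

abbreviation edge_expr :: "expr \<Rightarrow> expr \<Rightarrow> expr" where
  "edge_expr v w \<equiv> pair_expr (Bin Sub v (Bin Sub v w)) (Bin Add w (Bin Sub v w))"

definition sign_prog :: "nat \<Rightarrow> expr \<Rightarrow> lp" where
  "sign_prog d u = LSeq (LAssign ''y'' (Const 0)) (LSeq (LAssign ''u'' (Reg ''t''))
    (LSeq (LFor ''j'' ''H'' (LSeq
        (LAssign ''y'' (Bin Add (Reg ''y'') (Bin Mul
          (Load (Bin Add (Reg ''fb'') (Bin Add (Bin Add (Const d) (Bin Mul u (Reg ''H''))) (Reg ''j''))))
          (Bin Mod (Reg ''u'') (Const 2)))))
        (LAssign ''u'' (Bin Div (Reg ''u'') (Const 2)))))
    (LAssign ''y'' (Bin Mul (Const 2) (Bin Mod (Reg ''y'') (Const 2))))))"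

abbreviation wt_bit :: "nat \<Rightarrow> expr \<Rightarrow> expr" where
  "wt_bit d u \<equiv> Load (Bin Add (Reg ''fb'') (Bin Add (Bin Add (Bin Add (Const d)
     (Bin Mul (Reg ''nn'') (Reg ''H''))) (Bin Mul u (Reg ''q''))) (Reg ''s'')))"

text \<open>One round of square and multiply over the bits of the random weight. Only the power of
  two with the weight in its exponent is formed, never the weight itself.\<close>

definition square_prog :: "nat \<Rightarrow> expr \<Rightarrow> lp" where
  "square_prog d u = LSeq
     (LAssign ''x'' (Bin Mul (Reg ''x'') (Bin Add (e_not (wt_bit d u)) (Bin Mul (wt_bit d u) (Reg ''z'')))))
     (LAssign ''z'' (Bin Mul (Reg ''z'') (Reg ''z'')))"

definition edge_prog :: "nat \<Rightarrow> expr \<Rightarrow> expr \<Rightarrow> lp" where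
  "edge_prog d v w = LSeq (sign_prog d (edge_expr v w))
    (LSeq (LAssign ''y'' (Bin Add (e_not (Bin Mul (e_not (in_Y v)) (e_not (in_Y w))))
      (Bin Mul (Bin Mul (e_not (in_Y v)) (e_not (in_Y w))) (Reg ''y''))))
    (LSeq (LAssign ''x'' (Reg ''xb'')) (LSeq (LAssign ''z'' (Reg ''bt''))
    (LSeq (LFor ''s'' ''q'' (square_prog d (edge_expr v w)))
    (LAssign ''x'' (Bin Mul (Bin Mul (Reg ''x'') (Reg ''y''))
      (Load (Bin Add (Bin Add (Const 3) (Reg ''n'')) (pair_expr v w)))))))))"

lemma edge_static [simp]:
  "assigned (sign_prog d u) = {''y'', ''u'', ''j''}" "\<not> stores (sign_prog d u)"
  "loop_bounds (sign_prog d u) = {''H''}" "counters_ok (sign_prog d u)"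
  "assigned (square_prog d u) = {''x'', ''z''}" "\<not> stores (square_prog d u)"
  "loop_bounds (square_prog d u) = {}" "counters_ok (square_prog d u)"
  "assigned (edge_prog d v w) = {''x'', ''y'', ''z'', ''u'', ''j'', ''s''}" "\<not> stores (edge_prog d v w)"
  "loop_bounds (edge_prog d v w) = {''H'', ''q''}" "counters_ok (edge_prog d v w)"
  by (auto simp: sign_prog_def square_prog_def edge_prog_def)

text \<open>The register \<open>''e''\<close> enumerates pairs as \<open>p * n + v\<close>, for
  walks at \<open>v\<close> that were entered from \<open>p\<close>.\<close>

definition p_expr :: expr where "p_expr = Bin Div (Reg ''e'') (Reg ''n'')"
definition v_expr :: expr where "v_expr = Bin Mod (Reg ''e'') (Reg ''n'')"

abbreviation table_expr :: "expr \<Rightarrow> expr \<Rightarrow> expr" where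
  "table_expr i u \<equiv> Bin Add (Bin Add (Bin Add (Reg ''fb'') (Reg ''R'')) (Bin Mul i (Reg ''nn''))) u"

text \<open>The tests \<open>w \<noteq> p\<close>, \<open>w \<noteq> r\<close> and
  \<open>v \<noteq> r\<close> enter as factors 0 or 1: no turning back, and no use of the
  root.\<close>

definition fold_prog :: "nat \<Rightarrow> lp" where
  "fold_prog d = LSeq (edge_prog d v_expr (Reg ''w''))
    (LAssign ''a'' (Bin Add (Reg ''a'') (Bin Mul (Bin Add (Const 1) (Reg ''a''))
      (Bin Mul (Bin Mul (Reg ''x'') (Load (table_expr (Reg ''i'') (pair_expr v_expr (Reg ''w'')))))
        (Bin Mul (e_not (Bin Equal (Reg ''w'') p_expr))
          (Bin Mul (e_not (Bin Equal (Reg ''w'') (Reg ''r''))) (e_not (Bin Equal v_expr (Reg ''r'')))))))))"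

definition cell_prog :: "nat \<Rightarrow> lp" where
  "cell_prog d = LSeq (LAssign ''a'' (Const 0)) (LSeq (LFor ''w'' ''n'' (fold_prog d))
    (LSeq (sign_prog d (pair_expr v_expr v_expr))
    (LStore (table_expr (Bin Add (Reg ''i'') (Const 1)) (Reg ''e''))
      (Bin Mul (Bin Add (Bin Mul (in_Y v_expr) (Reg ''y'')) (e_not (in_Y v_expr)))
        (Bin Add (Reg ''a'') (Bin Mul (Reg ''zb'') (Bin Add (in_Y v_expr) (Bin Mul (e_not (in_Y v_expr)) (Reg ''y'')))))))))"

text \<open>Layer 0 is never written; its cells hold 0, the value of walks of depth 0. The other
  layers are overwritten for every root and every \<open>t\<close>, so the table stays
  polynomial.\<close>

definition table_prog :: "nat \<Rightarrow> lp" where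
  "table_prog d = LFor ''i'' ''k'' (LFor ''e'' ''nn'' (cell_prog d))"

definition root_prog :: "nat \<Rightarrow> lp" where
  "root_prog d = LSeq (edge_prog d (Reg ''r'') (Reg ''w''))
    (LAssign ''S'' (Bin Add (Reg ''S'') (Bin Mul (Reg ''x'')
      (Load (table_expr (Reg ''k'') (pair_expr (Reg ''r'') (Reg ''w'')))))))"

definition total_prog :: "nat \<Rightarrow> lp" where
  "total_prog d = LFor ''t'' ''T'' (LSeq (table_prog d) (LFor ''w'' ''n'' (root_prog d)))"

text \<open>Bit \<open>H\<close> of the lowest block is tested because the sum over all
  \<open>t\<close> carries the factor \<open>2 ^ H\<close>. Then the block of the next weight is
  shifted into place. Once set, the result stays set.\<close>

definition digit_prog :: lp where
  "digit_prog = LSeq (LAssign ''result'' (Bin Add (Reg ''result'') (Bin Mul (e_not (Reg ''result''))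
      (Bin Mod (Bin Div (Reg ''D'') (Reg ''T'')) (Const 2)))))
    (LAssign ''D'' (Bin Div (Reg ''D'') (Reg ''bt'')))"

definition main_prog :: "nat \<Rightarrow> lp" where
  "main_prog d = LFor ''r'' ''n'' (LSeq (LAssign ''S'' (Const 0)) (LSeq (total_prog d)
    (LSeq (LAssign ''D'' (Bin Div (Reg ''S'') (Reg ''dv''))) (LFor ''c'' ''M1'' digit_prog))))"

lemma main_static [simp]:
  "expr_regs p_expr = {''e'', ''n''}" "expr_regs v_expr = {''e'', ''n''}"
  "assigned (fold_prog d) = {''x'', ''y'', ''z'', ''u'', ''j'', ''s'', ''a''}" "\<not> stores (fold_prog d)"
  "loop_bounds (fold_prog d) = {''H'', ''q''}" "counters_ok (fold_prog d)"
  "assigned (cell_prog d) = {''x'', ''y'', ''z'', ''u'', ''j'', ''s'', ''a'', ''w''}"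
  "loop_bounds (cell_prog d) = {''H'', ''q'', ''n''}" "counters_ok (cell_prog d)"
  "assigned (table_prog d) = {''x'', ''y'', ''z'', ''u'', ''j'', ''s'', ''a'', ''w'', ''e'', ''i''}"
  "loop_bounds (table_prog d) = {''H'', ''q'', ''n'', ''k'', ''nn''}" "counters_ok (table_prog d)"
  "assigned (root_prog d) = {''x'', ''y'', ''z'', ''u'', ''j'', ''s'', ''S''}" "\<not> stores (root_prog d)"
  "loop_bounds (root_prog d) = {''H'', ''q''}" "counters_ok (root_prog d)"
  "assigned (total_prog d) = {''x'', ''y'', ''z'', ''u'', ''j'', ''s'', ''a'', ''w'', ''e'', ''i'', ''S'', ''t''}"
  "loop_bounds (total_prog d) = {''H'', ''q'', ''n'', ''k'', ''nn'', ''T''}" "counters_ok (total_prog d)"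
  "assigned digit_prog = {''result'', ''D''}" "\<not> stores digit_prog" "counters_ok digit_prog"
  "loop_bounds digit_prog = {}"
  "assigned (main_prog d) = {''x'', ''y'', ''z'', ''u'', ''j'', ''s'', ''a'', ''w'', ''e'', ''i'', ''S'', ''t'', ''result'', ''D'', ''c'', ''r''}"
  "loop_bounds (main_prog d) = {''H'', ''q'', ''n'', ''k'', ''nn'', ''T'', ''M1''}" "counters_ok (main_prog d)"
  by (auto simp: p_expr_def v_expr_def fold_prog_def cell_prog_def table_prog_def root_prog_def total_prog_def
    digit_prog_def main_prog_def)

section \<open>Correctness of the main loop\<close>

lemma expr_val_unassigned:
  assumes "expr_regs e \<inter> A = {}" "\<And>x. x \<notin> A \<Longrightarrow> reg s' x = reg s x" "mem s' = mem s"
  shows "expr_val e s' = expr_val e s"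
  by (rule expr_val_cong) (use assms in blast)+

text \<open>\<open>digits\<close> puts every digit that is read below bit \<open>N\<close> of the
  modulus, and \<open>memory\<close> keeps the whole table within the addresses that are not wrapped
  around.\<close>

locale kl_run = simple_graph n E for n E +
  fixes d k l H q R B M1 M3 N M :: nat and c :: "nat \<Rightarrow> nat" and \<omega> :: "nat set"
  assumes c_less: "v < n \<Longrightarrow> c v < d"
    and R: "R = d + n * n * H + n * n * q"
    and memory: "(3 + n + n * n) + R + (k + 1) * (n * n) < N"
    and digits: "B * (M3 * (k - 1) + M1 * (l - 1) + M1) + H < N"
    and small: "n < N" "B < N" "8 * (n * n) < N" "M1 < N"
    and M: "M = 2 ^ N"
begin

definition env_regs :: "string set" where
  "env_regs = {''n'', ''nn'', ''k'', ''H'', ''q'', ''T'', ''bt'', ''M1'', ''R'', ''fb'', ''zb'', ''xb'', ''dv'', ''M'', ''N''}"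

text \<open>The relation between the machine state and the objects of the proof. The last clause is
  layer 0 of the table.\<close>

definition env :: "state \<Rightarrow> bool" where
  "env s \<longleftrightarrow> reg s ''n'' = n \<and> reg s ''nn'' = n * n \<and> reg s ''k'' = k \<and> reg s ''H'' = H \<and> reg s ''q'' = q
    \<and> reg s ''T'' = 2 ^ H \<and> reg s ''bt'' = 2 ^ B \<and> reg s ''M1'' = M1 \<and> reg s ''R'' = R \<and> reg s ''fb'' = 3 + n + n * n
    \<and> reg s ''zb'' = 2 ^ (B * M1) mod M \<and> reg s ''xb'' = 2 ^ (B * M3) mod M
    \<and> reg s ''dv'' = 2 ^ (B * (M3 * (k - 1) + M1 * (l - 1))) \<and> reg s ''M'' = M \<and> reg s ''N'' = N
    \<and> (\<forall>v<n. mem s (3 + v) = c v) \<and> (\<forall>v<n. \<forall>w<n. mem s (3 + n + (v * n + w)) = of_bool (E v w))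
    \<and> (\<forall>m<R. mem s (3 + n + n * n + m) = of_bool (m \<in> \<omega>))
    \<and> (\<forall>m<n * n. mem s (3 + n + n * n + R + m) = 0)"

lemma pair_less: "v < n \<Longrightarrow> w < n \<Longrightarrow> v * n + w < n * n"
  using mult_le_mono1[of "Suc v" n n] by simp

lemma env_cong:
  assumes "env s" "\<And>x. x \<in> env_regs \<Longrightarrow> reg s' x = reg s x"
    and mem: "\<And>a. a < 3 + n + n * n + R + n * n \<Longrightarrow> mem s' a = mem s a"
  shows "env s'"
proof -
  have 1: "mem s' (3 + v) = mem s (3 + v)" if "v < n" for v using that by (intro mem) linarith
  have 2: "mem s' (3 + n + (v * n + w)) = mem s (3 + n + (v * n + w))" if "v < n" "w < n" for v w
    using pair_less[OF that] by (intro mem) linarith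
  have 3: "mem s' (3 + n + n * n + m) = mem s (3 + n + n * n + m)" if "m < R" for m using that by (intro mem) linarith
  have 4: "mem s' (3 + n + n * n + R + m) = mem s (3 + n + n * n + R + m)" if "m < n * n" for m
    using that by (intro mem) linarith
  have r: "reg s' ''n'' = reg s ''n''" "reg s' ''nn'' = reg s ''nn''" "reg s' ''k'' = reg s ''k''"
    "reg s' ''H'' = reg s ''H''" "reg s' ''q'' = reg s ''q''" "reg s' ''T'' = reg s ''T''"
    "reg s' ''bt'' = reg s ''bt''" "reg s' ''M1'' = reg s ''M1''" "reg s' ''R'' = reg s ''R''"
    "reg s' ''fb'' = reg s ''fb''" "reg s' ''zb'' = reg s ''zb''" "reg s' ''xb'' = reg s ''xb''"
    "reg s' ''dv'' = reg s ''dv''" "reg s' ''M'' = reg s ''M''" "reg s' ''N'' = reg s ''N''"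
    by (rule assms(2), simp add: env_regs_def)+
  show ?thesis using assms(1) unfolding env_def r
    by (elim conjE, intro conjI allI impI; (assumption | simp only: 1 2 3 4 simp_thms))
qed

lemma env_sem: "env s \<Longrightarrow> assigned p \<inter> env_regs = {} \<Longrightarrow> \<not> stores p \<Longrightarrow> env (sem p s)"
  by (rule env_cong[of s]) (auto simp: sem_mem intro: sem_unassigned)

lemma env_set_reg: "env s \<Longrightarrow> x \<notin> env_regs \<Longrightarrow> env (set_reg x v s)"
  by (rule env_cong[of s]) auto

lemma env_rules:
  assumes "env s"
  shows "reg s ''n'' = n" "reg s ''nn'' = n * n" "reg s ''k'' = k" "reg s ''H'' = H" "reg s ''q'' = q"
    "reg s ''T'' = 2 ^ H" "reg s ''bt'' = 2 ^ B" "reg s ''M1'' = M1" "reg s ''R'' = R" "reg s ''fb'' = 3 + n + n * n"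
    "reg s ''zb'' = 2 ^ (B * M1) mod M" "reg s ''xb'' = 2 ^ (B * M3) mod M"
    "reg s ''dv'' = 2 ^ (B * (M3 * (k - 1) + M1 * (l - 1)))" "reg s ''M'' = M" "reg s ''N'' = N"
  using assms unfolding env_def by blast+

lemma env_mem:
  assumes "env s"
  shows "v < n \<Longrightarrow> mem s (3 + v) = c v" "v < n \<Longrightarrow> w < n \<Longrightarrow> mem s (3 + n + (v * n + w)) = of_bool (E v w)"
    "m < R \<Longrightarrow> mem s (3 + n + n * n + m) = of_bool (m \<in> \<omega>)"
    "m < n * n \<Longrightarrow> mem s (3 + n + n * n + R + m) = 0"
proof -
  have 1: "\<forall>v<n. mem s (3 + v) = c v" using assms unfolding env_def by (elim conjE)
  have 2: "\<forall>v<n. \<forall>w<n. mem s (3 + n + (v * n + w)) = of_bool (E v w)" using assms unfolding env_def by (elim conjE)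
  have 3: "\<forall>m<R. mem s (3 + n + n * n + m) = of_bool (m \<in> \<omega>)" using assms unfolding env_def by (elim conjE)
  have 4: "\<forall>m<n * n. mem s (3 + n + n * n + R + m) = 0" using assms unfolding env_def by (elim conjE)
  show "v < n \<Longrightarrow> mem s (3 + v) = c v" by (rule 1[rule_format])
  show "v < n \<Longrightarrow> w < n \<Longrightarrow> mem s (3 + n + (v * n + w)) = of_bool (E v w)" by (rule 2[rule_format])
  show "m < R \<Longrightarrow> mem s (3 + n + n * n + m) = of_bool (m \<in> \<omega>)" by (rule 3[rule_format])
  show "m < n * n \<Longrightarrow> mem s (3 + n + n * n + R + m) = 0" by (rule 4[rule_format])
qed

lemma M_gt: "x < N \<Longrightarrow> x < M"
  unfolding M using less_exp[of N] by linarith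

lemma M_two: "2 < M" "2 dvd M"
proof -
  have N: "3 < N" using memory by linarith
  show "2 < M" by (rule M_gt) (use N in linarith)
  show "2 dvd M" unfolding M using N by (intro dvd_power) simp
qed

lemma HT: "2 ^ H < M" "2 ^ B < M"
proof -
  have "H < N" using digits by linarith
  then show "2 ^ H < M" unfolding M by (rule power_strict_increasing) simp
  show "2 ^ B < M" unfolding M by (rule power_strict_increasing[OF small(2)]) simp
qed

abbreviation "Y \<equiv> coin_Y n c \<omega>"
abbreviation "vb \<equiv> coin_vb d n H \<omega>"
abbreviation "wt \<equiv> coin_wt d n H q \<omega>"
abbreviation "h \<equiv> pack_weight Y vb H wt B M1 M3"

lemma expr_val_in_Y:
  assumes s: "env s" and v: "expr_val v s = v0" "v0 < n"
  shows "expr_val (in_Y v) s = of_bool (v0 \<in> Y)"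
proof -
  have "c v0 < R" using c_less[OF v(2)] R by linarith
  then have "mem s (3 + n + n * n + c v0) = of_bool (c v0 \<in> \<omega>)" by (rule env_mem(3)[OF s])
  then show ?thesis using v env_mem(1)[OF s v(2)] env_rules(10)[OF s]
    by (simp only: expr_val.simps apply_binop.simps coin_Y_def mem_Collect_eq simp_thms)
qed

lemma sem_sign_prog:
  assumes s: "env s" and t: "reg s ''t'' = t" "t < 2 ^ H" and u: "expr_regs u \<inter> {''y'', ''u'', ''j''} = {}"
    and i: "expr_val u s = pair_id n i" "fst i < n" "snd i < n"
  shows "reg (sem (sign_prog d u) s) ''y'' = sign_factor vb H t i"
proof -
  let ?bit = "Load (Bin Add (Reg ''fb'') (Bin Add (Bin Add (Const d) (Bin Mul u (Reg ''H''))) (Reg ''j'')))"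
  let ?body = "LSeq (LAssign ''y'' (Bin Add (Reg ''y'') (Bin Mul ?bit (Bin Mod (Reg ''u'') (Const 2)))))
        (LAssign ''u'' (Bin Div (Reg ''u'') (Const 2)))"
  define s1 where "s1 = set_reg ''u'' t (set_reg ''y'' 0 s)"
  have tM: "t < M" using t(2) HT by linarith
  let ?f = "\<lambda>j. \<Sum>j'<j. of_bool (vb i j') * digit t j'"
  let ?P = "\<lambda>j (s' :: state). mem s' = mem s \<and> reg s' ''u'' = t div 2 ^ j \<and> reg s' ''y'' = ?f j mod M"
  define s2 where "s2 = sem (LFor ''j'' ''H'' ?body) s1"
  have "?P (reg s1 ''H'') s2" unfolding s2_def
  proof (rule sem_LFor[where P = ?P])
    fix j and s' :: state assume j: "j < reg s1 ''H''" and P: "?P j s'" and rj: "reg s' ''j'' = j"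
      and s': "\<And>x. x \<notin> insert ''j'' (assigned ?body) \<Longrightarrow> reg s' x = reg s1 x"
    have jH: "j < H" using j env_rules(4)[OF s] by (simp add: s1_def)
    have keep: "reg s' x = reg s x" if "x \<notin> {''y'', ''u'', ''j''}" for x
      using s'[of x] that by (simp add: s1_def)
    have ms: "mem s' = mem s" using P by blast
    have u': "expr_val u s' = pair_id n i" unfolding i(1)[symmetric]
      by (rule expr_val_unassigned[OF u _ ms], rule keep)
    have r: "reg s' ''fb'' = 3 + n + n * n" "reg s' ''H'' = H" "reg s' ''M'' = M"
      using s'[of "''fb''"] s'[of "''H''"] s'[of "''M''"] env_rules[OF s] by (simp_all add: s1_def)
    have "pair_id n i * H + j < n * n * H"
    proof -
      have "Suc (pair_id n i) \<le> n * n" using pair_less[OF i(2,3)] by (simp add: pair_id_def)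
      then have "Suc (pair_id n i) * H \<le> n * n * H" by (rule mult_le_mono1)
      then show ?thesis using jH by simp
    qed
    then have "d + pair_id n i * H + j < R" using R by linarith
    from env_mem(3)[OF s this]
    have bit: "expr_val ?bit s' = of_bool (vb i j)"
      using P r u' rj by (simp only: expr_val.simps apply_binop.simps coin_vb_def)
    have "t div 2 ^ j div 2 < M" using tM by (meson div_le_dividend le_less_trans)
    then have U: "t div 2 ^ j div 2 mod M = t div 2 ^ Suc j"
      using div_mult2_eq[of t "2 ^ j" 2] by (simp add: mult.commute)
    have e1: "reg (sem ?body s') ''u'' = t div 2 ^ Suc j"
      using U P r by simp
    have e2: "reg (sem ?body s') ''y'' = (?f j mod M + of_bool (vb i j) * (t div 2 ^ j mod 2)) mod M"
      using bit P r by simp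
    have "(?f j mod M + of_bool (vb i j) * (t div 2 ^ j mod 2)) mod M = ?f (Suc j) mod M"
      by (simp add: mod_add_left_eq digit_def)
    then show "?P (Suc j) (set_reg ''j'' (Suc j) (sem ?body s'))" using e1 e2 P by simp
  qed (use tM in \<open>auto simp: s1_def\<close>)
  moreover have "reg s1 ''H'' = H" "reg s2 ''M'' = M"
    using env_rules[OF s] by (simp_all add: s1_def s2_def sem_unassigned del: sem.simps)
  moreover have "sem (sign_prog d u) s
      = sem (LAssign ''y'' (Bin Mul (Const 2) (Bin Mod (Reg ''y'') (Const 2)))) s2"
    using tM t env_rules(14)[OF s] by (simp add: sign_prog_def s1_def s2_def del: sem.simps(4))
  \<comment> \<open>The modulus is even, so the reductions have not disturbed the parity.\<close>
  moreover have "?f H mod M mod 2 = ?f H mod 2" using M_two(2) by (rule mod_mod_cancel)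
  moreover have "2 * (?f H mod 2) mod M = 2 * (?f H mod 2)" using M_two(1) by (intro mod_less) presburger
  ultimately show ?thesis by (simp add: sign_factor_def)
qed

lemma sem_edge_prog:
  assumes s: "env s" and t: "reg s ''t'' = t" "t < 2 ^ H"
    and vw: "(expr_regs v \<union> expr_regs w) \<inter> {''x'', ''y'', ''z'', ''u'', ''j'', ''s''} = {}"
    and v: "expr_val v s = v0" "v0 < n" and w: "expr_val w s = w0" "w0 < n"
  shows "reg (sem (edge_prog d v w) s) ''x'' = of_bool (E v0 w0) * h t (edge v0 w0) mod M"
proof -
  let ?i = "(min v0 w0, max v0 w0)" and ?u = "edge_expr v w"
  have vw_val: "expr_val v s' = v0" "expr_val w s' = w0"
    if "mem s' = mem s" "\<And>x. x \<notin> {''x'', ''y'', ''z'', ''u'', ''j'', ''s''} \<Longrightarrow> reg s' x = reg s x" for s'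
  proof -
    have "expr_regs v \<inter> {''x'', ''y'', ''z'', ''u'', ''j'', ''s''} = {}" "expr_regs w \<inter> {''x'', ''y'', ''z'', ''u'', ''j'', ''s''} = {}"
      using vw by blast+
    note this[THEN expr_val_unassigned]
    then show "expr_val v s' = v0" "expr_val w s' = w0"
      unfolding v(1)[symmetric] w(1)[symmetric] using that by blast+
  qed
  have minmax: "v0 - (v0 - w0) = min v0 w0" "w0 + (v0 - w0) = max v0 w0" by (auto simp: min_def max_def)
  have u_val: "expr_val ?u s' = pair_id n ?i"
    if "mem s' = mem s" "env s'" "\<And>x. x \<notin> {''x'', ''y'', ''z'', ''u'', ''j'', ''s''} \<Longrightarrow> reg s' x = reg s x" for s'
  proof -
    have "expr_val v s' = v0" "expr_val w s' = w0" by (rule vw_val[OF that(1)], rule that(3), assumption)+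
    then show ?thesis using env_rules(1)[OF that(2)]
      by (simp only: expr_val.simps apply_binop.simps minmax pair_id_def fst_conv snd_conv)
  qed
  let ?g = "of_bool (v0 \<notin> Y) * of_bool (w0 \<notin> Y) :: nat"
  define s1 where "s1 = sem (sign_prog d ?u) s"
  have s1: "env s1" "mem s1 = mem s" "\<And>x. x \<notin> {''x'', ''y'', ''z'', ''u'', ''j'', ''s''} \<Longrightarrow> reg s1 x = reg s x"
    unfolding s1_def by (auto intro!: env_sem[OF s] simp: sem_mem sem_unassigned env_regs_def)
  have y1: "reg s1 ''y'' = sign_factor vb H t ?i" unfolding s1_def
    by (rule sem_sign_prog[OF s t]) (use vw u_val[OF refl s] v w in auto)
  define y where "y = (1 - ?g) + ?g * sign_factor vb H t ?i"
  have "sign_factor vb H t ?i < M" unfolding sign_factor_def using M_two(1) by presburger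
  then have yM: "y < M" using M_two by (auto simp: y_def)
  define s2 where "s2 = set_reg ''z'' (2 ^ B) (set_reg ''x'' (2 ^ (B * M3) mod M) (set_reg ''y'' y s1))"
  have in_Y: "expr_val (in_Y v) s1 = of_bool (v0 \<in> Y)" "expr_val (in_Y w) s1 = of_bool (w0 \<in> Y)"
    by (rule expr_val_in_Y[OF s1(1)]; use vw_val[OF s1(2,3)] v w in simp)+
  have s2: "env s2" unfolding s2_def by (intro env_set_reg s1) (auto simp: env_regs_def)
  have s2': "mem s2 = mem s" "\<And>x. x \<notin> {''x'', ''y'', ''z'', ''u'', ''j'', ''s''} \<Longrightarrow> reg s2 x = reg s x"
    using s1 by (auto simp: s2_def)
  define s3 where "s3 = sem (LFor ''s'' ''q'' (square_prog d ?u)) s2"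
  have sq: "sem (edge_prog d v w) s = sem (LAssign ''x'' (Bin Mul (Bin Mul (Reg ''x'') (Reg ''y''))
      (Load (Bin Add (Bin Add (Const 3) (Reg ''n'')) (pair_expr v w))))) s3"
  proof -
    have "sem (LAssign ''y'' (Bin Add (e_not (Bin Mul (e_not (in_Y v)) (e_not (in_Y w))))
      (Bin Mul (Bin Mul (e_not (in_Y v)) (e_not (in_Y w))) (Reg ''y'')))) s1 = set_reg ''y'' y s1"
    proof -
      have "expr_val (Bin Add (e_not (Bin Mul (e_not (in_Y v)) (e_not (in_Y w))))
        (Bin Mul (Bin Mul (e_not (in_Y v)) (e_not (in_Y w))) (Reg ''y''))) s1 = y"
        using in_Y y1 unfolding expr_val.simps(4) apply_binop.simps y_def by (simp add: of_bool_def)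
      then show ?thesis using yM env_rules(14)[OF s1(1)] by (simp only: sem.simps mod_less)
    qed
    then show ?thesis
      using env_rules[OF s1(1)] HT
      by (simp add: edge_prog_def s1_def[symmetric] s3_def s2_def del: sem.simps(4) expr_val.simps(3,4))
  qed
  \<comment> \<open>The part of the edge weight given by its \<open>j\<close> lowest bits.\<close>
  let ?blk = "\<lambda>j. \<Sum>m<j. of_bool (d + n * n * H + pair_id n ?i * q + m \<in> \<omega>) * 2 ^ m :: nat"
  let ?P = "\<lambda>j (s' :: state). mem s' = mem s \<and> reg s' ''z'' = 2 ^ (B * 2 ^ j) mod M \<and>
      reg s' ''x'' = 2 ^ (B * (M3 + ?blk j)) mod M \<and> env s'"
  have "?P (reg s2 ''q'') s3" unfolding s3_def
  proof (rule sem_LFor[where P = ?P])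
    fix j and s' :: state assume j: "j < reg s2 ''q''" and P: "?P j s'" and rj: "reg s' ''s'' = j"
      and s': "\<And>x. x \<notin> insert ''s'' (assigned (square_prog d ?u)) \<Longrightarrow> reg s' x = reg s2 x"
    have es: "env s'" and ms: "mem s' = mem s" using P by auto
    have jq: "j < q" using j env_rules(5)[OF s2] by simp
    have u': "expr_val ?u s' = pair_id n ?i" by (rule u_val[OF ms es]) (use s' s2' in auto)
    have "pair_id n ?i * q + j < n * n * q"
    proof -
      have "Suc (pair_id n ?i) \<le> n * n" using pair_less[of "min v0 w0" "max v0 w0"] v(2) w(2)
        by (simp only: pair_id_def fst_conv snd_conv Suc_le_eq min_less_iff_disj max_less_iff_conj simp_thms)
      then have "Suc (pair_id n ?i) * q \<le> n * n * q" by (rule mult_le_mono1)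
      then show ?thesis using jq by simp
    qed
    then have "d + n * n * H + pair_id n ?i * q + j < R" using R by linarith
    from env_mem(3)[OF es this]
    have bit: "expr_val (wt_bit d ?u) s' = of_bool (d + n * n * H + pair_id n ?i * q + j \<in> \<omega>)"
      using env_rules[OF es] u' rj by (simp only: expr_val.simps apply_binop.simps)
    let ?b = "of_bool (d + n * n * H + pair_id n ?i * q + j \<in> \<omega>) :: nat"
    have "reg (sem (square_prog d ?u) s') ''x''
        = (2 ^ (B * (M3 + ?blk j)) mod M * ((1 - ?b) + ?b * (2 ^ (B * 2 ^ j) mod M))) mod M"
      using P bit env_rules(14)[OF es] unfolding square_prog_def
      by (simp only: sem.simps set_simps expr_val.simps(1,2,4) apply_binop.simps fun_upd_apply
        char.inject list.inject list.distinct simp_thms if_True if_False)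
    also have "\<dots> = 2 ^ (B * (M3 + ?blk (Suc j))) mod M"
      by (cases "d + n * n * H + pair_id n ?i * q + j \<in> \<omega>") (simp_all add: mod_mult_eq power_add[symmetric] distrib_left add_ac)
    finally have x: "reg (sem (square_prog d ?u) s') ''x'' = 2 ^ (B * (M3 + ?blk (Suc j))) mod M" .
    have "reg (sem (square_prog d ?u) s') ''z'' = (2 ^ (B * 2 ^ j) mod M) * (2 ^ (B * 2 ^ j) mod M) mod M"
      using P env_rules(14)[OF es] unfolding square_prog_def
      by (simp only: sem.simps set_simps expr_val.simps(1,2,4) apply_binop.simps fun_upd_apply
        char.inject list.inject list.distinct simp_thms if_True if_False)
    also have "\<dots> = 2 ^ (B * 2 ^ Suc j) mod M" by (simp add: mod_mult_eq power_add[symmetric] mult_2[symmetric] mult.left_commute)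
    finally have z: "reg (sem (square_prog d ?u) s') ''z'' = 2 ^ (B * 2 ^ Suc j) mod M" .
    have "env (set_reg ''s'' (Suc j) (sem (square_prog d ?u) s'))"
      by (intro env_set_reg env_sem es) (auto simp: env_regs_def)
    then show "?P (Suc j) (set_reg ''s'' (Suc j) (sem (square_prog d ?u) s'))"
      using x z ms by (simp add: sem_mem del: sum.lessThan_Suc)
  next
    show "?P 0 (set_reg ''s'' 0 s2)"
      using env_set_reg[OF s2, of "''s''"] s2' HT by (simp add: s2_def env_regs_def)
  qed auto
  then have P: "mem s3 = mem s" "reg s3 ''x'' = 2 ^ (B * (M3 + wt ?i)) mod M" "env s3"
    using env_rules(5)[OF s2] by (simp_all add: coin_wt_def block_value_def)
  have s3: "reg s3 x = reg s2 x" if "x \<notin> {''x'', ''z'', ''s''}" for x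
    unfolding s3_def using that by (subst sem_unassigned) auto
  have y3: "reg s3 ''y'' = y" using s3[of "''y''"] by (simp add: s2_def)
  have vw3: "expr_val v s3 = v0" "expr_val w s3 = w0"
    by (rule vw_val[OF P(1)]; use s3 s2' in auto)+
  have "mem s3 (3 + n + (v0 * n + w0)) = of_bool (E v0 w0)" by (rule env_mem(2)[OF P(3) v(2) w(2)])
  then have adj: "expr_val (Load (Bin Add (Bin Add (Const 3) (Reg ''n'')) (pair_expr v w))) s3 = of_bool (E v0 w0)"
    using vw3 env_rules(1)[OF P(3)] by (simp only: expr_val.simps apply_binop.simps)
  have "reg (sem (edge_prog d v w) s) ''x'' = (2 ^ (B * (M3 + wt ?i)) mod M) * y * of_bool (E v0 w0) mod M"
    unfolding sq using adj P(2) y3 env_rules(14)[OF P(3)]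
    by (simp only: sem.simps set_simps expr_val.simps(2,4) apply_binop.simps fun_upd_same)
  also have "\<dots> = (2 ^ (B * (M3 + wt ?i)) mod M) * (y * of_bool (E v0 w0)) mod M"
    by (simp only: mult.assoc)
  also have "\<dots> = 2 ^ (B * (M3 + wt ?i)) * (y * of_bool (E v0 w0)) mod M"
    by (rule mod_mult_left_eq)
  also have "\<dots> = of_bool (E v0 w0) * (2 ^ (B * (M3 + wt ?i)) * y) mod M"
    by (simp only: mult_ac)
  also have "2 ^ (B * (M3 + wt ?i)) * y = h t (edge v0 w0)"
  proof -
    have "min v0 w0 \<in> Y \<or> max v0 w0 \<in> Y \<longleftrightarrow> v0 \<in> Y \<or> w0 \<in> Y"
      unfolding min_def max_def by (cases "v0 \<le> w0") (simp_all add: disj_commute)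
    then show ?thesis
      by (cases "v0 \<in> Y"; cases "w0 \<in> Y") (simp_all only: pack_weight_def edge_def pack_exp_def label_def y_def
        el.case if_True if_False simp_thms not_False_eq_True of_bool_eq image_mset_empty image_mset_single prod_mset_empty
        prod_mset.singleton mult_0 mult_0_right mult_1 mult_1_right diff_zero diff_self_eq_0 add_0 add_0_right)
  qed
  finally show ?thesis .
qed

lemma congI: "[a = b] (mod M) \<Longrightarrow> a mod M = b mod M"
  by (simp add: cong_def)

lemma cong_mod_self: "[a mod M = a] (mod M)"
  by (simp add: cong_def)

abbreviation "W r t \<equiv> walks_val n (without r E) (h t)"

abbreviation "table \<equiv> 3 + n + n * n + R"

lemma table_less: "i \<le> k \<Longrightarrow> e < n * n \<Longrightarrow> table + i * (n * n) + e < N"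
proof -
  assume "i \<le> k" and e: "e < n * n"
  then have "i * (n * n) \<le> k * (n * n)" by (intro mult_le_mono1)
  then show ?thesis using e memory by (simp only: distrib_right mult_1)
qed

text \<open>One unfolding of the recursion for \<open>walks_val\<close>. The table holds residues
  only, which is enough because the recursion consists of sums and products.\<close>

lemma sem_cell_prog:
  assumes s: "env s" and t: "reg s ''t'' = t" "t < 2 ^ H" and r: "reg s ''r'' = r0"
    and i: "reg s ''i'' = i0" "i0 < k" and e: "reg s ''e'' = e0" "e0 < n * n"
    and tab: "\<And>p v. p < n \<Longrightarrow> v < n \<Longrightarrow> mem s (table + i0 * (n * n) + (p * n + v)) = W r0 t i0 p v mod M"
  shows "mem (sem (cell_prog d) s)
    = (mem s)(table + Suc i0 * (n * n) + e0 := W r0 t (Suc i0) (e0 div n) (e0 mod n) mod M)"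
proof -
  have n0: "0 < n" using e(2) by (cases n) auto
  define v0 p0 where "v0 = e0 mod n" and "p0 = e0 div n"
  have v0: "v0 < n" using n0 by (simp add: v0_def)
  define s1 where "s1 = set_reg ''a'' 0 s"
  define s2 where "s2 = sem (LFor ''w'' ''n'' (fold_prog d)) s1"
  let ?t = "\<lambda>w. if without r0 E v0 w \<and> w \<noteq> p0 then h t (edge v0 w) * W r0 t i0 v0 w else 0"
  have s1: "env s1" unfolding s1_def by (rule env_set_reg[OF s]) (simp add: env_regs_def)
  have "reg s2 ''a'' = fold_val ?t (reg s1 ''n'') mod M \<and> mem s2 = mem s1"
    unfolding s2_def
  proof (rule sem_LFor_accumulate[where g = "\<lambda>j. fold_val ?t j mod M"])
    fix j and s' :: state assume j: "j < reg s1 ''n''" and ms: "mem s' = mem s1"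
      and a: "reg s' ''a'' = fold_val ?t j mod M" and w: "reg s' ''w'' = j"
      and keep: "\<And>x. x \<notin> insert ''w'' (assigned (fold_prog d)) \<Longrightarrow> reg s' x = reg s1 x"
    have jn: "j < n" using j env_rules(1)[OF s1] by simp
    have s': "env s'"
      by (rule env_cong[OF s1]) (use ms in \<open>auto simp: env_regs_def intro!: keep\<close>)
    have r': "reg s' ''t'' = t" "reg s' ''r'' = r0" "reg s' ''i'' = i0" "reg s' ''e'' = e0"
      using keep[of "''t''"] keep[of "''r''"] keep[of "''i''"] keep[of "''e''"] t r i e by (simp_all add: s1_def)
    define s'' where "s'' = sem (edge_prog d v_expr (Reg ''w'')) s'"
    have v': "expr_val v_expr s' = v0" using r' env_rules(1)[OF s'] by (simp add: v_expr_def v0_def)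
    have x: "reg s'' ''x'' = of_bool (E v0 j) * h t (edge v0 j) mod M" unfolding s''_def
      by (rule sem_edge_prog[OF s' r'(1) t(2) _ v' v0 _ jn]) (use w in auto)
    have u: "reg s'' ''w'' = j" "reg s'' ''a'' = fold_val ?t j mod M" "reg s'' ''r'' = r0" "reg s'' ''i'' = i0"
      "reg s'' ''e'' = e0" "mem s'' = mem s"
      unfolding s''_def using w a r' ms by (simp_all add: sem_unassigned sem_mem s1_def)
    have s'': "env s''" unfolding s''_def by (rule env_sem[OF s']) (auto simp: env_regs_def)
    have vp: "expr_val v_expr s'' = v0" "expr_val p_expr s'' = p0"
      using u env_rules(1)[OF s''] by (simp_all add: v_expr_def p_expr_def v0_def p0_def)
    have f: "expr_val (Load (table_expr (Reg ''i'') (pair_expr v_expr (Reg ''w'')))) s'' = W r0 t i0 v0 j mod M"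
      using tab[OF v0 jn] u vp env_rules[OF s''] by (simp only: expr_val.simps apply_binop.simps)
    let ?A = "fold_val ?t j" and ?b = "(1 - of_bool (j = p0)) * ((1 - of_bool (j = r0)) * (1 - of_bool (v0 = r0))) :: nat"
    have "reg (sem (fold_prog d) s') ''a'' = (?A mod M + (1 + ?A mod M) *
        ((of_bool (E v0 j) * h t (edge v0 j) mod M) * (W r0 t i0 v0 j mod M) * ?b)) mod M"
      using f x u vp env_rules(14)[OF s''] unfolding fold_prog_def
      by (simp only: sem.simps set_simps s''_def[symmetric] expr_val.simps(1,2,4) apply_binop.simps fun_upd_same)
    also have "\<dots> = (?A + (1 + ?A) * ((of_bool (E v0 j) * h t (edge v0 j)) * W r0 t i0 v0 j * ?b)) mod M"
      by (intro congI cong_add cong_mult cong_mod_self cong_refl)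
    also have "?A + (1 + ?A) * ((of_bool (E v0 j) * h t (edge v0 j)) * W r0 t i0 v0 j * ?b) = fold_val ?t (Suc j)"
      by (simp add: without_def of_bool_def)
    finally show "reg (sem (fold_prog d) s') ''a'' = fold_val ?t (Suc j) mod M \<and> mem (sem (fold_prog d) s') = mem s'"
      by (simp add: sem_mem)
  qed (auto simp: s1_def)
  then have a2: "reg s2 ''a'' = fold_val ?t n mod M" and ms2: "mem s2 = mem s"
    using env_rules(1)[OF s1] by (simp_all add: s1_def)
  have keep2: "reg s2 x = reg s x" if "x \<notin> {''x'', ''y'', ''z'', ''u'', ''j'', ''s'', ''a'', ''w''}" for x
    unfolding s2_def using that by (subst sem_unassigned) (auto simp: s1_def)
  have s2: "env s2" unfolding s2_def by (rule env_sem[OF s1]) (auto simp: env_regs_def)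
  define s3 where "s3 = sem (sign_prog d (pair_expr v_expr v_expr)) s2"
  have v2: "expr_val v_expr s2 = v0" using keep2[of "''e''"] e env_rules(1)[OF s2] by (simp add: v_expr_def v0_def)
  have y: "reg s3 ''y'' = sign_factor vb H t (v0, v0)" unfolding s3_def
    by (rule sem_sign_prog[OF s2 _ t(2)])
      (use keep2[of "''t''"] t v2 v0 env_rules(1)[OF s2] in \<open>auto simp: pair_id_def\<close>)
  have s3: "env s3" unfolding s3_def by (rule env_sem[OF s2]) (auto simp: env_regs_def)
  have u3: "reg s3 ''a'' = fold_val ?t n mod M" "reg s3 ''i'' = i0" "reg s3 ''e'' = e0" "mem s3 = mem s"
    unfolding s3_def using a2 ms2 keep2[of "''i''"] keep2[of "''e''"] i e by (simp_all add: sem_unassigned sem_mem)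
  have v3: "expr_val v_expr s3 = v0" using u3 env_rules(1)[OF s3] by (simp add: v_expr_def v0_def)
  note inY = expr_val_in_Y[OF s3 v3 v0]
  let ?y = "of_bool (v0 \<in> Y) :: nat" and ?g = "sign_factor vb H t (v0, v0)"
  have addr: "expr_val (table_expr (Bin Add (Reg ''i'') (Const 1)) (Reg ''e'')) s3 = table + Suc i0 * (n * n) + e0"
    using u3 env_rules[OF s3] by (simp only: expr_val.simps apply_binop.simps Suc_eq_plus1)
  have adM: "(table + Suc i0 * (n * n) + e0) mod N = table + Suc i0 * (n * n) + e0"
    by (rule mod_less, rule table_less) (use i e in auto)
  let ?val = "(Bin Mul (Bin Add (Bin Mul (in_Y v_expr) (Reg ''y'')) (e_not (in_Y v_expr)))
        (Bin Add (Reg ''a'') (Bin Mul (Reg ''zb'') (Bin Add (in_Y v_expr) (Bin Mul (e_not (in_Y v_expr)) (Reg ''y''))))))"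
  have "expr_val ?val s3 mod M
      = (?y * ?g + (1 - ?y)) * (fold_val ?t n mod M + (2 ^ (B * M1) mod M) * (?y + (1 - ?y) * ?g)) mod M"
    using y u3(1) inY env_rules(11)[OF s3] by (simp only: expr_val.simps(1,2,4) apply_binop.simps)
  also have "\<dots> = (?y * ?g + (1 - ?y)) * (fold_val ?t n + 2 ^ (B * M1) * (?y + (1 - ?y) * ?g)) mod M"
    by (intro congI cong_add cong_mult cong_mod_self cong_refl)
  also have "?y * ?g + (1 - ?y) = h t (Vert v0)"
    by (simp add: pack_weight_def pack_exp_def label_def)
  also have "2 ^ (B * M1) * (?y + (1 - ?y) * ?g) = h t (Lf v0)"
    by (simp add: pack_weight_def pack_exp_def label_def)
  finally have val: "expr_val ?val s3 mod M = W r0 t (Suc i0) p0 v0 mod M" by simp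
  have "sem (cell_prog d) s = set_mem (expr_val (table_expr (Bin Add (Reg ''i'') (Const 1)) (Reg ''e'')) s3 mod N)
      (expr_val ?val s3 mod M) s3"
    using env_rules(14,15)[OF s3] unfolding cell_prog_def s3_def s2_def s1_def
    by (simp only: sem.simps(1,2,3) expr_val.simps(1) mod_0)
  then show ?thesis using u3(4) unfolding addr adM val p0_def[symmetric] v0_def[symmetric] by simp
qed

lemma sem_table_prog:
  assumes s: "env s" and t: "reg s ''t'' = t" "t < 2 ^ H" and r: "reg s ''r'' = r0"
  shows "env (sem (table_prog d) s)"
    and "p < n \<Longrightarrow> v < n \<Longrightarrow> mem (sem (table_prog d) s) (table + k * (n * n) + (p * n + v)) = W r0 t k p v mod M"
proof -
  let ?P = "\<lambda>i (s' :: state). env s' \<and>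
    (\<forall>p<n. \<forall>v<n. mem s' (table + i * (n * n) + (p * n + v)) = W r0 t i p v mod M)"
  have "?P (reg s ''k'') (sem (table_prog d) s)" unfolding table_prog_def
  proof (rule sem_LFor[where P = ?P])
    show "?P 0 (set_reg ''i'' 0 s)"
    proof (intro conjI allI impI)
      show "env (set_reg ''i'' 0 s)" by (rule env_set_reg[OF s]) (simp add: env_regs_def)
      fix p v assume "p < n" "v < n"
      from env_mem(4)[OF s pair_less[OF this]]
      show "mem (set_reg ''i'' 0 s) (table + 0 * (n * n) + (p * n + v)) = W r0 t 0 p v mod M" by simp
    qed
  next
    fix i and s' :: state assume i: "i < reg s ''k''" and P: "?P i s'" and ri: "reg s' ''i'' = i"
      and keep: "\<And>x. x \<notin> insert ''i'' (assigned (LFor ''e'' ''nn'' (cell_prog d))) \<Longrightarrow> reg s' x = reg s x"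
    let ?base = "table + Suc i * (n * n)" and ?f = "\<lambda>e. W r0 t (Suc i) (e div n) (e mod n) mod M"
    have ik: "i < k" using i env_rules(3)[OF s] by simp
    have es: "env s'" using P by blast
    have tr: "reg s' ''t'' = t" "reg s' ''r'' = r0" using keep[of "''t''"] keep[of "''r''"] t r by simp_all
    \<comment> \<open>Writing the next layer leaves everything below it intact, in particular the
      layer that is being read.\<close>
    have low: "fill (mem s') ?base j ?f a = mem s' a" if "a < ?base" for a j using that by (simp add: fill_def)
    have "mem (sem (LFor ''e'' ''nn'' (cell_prog d)) s') = fill (mem s') ?base (reg s' ''nn'') ?f"
    proof (rule sem_LFor_fill)
      fix j and s'' :: state assume j: "j < reg s' ''nn''" and ms: "mem s'' = fill (mem s') ?base j ?f"
        and e: "reg s'' ''e'' = j"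
        and keep'': "\<And>x. x \<notin> insert ''e'' (assigned (cell_prog d)) \<Longrightarrow> reg s'' x = reg s' x"
      have jn: "j < n * n" using j env_rules(2)[OF es] by simp
      have es'': "env s''"
      proof (rule env_cong[OF es])
        fix x assume "x \<in> env_regs" then show "reg s'' x = reg s' x"
          by (intro keep'') (auto simp: env_regs_def)
      next
        fix a assume "a < 3 + n + n * n + R + n * n"
        then have "a < ?base" by simp
        then show "mem s'' a = mem s' a" unfolding ms by (rule low)
      qed
      have tr'': "reg s'' ''t'' = t" "reg s'' ''r'' = r0" "reg s'' ''i'' = i"
        using keep''[of "''t''"] keep''[of "''r''"] keep''[of "''i''"] tr ri by simp_all
      show "mem (sem (cell_prog d) s'') = (mem s'')(?base + j := ?f j)"
      proof (rule sem_cell_prog[OF es'' tr''(1) t(2) tr''(2,3) ik e jn])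
        fix p v assume pv: "p < n" "v < n"
        have "table + i * (n * n) + (p * n + v) < ?base" using pair_less[OF pv] by simp
        from low[OF this] show "mem s'' (table + i * (n * n) + (p * n + v)) = W r0 t i p v mod M"
          using P pv unfolding ms by simp
      qed
    qed auto
    then have m: "mem (sem (LFor ''e'' ''nn'' (cell_prog d)) s') = fill (mem s') ?base (n * n) ?f"
      using env_rules(2)[OF es] by simp
    show "?P (Suc i) (set_reg ''i'' (Suc i) (sem (LFor ''e'' ''nn'' (cell_prog d)) s'))"
    proof (intro conjI allI impI)
      show "env (set_reg ''i'' (Suc i) (sem (LFor ''e'' ''nn'' (cell_prog d)) s'))"
      proof (intro env_set_reg env_cong[OF es])
        fix x assume "x \<in> env_regs" then show "reg (sem (LFor ''e'' ''nn'' (cell_prog d)) s') x = reg s' x"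
          by (intro sem_unassigned) (auto simp: env_regs_def)
      next
        fix a assume "a < 3 + n + n * n + R + n * n"
        then have "a < ?base" by simp
        then show "mem (sem (LFor ''e'' ''nn'' (cell_prog d)) s') a = mem s' a" unfolding m by (rule low)
      qed (simp add: env_regs_def)
      fix p v assume pv: "p < n" "v < n"
      then have "(p * n + v) div n = p" "(p * n + v) mod n = v" by simp_all
      then show "mem (set_reg ''i'' (Suc i) (sem (LFor ''e'' ''nn'' (cell_prog d)) s')) (?base + (p * n + v))
          = W r0 t (Suc i) p v mod M"
        using pair_less[OF pv] unfolding set_simps m fill_def by (simp only: add_diff_cancel_left' le_add1 add_less_cancel_left simp_thms if_True)
    qed
  qed auto
  then have *: "?P k (sem (table_prog d) s)" using env_rules(3)[OF s] by simp
  then show "env (sem (table_prog d) s)" by blast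
  show "p < n \<Longrightarrow> v < n \<Longrightarrow> mem (sem (table_prog d) s) (table + k * (n * n) + (p * n + v)) = W r0 t k p v mod M"
    using * by blast
qed

abbreviation "PT \<equiv> packed_total n E Y vb H wt B M1 M3 k"

lemma sem_total_prog:
  assumes s: "env s" and r: "reg s ''r'' = r0" "r0 < n" and S: "reg s ''S'' = 0"
  shows "env (sem (total_prog d) s)" and "reg (sem (total_prog d) s) ''S'' = PT r0 mod M"
proof -
  let ?rv = "\<lambda>t. rooted_val n E (h t) k r0"
  let ?P = "\<lambda>t (s' :: state). env s' \<and> reg s' ''S'' = (\<Sum>t'<t. ?rv t') mod M"
  let ?body = "LSeq (table_prog d) (LFor ''w'' ''n'' (root_prog d))"
  have "?P (reg s ''T'') (sem (total_prog d) s)" unfolding total_prog_def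
  proof (rule sem_LFor[where P = ?P])
    show "?P 0 (set_reg ''t'' 0 s)" using S env_set_reg[OF s, of "''t''"] by (simp add: env_regs_def)
  next
    fix t and s' :: state assume t: "t < reg s ''T''" and P: "?P t s'" and rt: "reg s' ''t'' = t"
      and keep: "\<And>x. x \<notin> insert ''t'' (assigned ?body) \<Longrightarrow> reg s' x = reg s x"
    have tH: "t < 2 ^ H" using t env_rules(6)[OF s] by simp
    have es: "env s'" using P by blast
    have r': "reg s' ''r'' = r0" using keep[of "''r''"] r by simp
    define s1 where "s1 = sem (table_prog d) s'"
    have s1: "env s1" and tab: "\<And>p v. p < n \<Longrightarrow> v < n \<Longrightarrow> mem s1 (table + k * (n * n) + (p * n + v)) = W r0 t k p v mod M"
      unfolding s1_def by (rule sem_table_prog[OF es rt tH r'], assumption?)+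
    let ?h = "\<lambda>w. if E r0 w then h t (edge r0 w) * W r0 t k r0 w else 0"
    let ?g = "\<lambda>j. ((\<Sum>t'<t. ?rv t') + (\<Sum>w<j. ?h w)) mod M"
    have u1: "reg s1 ''t'' = t" "reg s1 ''r'' = r0" "reg s1 ''S'' = (\<Sum>t'<t. ?rv t') mod M"
      unfolding s1_def using rt r' P by (simp_all add: sem_unassigned)
    define s2 where "s2 = sem (LFor ''w'' ''n'' (root_prog d)) s1"
    have "reg s2 ''S'' = ?g (reg s1 ''n'') \<and> mem s2 = mem s1" unfolding s2_def
    proof (rule sem_LFor_accumulate[where g = ?g])
      fix j and s3 :: state assume j: "j < reg s1 ''n''" and ms: "mem s3 = mem s1"
        and S3: "reg s3 ''S'' = ?g j" and w: "reg s3 ''w'' = j"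
        and keep3: "\<And>x. x \<notin> insert ''w'' (assigned (root_prog d)) \<Longrightarrow> reg s3 x = reg s1 x"
      have jn: "j < n" using j env_rules(1)[OF s1] by simp
      have s3: "env s3"
        by (rule env_cong[OF s1]) (use ms in \<open>auto simp: env_regs_def intro!: keep3\<close>)
      have u3: "reg s3 ''t'' = t" "reg s3 ''r'' = r0" using keep3[of "''t''"] keep3[of "''r''"] u1 by simp_all
      define s4 where "s4 = sem (edge_prog d (Reg ''r'') (Reg ''w'')) s3"
      have x: "reg s4 ''x'' = of_bool (E r0 j) * h t (edge r0 j) mod M" unfolding s4_def
        by (rule sem_edge_prog[OF s3 u3(1) tH _ _ r(2) _ jn]) (use w u3 in auto)
      have u4: "reg s4 ''w'' = j" "reg s4 ''S'' = ?g j" "reg s4 ''r'' = r0" "mem s4 = mem s1"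
        unfolding s4_def using w S3 u3 ms by (simp_all add: sem_unassigned sem_mem)
      have s4: "env s4" unfolding s4_def by (rule env_sem[OF s3]) (auto simp: env_regs_def)
      have f: "expr_val (Load (table_expr (Reg ''k'') (pair_expr (Reg ''r'') (Reg ''w'')))) s4 = W r0 t k r0 j mod M"
        using tab[OF r(2) jn] u4 env_rules[OF s4] by (simp only: expr_val.simps apply_binop.simps)
      have "reg (sem (root_prog d) s3) ''S'' = (?g j + (of_bool (E r0 j) * h t (edge r0 j) mod M) * (W r0 t k r0 j mod M)) mod M"
        using f x u4 env_rules(14)[OF s4] unfolding root_prog_def
        by (simp only: sem.simps set_simps s4_def[symmetric] expr_val.simps(1,2,4) apply_binop.simps fun_upd_same)
      also have "\<dots> = ((\<Sum>t'<t. ?rv t') + (\<Sum>w<j. ?h w) + (of_bool (E r0 j) * h t (edge r0 j)) * W r0 t k r0 j) mod M"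
        by (intro congI cong_add cong_mult cong_mod_self cong_refl)
      also have "\<dots> = ?g (Suc j)" by (simp add: add.assoc)
      finally show "reg (sem (root_prog d) s3) ''S'' = ?g (Suc j) \<and> mem (sem (root_prog d) s3) = mem s3"
        by (simp add: sem_mem)
    qed (use u1 in auto)
    then have S2: "reg s2 ''S'' = (\<Sum>t'<Suc t. ?rv t') mod M"
      using env_rules(1)[OF s1] by (simp add: rooted_val_def)
    have s2: "env s2" unfolding s2_def by (rule env_sem[OF s1]) (auto simp: env_regs_def)
    have "sem ?body s' = s2" by (simp only: sem.simps(3) s1_def s2_def)
    then show "?P (Suc t) (set_reg ''t'' (Suc t) (sem ?body s'))"
      using S2 env_set_reg[OF s2, of "''t''"] by (simp add: env_regs_def del: sum.lessThan_Suc)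
  qed auto
  then have *: "?P (2 ^ H) (sem (total_prog d) s)" using env_rules(6)[OF s] by simp
  then show "env (sem (total_prog d) s)" "reg (sem (total_prog d) s) ''S'' = PT r0 mod M"
    by (simp_all add: packed_total_def)
qed

abbreviation "found r \<equiv> \<exists>w<M1. odd (PT r div 2 ^ (B * (M3 * (k - 1) + M1 * (l - 1) + w) + H))"

text \<open>All inspected digits lie below bit \<open>N\<close>, so by \<open>odd_mod_div\<close>
  the reduction modulo \<open>2 ^ N\<close> cannot be noticed.\<close>

lemma sem_digits:
  assumes s: "env s" and res: "reg s ''result'' = of_bool b" and D: "reg s ''D'' = x mod M div 2 ^ (B * X)"
    and X: "X = M3 * (k - 1) + M1 * (l - 1)"
  shows "reg (sem (LFor ''c'' ''M1'' digit_prog) s) ''result''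
    = of_bool (b \<or> (\<exists>w<M1. odd (x div 2 ^ (B * (X + w) + H))))"
proof -
  let ?P = "\<lambda>w (s' :: state). reg s' ''D'' = x mod M div 2 ^ (B * (X + w)) \<and>
    reg s' ''result'' = of_bool (b \<or> (\<exists>w'<w. odd (x div 2 ^ (B * (X + w') + H))))"
  have "?P (reg s ''M1'') (sem (LFor ''c'' ''M1'' digit_prog) s)"
  proof (rule sem_LFor[where P = ?P])
    fix w and s' :: state assume w: "w < reg s ''M1''" and P: "?P w s'"
      and keep: "\<And>x. x \<notin> insert ''c'' (assigned digit_prog) \<Longrightarrow> reg s' x = reg s x"
    have wM: "w < M1" using w env_rules(8)[OF s] by simp
    have r: "reg s' ''T'' = 2 ^ H" "reg s' ''bt'' = 2 ^ B" "reg s' ''M'' = M"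
      using keep[of "''T''"] keep[of "''bt''"] keep[of "''M''"] env_rules[OF s] by simp_all
    have "B * (X + w) \<le> B * (X + M1)" using wM by (intro mult_le_mono2) simp
    then have N: "B * (X + w) + H < N" using digits unfolding X by linarith
    have dig: "x mod M div 2 ^ (B * (X + w)) div 2 ^ H mod 2 = of_bool (odd (x div 2 ^ (B * (X + w) + H)))"
    proof -
      have "x mod M div 2 ^ (B * (X + w)) div 2 ^ H = x mod 2 ^ N div 2 ^ (B * (X + w) + H)"
        by (simp only: M power_add div_mult2_eq)
      then show ?thesis using odd_mod_div[OF N, of x] by (simp add: mod2_eq_if)
    qed
    have M0: "0 < M" using M_two by simp
    have "x mod M div 2 ^ (B * (X + w)) div 2 ^ B \<le> x mod M" by (meson div_le_dividend le_trans)
    also have "\<dots> < M" using M0 by (rule mod_less_divisor)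
    finally have D': "x mod M div 2 ^ (B * (X + w)) div 2 ^ B mod M = x mod M div 2 ^ (B * (X + Suc w))"
      by (simp only: mod_less add_Suc_right mult_Suc_right power_add div_mult2_eq[symmetric] mult.commute[of "2 ^ B"])
    have res': "reg s' ''result'' = of_bool (b \<or> (\<exists>w'<w. odd (x div 2 ^ (B * (X + w') + H))))"
      and Dw: "reg s' ''D'' = x mod M div 2 ^ (B * (X + w))" using P by blast+
    have one: "of_bool Q mod M = of_bool Q" for Q using M_two by (intro mod_less) simp
    have 1: "reg (sem digit_prog s') ''D'' = x mod M div 2 ^ (B * (X + Suc w))"
      using D' Dw r by (simp add: digit_prog_def)
    let ?Q = "b \<or> (\<exists>w'<w. odd (x div 2 ^ (B * (X + w') + H)))" and ?O = "odd (x div 2 ^ (B * (X + w) + H))"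
    have "reg (sem digit_prog s') ''result'' = (of_bool ?Q + (1 - of_bool ?Q) * of_bool ?O) mod M"
      using dig res' Dw r unfolding digit_prog_def
      by (simp only: sem.simps set_simps expr_val.simps(1,2,4) apply_binop.simps fun_upd_apply
        char.inject list.inject list.distinct simp_thms if_True if_False)
    also have "of_bool ?Q + (1 - of_bool ?Q) * of_bool ?O = (of_bool (?Q \<or> ?O) :: nat)" by (simp add: of_bool_def)
    also have "\<dots> mod M = of_bool (?Q \<or> ?O)" by (rule one)
    also have "(?Q \<or> ?O) = (b \<or> (\<exists>w'<Suc w. odd (x div 2 ^ (B * (X + w') + H))))" by (auto simp: less_Suc_eq)
    finally show "?P (Suc w) (set_reg ''c'' (Suc w) (sem digit_prog s'))" using 1 by simp
  qed (use assms in auto)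
  then show ?thesis using env_rules(8)[OF s] by simp
qed

theorem sem_main_prog:
  assumes s: "env s" and res: "reg s ''result'' = 0"
  shows "reg (sem (main_prog d) s) ''result'' = of_bool (\<exists>r<n. found r)"
proof -
  let ?P = "\<lambda>r (s' :: state). env s' \<and> reg s' ''result'' = of_bool (\<exists>r'<r. found r')"
  let ?dig = "LFor ''c'' ''M1'' digit_prog"
  let ?body = "LSeq (LAssign ''S'' (Const 0)) (LSeq (total_prog d)
    (LSeq (LAssign ''D'' (Bin Div (Reg ''S'') (Reg ''dv''))) ?dig))"
  define X where "X = M3 * (k - 1) + M1 * (l - 1)"
  have "?P (reg s ''n'') (sem (main_prog d) s)" unfolding main_prog_def
  proof (rule sem_LFor[where P = ?P])
    show "?P 0 (set_reg ''r'' 0 s)" using res env_set_reg[OF s, of "''r''"] by (simp add: env_regs_def)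
  next
    fix r and s' :: state assume r: "r < reg s ''n''" and P: "?P r s'" and rr: "reg s' ''r'' = r"
    have rn: "r < n" using r env_rules(1)[OF s] by simp
    define s1 where "s1 = set_reg ''S'' 0 s'"
    have s1: "env s1" "reg s1 ''r'' = r" "reg s1 ''S'' = 0"
      unfolding s1_def using P rr by (auto intro!: env_set_reg simp: env_regs_def)
    define s2 where "s2 = sem (total_prog d) s1"
    have s2: "env s2" "reg s2 ''S'' = PT r mod M" unfolding s2_def by (rule sem_total_prog[OF s1(1,2) rn s1(3)])+
    define s3 where "s3 = set_reg ''D'' (PT r mod M div 2 ^ (B * X)) s2"
    have s3: "env s3" unfolding s3_def by (rule env_set_reg[OF s2(1)]) (simp add: env_regs_def)
    have "PT r mod M div 2 ^ (B * X) \<le> PT r mod M" by simp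
    also have "\<dots> < M" using M_two by simp
    finally have "PT r mod M div 2 ^ (B * X) mod M = PT r mod M div 2 ^ (B * X)" by (rule mod_less)
    then have "sem (LAssign ''D'' (Bin Div (Reg ''S'') (Reg ''dv''))) s2 = s3"
      using s2 env_rules(13,14)[OF s2(1)] by (simp only: sem.simps expr_val.simps apply_binop.simps s3_def X_def)
    then have body: "sem ?body s' = sem ?dig s3"
      by (simp only: sem.simps(1,3) expr_val.simps(1) mod_0 s1_def[symmetric] s2_def[symmetric])
    have "reg s2 ''result'' = reg s' ''result''" unfolding s2_def s1_def by (simp add: sem_unassigned)
    then have "reg s3 ''result'' = of_bool (\<exists>r'<r. found r')" using P by (simp add: s3_def)
    from sem_digits[OF s3 this _ X_def, of "PT r"]
    have "reg (sem ?dig s3) ''result'' = of_bool ((\<exists>r'<r. found r') \<or> found r)"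
      unfolding X_def[symmetric] by (simp add: s3_def)
    also have "((\<exists>r'<r. found r') \<or> found r) = (\<exists>r'<Suc r. found r')" unfolding less_Suc_eq by blast
    finally have res': "reg (sem ?dig s3) ''result'' = of_bool (\<exists>r'<Suc r. found r')" .
    have "env (sem ?dig s3)" by (rule env_sem[OF s3]) (auto simp: env_regs_def)
    from env_set_reg[OF this, of "''r''" "Suc r"] res'
    show "?P (Suc r) (set_reg ''r'' (Suc r) (sem ?body s'))" unfolding body by (simp add: env_regs_def)
  qed auto
  then show ?thesis using env_rules(1)[OF s] by simp
qed

end

section \<open>The algorithm\<close>

lemma (in simple_graph) root_els_counts:
  assumes t: "(w, V, A, L) \<in> root_trees E r"
  shows "n_edges (mset_set (root_els r (w, V, A, L))) = card V"
    and "n_leaves (mset_set (root_els r (w, V, A, L))) = card (with_root w V L)"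
proof -
  let ?S = "root_els r (w, V, A, L)"
  note rt = root_tree_rtree[OF t]
  have nm: "Vert u \<notin> insert (edge r w) A" "Lf u \<notin> insert (edge r w) A" for u using rtree_no_marks[OF rt] by blast+
  have Vn: "V \<subseteq> {..<n}" by (rule root_trees_less(1)[OF t])
  have "insert (edge r w) A \<subseteq> universe n"
    using rtree_edges[OF rt] edge_in_universe E_less E_less2 by (metis subsetI)
  moreover have "with_root w V L \<subseteq> V" using rtree_leaves[OF rt] by blast
  ultimately have "?S \<subseteq> universe n" using Vn by (auto simp: root_els_def tree_els_def universe_def)
  then have fin: "finite ?S" by (rule finite_subset) simp
  have "{v. Vert v \<in> ?S} = V" using nm(1) by (auto simp: root_els_def tree_els_def)
  then show "n_edges (mset_set ?S) = card V"
    using n_edges_mset_set[OF fin] n_vertices_root_els[of ?S r] t by simp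
  have Lf: "?S \<inter> range Lf = Lf ` with_root w V L" using nm(2) by (auto simp: root_els_def tree_els_def)
  have "n_leaves (mset_set ?S) = (\<Sum>e\<in>?S. of_bool (e \<in> range Lf))"
    unfolding n_leaves_def sum_unfold_sum_mset[symmetric] by (rule sum.cong) (auto split: el.splits)
  also have "\<dots> = card (?S \<inter> range Lf)" using fin by (simp add: sum.If_cases of_bool_def)
  also have "\<dots> = card (with_root w V L)" unfolding Lf by (rule card_image) (simp add: inj_on_def)
  finally show "n_leaves (mset_set ?S) = card (with_root w V L)" .
qed

definition registers :: "string set" where
  "registers = {''n'', ''k'', ''l'', ''N'', ''M'', ''i'', ''nn'', ''n2'', ''H'', ''B'', ''fb'', ''Q'', ''q'', ''T'', ''bt'',
     ''M1'', ''M3'', ''R'', ''X'', ''zb'', ''xb'', ''dv'', ''b'', ''x'', ''y'', ''z'', ''u'', ''j'', ''s'', ''a'', ''w'', ''e'',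
     ''S'', ''t'', ''result'', ''D'', ''c'', ''r''}"

lemma finite_registers [simp]: "finite registers"
  by (simp add: registers_def)

definition phases :: "nat \<Rightarrow> lp list" where
  "phases d = [setup_A d, setup_B, setup_C d, setup_D, main_prog d]"

text \<open>Sums over the phases stand in for maxima. The added constants cover the expressions
  outside the loop programs, such as \<open>size_expr\<close>.\<close>

definition esize_bound :: "nat \<Rightarrow> nat" where "esize_bound d = (\<Sum>p\<leftarrow>phases d. lp_esize p) + 60"
definition const_bound :: "nat \<Rightarrow> nat" where "const_bound d = (\<Sum>p\<leftarrow>phases d. lp_max_const p) + 8 + d"
definition size_sum :: "nat \<Rightarrow> nat" where "size_sum d = (\<Sum>p\<leftarrow>phases d. lp_size p)"
definition depth_sum :: "nat \<Rightarrow> nat" where "depth_sum d = (\<Sum>p\<leftarrow>phases d. loop_depth ''T'' p)"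

lemma phases_static:
  assumes "p \<in> set (phases d)"
  shows "counters_ok p" "loop_bounds p \<inter> assigned p = {}" "''M'' \<notin> assigned p" "''N'' \<notin> assigned p"
    "assigned p \<subseteq> registers" "loop_nesting ''T'' p \<le> 1"
proof -
  have "loop_nesting ''T'' (pow_prog x b y) = (if b = ''T'' then 1 else 0)" for x b y by (simp add: pow_prog_def)
  moreover have "loop_nesting ''T'' (sign_prog d u) = 0" for u by (simp add: sign_prog_def)
  moreover have "loop_nesting ''T'' (square_prog d u) = 0" for u by (simp add: square_prog_def)
  ultimately show "loop_nesting ''T'' p \<le> 1"
    using assms by (auto simp: phases_def setup_A_def setup_B_def setup_C_def setup_D_def double_Q_def main_prog_def
      total_prog_def table_prog_def cell_prog_def root_prog_def fold_prog_def edge_prog_def digit_prog_def)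
qed (use assms in \<open>auto simp: phases_def registers_def\<close>)

text \<open>\<open>T\<close> stands for the exponential factor and must enter linearly; the rest is
  polynomial in \<open>N\<close> because \<open>d\<close> is fixed.\<close>

definition phase_time :: "nat \<Rightarrow> nat \<Rightarrow> nat \<Rightarrow> nat" where
  "phase_time d N T = 4 ^ size_sum d * (N ^ depth_sum d * T)"

lemma runs_phase:
  assumes s: "bounded_state registers V A s" and p: "p \<in> set (phases d)" and c: "const_bound d < 2 ^ V"
    and MN: "0 < reg s ''M''" "0 < reg s ''N''" "reg s ''N'' \<le> A"
    and b: "\<And>b. b \<in> loop_bounds p \<Longrightarrow> b \<noteq> ''T'' \<Longrightarrow> reg s b \<le> N" and N: "1 \<le> N"
    and T: "reg s ''T'' \<le> T" "1 \<le> T"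
  shows "runs (compile p) s (sem p s) (step_cost V (esize_bound d + 2) * phase_time d N T)
      (space_bound registers V A (esize_bound d + 2)) \<and> bounded_state registers V A (sem p s)"
proof -
  note st = phases_static[OF p]
  have le: "f p \<le> (\<Sum>p\<leftarrow>phases d. f p)" for f :: "lp \<Rightarrow> nat"
    using p by (intro member_le_sum_list) auto
  have "runs (compile p) s (sem p s) (step_cost V (esize_bound d + 2) * steps (reg s) p)
      (space_bound registers V A (esize_bound d + 2)) \<and> bounded_state registers V A (sem p s)"
    by (rule runs_compile[OF s st(1-5)])
      (use le[of lp_max_const] le[of lp_esize] c MN in \<open>auto simp: const_bound_def esize_bound_def\<close>)
  moreover have "steps (reg s) p \<le> phase_time d N T"
  proof -
    have "steps (reg s) p \<le> 4 ^ lp_size p * (N ^ loop_depth ''T'' p * T ^ loop_nesting ''T'' p)"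
      by (rule steps_le) (use b N T in auto)
    also have "\<dots> \<le> 4 ^ size_sum d * (N ^ depth_sum d * T ^ 1)"
      using le[of lp_size] le[of "loop_depth ''T''"] st(6) N T(2)
      by (intro mult_le_mono power_increasing) (auto simp: size_sum_def depth_sum_def)
    finally show ?thesis by (simp add: phase_time_def)
  qed
  ultimately show ?thesis by (auto intro: runs_mono)
qed

text \<open>The coins are flipped after the setup because their number depends on \<open>H\<close>
  and \<open>q\<close>.\<close>

definition search :: "nat \<Rightarrow> com" where
  "search d = Seq (compile (setup_A d)) (Seq (compile setup_B) (Seq (compile (setup_C d)) (Seq (compile setup_D)
     (Seq flip_loop (compile (main_prog d))))))"

text \<open>The result can be stated in terms of trees: \<open>sem_main_prog\<close> yields digits
  of the packed total, \<open>odd_digit_packed_total\<close> turns them into parities of walks, and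
  \<open>parity_of_selected\<close> turns these into parities of trees.\<close>

lemma search_run:
  assumes s: "bounded_state registers V N s" and d: "2 \<le> d" and c: "const_bound d < 2 ^ V"
    and N: "N = (n + 8 + d) ^ 9"
    and r: "reg s ''n'' = n" "reg s ''k'' = k" "reg s ''l'' = l" "reg s ''N'' = N" "reg s ''M'' = 2 ^ N"
      "reg s ''b'' = 0" "reg s ''result'' = 0" "reg s ''T'' = 0"
    and k: "2 \<le> k" "k \<le> n" and l: "1 \<le> l" "l \<le> k"
    and graph: "simple_graph n E" and col: "\<And>v. v < n \<Longrightarrow> c v < d"
    and m: "\<And>v. v < n \<Longrightarrow> mem s (3 + v) = c v"
      "\<And>v w. v < n \<Longrightarrow> w < n \<Longrightarrow> mem s (3 + n + (v * n + w)) = of_bool (E v w)"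
      "\<And>a. 3 + n + n * n \<le> a \<Longrightarrow> mem s a = 0"
    and H: "H = label_bound d k l + 2"
  shows "\<exists>q f. 2 * (n * n) \<le> 2 ^ q \<and>
    dist_runs (search d) s (map_pmf f (pmf_of_set (Pow {..<d + n * n * H + n * n * q})))
      (step_cost V (esize_bound d + 2) * (5 * phase_time d N (2 ^ H) + (1 + 5 * N)))
      (space_bound registers V N (esize_bound d + 2)) \<and>
    (\<forall>\<omega>. reg (f \<omega>) ''result'' \<noteq> 0 \<longleftrightarrow> (\<exists>r<n. \<exists>w<n * 2 ^ q.
      odd (card {S \<in> root_els r ` root_trees E r. selected (coin_Y n c \<omega>) (coin_vb d n H \<omega>) H (coin_wt d n H q \<omega>) k l w (mset_set S)})))"
proof -
  let ?U = "step_cost V (esize_bound d + 2)" and ?S = "space_bound registers V N (esize_bound d + 2)"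
  let ?P = "phase_time d N (2 ^ H)"
  define sA where "sA = sem (setup_A d) s"
  define sB where "sB = sem setup_B sA"
  define sC where "sC = sem (setup_C d) sB"
  define sD where "sD = sem setup_D sC"
  have mem: "mem sA = mem s" "mem sB = mem s" "mem sC = mem s" "mem sD = mem s"
    by (simp_all add: sD_def sC_def sB_def sA_def sem_mem)
  have kA: "reg sA x = reg s x" if "x \<notin> {''nn'', ''n2'', ''H'', ''B'', ''fb''}" for x
    unfolding sA_def using that by (intro sem_unassigned) simp
  have kB: "reg sB x = reg sA x" if "x \<notin> {''Q'', ''q'', ''i'', ''T'', ''bt''}" for x
    unfolding sB_def using that by (intro sem_unassigned) simp
  have kC: "reg sC x = reg sB x" if "x \<notin> {''M1'', ''M3'', ''R'', ''X''}" for x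
    unfolding sC_def using that by (intro sem_unassigned) simp
  have kD: "reg sD x = reg sC x" if "x \<notin> {''zb'', ''xb'', ''dv'', ''i''}" for x
    unfolding sD_def using that by (intro sem_unassigned) simp
  have Hn: "H \<le> n + 2" using label_bound_le[OF d, of k l] k H by simp
  have ln: "l \<le> n" using k l by simp
  have n2: "1 \<le> 2 * (n * n)" using k by (cases n) auto
  have NM: "x < 2 ^ N" if "x < N" for x using that less_exp[of N] by linarith
  have small: "8 * (n * n) < N" "(n + 4) * (n + 4) < N" "H < N" "3 + n + n * n < N" "n < N"
  proof -
    \<comment> \<open>The bounds needed here do not involve \<open>q\<close>, so
      \<open>q = 0\<close> is put in before the actual value is known.\<close>
    have *: "0 \<le> 2 * (n * n)" "2 ^ 0 \<le> 2 * (2 * (n * n))" using n2 by simp_all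
    note sb = size_bounds[OF Hn * k(2) ln refl refl N]
    show "8 * (n * n) < N" "(n + 4) * (n + 4) < N" "H < N" "n < N" by (rule sb)+
    show "3 + n + n * n < N" using sb(4) by linarith
  qed
  have A: "reg sA ''nn'' = n * n" "reg sA ''n2'' = 2 * (n * n)" "reg sA ''H'' = H" "reg sA ''B'' = (n + 4)\<^sup>2"
    "reg sA ''fb'' = 3 + n + n * n"
    unfolding sA_def H
    by (rule sem_setup_A[OF r(1-3,5) NM[OF small(1)] NM[OF small(2)] NM[OF small(3)[unfolded H]] NM[OF small(4)]])+
  have Mpos: "reg x ''M'' = 2 ^ N \<and> reg x ''N'' = N \<and> reg x ''n'' = n \<and> reg x ''k'' = k \<and> reg x ''l'' = l"
    if "x \<in> {s, sA, sB, sC, sD}" for x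
    using that by (elim insertE emptyE) (simp_all add: kD kC kB kA r)
  define q where "q = reg sB ''q''"
  have sq: "(n + 4)\<^sup>2 < N" using small(2) by (simp add: power2_eq_square)
  have HB: "(2 :: nat) ^ reg sA ''H'' < 2 ^ N" "(2 :: nat) ^ reg sA ''B'' < 2 ^ N"
    unfolding A by (rule power_strict_increasing; use small sq in simp)+
  have "2 * (2 * (n * n)) < 2 ^ N" "2 * (n * n) < 2 ^ N" by (rule NM; use small in linarith)+
  note B = sem_setup_B[OF A(2) conjunct1[OF Mpos] n2 this HB, folded sB_def q_def, simplified]
  have Q: "reg sB ''Q'' = 2 ^ q" "q \<le> 2 * (n * n)" "2 * (n * n) \<le> 2 ^ q" "2 ^ q \<le> 2 * (2 * (n * n))"
    "reg sB ''T'' = 2 ^ H" "reg sB ''bt'' = 2 ^ ((n + 4)\<^sup>2)"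
    using B by (simp_all add: A q_def)
  define M1 where "M1 = n * 2 ^ q"
  define M3 where "M3 = M1 * (n + 1)"
  define R where "R = d + n * n * H + n * n * q"
  define X where "X = M3 * (k - 1) + M1 * (l - 1)"
  note sb = size_bounds[OF Hn Q(2,4) k(2) ln M1_def M3_def N]
  have RN: "(3 + n + n * n) + R + (k + 1) * (n * n) < N" using sb(4) by (simp add: R_def)
  have BX: "(n + 4)\<^sup>2 * (X + M1) + H < N" using sb(5) by (simp add: X_def)
  have XN: "(n + 4)\<^sup>2 * X < N"
  proof -
    have "(n + 4)\<^sup>2 * X \<le> (n + 4)\<^sup>2 * (X + M1)" by (intro mult_le_mono2) simp
    then show ?thesis using BX by linarith
  qed
  have X': "X < N"
  proof -
    have "1 * X \<le> (n + 4)\<^sup>2 * X" by (intro mult_le_mono1) simp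
    then show ?thesis using XN by linarith
  qed
  have nnB: "reg sB ''nn'' = n * n" "reg sB ''H'' = H" by (simp_all add: kB A)
  have less: "M1 < 2 ^ N" "M3 < 2 ^ N" "R < 2 ^ N" "X < 2 ^ N"
    by (rule NM; use sb RN X' in linarith)+
  have rB: "reg sB ''n'' = n" "reg sB ''k'' = k" "reg sB ''l'' = l" "reg sB ''M'' = 2 ^ N" by (simp_all add: kB kA r)
  note C = sem_setup_C[OF rB(1) nnB(1) rB(2-4) Q(1) q_def[symmetric] nnB(2) M1_def M3_def R_def X_def less, folded sC_def]
  have btC: "reg sC ''bt'' = 2 ^ ((n + 4)\<^sup>2)" "reg sC ''M'' = 2 ^ N" by (simp_all add: kC kB kA r Q)
  have M1': "1 < (2 :: nat) ^ N" by (rule NM) (use small in linarith)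
  note D = sem_setup_D[OF btC M1', folded sD_def, unfolded C power_mult[symmetric]]
  have "(2 :: nat) ^ ((n + 4)\<^sup>2 * X) < 2 ^ N" by (rule power_strict_increasing[OF XN]) simp
  then have dv: "reg sD ''dv'' = 2 ^ ((n + 4)\<^sup>2 * (M3 * (k - 1) + M1 * (l - 1)))"
    using D(3) by (simp only: mod_less X_def)
  have N1: "1 \<le> N" using small by linarith
  have T1: "(1 :: nat) \<le> 2 ^ H" by simp
  have pos: "0 < reg x ''M''" "0 < reg x ''N''" "reg x ''N'' \<le> N" if "x \<in> {s, sA, sB, sC, sD}" for x
    using Mpos[OF that] N1 by simp_all
  have runA: "runs (compile (setup_A d)) s sA (?U * ?P) ?S \<and> bounded_state registers V N sA"
    unfolding sA_def by (rule runs_phase[OF s _ c pos _ N1 _ T1]) (auto simp: phases_def r)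
  have lA: "reg sA b \<le> N" if "b \<in> {''n2'', ''H'', ''B''}" for b
    using that small sq by (elim insertE emptyE) (simp_all add: A)
  have T: "reg sA ''T'' = 0" "reg sC ''T'' = 2 ^ H" by (simp_all add: kA kC r Q)
  have runB: "runs (compile setup_B) sA sB (?U * ?P) ?S \<and> bounded_state registers V N sB"
    unfolding sB_def by (rule runs_phase[OF conjunct2[OF runA] _ c pos _ N1 _ T1])
      (auto simp: phases_def lA T)
  have runC: "runs (compile (setup_C d)) sB sC (?U * ?P) ?S \<and> bounded_state registers V N sC"
    unfolding sC_def by (rule runs_phase[OF conjunct2[OF runB] _ c pos _ N1 _ T1])
      (auto simp: phases_def Q)
  have lD: "reg sC b \<le> N" if "b \<in> {''M1'', ''M3'', ''X''}" for b
    using that sb(6,7) X' by (elim insertE emptyE) (simp_all add: C)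
  have runD: "runs (compile setup_D) sC sD (?U * ?P) ?S \<and> bounded_state registers V N sD"
    unfolding sD_def by (rule runs_phase[OF conjunct2[OF runC] _ c pos _ N1 _ T1])
      (auto simp: phases_def T lD)
  define res where "res \<omega> = sD\<lparr>reg := (reg sD)(''i'' := R), mem := fill (mem sD) (reg sD ''fb'') R (\<lambda>m. of_bool (m \<in> \<omega>))\<rparr>" for \<omega>
  have rD: "reg sD ''R'' = R" "reg sD ''fb'' = 3 + n + n * n" "reg sD ''b'' = 0" "reg sD ''result'' = 0"
    "reg sD ''T'' = 2 ^ H" "reg sD ''nn'' = n * n" "reg sD ''H'' = H" "reg sD ''q'' = q" "reg sD ''M1'' = M1"
    "reg sD ''bt'' = 2 ^ ((n + 4)\<^sup>2)"
    by (simp_all add: kD kC kB kA A C r Q q_def[symmetric])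
  have flipsD: "reg sD ''fb'' + R \<le> N" using rD(2) RN by linarith
  have k3: "3 \<le> esize_bound d + 2" by (simp add: esize_bound_def)
  have ib: "{''i'', ''b''} \<subseteq> registers" by (simp add: registers_def)
  note flips = dist_runs_flips[OF conjunct2[OF runD] ib k3 rD(1) flipsD D(4) rD(3), folded res_def]
  have le: "H \<le> N" "q \<le> N" "n \<le> N" "k \<le> N" "n * n \<le> N" "M1 \<le> N"
    using small sb(7) Q(2) k(2) by linarith+
  have lM: "reg sD b \<le> N" if "b \<in> {''H'', ''q'', ''n'', ''k'', ''nn'', ''M1''}" for b
    using that by (elim insertE emptyE) (simp_all add: rD le kD kC kB kA r)
  have runM: "dist_runs (compile (main_prog d)) (res \<omega>) (return_pmf (sem (main_prog d) (res \<omega>))) (?U * ?P) ?S" for \<omega>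
  proof (rule dist_runs_if_runs, rule conjunct1, rule runs_phase[OF flips(2) _ c _ _ _ _ N1 _ T1])
    show "main_prog d \<in> set (phases d)" by (simp add: phases_def)
    show "reg (res \<omega>) b \<le> N" if "b \<in> loop_bounds (main_prog d)" "b \<noteq> ''T''" for b
      using that by (auto simp: res_def lM)
  qed (use pos[of sD] in \<open>simp_all add: res_def rD\<close>)
  let ?f = "\<lambda>\<omega>. sem (main_prog d) (res \<omega>)"
  have t1: "dist_runs (Seq flip_loop (compile (main_prog d))) sD
      (bind_pmf (map_pmf res (pmf_of_set (Pow {..<R}))) (\<lambda>s. return_pmf (sem (main_prog d) s)))
      (?U * (1 + 5 * R) + ?U * ?P) ?S"
    by (rule dist_runs_Seq[OF flips(1)]) (use runM in auto)
  have t1': "bind_pmf (map_pmf res (pmf_of_set (Pow {..<R}))) (\<lambda>s. return_pmf (sem (main_prog d) s))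
      = map_pmf ?f (pmf_of_set (Pow {..<R}))"
    by (simp add: map_pmf_def bind_assoc_pmf bind_return_pmf)
  have seq: "dist_runs (Seq p0 q0) s1 D0 (?U * ?P + T0) ?S"
    if "runs p0 s1 s2 (?U * ?P) ?S" "dist_runs q0 s2 D0 T0 ?S" for p0 q0 s1 s2 D0 T0
    using dist_runs_Seq[OF dist_runs_if_runs[OF that(1)], of q0 "\<lambda>_. D0" T0] that(2) by (simp add: bind_return_pmf)
  have "dist_runs (search d) s (map_pmf ?f (pmf_of_set (Pow {..<R})))
      (?U * ?P + (?U * ?P + (?U * ?P + (?U * ?P + (?U * (1 + 5 * R) + ?U * ?P))))) ?S"
    unfolding search_def
    by (intro seq[OF conjunct1[OF runA]] seq[OF conjunct1[OF runB]] seq[OF conjunct1[OF runC]] seq[OF conjunct1[OF runD]]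
      t1[unfolded t1'])
  then have run: "dist_runs (search d) s (map_pmf ?f (pmf_of_set (Pow {..<R}))) (?U * (5 * ?P + (1 + 5 * N))) ?S"
  proof (rule dist_runs_mono)
    have "R \<le> N" using RN by linarith
    then have "?U * (1 + 5 * R) \<le> ?U * (1 + 5 * N)" by (intro mult_le_mono2) simp
    then show "?U * ?P + (?U * ?P + (?U * ?P + (?U * ?P + (?U * (1 + 5 * R) + ?U * ?P)))) \<le> ?U * (5 * ?P + (1 + 5 * N))"
      by (simp only: distrib_left)
  qed simp
  have result: "reg (?f \<omega>) ''result'' \<noteq> 0 \<longleftrightarrow> (\<exists>r<n. \<exists>w<n * 2 ^ q.
      odd (card {S \<in> root_els r ` root_trees E r. selected (coin_Y n c \<omega>) (coin_vb d n H \<omega>) H (coin_wt d n H q \<omega>) k l w (mset_set S)}))" for \<omega>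
  proof -
    interpret simple_graph n E by fact
    interpret kr: kl_run n E d k l H q R "(n + 4)\<^sup>2" M1 M3 N "2 ^ N" c \<omega>
    proof unfold_locales
      show "(n + 4)\<^sup>2 * (M3 * (k - 1) + M1 * (l - 1) + M1) + H < N" using sb(5) .
    qed (rule R_def RN small sq sb(7) refl | (rule col, assumption))+
    have "kr.env (res \<omega>)" unfolding kr.env_def
    proof (intro conjI allI impI)
      show "mem (res \<omega>) (3 + v) = c v" if "v < n" for v using that m(1)[OF that] by (simp add: res_def fill_def rD mem)
      show "mem (res \<omega>) (3 + n + (v * n + w)) = of_bool (E v w)" if "v < n" "w < n" for v w
      proof -
        have "3 + n + (v * n + w) < 3 + n + n * n" using kr.pair_less[OF that] by linarith
        then show ?thesis using m(2)[OF that] by (simp add: res_def fill_def rD mem)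
      qed
      show "mem (res \<omega>) (3 + n + n * n + a) = of_bool (a \<in> \<omega>)" if "a < R" for a
        using that by (simp add: res_def fill_def rD mem)
      show "mem (res \<omega>) (3 + n + n * n + R + a) = 0" if "a < n * n" for a
        using m(3)[of "3 + n + n * n + R + a"] by (simp add: res_def fill_def rD mem)
    qed (use rD D(1,2) dv Mpos[of sD] in \<open>simp_all add: res_def\<close>)
    moreover have "reg (res \<omega>) ''result'' = 0" by (simp add: res_def rD)
    ultimately have "reg (?f \<omega>) ''result'' = of_bool (\<exists>r<n. kr.found r)" by (rule kr.sem_main_prog)
    also have "(\<exists>r<n. kr.found r) \<longleftrightarrow> (\<exists>r<n. \<exists>w<M1. odd (card {S \<in> root_els r ` root_trees E r.
        selected (coin_Y n c \<omega>) (coin_vb d n H \<omega>) H (coin_wt d n H q \<omega>) k l w (mset_set S)}))"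
    proof -
      have wt: "coin_wt d n H q \<omega> i < 2 ^ q" for i unfolding coin_wt_def by (rule block_value_less)
      have Y: "coin_Y n c \<omega> \<subseteq> {..<n}" by (auto simp: coin_Y_def)
      have "odd (packed_total n E (coin_Y n c \<omega>) (coin_vb d n H \<omega>) H (coin_wt d n H q \<omega>) ((n + 4)\<^sup>2) M1 M3 k r
          div 2 ^ ((n + 4)\<^sup>2 * (M3 * (k - 1) + M1 * (l - 1) + w) + H))
        \<longleftrightarrow> odd (card {S \<in> root_els r ` root_trees E r.
        selected (coin_Y n c \<omega>) (coin_vb d n H \<omega>) H (coin_wt d n H q \<omega>) k l w (mset_set S)})" if "w < M1" for r w
        unfolding odd_digit_packed_total[OF k ln that wt M1_def M3_def Hn refl] by (rule parity_of_selected[OF k(1) Y])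
      then show ?thesis by blast
    qed
    finally show ?thesis by (simp add: M1_def)
  qed
  show ?thesis
    by (rule exI[of _ q], rule exI[of _ ?f]) (use Q(3) run result in \<open>simp only: R_def simp_thms\<close>)
qed

section \<open>Encoded inputs\<close>

lemma nth_rows:
  "length (concat (map (\<lambda>u. map (f u) [0..<n]) [0..<m])) = m * n"
  "v < m \<Longrightarrow> w < n \<Longrightarrow> concat (map (\<lambda>u. map (f u) [0..<n]) [0..<m]) ! (v * n + w) = f v w"
proof -
  show len: "length (concat (map (\<lambda>u. map (f u) [0..<n]) [0..<m])) = m * n" for m
    by (induction m) simp_all
  show "v < m \<Longrightarrow> w < n \<Longrightarrow> concat (map (\<lambda>u. map (f u) [0..<n]) [0..<m]) ! (v * n + w) = f v w"
  proof (induction m)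
    case (Suc m)
    show ?case
    proof (cases "v < m")
      case True
      have "Suc v * n \<le> m * n" using True by (intro mult_le_mono1) simp
      then have "v * n + w < m * n" using Suc.prems(2) by simp
      then show ?thesis using Suc.IH[OF True Suc.prems(2)] len[of m] by (simp add: nth_append)
    next
      case False
      then have "v = m" using Suc.prems by simp
      then show ?thesis using Suc.prems(2) len[of m] by (simp add: nth_append)
    qed
  qed simp
qed

lemma encode_instance_nth:
  assumes G: "pverts G = {..<n}"
  shows "length (encode_instance (G, c, k, l)) = 3 + n + n * n"
    "encode_instance (G, c, k, l) ! 0 = n" "encode_instance (G, c, k, l) ! 1 = k" "encode_instance (G, c, k, l) ! 2 = l"
    "v < n \<Longrightarrow> encode_instance (G, c, k, l) ! (3 + v) = c v"
    "v < n \<Longrightarrow> w < n \<Longrightarrow> encode_instance (G, c, k, l) ! (3 + n + (v * n + w)) = of_bool ((v, w) \<in> parcs G)"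
proof -
  let ?rows = "concat (map (\<lambda>u. map (\<lambda>v. of_bool ((u, v) \<in> parcs G)) [0..<n]) [0..<n]) :: nat list"
  have enc: "encode_instance (G, c, k, l) = [n, k, l] @ map c [0..<n] @ ?rows" by (simp add: G Let_def)
  note rows = nth_rows[where f = "\<lambda>u v. of_bool ((u, v) \<in> parcs G) :: nat" and n = n and m = n]
  show "length (encode_instance (G, c, k, l)) = 3 + n + n * n"
    "encode_instance (G, c, k, l) ! 0 = n" "encode_instance (G, c, k, l) ! 1 = k" "encode_instance (G, c, k, l) ! 2 = l"
    unfolding enc using rows(1) by simp_all
  have "([n, k, l] @ map c [0..<n] @ ?rows) ! (length [n, k, l] + v) = (map c [0..<n] @ ?rows) ! v"
    by (rule nth_append_length_plus)
  then show "v < n \<Longrightarrow> encode_instance (G, c, k, l) ! (3 + v) = c v"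
    unfolding enc by (simp add: nth_append eval_nat_numeral)
  assume "v < n" "w < n"
  have "(([n, k, l] @ map c [0..<n]) @ ?rows) ! (length ([n, k, l] @ map c [0..<n]) + (v * n + w)) = ?rows ! (v * n + w)"
    by (rule nth_append_length_plus)
  also have "\<dots> = of_bool ((v, w) \<in> parcs G)" by (rule rows(2)) fact+
  finally show "encode_instance (G, c, k, l) ! (3 + n + (v * n + w)) = of_bool ((v, w) \<in> parcs G)"
    unfolding enc by (simp add: eval_nat_numeral)
qed

lemma less_two_pow_bits: "x < 2 ^ bits x"
proof (cases "x = 0")
  case False
  have "x < 2 ^ floorlog 2 x" using floorlog_bounds[of x 2] False by simp
  also have "\<dots> \<le> 2 ^ bits x" unfolding bits_def by (intro power_increasing) auto
  finally show ?thesis .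
qed simp

lemma input_size_bounds:
  shows "length xs \<le> input_size xs" "x \<in> set xs \<Longrightarrow> x < 2 ^ input_size xs"
proof -
  have "(\<Sum>x\<leftarrow>xs. 1) \<le> input_size xs" unfolding input_size_def by (rule sum_list_mono) (simp add: bits_def)
  then show "length xs \<le> input_size xs" by (simp add: sum_list_triv)
  assume "x \<in> set xs"
  then have "bits x \<le> input_size xs" unfolding input_size_def by (intro member_le_sum_list) auto
  then have "(2 :: nat) ^ bits x \<le> 2 ^ input_size xs" by (intro power_increasing) auto
  then show "x < 2 ^ input_size xs" using less_two_pow_bits[of x] by linarith
qed

lemma bounded_initial_state:
  assumes "input_size xs \<le> V" "1 \<le> V" "A < 2 ^ V" "length xs \<le> A"
  shows "bounded_state registers V A (initial_state xs)"
proof -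
  have "xs ! i < 2 ^ V" if "i < length xs" for i
  proof -
    have "xs ! i < 2 ^ input_size xs" by (rule input_size_bounds(2)[OF nth_mem[OF that]])
    also have "\<dots> \<le> 2 ^ V" by (rule power_increasing[OF assms(1)]) simp
    finally show ?thesis .
  qed
  then show ?thesis using assms by (auto simp: bounded_state_def initial_state_def)
qed

section \<open>Correctness and resources of the algorithm\<close>

primrec pow_expr :: "expr \<Rightarrow> nat \<Rightarrow> expr" where
  "pow_expr e 0 = Const 1"
| "pow_expr e (Suc j) = Bin Mul e (pow_expr e j)"

lemma expr_val_pow_expr: "expr_val (pow_expr e j) s = expr_val e s ^ j"
  by (induction j) simp_all

lemma pow_expr_static: "max_const (pow_expr e j) \<le> max 1 (max_const e)" "esize (pow_expr e j) = 1 + j * (1 + esize e)"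
  by (induction j) auto

definition size_expr :: "nat \<Rightarrow> expr" where
  "size_expr d = pow_expr (Bin Add (Reg ''n'') (Const (8 + d))) 9"

definition init_prog :: "nat \<Rightarrow> com" where
  "init_prog d = Seq (Assign ''n'' (Load (Const 0))) (Seq (Assign ''k'' (Load (Const 1)))
     (Seq (Assign ''l'' (Load (Const 2))) (Seq (Assign ''N'' (size_expr d)) (Seq (Assign ''M'' (Const 1)) double_loop))))"

text \<open>By \<open>kl_tree_le\<close> all other inputs are settled by
  \<open>trivial_expr\<close>. The digit layout needs \<open>k \<le> n\<close>, and the time bound
  needs \<open>l \<le> k\<close>.\<close>

definition nontrivial_expr :: expr where
  "nontrivial_expr = Bin Mul (Bin Less (Const 1) (Reg ''k'')) (Bin Mul (e_not (Bin Less (Reg ''n'') (Reg ''k'')))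
     (Bin Mul (Bin Less (Const 0) (Reg ''l'')) (e_not (Bin Less (Reg ''k'') (Reg ''l'')))))"

definition trivial_expr :: expr where
  "trivial_expr = Bin Mul (Bin Equal (Reg ''k'') (Const 1)) (Bin Mul (Bin Equal (Reg ''l'') (Const 0))
     (Bin Less (Const 0) (Reg ''n'')))"

definition algorithm :: "nat \<Rightarrow> com" where
  "algorithm d = Seq (init_prog d) (Cond nontrivial_expr (search d) (Assign ''result'' trivial_expr))"

lemma init_prog_run:
  assumes s: "bounded_state registers V A s" and c: "const_bound d < 2 ^ V"
    and r: "mem s 0 = n" "mem s 1 = k" "mem s 2 = l" "reg s ''i'' = 0" and N: "N = (n + 8 + d) ^ 9" "N < V"
  defines "s' \<equiv> set_reg ''i'' N (set_reg ''M'' (2 ^ N) (set_reg ''N'' N (set_reg ''l'' l (set_reg ''k'' k (set_reg ''n'' n s)))))"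
  shows "runs (init_prog d) s s' (step_cost V (esize_bound d + 2) * (6 + 3 * N)) (space_bound registers V A (esize_bound d + 2))
    \<and> bounded_state registers V A s'"
proof -
  let ?k = "esize_bound d + 2"
  let ?U = "step_cost V ?k" and ?S = "space_bound registers V A ?k"
  have mV: "mem s a < 2 ^ V" for a using s by (simp add: bounded_state_def)
  have const: "2 < (2 :: nat) ^ V" "8 + d < 2 ^ V" "1 < (2 :: nat) ^ V" using c by (auto simp: const_bound_def)
  have NV: "N < 2 ^ V" using N(2) less_exp[of V] by linarith
  define s1 where "s1 = set_reg ''n'' n s"
  define s2 where "s2 = set_reg ''k'' k s1"
  define s3 where "s3 = set_reg ''l'' l s2"
  define s4 where "s4 = set_reg ''N'' N s3"
  define s5 where "s5 = set_reg ''M'' 1 s4"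
  have 1: "runs (Assign ''n'' (Load (Const 0))) s s1 ?U ?S \<and> bounded_state registers V A s1"
    unfolding s1_def by (rule runs_Assign_bounded[OF s]) (use r mV[of 0] in \<open>auto simp: registers_def\<close>)
  have 2: "runs (Assign ''k'' (Load (Const 1))) s1 s2 ?U ?S \<and> bounded_state registers V A s2"
    unfolding s2_def by (rule runs_Assign_bounded[OF conjunct2[OF 1]])
      (use r mV[of 1] const in \<open>auto simp: registers_def s1_def\<close>)
  have 3: "runs (Assign ''l'' (Load (Const 2))) s2 s3 ?U ?S \<and> bounded_state registers V A s3"
    unfolding s3_def by (rule runs_Assign_bounded[OF conjunct2[OF 2]])
      (use r mV[of 2] const in \<open>auto simp: registers_def s1_def s2_def\<close>)
  have 4: "runs (Assign ''N'' (size_expr d)) s3 s4 ?U ?S \<and> bounded_state registers V A s4"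
    unfolding s4_def
  proof (rule runs_Assign_bounded[OF conjunct2[OF 3]])
    show "max_const (size_expr d) < 2 ^ V" unfolding size_expr_def
      by (rule le_less_trans[OF pow_expr_static(1)]) (use const in simp)
    show "esize (size_expr d) \<le> ?k + 2" by (simp add: size_expr_def pow_expr_static(2) esize_bound_def)
    show "expr_val (size_expr d) s3 = N"
      by (simp add: size_expr_def expr_val_pow_expr N s3_def s2_def s1_def add.assoc)
  qed (use NV in \<open>auto simp: registers_def\<close>)
  have 5: "runs (Assign ''M'' (Const 1)) s4 s5 ?U ?S \<and> bounded_state registers V A s5"
    unfolding s5_def by (rule runs_Assign_bounded[OF conjunct2[OF 4]]) (use const in \<open>auto simp: registers_def\<close>)
  have 6: "runs double_loop s5 (set_reg ''i'' N (set_reg ''M'' (2 ^ N) s5)) (?U * (1 + 3 * N)) ?S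
      \<and> bounded_state registers V A (set_reg ''i'' N (set_reg ''M'' (2 ^ N) s5))"
    by (rule runs_double_loop[OF conjunct2[OF 5] N(2)])
      (use r in \<open>auto simp: registers_def esize_bound_def s5_def s4_def s3_def s2_def s1_def\<close>)
  have s': "set_reg ''i'' N (set_reg ''M'' (2 ^ N) s5) = s'"
    by (simp add: s'_def s5_def s4_def s3_def s2_def s1_def set_reg_def)
  have "runs (init_prog d) s s' (?U + (?U + (?U + (?U + (?U + ?U * (1 + 3 * N)))))) ?S"
    unfolding init_prog_def s'[symmetric]
    by (intro runs_Seq[OF conjunct1[OF 1]] runs_Seq[OF conjunct1[OF 2]] runs_Seq[OF conjunct1[OF 3]]
      runs_Seq[OF conjunct1[OF 4]] runs_Seq[OF conjunct1[OF 5]] conjunct1[OF 6])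
  then show ?thesis using conjunct2[OF 6] unfolding s' by (simp add: algebra_simps)
qed

text \<open>\<open>N\<close> with the number of vertices replaced by the input size.
  \<open>width_poly\<close> in addition exceeds the input size and all constants of the program, so
  that it can serve as bit length \<open>V\<close>.\<close>

definition size_poly :: "nat \<Rightarrow> nat poly" where "size_poly d = [:8 + d, 1:] ^ 9"
definition width_poly :: "nat \<Rightarrow> nat poly" where "width_poly d = size_poly d + [:1 + const_bound d, 1:]"
definition step_poly :: "nat \<Rightarrow> nat poly" where
  "step_poly d = 1 + smult (2 * (esize_bound d + 2 + 2)\<^sup>2) (width_poly d)"
definition time_poly :: "nat \<Rightarrow> nat poly" where
  "time_poly d = step_poly d * ([:9:] + smult 8 (size_poly d) + smult (20 * 4 ^ size_sum d) (size_poly d ^ depth_sum d))"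
definition space_poly :: "nat \<Rightarrow> nat poly" where
  "space_poly d = smult (card registers) (width_poly d) + smult 2 (size_poly d * width_poly d) + step_poly d"

lemma poly_simps:
  "poly (size_poly d) x = (x + 8 + d) ^ 9" "poly (width_poly d) x = (x + 8 + d) ^ 9 + 1 + x + const_bound d"
  "poly (step_poly d) x = step_cost (poly (width_poly d) x) (esize_bound d + 2)"
  "poly (time_poly d) x = poly (step_poly d) x * (9 + 8 * poly (size_poly d) x + 5 * phase_time d (poly (size_poly d) x) 4)"
  "poly (space_poly d) x = space_bound registers (poly (width_poly d) x) (poly (size_poly d) x) (esize_bound d + 2)"
proof -
  show 1: "poly (size_poly d) x = (x + 8 + d) ^ 9" by (simp add: size_poly_def add_ac)
  show "poly (width_poly d) x = (x + 8 + d) ^ 9 + 1 + x + const_bound d"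
    by (simp add: width_poly_def 1)
  show 3: "poly (step_poly d) x = step_cost (poly (width_poly d) x) (esize_bound d + 2)"
    by (simp only: step_poly_def step_cost_def poly_add poly_1 poly_smult mult_ac)
  show "poly (time_poly d) x = poly (step_poly d) x * (9 + 8 * poly (size_poly d) x + 5 * phase_time d (poly (size_poly d) x) 4)"
    unfolding time_poly_def phase_time_def poly_mult poly_add poly_smult poly_power by simp
  show "poly (space_poly d) x = space_bound registers (poly (width_poly d) x) (poly (size_poly d) x) (esize_bound d + 2)"
    unfolding space_poly_def space_bound_def 3[symmetric] poly_mult poly_add poly_smult by simp
qed

text \<open>An odd count is nonzero, so acceptance exhibits a tree whatever the coins are.
  Conversely a leaf of a given tree yields \<open>S0\<close>, and
  \<open>ex_colors_few_labels\<close> supplies the color set that the coins have to hit.\<close>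

lemma search_correct:
  assumes G: "pair_graph G" "pverts G = {..<n}" and d: "2 \<le> d" and k: "2 \<le> k" "k \<le> n" and l: "1 \<le> l" "l \<le> k"
    and col: "proper_coloring d G c" and q: "2 * (n * n) \<le> 2 ^ q"
    and H: "H = label_bound d k l + 2" and R: "R = d + n * n * H + n * n * q"
    and f: "\<And>\<omega>. acc \<omega> \<longleftrightarrow> (\<exists>r<n. \<exists>w<n * 2 ^ q. odd (card {S \<in> root_els r ` root_trees (\<lambda>a b. (a, b) \<in> parcs G) r.
      selected (coin_Y n c \<omega>) (coin_vb d n H \<omega>) H (coin_wt d n H q \<omega>) k l w (mset_set S)}))"
  shows "acc \<omega> \<Longrightarrow> contains_kl_tree G k l"
    and "contains_kl_tree G k l \<Longrightarrow> measure_pmf.prob (pmf_of_set (Pow {..<R})) {\<omega>. \<not> acc \<omega>} \<le> 1 - 3 / (8 * 2 ^ d)"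
proof -
  let ?E = "\<lambda>a b. (a, b) \<in> parcs G"
  interpret G: pair_graph G by fact
  interpret simple_graph n ?E
  proof
    show "?E v w \<longleftrightarrow> ?E w v" for v w using G.graph_symmetric by auto
    show "\<not> ?E v v" for v using G.no_loops' by blast
    show "?E v w \<Longrightarrow> v < n" for v w using G.in_arcsD1 G(2) by auto
  qed
  have c: "c v < d" if "v < n" for v using col that G(2) by (auto simp: proper_coloring_def)
  have proper: "c a \<noteq> c b" if "?E a b" for a b using col that by (auto simp: proper_coloring_def)
  show "contains_kl_tree G k l" if a: "acc \<omega>"
  proof -
    obtain r w where "odd (card {S \<in> root_els r ` root_trees ?E r.
      selected (coin_Y n c \<omega>) (coin_vb d n H \<omega>) H (coin_wt d n H q \<omega>) k l w (mset_set S)})"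
      using a f by blast
    then have "{S \<in> root_els r ` root_trees ?E r.
      selected (coin_Y n c \<omega>) (coin_vb d n H \<omega>) H (coin_wt d n H q \<omega>) k l w (mset_set S)} \<noteq> {}" by (metis card.empty even_zero)
    then obtain t where t: "t \<in> root_trees ?E r" and
      sel: "selected (coin_Y n c \<omega>) (coin_vb d n H \<omega>) H (coin_wt d n H q \<omega>) k l w (mset_set (root_els r t))" by blast
    obtain v V A L where tt: "t = (v, V, A, L)" by (cases t)
    have "card V = k - 1" "card (with_root v V L) = l - 1"
      using sel root_els_counts[OF t[unfolded tt]] unfolding selected_def tt by simp_all
    then show ?thesis using root_trees_imp_kl_tree[OF G(1) t[unfolded tt]] k l by simp
  qed
  assume tree: "contains_kl_tree G k l"
  obtain r v V A L where t: "(v, V, A, L) \<in> root_trees ?E r" and kV: "Suc (card V) = k"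
    and lL: "Suc (card (with_root v V L)) = l" and rG: "r \<in> pverts G"
    by (rule kl_tree_imp_root_trees[OF G(1) tree k(1) l(1)])
  define S0 where "S0 = root_els r (v, V, A, L)"
  have S0: "S0 \<in> root_els r ` root_trees ?E r" unfolding S0_def using t by (rule imageI)
  have n0: "n_edges (mset_set S0) = k - 1" "n_leaves (mset_set S0) = l - 1"
    unfolding S0_def root_els_counts[OF t] using kV lL by simp_all
  have "\<exists>X\<subseteq>{..<d}. size (labels {v. v < n \<and> c v \<in> X} (mset_set S0)) \<le> label_bound d k l"
    by (rule ex_colors_few_labels[OF S0 n0 d], erule c, erule proper)
  then obtain X0 where X0: "X0 \<subseteq> {..<d}" "size (labels {v. v < n \<and> c v \<in> X0} (mset_set S0)) \<le> label_bound d k l"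
    by (elim exE conjE) (rule that)
  have lab: "size (labels {v. v < n \<and> c v \<in> X0} (mset_set S0)) + 2 \<le> H" using X0(2) H by simp
  let ?good = "{\<omega> \<in> Pow {..<R}. \<exists>w<n * 2 ^ q. odd (card {S \<in> root_els r ` root_trees ?E r.
    selected (coin_Y n c \<omega>) (coin_vb d n H \<omega>) H (coin_wt d n H q \<omega>) k l w (mset_set S)})}"
  have many: "3 * 2 ^ R \<le> 8 * 2 ^ d * card ?good"
    by (rule random_success[OF k q refl S0 n0 X0(1) lab c R])
  have fin: "finite (Pow {..<R})" by simp
  have sub: "Pow {..<R} \<inter> {\<omega>. \<not> acc \<omega>} \<subseteq> Pow {..<R} - ?good"
    using f rG G(2) by blast
  have cP: "card (Pow {..<R}) = 2 ^ R" by (simp add: card_Pow)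
  have gP: "?good \<subseteq> Pow {..<R}" by blast
  have "card (Pow {..<R} \<inter> {\<omega>. \<not> acc \<omega>}) \<le> card (Pow {..<R} - ?good)"
    by (rule card_mono[OF _ sub]) simp
  also have "\<dots> = 2 ^ R - card ?good"
    using card_Diff_subset[OF finite_subset[OF gP fin] gP] cP by simp
  finally have le: "card (Pow {..<R} \<inter> {\<omega>. \<not> acc \<omega>}) \<le> 2 ^ R - card ?good" .
  have gle: "card ?good \<le> 2 ^ R" using card_mono[OF fin gP] cP by simp
  have arith: "real b \<le> (1 - 3 / (8 * 2 ^ d)) * 2 ^ R"
    if "b \<le> 2 ^ R - g" "g \<le> 2 ^ R" "3 * 2 ^ R \<le> 8 * 2 ^ d * g" for b g :: nat
  proof -
    have "b + g \<le> 2 ^ R" using that(1,2) by linarith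
    then have "real (b + g) \<le> real (2 ^ R)" by (simp only: of_nat_le_iff)
    then have 1: "real b + real g \<le> 2 ^ R" by simp
    have "real (3 * 2 ^ R) \<le> real (8 * 2 ^ d * g)" using that(3) by (simp only: of_nat_le_iff)
    then have "3 * 2 ^ R \<le> 8 * 2 ^ d * real g" by simp
    then have "3 / (8 * 2 ^ d) * 2 ^ R \<le> real g" by (simp add: field_simps)
    then show ?thesis using 1 by (simp add: left_diff_distrib)
  qed
  have "measure_pmf.prob (pmf_of_set (Pow {..<R})) {\<omega>. \<not> acc \<omega>}
      = real (card (Pow {..<R} \<inter> {\<omega>. \<not> acc \<omega>})) / real (2 ^ R)"
    unfolding cP[symmetric] by (rule measure_pmf_of_set) auto
  also have "\<dots> \<le> 1 - 3 / (8 * 2 ^ d)"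
    unfolding of_nat_power of_nat_numeral using arith[OF le gle many]
    by (simp only: pos_divide_le_eq zero_less_power zero_less_numeral)
  finally show "measure_pmf.prob (pmf_of_set (Pow {..<R})) {\<omega>. \<not> acc \<omega>} \<le> 1 - 3 / (8 * 2 ^ d)" .
qed

text \<open>\<open>T\<close> is \<open>2 ^ label_bound d k l\<close>, or 1 for inputs settled
  directly, among which \<open>fine_bound\<close> can be less than 1. The two bits by which
  \<open>H\<close> exceeds the label bound cost only a factor 4.\<close>

lemma algorithm_run:
  assumes d: "2 \<le> d" and i: "(G, c, k, l) \<in> kl_instances d"
  defines "xs \<equiv> encode_instance (G, c, k, l)"
  shows "\<exists>D T. dist_runs (algorithm d) (initial_state xs) D (poly (time_poly d) (input_size xs) * T) (poly (space_poly d) (input_size xs))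
    \<and> real T \<le> max 1 (fine_bound d (G, c, k, l)) \<and> real T \<le> max 1 (coarse_bound d (G, c, k, l))
    \<and> (\<not> contains_kl_tree G k l \<longrightarrow> (\<forall>s \<in> set_pmf D. reg s ''result'' = 0))
    \<and> (contains_kl_tree G k l \<longrightarrow> measure_pmf.prob D {s. reg s ''result'' = 0} \<le> 1 - 3 / (8 * 2 ^ d))"
proof -
  obtain n where G: "pair_graph G" "pverts G = {..<n}" and col: "proper_coloring d G c" and k1: "1 \<le> k"
    using i by (auto simp: kl_instances_def)
  note enc = encode_instance_nth[OF G(2), where c = c and k = k and l = l, folded xs_def]
  define I where "I = input_size xs"
  define N where "N = (n + 8 + d) ^ 9"
  define N' where "N' = poly (size_poly d) I"
  define V where "V = poly (width_poly d) I"
  let ?k = "esize_bound d + 2"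
  let ?U = "step_cost V ?k" and ?S = "space_bound registers V N ?k"
  have "length xs \<le> I" unfolding I_def by (rule input_size_bounds)
  then have nI: "n \<le> I" using enc(1) by simp
  have NN: "N \<le> N'" unfolding N_def N'_def poly_simps(1) by (intro power_mono) (use nI in auto)
  have V: "N < V" "I \<le> V" "1 \<le> V" "const_bound d < V" using NN by (auto simp: V_def N'_def poly_simps)
  have c: "const_bound d < 2 ^ V" "N < 2 ^ V" using V(1,4) less_exp[of V] by linarith+
  have len: "length xs \<le> N"
    unfolding enc(1)
  proof -
    define a where "a = n + 8 + d"
    have "n * n \<le> a * a" by (intro mult_le_mono) (auto simp: a_def)
    moreover have "1 * a \<le> a * a" by (rule mult_le_mono1) (simp add: a_def)
    moreover have "n \<le> a" "3 \<le> a" by (simp_all add: a_def)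
    ultimately have "3 + n + n * n \<le> 3 * (a * a)" by linarith
    then have "3 + n + n * n \<le> 3 * a ^ 2" by (simp only: power2_eq_square)
    also have "\<dots> \<le> a * a ^ 2" by (intro mult_le_mono1) (simp add: a_def)
    also have "\<dots> = a ^ 3" by (simp add: eval_nat_numeral)
    also have "\<dots> \<le> a ^ 9" by (rule power_increasing) (auto simp: a_def)
    finally show "3 + n + n * n \<le> N" by (simp add: N_def a_def)
  qed
  let ?s0 = "initial_state xs"
  have s0: "bounded_state registers V N ?s0"
    by (rule bounded_initial_state) (use V c len in \<open>auto simp: I_def\<close>)
  have mem0: "mem ?s0 a = xs ! a" if "a < 3 + n + n * n" for a using that enc(1) by (simp add: initial_state_def)
  have z0: "mem ?s0 a = 0" if "3 + n + n * n \<le> a" for a using that enc(1) by (simp add: initial_state_def)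
  have reg0: "reg ?s0 x = 0" for x by (simp add: initial_state_def)
  have m3: "mem ?s0 0 = n" "mem ?s0 1 = k" "mem ?s0 2 = l"
    using mem0[of 0] mem0[of 1] mem0[of 2] enc(2-4) by simp_all
  define s' where "s' = set_reg ''i'' N (set_reg ''M'' (2 ^ N) (set_reg ''N'' N (set_reg ''l'' l (set_reg ''k'' k (set_reg ''n'' n ?s0)))))"
  have init: "runs (init_prog d) ?s0 s' (?U * (6 + 3 * N)) ?S \<and> bounded_state registers V N s'"
    unfolding s'_def by (rule init_prog_run[OF s0 c(1) m3 reg0 N_def V(1)])
  have s': "bounded_state registers V N s'" using init by blast
  have r: "reg s' ''n'' = n" "reg s' ''k'' = k" "reg s' ''l'' = l" "reg s' ''N'' = N" "reg s' ''M'' = 2 ^ N"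
    "reg s' ''b'' = 0" "reg s' ''result'' = 0" "reg s' ''T'' = 0" and ms: "mem s' = mem ?s0"
    by (simp_all add: s'_def reg0)
  have "N * (2 * V) \<le> N' * (2 * V)" using NN by (rule mult_le_mono1)
  then have "?S \<le> space_bound registers V N' ?k" unfolding space_bound_def by linarith
  then have space: "?S \<le> poly (space_poly d) I" by (simp only: poly_simps(5) V_def N'_def)
  have one: "(1 :: nat) < 2 ^ V" using V by (intro one_less_power) auto
  have cost: "expr_cost e s' < ?U" if "max_const e \<le> 1" "esize e \<le> 30" for e
  proof -
    have "2 * expr_cost e s' < ?U" by (rule cost_less[OF s']) (use that one in \<open>auto simp: esize_bound_def\<close>)
    then show ?thesis by simp
  qed
  have nt: "expr_val nontrivial_expr s' \<noteq> 0 \<longleftrightarrow> 2 \<le> k \<and> k \<le> n \<and> 1 \<le> l \<and> l \<le> k"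
    by (auto simp: nontrivial_expr_def r)
  have time_poly: "poly (time_poly d) I = ?U * (9 + 8 * N' + 5 * phase_time d N' 4)"
    by (simp only: poly_simps(3,4) V_def[symmetric] N'_def[symmetric])
  show ?thesis
  proof (cases "expr_val nontrivial_expr s' = 0")
    case True
    define s'' where "s'' = set_reg ''result'' (expr_val trivial_expr s') s'"
    have "runs (Assign ''result'' trivial_expr) s' s'' ?U ?S" unfolding s''_def
      by (rule runs_Assign[OF cost space_used_le[OF s']]) (simp_all add: trivial_expr_def)
    from dist_runs_CondFalse[OF True dist_runs_if_runs[OF this] cost space_used_le[OF s'], of "search d"]
    have "dist_runs (Cond nontrivial_expr (search d) (Assign ''result'' trivial_expr)) s' (return_pmf s'') (?U + ?U) ?S"
      by (simp add: nontrivial_expr_def)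
    then have "dist_runs (algorithm d) ?s0 (bind_pmf (return_pmf s') (\<lambda>_. return_pmf s'')) (?U * (6 + 3 * N) + (?U + ?U)) ?S"
      unfolding algorithm_def by (intro dist_runs_Seq[OF dist_runs_if_runs[OF conjunct1[OF init]]]) simp
    then have run: "dist_runs (algorithm d) ?s0 (return_pmf s'') (poly (time_poly d) I * 1) (poly (space_poly d) I)"
      unfolding bind_return_pmf
    proof (rule dist_runs_mono[OF _ _ space])
      have "?U * (6 + 3 * N) + (?U + ?U) = ?U * (8 + 3 * N)" by (simp add: distrib_left)
      also have "\<dots> \<le> ?U * (9 + 8 * N' + 5 * phase_time d N' 4)" using NN by (intro mult_le_mono2) linarith
      finally show "?U * (6 + 3 * N) + (?U + ?U) \<le> poly (time_poly d) I * 1" unfolding time_poly by simp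
    qed
    have res: "reg s'' ''result'' \<noteq> 0 \<longleftrightarrow> contains_kl_tree G k l"
    proof -
      have "reg s'' ''result'' \<noteq> 0 \<longleftrightarrow> k = 1 \<and> l = 0 \<and> 0 < n" by (auto simp: s''_def trivial_expr_def r)
      moreover have "contains_kl_tree G k l" if "k = 1 \<and> l = 0 \<and> 0 < n"
        using single_vertex_tree[OF G(1), of 0] G(2) that by simp
      moreover have "k = 1 \<and> l = 0 \<and> 0 < n" if t: "contains_kl_tree G k l"
        using kl_tree_le[OF G(1) t] G(2) nt True k1 by (cases "k = 1") auto
      ultimately show ?thesis by blast
    qed
    have prob: "measure_pmf.prob (return_pmf s'') {s. reg s ''result'' = 0} \<le> 1 - 3 / (8 * 2 ^ d)"
      if "contains_kl_tree G k l"
    proof -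
      have "(1 :: real) \<le> 2 ^ d" by simp
      then have "(3 :: real) \<le> 8 * 2 ^ d" by linarith
      then have "(0 :: real) \<le> 1 - 3 / (8 * 2 ^ d)" by (simp add: divide_le_eq)
      then show ?thesis using res that by (simp add: measure_return_pmf)
    qed
    have no: "reg s ''result'' = 0" if "\<not> contains_kl_tree G k l" "s \<in> set_pmf (return_pmf s'')" for s
      using that res by simp
    have T: "real 1 \<le> max 1 F" for F by simp
    show ?thesis unfolding I_def[symmetric]
      by (intro exI[of _ "return_pmf s''"] exI[of _ 1] conjI run T impI ballI) (erule (1) no, erule prob)
  next
    case False
    then have kl: "2 \<le> k" "k \<le> n" "1 \<le> l" "l \<le> k" using nt by blast+
    define H where "H = label_bound d k l + 2"
    define T where "T = (2 :: nat) ^ label_bound d k l"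
    interpret G: pair_graph G by fact
    have graph: "simple_graph n (\<lambda>a b. (a, b) \<in> parcs G)"
    proof
      show "(v, w) \<in> parcs G \<longleftrightarrow> (w, v) \<in> parcs G" for v w using G.graph_symmetric by auto
      show "(v, v) \<notin> parcs G" for v using G.no_loops' by blast
      show "(v, w) \<in> parcs G \<Longrightarrow> v < n" for v w using G.in_arcsD1 G(2) by auto
    qed
    have cd: "c v < d" if "v < n" for v using col that G(2) by (auto simp: proper_coloring_def)
    have m: "mem s' (3 + v) = c v" if "v < n" for v
      using mem0[of "3 + v"] enc(5)[OF that] that by (simp add: ms)
    have adj: "mem s' (3 + n + (v * n + w)) = of_bool ((v, w) \<in> parcs G)" if "v < n" "w < n" for v w
    proof -
      have "Suc v * n \<le> n * n" using that by (intro mult_le_mono1) simp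
      then have "3 + n + (v * n + w) < 3 + n + n * n" using that by simp
      from mem0[OF this] show ?thesis using enc(6)[OF that] by (simp only: ms)
    qed
    have z: "mem s' a = 0" if "3 + n + n * n \<le> a" for a using z0[OF that] by (simp only: ms)
    have "\<exists>q f. 2 * (n * n) \<le> 2 ^ q \<and> dist_runs (search d) s' (map_pmf f (pmf_of_set (Pow {..<d + n * n * H + n * n * q})))
        (?U * (5 * phase_time d N (2 ^ H) + (1 + 5 * N))) ?S \<and>
      (\<forall>\<omega>. reg (f \<omega>) ''result'' \<noteq> 0 \<longleftrightarrow> (\<exists>r<n. \<exists>w<n * 2 ^ q.
        odd (card {S \<in> root_els r ` root_trees (\<lambda>a b. (a, b) \<in> parcs G) r.
          selected (coin_Y n c \<omega>) (coin_vb d n H \<omega>) H (coin_wt d n H q \<omega>) k l w (mset_set S)})))"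
      by (rule search_run[OF s' d c(1) N_def r kl graph cd m adj z H_def])
    then obtain q f where q: "2 * (n * n) \<le> 2 ^ q"
      and run: "dist_runs (search d) s' (map_pmf f (pmf_of_set (Pow {..<d + n * n * H + n * n * q})))
        (?U * (5 * phase_time d N (2 ^ H) + (1 + 5 * N))) ?S"
      and acc: "\<forall>\<omega>. reg (f \<omega>) ''result'' \<noteq> 0 \<longleftrightarrow> (\<exists>r<n. \<exists>w<n * 2 ^ q.
        odd (card {S \<in> root_els r ` root_trees (\<lambda>a b. (a, b) \<in> parcs G) r.
          selected (coin_Y n c \<omega>) (coin_vb d n H \<omega>) H (coin_wt d n H q \<omega>) k l w (mset_set S)}))"
      by (elim exE conjE) (rule that)
    let ?R = "d + n * n * H + n * n * q"
    let ?D = "map_pmf f (pmf_of_set (Pow {..<?R}))"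
    note correct = search_correct[OF G d kl col q H_def refl acc[rule_format]]
    from dist_runs_CondTrue[OF False run cost space_used_le[OF s'], of "Assign ''result'' trivial_expr"]
    have "dist_runs (Cond nontrivial_expr (search d) (Assign ''result'' trivial_expr)) s' ?D
        (?U + ?U * (5 * phase_time d N (2 ^ H) + (1 + 5 * N))) ?S"
      by (simp add: nontrivial_expr_def)
    then have "dist_runs (algorithm d) ?s0 (bind_pmf (return_pmf s') (\<lambda>_. ?D))
        (?U * (6 + 3 * N) + (?U + ?U * (5 * phase_time d N (2 ^ H) + (1 + 5 * N)))) ?S"
      unfolding algorithm_def by (intro dist_runs_Seq[OF dist_runs_if_runs[OF conjunct1[OF init]]]) simp
    then have run': "dist_runs (algorithm d) ?s0 ?D (poly (time_poly d) I * T) (poly (space_poly d) I)"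
      unfolding bind_return_pmf
    proof (rule dist_runs_mono[OF _ _ space])
      have T1: "1 \<le> T" by (simp add: T_def)
      have pt: "phase_time d N (2 ^ H) \<le> phase_time d N' 4 * T"
      proof -
        have "N ^ depth_sum d \<le> N' ^ depth_sum d" using NN by (intro power_mono) auto
        then have "4 ^ size_sum d * (N ^ depth_sum d * (4 * T)) \<le> 4 ^ size_sum d * (N' ^ depth_sum d * (4 * T))"
          by (intro mult_le_mono2 mult_le_mono1)
        moreover have "2 ^ H = 4 * T" by (simp add: H_def T_def)
        ultimately show ?thesis by (simp only: phase_time_def mult.assoc)
      qed
      have "N * 1 \<le> N' * T" by (rule mult_le_mono[OF NN T1])
      then have "8 + 8 * N + 5 * phase_time d N (2 ^ H) \<le> (9 + 8 * N' + 5 * phase_time d N' 4) * T"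
        unfolding distrib_right using pt T1 by (simp only: mult.assoc)
      then have "?U * (8 + 8 * N + 5 * phase_time d N (2 ^ H)) \<le> ?U * ((9 + 8 * N' + 5 * phase_time d N' 4) * T)"
        by (rule mult_le_mono2)
      then show "?U * (6 + 3 * N) + (?U + ?U * (5 * phase_time d N (2 ^ H) + (1 + 5 * N))) \<le> poly (time_poly d) I * T"
        unfolding time_poly by (simp add: algebra_simps)
    qed
    have Tf: "real T \<le> max 1 (fine_bound d (G, c, k, l))" "real T \<le> max 1 (coarse_bound d (G, c, k, l))"
      using two_pow_label_bound_le[OF d k1 kl(4), of G c] by (simp_all add: T_def le_max_iff_disj)
    have no: "reg s ''result'' = 0" if nc: "\<not> contains_kl_tree G k l" and sD: "s \<in> set_pmf ?D" for s
    proof (rule ccontr)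
      assume "reg s ''result'' \<noteq> 0"
      moreover obtain \<omega> where "s = f \<omega>" using sD unfolding set_map_pmf by (rule imageE)
      ultimately show False using correct(1)[of \<omega>] nc by blast
    qed
    have yes: "measure_pmf.prob ?D {s. reg s ''result'' = 0} \<le> 1 - 3 / (8 * 2 ^ d)" if "contains_kl_tree G k l"
      using correct(2)[OF that] by (simp add: measure_map_pmf vimage_def)
    show ?thesis unfolding I_def[symmetric]
      by (intro exI[of _ ?D] exI[of _ T] conjI run' Tf impI ballI) (erule (1) no, erule yes)
  qed
qed

theorem theorem4:
  fixes d :: nat
  assumes "2 \<le> d"
  shows "\<exists>p \<epsilon>. \<epsilon> < 1
    \<and> monte_carlo_decides p (kl_instances d) encode_instance has_kl_tree \<epsilon>
    \<and> runs_in_ostar_time p (kl_instances d) encode_instance (fine_bound d)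
    \<and> runs_in_ostar_time p (kl_instances d) encode_instance (coarse_bound d)
    \<and> runs_in_polynomial_space p (kl_instances d) encode_instance"
proof -
  define \<epsilon> :: real where "\<epsilon> = 1 - 3 / (8 * 2 ^ d)"
  have eps: "\<epsilon> < 1" by (simp add: \<epsilon>_def)
  \<comment> \<open>All claims are proved for one and the same run and then projected.\<close>
  have main: "\<exists>D. exec (algorithm d) (initial_state (encode_instance i)) D
      \<and> (\<not> has_kl_tree i \<longrightarrow> (\<forall>r \<in> set_pmf D. \<not> accepts r))
      \<and> (has_kl_tree i \<longrightarrow> measure_pmf.prob D {r. \<not> accepts r} \<le> \<epsilon>)
      \<and> (\<forall>(s, t, m) \<in> set_pmf D. real t \<le> real (poly (time_poly d) (input_size (encode_instance i))) * max 1 (fine_bound d i))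
      \<and> (\<forall>(s, t, m) \<in> set_pmf D. real t \<le> real (poly (time_poly d) (input_size (encode_instance i))) * max 1 (coarse_bound d i))
      \<and> (\<forall>(s, t, m) \<in> set_pmf D. m \<le> poly (space_poly d) (input_size (encode_instance i)))"
    if i: "i \<in> kl_instances d" for i
  proof -
    obtain G c k l where ii: "i = (G, c, k, l)" by (cases i)
    let ?I = "input_size (encode_instance i)"
    obtain D0 T where run: "dist_runs (algorithm d) (initial_state (encode_instance i)) D0
        (poly (time_poly d) ?I * T) (poly (space_poly d) ?I)"
      and T: "real T \<le> max 1 (fine_bound d i)" "real T \<le> max 1 (coarse_bound d i)"
      and no: "\<not> has_kl_tree i \<Longrightarrow> \<forall>s \<in> set_pmf D0. reg s ''result'' = 0"
      and yes: "has_kl_tree i \<Longrightarrow> measure_pmf.prob D0 {s. reg s ''result'' = 0} \<le> \<epsilon>"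
      using algorithm_run[OF assms i[unfolded ii]] unfolding ii has_kl_tree.simps \<epsilon>_def by blast
    obtain D where D: "exec (algorithm d) (initial_state (encode_instance i)) D" "map_pmf fst D = D0"
      "\<forall>(s, t, m) \<in> set_pmf D. t \<le> poly (time_poly d) ?I * T \<and> m \<le> poly (space_poly d) ?I"
      using run unfolding dist_runs_def by blast
    have no': "\<not> has_kl_tree i \<longrightarrow> (\<forall>r \<in> set_pmf D. \<not> accepts r)"
    proof (intro impI ballI)
      fix r assume "\<not> has_kl_tree i" and r: "r \<in> set_pmf D"
      from no[OF this(1)] have "reg (fst r) ''result'' = 0"
        unfolding D(2)[symmetric] set_map_pmf using r by simp
      then show "\<not> accepts r" by (simp add: accepts_def)
    qed
    have yes': "has_kl_tree i \<longrightarrow> measure_pmf.prob D {r. \<not> accepts r} \<le> \<epsilon>"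
    proof
      assume tree: "has_kl_tree i"
      have "measure_pmf.prob D {r. \<not> accepts r} = measure_pmf.prob D0 {s. reg s ''result'' = 0}"
        unfolding D(2)[symmetric] measure_map_pmf by (rule arg_cong) (auto simp: accepts_def)
      then show "measure_pmf.prob D {r. \<not> accepts r} \<le> \<epsilon>" using yes[OF tree] by simp
    qed
    have bound: "real t \<le> real (poly (time_poly d) ?I) * F"
      if "t \<le> poly (time_poly d) ?I * T" "real T \<le> F" for t F
    proof -
      have "real t \<le> real (poly (time_poly d) ?I * T)" using that(1) by (simp only: of_nat_le_iff)
      also have "\<dots> \<le> real (poly (time_poly d) ?I) * F"
        unfolding of_nat_mult by (rule mult_left_mono[OF that(2)]) simp
      finally show ?thesis .
    qed
    have "\<forall>(s, t, m) \<in> set_pmf D. real t \<le> real (poly (time_poly d) ?I) * F" if "real T \<le> F" for F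
      using D(3) bound[OF _ that] by fast
    note b = this[OF T(1)] this[OF T(2)]
    have b3: "\<forall>(s, t, m) \<in> set_pmf D. m \<le> poly (space_poly d) ?I" using D(3) by fast
    show ?thesis by (intro exI[of _ D] conjI D(1) no' yes' b b3)
  qed
  show ?thesis
  proof (intro exI conjI)
    show "\<epsilon> < 1" by (rule eps)
    show "monte_carlo_decides (algorithm d) (kl_instances d) encode_instance has_kl_tree \<epsilon>"
      unfolding monte_carlo_decides_def
      by (intro ballI, drule main, erule ex_forward, elim conjE, intro conjI)
    show "runs_in_ostar_time (algorithm d) (kl_instances d) encode_instance (fine_bound d)"
      unfolding runs_in_ostar_time_def
      by (rule exI[of _ "time_poly d"], intro ballI, drule main, erule ex_forward, elim conjE, intro conjI)
    show "runs_in_ostar_time (algorithm d) (kl_instances d) encode_instance (coarse_bound d)"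
      unfolding runs_in_ostar_time_def
      by (rule exI[of _ "time_poly d"], intro ballI, drule main, erule ex_forward, elim conjE, intro conjI)
    show "runs_in_polynomial_space (algorithm d) (kl_instances d) encode_instance"
      unfolding runs_in_polynomial_space_def
      by (rule exI[of _ "space_poly d"], intro ballI, drule main, erule ex_forward, elim conjE, intro conjI)
  qed
qed

end
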